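(* Let $f:\mathbb W\to\mathbb R$ be a measurable function such that, $\nu$-a.s., $$-\log\mathbb E_\nu\left[e^{-f}\,\middle|\,\mathcal F_\tau\right]=\inf_{\alpha\in\widetilde{\mathcal D}_\tau\cap L^2_a(\nu,H)}\mathbb E_\nu\left[f\circ W^\alpha+\frac12|\alpha|_H^2\,\middle|\,\mathcal F_\tau\right].$$ Denote this infimum by $J_*$. Then $J_*$ is attained at $u\in\widetilde{\mathcal D}_\tau\cap L^2_a(\nu,H)$ if and only if $W^u$ is $\nu$-a.s. left-invertible and $$\frac{d(W^u\nu)}{d\nu}=\frac{e^{-f}}{\mathbb E_\nu\left[e^{-f}\,\middle|\,\mathcal F_\tau\right]}.$$
   Context: Basic setting. $n\ge1$; $\mathbb W=C([0,1],\mathbb R^n)$ with a probability measure $\nu$; $W$ is the coordinate process, $(\mathcal F_t)$ its filtration (all filtrations are completed with respect to $\nu$), $\tau$ a stopping time of $(\mathcal F_t)$. $H=\{\int_0^\cdot\dot h(s)ds:\dot h\in L^2([0,1];\mathbb R^n)\}$, $|h|_H^2=\int_0^1|\dot h(s)|^2ds$. For $p\ge0$, $L^p_a(\nu,H)$ is the set of $u\in L^p(\nu,H)$ with $\dot u$ $(\mathcal F_t)$-adapted ($L^0$ = all measurable maps). $\mathcal D=\{u\in L^0_a(\nu,H):\dot u\text{ is } d\nu\times dt\text{-a.s. bounded}\}$. For $u\in L^0_a(\nu,H)$: $\pi_\tau u=\int_0^\cdot\dot u(s)1_{s\le\tau}ds$, $(I-\pi_\tau)u=\int_0^\cdot\dot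 u(s)1_{s>\tau}ds$. For a $\nu$-Brownian motion $\beta$: $\delta_\beta v=\int_0^1\dot v(s)d\beta(s)$, $\rho(\delta_\beta v)=\exp(\int_0^1\dot v\,d\beta-\frac12\int_0^1|\dot v|^2ds)$, and $G_p(\nu,\beta)=\{u\in L^p_a(\nu,H):\mathbb E_\nu[\rho(-\delta_\beta u)]=1\}$. Standing assumption: there are a $\nu$-Brownian motion $\beta$ and adapted processes $(W^u)_{u\in\mathcal D}$ (viewed as maps $\mathbb W\to\mathbb W$) such that: (i) $\beta$ and $W$ have the same filtration; (ii) $W^0=W$; (iii) for $u\in\mathcal D$ the law of $W^u$ under $\tilde\nu^u$, $d\tilde\nu^u=\rho(-\delta_\beta u)d\nu$, equals the law of $W$ under $\nu$; (iv) $\beta\circ W^u=\beta+u$ for $u\in\mathcal D$; (v) $W^u\circ W^v=W^{v+u\circ W^v}$ $\nu$-a.s. for $u,v\in\mathcal D$; (vi) $(W^u(s\wedge\tau))_{s\le1}=(W^{\pi_\tau u}(s\wedge\tau))_{s\le1}$ for $u\in\mathcal D$. Extended class. $\widetilde{\mathcal D}$ is a fixed set to which $u\mapsto W^u$ is extended such that: (i) $\mathcal D\subset\widetilde{\mathcal D}\subset G_2(\nu,\beta)$; (ii) $W^u$ is adapted for $u\in\widetilde{\mathcal D}$; (iii) for $u\in\widetilde{\mathcal D}$ the law of $W^u$ under $\tilde\nu^u$, $d\tilde\nu^u=\rho(-\delta_\beta u)d\nu$, equals the law of $W$ under $\nu$; (iv) $\beta\circ W^u=\beta+u$ for $u\in\widetilde{\mathcal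 D}$; (v) $W^u\circ W^v=W^{v+u\circ W^v}$ $\nu$-a.s. whenever $u,v,v+u\circ W^v\in\widetilde{\mathcal D}$; (vi) there is $\widetilde{\widetilde{\mathcal D}}$ with $\widetilde{\mathcal D}\subset\widetilde{\widetilde{\mathcal D}}\subset L^0_a(\nu,H)$ and $\widetilde{\mathcal D}=\widetilde{\widetilde{\mathcal D}}\cap G_2(\nu,\beta)$ such that for every $u\in\widetilde{\mathcal D}$ for which the equation $u+v\circ W^u=0$ (unknown $v$) has a solution in $G_0(\nu,\beta)$, it has a solution in $\widetilde{\widetilde{\mathcal D}}$; (vii) $(W^u(s\wedge\tau))_{s\le1}=(W^{\pi_\tau u}(s\wedge\tau))_{s\le1}$ whenever $u,\pi_\tau u\in\widetilde{\mathcal D}$. Under these conditions $W^u\nu\sim\nu$ for $u\in\widetilde{\mathcal D}$, where $W^u\nu$ is the image of $\nu$ under $W^u$. $\widetilde{\mathcal D}_\tau=\widetilde{\mathcal D}\cap(I-\pi_\tau)L^0_a(\nu,H)$. A measurable $U:\mathbb W\to\mathbb W$ is $\nu$-a.s. left-invertible if $U\nu\ll\nu$ and there is a measurable $V:\mathbb W\to\mathbb W$ with $V\circ U=I_{\mathbb W}$ $\nu$-a.s. The infimum of a family of random variables is understood up to $\nu$-null sets (essential infimum); "attained at $u$" means that $\mathbb E_\nu[f\circ W^u+\frac12|u|_H^2|\mathcal F_\tau]$ equals it $\nu$-a.s.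
   Formalization: The formal statement additionally assumes E_ν[e^{-f}|F_τ] < ∞ ν-a.s.; without it the claim fails (e.g. τ=0, f bounded above with E f = −∞: J_* = −∞ is attained at u=0, but the density formula would give 0 instead of 1). *)

theory Defs
  imports "HOL-Probability.Probability"
begin

section \<open>Path space and filtrations\<close>

text \<open>Paths are functions on \<open>real\<close> that are extensional on \<open>{0..1}\<close>. The trace of the product
  \<open>\<sigma>\<close>-algebra on the continuous paths is the Borel \<open>\<sigma>\<close>-algebra of the uniform norm. The coordinate
  process \<open>W\<close>, seen as a map of the path space into itself, is the identity.\<close>

type_synonym 'n path = "real \<Rightarrow> (real, 'n) vec"

definition path_algebra :: "('n::finite) path measure" where
  "path_algebra = restrict_space (Pi\<^sub>M {0..1} (\<lambda>_. borel)) {w. continuous_on {0..1} w}"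

lemma space_path_algebra:
  "space (path_algebra :: ('n::finite) path measure) = {w \<in> extensional {0..1}. continuous_on {0..1} w}"
  by (auto simp: path_algebra_def space_restrict_space space_PiM PiE_UNIV_domain PiE_def)

text \<open>The \<open>\<nu>\<close>-completed filtration generated by a path-valued map \<open>X\<close>. It is indexed by all reals and
  constant on \<open>{1..}\<close>, so that the value \<open>\<infinity>\<close> of a stopping time can be represented by any real
  number greater than 1 without affecting the stopped \<open>\<sigma>\<close>-algebra.\<close>

definition natural_filtration ::
    "('n::finite) path measure \<Rightarrow> ('n path \<Rightarrow> 'n path) \<Rightarrow> real \<Rightarrow> 'n path measure" where
  "natural_filtration \<nu> X t =
     sigma (space \<nu>)
       ({(\<lambda>\<omega>. X \<omega> s) -` B \<inter> space \<nu> | s B. s \<in> {0..1} \<and> s \<le> t \<and> B \<in> sets borel}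
        \<union> null_sets (completion \<nu>))"

abbreviation coord_filtration :: "('n::finite) path measure \<Rightarrow> real \<Rightarrow> 'n path measure" where
  "coord_filtration \<nu> \<equiv> natural_filtration \<nu> (\<lambda>\<omega>. \<omega>)"

definition stopped_algebra ::
    "('n::finite) path measure \<Rightarrow> ('n path \<Rightarrow> real) \<Rightarrow> 'n path measure" where
  "stopped_algebra \<nu> \<tau> = filtration.pre_sigma (space \<nu>) (coord_filtration \<nu>) \<tau>"

lemma natural_filtration_generator:
  "{(\<lambda>\<omega>. X \<omega> s) -` B \<inter> space \<nu> | s B. s \<in> {0..1} \<and> s \<le> t \<and> B \<in> sets borel}
     \<union> null_sets (completion \<nu>) \<subseteq> Pow (space \<nu>)"
  using sets.sets_into_space[of _ "completion \<nu>"] by (auto simp: null_sets_def)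

lemma filtration_natural_filtration: "filtration (space \<nu>) (natural_filtration \<nu> X)"
proof
  fix i j :: real
  show "space (natural_filtration \<nu> X i) = space \<nu>"
    unfolding natural_filtration_def
    by (intro space_measure_of natural_filtration_generator)
  assume "i \<le> j"
  then show "sets (natural_filtration \<nu> X i) \<le> sets (natural_filtration \<nu> X j)"
    unfolding natural_filtration_def sets_measure_of[OF natural_filtration_generator]
    by (intro sigma_sets_mono') (auto intro: order_trans)
qed

definition brownian_motion ::
    "('n::finite) path measure \<Rightarrow> ('n path \<Rightarrow> 'n path) \<Rightarrow> bool" where
  "brownian_motion \<nu> \<beta> \<longleftrightarrow>
     \<beta> \<in> completion \<nu> \<rightarrow>\<^sub>M path_algebra \<and>
     (AE \<omega> in completion \<nu>. \<beta> \<omega> 0 = 0) \<and>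
     (\<forall>s t. 0 \<le> s \<and> s < t \<and> t \<le> 1 \<longrightarrow>
        distributed (completion \<nu>) lborel (\<lambda>\<omega>. \<beta> \<omega> t - \<beta> \<omega> s)
          (\<lambda>x. ennreal (\<Prod>i\<in>UNIV. normal_density 0 (sqrt (t - s)) (x $ i))) \<and>
        prob_space.indep_set (completion \<nu>)
          {(\<lambda>\<omega>. \<beta> \<omega> t - \<beta> \<omega> s) -` B \<inter> space \<nu> | B. B \<in> sets borel}
          (sets (natural_filtration \<nu> \<beta> s)))"

section \<open>Adapted Cameron-Martin valued random variables\<close>

text \<open>The isometry that maps \<open>L\<^sup>2([0,1])\<close> onto \<open>H\<close> by integration is used throughout: a random
  variable \<open>u\<close> with values in \<open>H\<close> is represented by a version of its density, that is, \<open>u \<omega> s\<close>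
  stands for the derivative of \<open>u(\<omega>)\<close> at time \<open>s\<close>. Elements of \<open>L\<^sup>p(\<nu>,H)\<close> are classes modulo
  \<open>\<nu> \<Otimes> ds\<close>-null sets; \<open>drift_eq\<close> is equality of classes, and sets of such elements are represented
  by \<open>drift_saturated\<close> sets of versions.\<close>

type_synonym 'n drift = "'n path \<Rightarrow> real \<Rightarrow> (real, 'n) vec"

abbreviation unit_time :: "real measure" where
  "unit_time \<equiv> restrict_space lborel {0..1}"

definition cm_path :: "(real \<Rightarrow> real ^ 'n) \<Rightarrow> real \<Rightarrow> real ^ 'n" where
  "cm_path h t = (LINT s:{0..t}|lborel. h s)"

definition cm_norm :: "(real \<Rightarrow> real ^ 'n) \<Rightarrow> real" where
  "cm_norm h = sqrt (LINT s:{0..1}|lborel. (norm (h s))\<^sup>2)"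

definition L0_adapted :: "('n::finite) path measure \<Rightarrow> 'n drift set" where
  "L0_adapted \<nu> = {u.
     (\<lambda>(\<omega>, s). u \<omega> s) \<in> borel_measurable (completion \<nu> \<Otimes>\<^sub>M unit_time) \<and>
     (\<forall>s\<in>{0..1}. (\<lambda>\<omega>. u \<omega> s) \<in> borel_measurable (coord_filtration \<nu> s)) \<and>
     (AE \<omega> in completion \<nu>. set_integrable lborel {0..1} (\<lambda>s. (norm (u \<omega> s))\<^sup>2))}"

definition Lp_adapted :: "('n::finite) path measure \<Rightarrow> real \<Rightarrow> 'n drift set" where
  "Lp_adapted \<nu> p =
     {u \<in> L0_adapted \<nu>. p = 0 \<or> integrable (completion \<nu>) (\<lambda>\<omega>. cm_norm (u \<omega>) powr p)}"

definition bounded_drifts :: "('n::finite) path measure \<Rightarrow> 'n drift set" where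
  "bounded_drifts \<nu> =
     {u \<in> L0_adapted \<nu>. \<exists>C. AE (\<omega>, s) in completion \<nu> \<Otimes>\<^sub>M unit_time. norm (u \<omega> s) \<le> C}"

definition drift_eq :: "('n::finite) path measure \<Rightarrow> 'n drift \<Rightarrow> 'n drift \<Rightarrow> bool" where
  "drift_eq \<nu> u v \<longleftrightarrow> (AE (\<omega>, s) in completion \<nu> \<Otimes>\<^sub>M unit_time. u \<omega> s = v \<omega> s)"

definition drift_saturated :: "('n::finite) path measure \<Rightarrow> 'n drift set \<Rightarrow> bool" where
  "drift_saturated \<nu> A \<longleftrightarrow> (\<forall>u\<in>A. \<forall>v\<in>L0_adapted \<nu>. drift_eq \<nu> u v \<longrightarrow> v \<in> A)"

definition zero_drift :: "('n::finite) drift" where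
  "zero_drift = (\<lambda>\<omega> s. 0)"

definition neg_drift :: "('n::finite) drift \<Rightarrow> 'n drift" where
  "neg_drift u = (\<lambda>\<omega> s. - u \<omega> s)"

definition add_drift :: "('n::finite) drift \<Rightarrow> 'n drift \<Rightarrow> 'n drift" where
  "add_drift u v = (\<lambda>\<omega> s. u \<omega> s + v \<omega> s)"

definition comp_drift :: "('n::finite) drift \<Rightarrow> ('n path \<Rightarrow> 'n path) \<Rightarrow> 'n drift" where
  "comp_drift u U = (\<lambda>\<omega>. u (U \<omega>))"

definition drift_upto :: "(('n::finite) path \<Rightarrow> real) \<Rightarrow> 'n drift \<Rightarrow> 'n drift" where
  "drift_upto \<tau> u = (\<lambda>\<omega> s. if s \<le> \<tau> \<omega> then u \<omega> s else 0)"

definition drift_after :: "(('n::finite) path \<Rightarrow> real) \<Rightarrow> 'n drift \<Rightarrow> 'n drift" where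
  "drift_after \<tau> u = (\<lambda>\<omega> s. if s > \<tau> \<omega> then u \<omega> s else 0)"

definition drifts_after ::
    "('n::finite) path measure \<Rightarrow> ('n path \<Rightarrow> real) \<Rightarrow> 'n drift set \<Rightarrow> 'n drift set" where
  "drifts_after \<nu> \<tau> A = {u \<in> A. \<exists>v\<in>L0_adapted \<nu>. drift_eq \<nu> u (drift_after \<tau> v)}"

section \<open>Ito integral and stochastic exponential\<close>

definition tendsto_in_prob :: "'a measure \<Rightarrow> (nat \<Rightarrow> 'a \<Rightarrow> real) \<Rightarrow> ('a \<Rightarrow> real) \<Rightarrow> bool" where
  "tendsto_in_prob M X Y \<longleftrightarrow>
     (\<forall>\<epsilon>>0. (\<lambda>j. measure M {\<omega> \<in> space M. \<epsilon> < \<bar>X j \<omega> - Y \<omega>\<bar>}) \<longlonglongrightarrow> 0)"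

text \<open>\<open>(m, t, \<xi>)\<close> codes the simple integrand equal to \<open>\<xi> k\<close> on \<open>(t k, t (k+1)]\<close> for \<open>k < m\<close> and to 0
  elsewhere.\<close>

definition simple_integrand ::
    "('n::finite) path measure \<Rightarrow> nat \<Rightarrow> (nat \<Rightarrow> real) \<Rightarrow> (nat \<Rightarrow> 'n path \<Rightarrow> real ^ 'n) \<Rightarrow> bool" where
  "simple_integrand \<nu> m t \<xi> \<longleftrightarrow>
     0 \<le> t 0 \<and> (\<forall>k<m. t k \<le> t (Suc k)) \<and> t m \<le> 1 \<and>
     (\<forall>k<m. \<xi> k \<in> borel_measurable (coord_filtration \<nu> (t k)) \<and> bounded (\<xi> k ` space \<nu>))"

definition simple_drift ::
    "nat \<Rightarrow> (nat \<Rightarrow> real) \<Rightarrow> (nat \<Rightarrow> ('n::finite) path \<Rightarrow> real ^ 'n) \<Rightarrow> 'n drift" where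
  "simple_drift m t \<xi> = (\<lambda>\<omega> s. \<Sum>k<m. if t k < s \<and> s \<le> t (Suc k) then \<xi> k \<omega> else 0)"

definition simple_integral ::
    "(('n::finite) path \<Rightarrow> 'n path) \<Rightarrow> nat \<Rightarrow> (nat \<Rightarrow> real) \<Rightarrow> (nat \<Rightarrow> 'n path \<Rightarrow> real ^ 'n)
      \<Rightarrow> 'n path \<Rightarrow> real" where
  "simple_integral \<beta> m t \<xi> \<omega> = (\<Sum>k<m. \<xi> k \<omega> \<bullet> (\<beta> \<omega> (t (Suc k)) - \<beta> \<omega> (t k)))"

definition has_ito_integral ::
    "('n::finite) path measure \<Rightarrow> ('n path \<Rightarrow> 'n path) \<Rightarrow> 'n drift \<Rightarrow> ('n path \<Rightarrow> real) \<Rightarrow> bool" where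
  "has_ito_integral \<nu> \<beta> v I \<longleftrightarrow>
     I \<in> borel_measurable (completion \<nu>) \<and>
     (\<exists>m t \<xi>. (\<forall>j. simple_integrand \<nu> (m j) (t j) (\<xi> j)) \<and>
        tendsto_in_prob (completion \<nu>)
          (\<lambda>j \<omega>. LINT s:{0..1}|lborel. (norm (simple_drift (m j) (t j) (\<xi> j) \<omega> s - v \<omega> s))\<^sup>2)
          (\<lambda>_. 0) \<and>
        tendsto_in_prob (completion \<nu>) (\<lambda>j. simple_integral \<beta> (m j) (t j) (\<xi> j)) I)"

text \<open>For \<open>v \<in> L0_adapted \<nu>\<close> and a Brownian motion \<open>\<beta>\<close> of the filtration, the integral exists and is
  determined up to \<open>\<nu>\<close>-null sets; one version is chosen.\<close>

definition ito_integral ::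
    "('n::finite) path measure \<Rightarrow> ('n path \<Rightarrow> 'n path) \<Rightarrow> 'n drift \<Rightarrow> 'n path \<Rightarrow> real" where
  "ito_integral \<nu> \<beta> v = (SOME I. has_ito_integral \<nu> \<beta> v I)"

definition stoch_exp ::
    "('n::finite) path measure \<Rightarrow> ('n path \<Rightarrow> 'n path) \<Rightarrow> 'n drift \<Rightarrow> 'n path \<Rightarrow> real" where
  "stoch_exp \<nu> \<beta> v \<omega> = exp (ito_integral \<nu> \<beta> v \<omega> - (cm_norm (v \<omega>))\<^sup>2 / 2)"

definition girsanov_class ::
    "('n::finite) path measure \<Rightarrow> ('n path \<Rightarrow> 'n path) \<Rightarrow> real \<Rightarrow> 'n drift set" where
  "girsanov_class \<nu> \<beta> p =
     {u \<in> Lp_adapted \<nu> p.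
        integrable (completion \<nu>) (stoch_exp \<nu> \<beta> (neg_drift u)) \<and>
        (LINT \<omega>|completion \<nu>. stoch_exp \<nu> \<beta> (neg_drift u) \<omega>) = 1}"

definition girsanov_measure ::
    "('n::finite) path measure \<Rightarrow> ('n path \<Rightarrow> 'n path) \<Rightarrow> 'n drift \<Rightarrow> 'n path measure" where
  "girsanov_measure \<nu> \<beta> u =
     density (completion \<nu>) (\<lambda>\<omega>. ennreal (stoch_exp \<nu> \<beta> (neg_drift u) \<omega>))"

section \<open>The standing assumptions\<close>

definition adapted_path_map ::
    "('n::finite) path measure \<Rightarrow> ('n path \<Rightarrow> 'n path) \<Rightarrow> bool" where
  "adapted_path_map \<nu> U \<longleftrightarrow>
     U \<in> space \<nu> \<rightarrow> space \<nu> \<and>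
     (\<forall>t\<in>{0..1}. (\<lambda>\<omega>. U \<omega> t) \<in> borel_measurable (coord_filtration \<nu> t))"

definition translates_to ::
    "('n::finite) path measure \<Rightarrow> ('n path \<Rightarrow> 'n path) \<Rightarrow> ('n path \<Rightarrow> 'n path) \<Rightarrow> 'n drift \<Rightarrow> bool" where
  "translates_to \<nu> \<beta> U u \<longleftrightarrow>
     (AE \<omega> in completion \<nu>. \<forall>t\<in>{0..1}. \<beta> (U \<omega>) t = \<beta> \<omega> t + cm_path (u \<omega>) t)"

definition agree_until ::
    "('n::finite) path measure \<Rightarrow> ('n path \<Rightarrow> real) \<Rightarrow> ('n path \<Rightarrow> 'n path) \<Rightarrow> ('n path \<Rightarrow> 'n path) \<Rightarrow> bool" where
  "agree_until \<nu> \<tau> U V \<longleftrightarrow>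
     (AE \<omega> in completion \<nu>. \<forall>s\<in>{0..1}. U \<omega> (min s (\<tau> \<omega>)) = V \<omega> (min s (\<tau> \<omega>)))"

locale stopped_path_space =
  fixes \<nu> :: "('n::finite) path measure" and \<tau> :: "'n path \<Rightarrow> real"
  assumes prob_nu: "prob_space \<nu>"
    and sets_nu: "sets \<nu> = sets path_algebra"
    and stopping_time_tau: "stopping_time (coord_filtration \<nu>) \<tau>"
    and tau_nonneg: "\<And>\<omega>. \<omega> \<in> space \<nu> \<Longrightarrow> 0 \<le> \<tau> \<omega>"

lemma (in stopped_path_space) subalgebra_stopped_algebra:
  "subalgebra (completion \<nu>) (stopped_algebra \<nu> \<tau>)"
proof -
  interpret filtration "space \<nu>" "coord_filtration \<nu>"
    by (rule filtration_natural_filtration)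
  have space_nu: "space \<nu> = space path_algebra"
    using sets_nu by (rule sets_eq_imp_space_eq)
  have ev: "(\<lambda>\<omega>. \<omega> s) \<in> borel_measurable \<nu>" if "s \<in> {0..1}" for s
    unfolding measurable_cong_sets[OF sets_nu refl] path_algebra_def
    by (intro measurable_restrict_space1 measurable_component_singleton that)
  have F: "sets (coord_filtration \<nu> t) \<subseteq> sets (completion \<nu>)" for t
    unfolding natural_filtration_def sets_measure_of[OF natural_filtration_generator]
    using ev sets.sigma_sets_subset[of _ "completion \<nu>"]
    by (auto intro!: sets.sigma_sets_subset[of _ "completion \<nu>", simplified] dest: measurable_sets)
  have "A \<in> sets (completion \<nu>)" if A: "A \<in> sets (pre_sigma \<tau>)" for A
  proof -
    have "{\<omega>\<in>A. \<tau> \<omega> \<le> real n} \<in> sets (completion \<nu>)" for n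
      using sets_pre_sigmaD[OF stopping_time_tau A] F by blast
    then have "(\<Union>n. {\<omega>\<in>A. \<tau> \<omega> \<le> real n}) \<in> sets (completion \<nu>)"
      by blast
    moreover have "(\<Union>n. {\<omega>\<in>A. \<tau> \<omega> \<le> real n}) = A"
      using real_arch_simple by blast
    ultimately show ?thesis by simp
  qed
  then show ?thesis
    by (auto simp: subalgebra_def stopped_algebra_def space_pre_sigma)
qed

text \<open>\<open>WW u\<close> is the map \<open>W\<^sup>u\<close>. That it depends only on the class of \<open>u\<close>, up to null sets, has to be
  said explicitly (\<open>cong\<close>, \<open>ext_cong\<close>) because \<open>u\<close> is a version.\<close>

locale drift_flow = stopped_path_space \<nu> \<tau>
  for \<nu> :: "('n::finite) path measure" and \<tau> :: "'n path \<Rightarrow> real" +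
  fixes \<beta> :: "'n path \<Rightarrow> 'n path" and WW :: "'n drift \<Rightarrow> 'n path \<Rightarrow> 'n path"
  assumes brownian: "brownian_motion \<nu> \<beta>"
    and cong: "\<And>u v. u \<in> bounded_drifts \<nu> \<Longrightarrow> v \<in> bounded_drifts \<nu> \<Longrightarrow> drift_eq \<nu> u v \<Longrightarrow>
          AE \<omega> in completion \<nu>. WW u \<omega> = WW v \<omega>"
    and adapted: "\<And>u. u \<in> bounded_drifts \<nu> \<Longrightarrow> adapted_path_map \<nu> (WW u)"
    and same_filtration:
          "\<And>t. t \<in> {0..1} \<Longrightarrow> sets (natural_filtration \<nu> \<beta> t) = sets (coord_filtration \<nu> t)"
    and zero: "AE \<omega> in completion \<nu>. WW zero_drift \<omega> = \<omega>"
    and law: "\<And>u. u \<in> bounded_drifts \<nu> \<Longrightarrow>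
          distr (girsanov_measure \<nu> \<beta> u) path_algebra (WW u)
            = distr (completion \<nu>) path_algebra (\<lambda>\<omega>. \<omega>)"
    and translate: "\<And>u. u \<in> bounded_drifts \<nu> \<Longrightarrow> translates_to \<nu> \<beta> (WW u) u"
    and compose: "\<And>u v. u \<in> bounded_drifts \<nu> \<Longrightarrow> v \<in> bounded_drifts \<nu> \<Longrightarrow>
          AE \<omega> in completion \<nu>. WW u (WW v \<omega>) = WW (add_drift v (comp_drift u (WW v))) \<omega>"
    and stop: "\<And>u. u \<in> bounded_drifts \<nu> \<Longrightarrow> agree_until \<nu> \<tau> (WW u) (WW (drift_upto \<tau> u))"

locale extended_drift_flow = drift_flow \<nu> \<tau> \<beta> WW
  for \<nu> :: "('n::finite) path measure" and \<tau> :: "'n path \<Rightarrow> real"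
    and \<beta> :: "'n path \<Rightarrow> 'n path" and WW :: "'n drift \<Rightarrow> 'n path \<Rightarrow> 'n path" +
  fixes \<D> :: "'n drift set"
  assumes saturated: "drift_saturated \<nu> \<D>"
    and ext_cong: "\<And>u v. u \<in> \<D> \<Longrightarrow> v \<in> \<D> \<Longrightarrow> drift_eq \<nu> u v \<Longrightarrow>
          AE \<omega> in completion \<nu>. WW u \<omega> = WW v \<omega>"
    and bounded_subset: "bounded_drifts \<nu> \<subseteq> \<D>"
    and subset_girsanov: "\<D> \<subseteq> girsanov_class \<nu> \<beta> 2"
    and ext_adapted: "\<And>u. u \<in> \<D> \<Longrightarrow> adapted_path_map \<nu> (WW u)"
    and ext_law: "\<And>u. u \<in> \<D> \<Longrightarrow>
          distr (girsanov_measure \<nu> \<beta> u) path_algebra (WW u)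
            = distr (completion \<nu>) path_algebra (\<lambda>\<omega>. \<omega>)"
    and ext_translate: "\<And>u. u \<in> \<D> \<Longrightarrow> translates_to \<nu> \<beta> (WW u) u"
    and ext_compose: "\<And>u v. u \<in> \<D> \<Longrightarrow> v \<in> \<D> \<Longrightarrow> add_drift v (comp_drift u (WW v)) \<in> \<D> \<Longrightarrow>
          AE \<omega> in completion \<nu>. WW u (WW v \<omega>) = WW (add_drift v (comp_drift u (WW v))) \<omega>"
    and ext_inverse: "\<exists>\<D>'. drift_saturated \<nu> \<D>' \<and> \<D> \<subseteq> \<D>' \<and> \<D>' \<subseteq> L0_adapted \<nu> \<and>
          \<D> = \<D>' \<inter> girsanov_class \<nu> \<beta> 2 \<and>
          (\<forall>u\<in>\<D>.
            (\<exists>v\<in>girsanov_class \<nu> \<beta> 0. drift_eq \<nu> (add_drift u (comp_drift v (WW u))) zero_drift) \<longrightarrow>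
            (\<exists>v\<in>\<D>'. drift_eq \<nu> (add_drift u (comp_drift v (WW u))) zero_drift))"
    and ext_stop: "\<And>u. u \<in> \<D> \<Longrightarrow> drift_upto \<tau> u \<in> \<D> \<Longrightarrow>
          agree_until \<nu> \<tau> (WW u) (WW (drift_upto \<tau> u))"

section \<open>Invertibility, conditional cost, essential infimum\<close>

definition image_law ::
    "('n::finite) path measure \<Rightarrow> ('n path \<Rightarrow> 'n path) \<Rightarrow> 'n path measure" where
  "image_law \<nu> U = distr (completion \<nu>) path_algebra U"

definition left_invertible ::
    "('n::finite) path measure \<Rightarrow> ('n path \<Rightarrow> 'n path) \<Rightarrow> bool" where
  "left_invertible \<nu> U \<longleftrightarrow>
     U \<in> completion \<nu> \<rightarrow>\<^sub>M path_algebra \<and>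
     absolutely_continuous \<nu> (image_law \<nu> U) \<and>
     (\<exists>V \<in> completion \<nu> \<rightarrow>\<^sub>M path_algebra. AE \<omega> in completion \<nu>. V (U \<omega>) = \<omega>)"

text \<open>Conditional expectation with values in the extended reals; unlike \<open>real_cond_exp\<close>, it does not
  replace infinite values by 0. Where both parts are infinite the value is \<open>\<infinity>\<close>; in \<open>cond_cost\<close> the
  negative part is finite almost surely as soon as the conditional expectation of \<open>exp (- f)\<close> is.\<close>

definition ereal_cond_exp :: "'a measure \<Rightarrow> 'a measure \<Rightarrow> ('a \<Rightarrow> real) \<Rightarrow> 'a \<Rightarrow> ereal" where
  "ereal_cond_exp M F X \<omega> =
     enn2ereal (nn_cond_exp M F (\<lambda>x. ennreal (X x)) \<omega>)
     - enn2ereal (nn_cond_exp M F (\<lambda>x. ennreal (- X x)) \<omega>)"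

definition cond_cost ::
    "('n::finite) path measure \<Rightarrow> ('n path \<Rightarrow> real) \<Rightarrow> ('n drift \<Rightarrow> 'n path \<Rightarrow> 'n path)
      \<Rightarrow> ('n path \<Rightarrow> real) \<Rightarrow> 'n drift \<Rightarrow> 'n path \<Rightarrow> ereal" where
  "cond_cost \<nu> \<tau> WW f u =
     ereal_cond_exp (completion \<nu>) (stopped_algebra \<nu> \<tau>)
       (\<lambda>\<omega>. f (WW u \<omega>) + (cm_norm (u \<omega>))\<^sup>2 / 2)"

definition is_ess_inf :: "'a measure \<Rightarrow> 'i set \<Rightarrow> ('i \<Rightarrow> 'a \<Rightarrow> ereal) \<Rightarrow> ('a \<Rightarrow> ereal) \<Rightarrow> bool" where
  "is_ess_inf M A Y J \<longleftrightarrow>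
     J \<in> borel_measurable M \<and>
     (\<forall>i\<in>A. AE \<omega> in M. J \<omega> \<le> Y i \<omega>) \<and>
     (\<forall>K\<in>borel_measurable M. (\<forall>i\<in>A. AE \<omega> in M. K \<omega> \<le> Y i \<omega>) \<longrightarrow> (AE \<omega> in M. K \<omega> \<le> J \<omega>))"

end

theory Submission
  imports Defs
begin

text \<open>Put \<open>M = exp (- f) / E[exp (- f) | F\<^sub>\<tau>]\<close>, \<open>U = W\<^sup>u\<close>, \<open>X = \<beta> \<circ> U = \<beta> + u\<close>, let \<open>\<rho>\<close> be the Girsanov density of \<open>u\<close>
  and \<open>Q = M(U) \<rho>\<close>. Since \<open>u\<close> vanishes before \<open>\<tau>\<close>, \<open>E[Q | F\<^sub>\<tau>] = 1\<close> and the stochastic integral of \<open>u\<close> has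
  conditional mean 0, so the conditional cost of \<open>u\<close> exceeds \<open>- ln E[exp (- f) | F\<^sub>\<tau>]\<close> by
  \<open>E[Q - 1 - ln Q | F\<^sub>\<tau>] \<ge> 0\<close>. Hence \<open>u\<close> is optimal iff \<open>Q = 1\<close>.

  If \<open>Q = 1\<close> then \<open>\<rho>\<close> is a function of \<open>U\<close>. Under \<open>\<rho> \<nu>\<close> the increments of \<open>X\<close> after time \<open>r\<close> are
  independent of \<open>F\<^sub>r\<close>; therefore conditioning on \<open>U\<close> maps bounded \<open>F\<^sub>r\<close>-measurable variables to
  \<open>F\<^sub>r\<close>-measurable functions of \<open>U\<close>. A simple approximation of \<open>u\<close> gets no worse in mean square when it
  is projected in this way, so the integral of \<open>u\<close>, then \<open>\<beta> = X - u\<close>, and finally, as \<open>\<beta>\<close> generates the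
  filtration, the path itself are functions of \<open>U\<close>. Conversely, a left inverse gives \<open>\<rho> = \<psi>(U)\<close>, and
  \<open>E[g] = E[\<rho> g(U)] = E[M \<psi> g]\<close> for all \<open>g\<close> forces \<open>M \<psi> = 1\<close>, that is \<open>Q = 1\<close>.\<close>

section \<open>Lagged averages\<close>

text \<open>The hard direction is from \<open>Q = 1\<close> to a left inverse. Conditioning on
  \<open>U\<close> preserves adaptedness under \<open>\<rho> \<nu>\<close>, whereas the mean-square
  comparison has to be made under \<nu>, where \<open>u\<close> is approximated. Both conditionings
  coincide because \<rho> is a function of \<open>U\<close> and cancels. The drift \<open>u\<close>
  itself is not known to be a function of \<open>U\<close>; but it enters the approximation error
  only through increments of its primitive, and these may be exchanged for increments of
  \<open>X\<close>, which are functions of \<open>U\<close>, because the increments of \<beta> are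
  orthogonal to the past.

  \<open>Q - 1 - ln Q\<close> appears instead of \<open>- ln Q\<close> because it is nonnegative:
  its conditional expectation exists in the extended half-line without integrability of the cost,
  and only terms with finite conditional expectation are cancelled.

  \<open>ito_integral\<close> is a version chosen among limits in probability. Identities are
  therefore proved for simple drifts by integrating out one Gaussian increment at a time, and
  carried to the limit by convergence of the densities in L1, for which almost sure convergence and
  total mass 1 suffice.\<close>

lemma bounded_by_continuous_L1:
  fixes f :: "real \<Rightarrow> 'a::euclidean_space"
  assumes f: "f \<in> borel_measurable borel" and K: "\<And>s. norm (f s) \<le> K" and e: "0 < e"
  obtains g where "continuous_on UNIV g" "\<And>s. norm (g s) \<le> K"
    "(LINT s:{0..1}|lborel. norm (f s - g s)) < e"
proof -
  have K0: "0 \<le> K" using K[of 0] norm_ge_zero order_trans by blast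
  have "f measurable_on UNIV"
    using f by (intro lebesgue_measurable_imp_measurable_on) (auto intro: measurable_completion)
  then obtain Z g where Z: "negligible Z" and g: "\<And>n. continuous_on UNIV (g n)"
    and lim: "\<And>x. x \<notin> Z \<Longrightarrow> (\<lambda>n. g n x) \<longlonglongrightarrow> f x"
    unfolding measurable_on_def by auto
  \<comment> \<open>Radial retraction onto the ball of radius \<open>K\<close>: continuous, and it
    fixes the limit values because \<open>norm (f x) \<le> K\<close>. For \<open>K = 0\<close> the
    quotient degenerates, hence the case split.\<close>
  define h where "h n x = (K / max K (norm (g n x))) *\<^sub>R g n x" for n x
  show ?thesis
  proof (cases "K = 0")
    case True
    then have "f = (\<lambda>_. 0)" using K by force
    then show ?thesis using e True by (intro that[of "\<lambda>_. 0"]) auto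
  next
    case False
    then have Kp: "0 < K" using K0 by simp
    have hc: "continuous_on UNIV (h n)" for n
      unfolding h_def using Kp g by (intro continuous_intros) (auto simp: max_def)
    have hK: "norm (h n x) \<le> K" for n x
      unfolding h_def using Kp by (auto simp: max_def field_simps)
    have hl: "(\<lambda>n. h n x) \<longlonglongrightarrow> f x" if "x \<notin> Z" for x
    proof -
      have "(\<lambda>n. h n x) \<longlonglongrightarrow> (K / max K (norm (f x))) *\<^sub>R f x"
        unfolding h_def using Kp lim[OF that] by (intro tendsto_intros) (auto simp: max_def)
      then show ?thesis using K[of x] Kp by (simp add: max_def split: if_splits)
    qed
    have AEZ: "AE x in lborel. x \<notin> Z"
    proof -
      have "Z \<in> null_sets lebesgue" using Z by (simp add: negligible_iff_null_sets)
      then have "AE x in lebesgue. x \<notin> Z" by (rule AE_not_in)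
      then show ?thesis by (simp add: AE_completion_iff)
    qed
    have hm[measurable]: "h n \<in> borel_measurable borel" for n
      using hc by (rule borel_measurable_continuous_onI)
    note f[measurable]
    have "(\<lambda>n. LINT s:{0..1}|lborel. norm (f s - h n s)) \<longlonglongrightarrow> (LINT s:{0..1::real}|lborel. (0::real))"
        unfolding set_lebesgue_integral_def real_scaleR_def
    proof (rule Bochner_Integration.integral_dominated_convergence[where w="\<lambda>s::real. indicator {0..1} s * (2*K)"])
      show "AE x in lborel. (\<lambda>n. indicator {0..1} x * norm (f x - h n x)) \<longlonglongrightarrow> indicator {0..1} x * (0::real)"
        using AEZ
      proof eventually_elim
        case (elim x)
        then show ?case using hl[OF elim]
          by (auto intro!: tendsto_eq_intros simp: indicator_def)
      qed
      have "norm (f x - h n x) \<le> 2*K" for x n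
        using norm_triangle_ineq4[of "f x" "h n x"] K[of x] hK[of n x] by simp
      then show "AE x in lborel. norm (indicator {0..1} x * norm (f x - h n x)) \<le> indicator {0..1} x * (2*K)" for n
        by (auto simp: indicator_def)
    qed auto
    then have "eventually (\<lambda>n. (LINT s:{0..1}|lborel. norm (f s - h n s)) < e) sequentially"
      using e by (auto dest: order_tendstoD)
    then obtain n where "(LINT s:{0..1}|lborel. norm (f s - h n s)) < e"
      by (auto simp: eventually_sequentially)
    then show ?thesis using that[OF hc hK] by blast
  qed
qed

text \<open>The mean is taken over the cell before \<open>k / N\<close>, so that it depends on
  \<open>f\<close> only up to time \<open>k / N\<close>; used as the value on the following cell, it
  yields an adapted step process. For \<open>k = 0\<close> and \<open>0 < N\<close> the window meets
  the unit interval in the single point 0, so the value is 0.\<close>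

definition lagged_average :: "nat \<Rightarrow> (real \<Rightarrow> 'a::euclidean_space) \<Rightarrow> nat \<Rightarrow> 'a" where
  "lagged_average N f k = real N *\<^sub>R (LINT r:{(real k - 1) / N<..real k / N} \<inter> {0..1}|lborel. f r)"

definition lagged_step :: "nat \<Rightarrow> (real \<Rightarrow> 'a::euclidean_space) \<Rightarrow> real \<Rightarrow> 'a" where
  "lagged_step N f s =
     (\<Sum>k<N. if real k / N < s \<and> s \<le> real (Suc k) / N then lagged_average N f k else 0)"

lemma lagged_step_at:
  assumes "k < N" "real k / N < s" "s \<le> real (Suc k) / N"
  shows "lagged_step N f s = lagged_average N f k"
proof -
  have "(if real j / N < s \<and> s \<le> real (Suc j) / N then lagged_average N f j else 0)
      = (if j = k then lagged_average N f k else 0)" for j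
  proof (cases "j = k")
    case True
    then show ?thesis using assms by simp
  next
    case False
    have N: "0 < real N" using assms by simp
    have "\<not> (real j / N < s \<and> s \<le> real (Suc j) / N)"
    proof
      assume *: "real j / N < s \<and> s \<le> real (Suc j) / N"
      have "real j / N < real (Suc k) / N" "real k / N < real (Suc j) / N"
        using * assms by linarith+
      then have "j < Suc k" "k < Suc j" using N by (auto simp: divide_less_cancel)
      then show False using False by simp
    qed
    then have "(if real j / N < s \<and> s \<le> real (Suc j) / N then lagged_average N f j else 0) = 0"
      by (rule if_not_P)
    then show ?thesis using False by simp
  qed
  then show ?thesis using assms by (simp add: lagged_step_def)
qed

lemma lagged_cell:
  assumes "0 < s" "s \<le> 1" "0 < N"
  obtains k where "k < N" "real k / N < s" "s \<le> real (Suc k) / N"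
proof -
  \<comment> \<open>Cells are open on the left and closed on the right, hence ceiling minus one
    rather than floor.\<close>
  define k where "k = nat (\<lceil>s * N\<rceil> - 1)"
  have p: "0 < s * N" using assms by simp
  have c: "1 \<le> \<lceil>s * N\<rceil>" using p by linarith
  have k: "real k = of_int \<lceil>s * N\<rceil> - 1" unfolding k_def using c by simp
  have 1: "real k < s * N" "s * N \<le> real (Suc k)" using k by linarith+
  have "s * N \<le> N" using assms by simp
  then have "k < N" using 1 by linarith
  moreover have "real k / N < s" "s \<le> real (Suc k) / N"
    using 1 assms by (auto simp: field_simps)
  ultimately show ?thesis using that by blast
qed

lemma norm_lagged_average_le:
  fixes f :: "real \<Rightarrow> 'a::euclidean_space"
  assumes f: "f \<in> borel_measurable borel" and K: "\<And>s. norm (f s) \<le> K" and N: "0 < N"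
  shows "norm (lagged_average N f k) \<le> N * (LINT r:{(real k - 1) / N<..real k / N} \<inter> {0..1}|lborel. norm (f r))"
    and "norm (lagged_average N f k) \<le> K"
proof -
  let ?I = "{(real k - 1) / N<..real k / N} \<inter> {0..1}"
  have K0: "0 \<le> K" using K[of 0] norm_ge_zero order_trans by blast
  note f[measurable]
  have fin: "emeasure lborel ?I < \<infinity>"
    by (intro le_less_trans[OF emeasure_mono[of ?I "{0..1}"]]) auto
  have int: "set_integrable lborel ?I f"
    unfolding set_integrable_def
    using fin K by (intro integrableI_bounded_set[where B=K and A="?I"]) (auto simp: indicator_def)
  have le: "norm (LINT r:?I|lborel. f r) \<le> (LINT r:?I|lborel. norm (f r))"
    using set_integral_norm_bound[OF int] .
  then show "norm (lagged_average N f k) \<le> N * (LINT r:?I|lborel. norm (f r))"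
    unfolding lagged_average_def by (simp add: mult_left_mono)
  also have "(LINT r:?I|lborel. norm (f r)) \<le> (LINT r:?I|lborel. K)"
    using K fin by (intro set_integral_mono set_integrable_norm int) (auto simp: set_integrable_def)
  also have "\<dots> = K * measure lborel ?I"
    unfolding set_lebesgue_integral_def by simp
  also have "measure lborel ?I \<le> measure lborel {(real k - 1) / N<..real k / N}"
    using N by (intro measure_mono_fmeasurable) (auto simp: fmeasurable_def emeasure_lborel_Ioc divide_right_mono)
  also have "\<dots> = 1 / N" using N by (simp add: field_simps)
  finally show "norm (lagged_average N f k) \<le> K"
    using N K0 by (simp add: mult_left_mono)
qed

lemma norm_lagged_step_le:
  fixes f :: "real \<Rightarrow> 'a::euclidean_space"
  assumes f: "f \<in> borel_measurable borel" and K: "\<And>s. norm (f s) \<le> K" and N: "0 < N"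
  shows "norm (lagged_step N f s) \<le> K"
proof (cases "0 < s \<and> s \<le> 1")
  case True
  then obtain k where k: "k < N" "real k / N < s" "s \<le> real (Suc k) / N"
    using lagged_cell[of s N] N by blast
  show ?thesis using lagged_step_at[OF k, of f] norm_lagged_average_le(2)[OF f K N] by simp
next
  case False
  have K0: "0 \<le> K" using K[of 0] norm_ge_zero order_trans by blast
  have "lagged_step N f s = (\<Sum>k<N. 0)"
    unfolding lagged_step_def
  proof (rule sum.cong, simp)
    fix k assume "k \<in> {..<N}"
    then have "real (Suc k) / N \<le> 1" "0 \<le> real k / N" using N by (auto simp: field_simps)
    then have "\<not> (real k / N < s \<and> s \<le> real (Suc k) / N)" using False by linarith
    then show "(if real k / N < s \<and> s \<le> real (Suc k) / N then lagged_average N f k else 0) = 0" by (rule if_not_P)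
  qed
  then show ?thesis using K0 by simp
qed

lemma measurable_lagged_step[measurable]: "lagged_step N f \<in> borel_measurable borel"
  unfolding lagged_step_def by measurable

lemma lagged_step_diff:
  fixes f g :: "real \<Rightarrow> 'a::euclidean_space"
  assumes f: "f \<in> borel_measurable borel" and Kf: "\<And>s. norm (f s) \<le> K"
    and g: "g \<in> borel_measurable borel" and Kg: "\<And>s. norm (g s) \<le> K"
  shows "lagged_step N (\<lambda>s. f s - g s) s = lagged_step N f s - lagged_step N g s"
proof -
  have int: "set_integrable lborel ({(real k - 1) / N<..real k / N} \<inter> {0..1}) h" (is "set_integrable _ ?A _")
    if h: "h \<in> borel_measurable borel" "\<And>s. norm (h s) \<le> K" for h :: "real \<Rightarrow> 'a" and k
  proof -
    have "emeasure lborel ?A < \<infinity>"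
      by (intro le_less_trans[OF emeasure_mono[of ?A "{0..1}"]]) auto
    then show ?thesis unfolding set_integrable_def
      using h by (intro integrableI_bounded_set[where B=K and A="?A"]) (auto simp: indicator_def)
  qed
  show ?thesis
    unfolding lagged_step_def lagged_average_def sum_subtractf[symmetric]
    by (intro sum.cong refl) (simp add: set_integral_diff(2)[OF int[OF f Kf] int[OF g Kg]] scaleR_right_diff_distrib)
qed

text \<open>Averaging over one cell and spreading the value over the next cell of the same length
  \<open>1 / N\<close> does not increase the integral of the norm, and the averaging cells are
  disjoint. This contraction carries convergence from continuous functions to all bounded
  ones.\<close>

lemma lagged_step_L1:
  fixes f :: "real \<Rightarrow> 'a::euclidean_space"
  assumes f: "f \<in> borel_measurable borel" and K: "\<And>s. norm (f s) \<le> K" and N: "0 < N"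
  shows "(LINT s:{0..1}|lborel. norm (lagged_step N f s)) \<le> (LINT s:{0..1}|lborel. norm (f s))"
proof -
  let ?J = "\<lambda>k. {real k / N<..real (Suc k) / N}"
  let ?I = "\<lambda>k. {(real k - 1) / N<..real k / N} \<inter> {0..1}"
  note f[measurable]
  have K0: "0 \<le> K" using K[of 0] norm_ge_zero order_trans by blast
  have int: "integrable lborel (\<lambda>r. indicator (A \<inter> {0..1}) r * norm (f r))" if "A \<in> sets borel" for A :: "real set"
    using that K K0 by (intro integrableI_bounded_set[where B=K and A="{0..1}"]) (auto simp: indicator_def)
  have intK: "integrable lborel (\<lambda>s. indicator {0..1} s * norm (lagged_step N f s))"
    using norm_lagged_step_le[OF f K N]
    by (intro integrableI_bounded_set[where B=K and A="{0..1}"]) (auto simp: indicator_def)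
  have "(LINT s:{0..1}|lborel. norm (lagged_step N f s))
      \<le> (LINT s|lborel. (\<Sum>k<N. indicator (?J k) s * norm (lagged_average N f k)))"
    unfolding set_lebesgue_integral_def
  proof (rule integral_mono)
    show "integrable lborel (\<lambda>s. \<Sum>k<N. indicator (?J k) s * norm (lagged_average N f k))"
      using N by (intro Bochner_Integration.integrable_sum integrable_mult_left) (auto simp: divide_right_mono)
    fix s :: real
    have "norm (lagged_step N f s) \<le> (\<Sum>k<N. indicator (?J k) s * norm (lagged_average N f k))"
      unfolding lagged_step_def
      by (intro order_trans[OF norm_sum] sum_mono) (auto simp: indicator_def)
    moreover have "0 \<le> (\<Sum>k<N. indicator (?J k) s * norm (lagged_average N f k))"
      by (intro sum_nonneg) auto
    ultimately show "indicator {0..1} s *\<^sub>R norm (lagged_step N f s) \<le> (\<Sum>k<N. indicator (?J k) s * norm (lagged_average N f k))"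
      by (auto simp: indicator_def)
  qed (use intK in simp)
  also have "\<dots> = (\<Sum>k<N. 1 / N * norm (lagged_average N f k))"
  proof -
    have m: "measure lborel (?J k) = 1 / N" for k using N by (simp add: divide_right_mono field_simps)
    have "integrable lborel (\<lambda>s. indicator (?J k) s * norm (lagged_average N f k))" for k
      using N by (intro integrable_mult_left) (auto simp: divide_right_mono)
    then have "(LINT s|lborel. (\<Sum>k<N. indicator (?J k) s * norm (lagged_average N f k)))
      = (\<Sum>k<N. (LINT s|lborel. indicator (?J k) s * norm (lagged_average N f k)))"
      by (intro Bochner_Integration.integral_sum)
    then show ?thesis using m by simp
  qed
  also have "\<dots> \<le> (\<Sum>k<N. (LINT r|lborel. indicator (?I k) r * norm (f r)))"
  proof (rule sum_mono)
    fix k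
    have "norm (lagged_average N f k) \<le> N * (LINT r|lborel. indicator (?I k) r * norm (f r))"
      using norm_lagged_average_le(1)[OF f K N] by (simp add: set_lebesgue_integral_def)
    then show "1 / N * norm (lagged_average N f k) \<le> (LINT r|lborel. indicator (?I k) r * norm (f r))"
      using N by (simp add: field_simps)
  qed
  also have "\<dots> = (LINT r|lborel. (\<Sum>k<N. indicator (?I k) r * norm (f r)))"
    by (subst Bochner_Integration.integral_sum) (auto intro!: int)
  also have "\<dots> \<le> (LINT r|lborel. indicator {0..1} r * norm (f r))"
  proof (rule integral_mono)
    fix r :: real
    have 1: "(\<Sum>k<N. indicator (?I k) r :: real) \<le> 1"
    proof (cases "\<exists>k<N. r \<in> ?I k")
      case True
      then obtain k where k: "k < N" "r \<in> ?I k" by blast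
      have "r \<notin> ?I j" if "j \<noteq> k" for j
      proof
        assume j: "r \<in> ?I j"
        have "(real j - 1) / N < real k / N" "(real k - 1) / N < real j / N" using k(2) j by auto
        then have "real j - 1 < real k" "real k - 1 < real j" using N by (simp_all add: divide_less_cancel)
        then show False using that by linarith
      qed
      then have "(\<Sum>j<N. indicator (?I j) r :: real) = (\<Sum>j<N. if j = k then 1 else 0)"
        using k(2) by (intro sum.cong refl) (metis indicator_simps)
      then show ?thesis using k(1) by simp
    next
      case False
      then have "(\<Sum>j<N. indicator (?I j) r :: real) = (\<Sum>j<N. 0)"
        by (intro sum.cong refl) (metis indicator_simps(2) lessThan_iff)
      then show ?thesis by simp
    qed
    show "(\<Sum>k<N. indicator (?I k) r * norm (f r)) \<le> indicator {0..1} r * norm (f r)"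
    proof (cases "r \<in> {0..1}")
      case True
      then show ?thesis using mult_right_mono[OF 1, of "norm (f r)"] by (simp add: sum_distrib_right)
    qed (auto simp: indicator_def)
  next
    show "integrable lborel (\<lambda>r. \<Sum>k<N. indicator (?I k) r * norm (f r))"
      by (intro Bochner_Integration.integrable_sum int) auto
    show "integrable lborel (\<lambda>r. indicator {0..1} r * norm (f r))"
      using int[of UNIV] by simp
  qed
  finally show ?thesis by (simp add: set_lebesgue_integral_def)
qed

text \<open>A point \<open>s\<close> and the averaging window of its cell lie within
  \<open>2 / N\<close> of each other, so continuity at \<open>s\<close> suffices. Once
  \<open>2 / N < s\<close> the cell is not the first one, whose window is degenerate.\<close>

lemma lagged_step_tendsto_continuous:
  fixes g :: "real \<Rightarrow> 'a::euclidean_space"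
  assumes g: "continuous_on UNIV g" and s: "0 < s" "s \<le> 1"
  shows "(\<lambda>N. lagged_step (Suc N) g s) \<longlonglongrightarrow> g s"
proof (rule LIMSEQ_I)
  fix e :: real assume "0 < e"
  define e' where "e' = e / 2"
  have e': "0 < e'" "e' < e" using \<open>0 < e\<close> by (auto simp: e'_def)
  have gm[measurable]: "g \<in> borel_measurable borel" using g by (rule borel_measurable_continuous_onI)
  obtain d where d: "0 < d" "\<And>r. dist r s < d \<Longrightarrow> dist (g r) (g s) < e'"
    using g e'(1) unfolding continuous_on_iff by (metis UNIV_I)
  obtain N0 where N0: "2 / min d s < real N0" using reals_Archimedean2 by blast
  show "\<exists>no. \<forall>n\<ge>no. norm (lagged_step (Suc n) g s - g s) < e"
  proof (intro exI[of _ N0] allI impI)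
    fix n assume n: "N0 \<le> n"
    define N where "N = Suc n"
    have N: "0 < N" "0 < real N" by (auto simp: N_def)
    have "2 / min d s < real N" using N0 n by (simp add: N_def)
    then have "2 < real N * min d s" using d(1) s(1) by (simp add: pos_divide_less_eq)
    then have "2 / N < min d s"
      by (subst pos_divide_less_eq[OF N(2)]) (simp only: mult.commute)
    then have ds: "2 / N < d" "2 / N < s" by auto
    obtain k where k: "k < N" "real k / N < s" "s \<le> real (Suc k) / N"
      using lagged_cell[OF s N(1)] by blast
    have k1: "1 \<le> real k"
    proof (rule ccontr)
      assume "\<not> 1 \<le> real k"
      then have "k = 0" by simp
      then have "s \<le> 1 / N" using k(3) by simp
      moreover have "1 / N \<le> 2 / N" using N by (simp add: divide_right_mono)
      ultimately show False using ds(2) by linarith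
    qed
    define I where "I = {(real k - 1) / N<..real k / N}"
    have I01: "I \<inter> {0..1} = I"
    proof -
      have "0 \<le> (real k - 1) / N" "real k / N \<le> 1" using k1 k(1) N by (auto simp: field_simps)
      then show ?thesis unfolding I_def by (auto intro: order_trans less_imp_le)
    qed
    have Im: "measure lborel I = 1 / N" "emeasure lborel I < \<infinity>"
      using N by (auto simp: I_def divide_right_mono emeasure_lborel_Ioc field_simps)
    have near: "norm (g r - g s) < e'" if "r \<in> I" for r
    proof -
      have "(real k - 1) / N < r" "r \<le> real k / N" using that by (auto simp: I_def)
      moreover have "(real (Suc k)) / N = (real k - 1) / N + 2 / N" by (simp add: add_divide_distrib[symmetric])
      ultimately have "\<bar>r - s\<bar> < 2 / N" using k(2,3) by linarith
      then show ?thesis using d(2)[of r] ds(1) by (simp add: dist_norm)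
    qed
    \<comment> \<open>The bound on averages is applied to \<open>g - g s\<close> cut off to the
      window, whose norm is at most \<open>e'\<close> everywhere.\<close>
    define h where "h r = indicator I r *\<^sub>R (g r - g s)" for r
    have [measurable]: "I \<in> sets borel" by (simp add: I_def)
    have hm: "h \<in> borel_measurable borel" unfolding h_def by measurable
    have hK: "norm (h r) \<le> e'" for r
      using near[of r] e' by (auto simp: h_def indicator_def)
    have int1: "integrable lborel (\<lambda>r. indicator I r *\<^sub>R (g r - g s))"
      using near Im(2) by (intro integrableI_bounded_set[where B=e' and A=I]) (auto simp: indicator_def less_imp_le)
    have int2: "integrable lborel (\<lambda>r. indicator I r *\<^sub>R g s)"
      using Im(2) by (intro integrable_scaleR_left) (auto simp: integrable_indicator_iff)
    have "(LINT r:I|lborel. h r) = (LINT r|lborel. indicator I r *\<^sub>R (g r - g s))"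
      unfolding set_lebesgue_integral_def h_def
      by (intro Bochner_Integration.integral_cong) (auto simp: indicator_def)
    also have "\<dots> = (LINT r|lborel. indicator I r *\<^sub>R (g r - g s) + indicator I r *\<^sub>R g s) - (LINT r|lborel. indicator I r *\<^sub>R g s)"
      using int1 int2 by (simp add: Bochner_Integration.integral_add)
    also have "\<dots> = (LINT r:I|lborel. g r) - (1 / N) *\<^sub>R g s"
      using Im by (simp add: set_lebesgue_integral_def scaleR_right_diff_distrib)
    finally have "lagged_average N h k = lagged_average N g k - g s"
      using N by (simp add: lagged_average_def I01[unfolded I_def] I_def scaleR_right_diff_distrib)
    then have "norm (lagged_average N g k - g s) \<le> e'"
      using norm_lagged_average_le(2)[OF hm hK N(1), of k] by simp
    then show "norm (lagged_step (Suc n) g s - g s) < e"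
      using lagged_step_at[OF k, of g] e'(2) unfolding N_def by simp
  qed
qed

text \<open>Convergence in L1 holds for continuous functions and passes to bounded ones by density
  and \<open>lagged_step_L1\<close>; the L2 statement follows since the difference is bounded by
  \<open>2 * K\<close>.\<close>

lemma lagged_step_tendsto_L2:
  fixes f :: "real \<Rightarrow> 'a::euclidean_space"
  assumes f: "f \<in> borel_measurable borel" and K: "\<And>s. norm (f s) \<le> K"
  shows "(\<lambda>N. LINT s:{0..1}|lborel. (norm (lagged_step (Suc N) f s - f s))\<^sup>2) \<longlonglongrightarrow> 0"
proof -
  have K0: "0 \<le> K" using K[of 0] norm_ge_zero order_trans by blast
  note f[measurable]
  let ?T = "\<lambda>N. lagged_step (Suc N)"
  have int: "integrable lborel (\<lambda>s. indicator {0..1} s * norm (h s))"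
    if "h \<in> borel_measurable borel" "\<And>s. norm (h s) \<le> C" for h :: "real \<Rightarrow> 'a" and C
  proof -
    have "0 \<le> C" using that(2)[of 0] norm_ge_zero order_trans by blast
    then show ?thesis
      using that by (intro integrableI_bounded_set[where B=C and A="{0..1}"]) (auto simp: indicator_def)
  qed
  have TK: "norm (?T N h s) \<le> C" if "h \<in> borel_measurable borel" "\<And>s. norm (h s) \<le> C" for h :: "real \<Rightarrow> 'a" and C N s
    using norm_lagged_step_le[OF that] by simp
  have L1: "(\<lambda>N. LINT s:{0..1}|lborel. norm (?T N f s - f s)) \<longlonglongrightarrow> 0"
  proof (rule LIMSEQ_I)
    fix e :: real assume "0 < e"
    then obtain g where g: "continuous_on UNIV g" "\<And>s. norm (g s) \<le> K"
      "(LINT s:{0..1}|lborel. norm (f s - g s)) < e / 4"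
      using bounded_by_continuous_L1[OF f K, of "e / 4"] by auto
    have gm[measurable]: "g \<in> borel_measurable borel" using g(1) by (rule borel_measurable_continuous_onI)
    have "(\<lambda>N. LINT s|lborel. indicator {0..1} s * norm (?T N g s - g s)) \<longlonglongrightarrow> (LINT s::real|lborel. 0)"
    proof (rule Bochner_Integration.integral_dominated_convergence[where w="\<lambda>s::real. indicator {0..1} s * (2*K)"])
      have "AE x in lborel. x \<noteq> (0::real)" by (rule AE_lborel_singleton)
      then show "AE x in lborel. (\<lambda>N. indicator {0..1} x * norm (?T N g x - g x)) \<longlonglongrightarrow> 0"
      proof eventually_elim
        case (elim x)
        show ?case
        proof (cases "x \<in> {0..1}")
          case True
          then have "(\<lambda>N. ?T N g x) \<longlonglongrightarrow> g x"
            using elim lagged_step_tendsto_continuous[OF g(1), of x] by auto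
          then have "(\<lambda>N. norm (?T N g x - g x)) \<longlonglongrightarrow> 0"
            using LIM_zero tendsto_norm_zero by blast
          then show ?thesis using True by simp
        qed auto
      qed
      have "norm (?T N g x - g x) \<le> 2*K" for x N
        using norm_triangle_ineq4[of "?T N g x" "g x"] g(2)[of x] TK[OF gm g(2), of N x] by simp
      then show "AE x in lborel. norm (indicator {0..1} x * norm (?T N g x - g x)) \<le> indicator {0..1} x * (2*K)" for N
        by (auto simp: indicator_def)
    qed auto
    then have "eventually (\<lambda>N. (LINT s:{0..1}|lborel. norm (?T N g s - g s)) < e / 4) sequentially"
      using \<open>0 < e\<close> order_tendstoD(2)[of _ 0 sequentially "e / 4"] by (simp add: set_lebesgue_integral_def)
    then obtain N0 where N0: "\<And>N. N0 \<le> N \<Longrightarrow> (LINT s:{0..1}|lborel. norm (?T N g s - g s)) < e / 4"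
      by (auto simp: eventually_sequentially)
    show "\<exists>no. \<forall>n\<ge>no. norm ((LINT s:{0..1}|lborel. norm (?T n f s - f s)) - 0) < e"
    proof (intro exI[of _ N0] allI impI)
      fix n assume n: "N0 \<le> n"
      let ?h = "\<lambda>s. f s - g s"
      have hm: "?h \<in> borel_measurable borel" by simp
      have hK: "norm (?h s) \<le> 2 * K" for s
        using norm_triangle_ineq4[of "f s" "g s"] K[of s] g(2)[of s] by simp
      have i1: "integrable lborel (\<lambda>s. indicator {0..1} s * norm (?T n ?h s))"
        using TK[OF hm hK] by (intro int) auto
      have i2: "integrable lborel (\<lambda>s. indicator {0..1} s * norm (?T n g s - g s))"
      proof (rule int)
        show "norm (?T n g s - g s) \<le> 2 * K" for s
          using norm_triangle_ineq4[of "?T n g s" "g s"] TK[OF gm g(2), of n s] g(2)[of s] by linarith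
      qed simp
      have i3: "integrable lborel (\<lambda>s. indicator {0..1} s * norm (?h s))"
        using hK by (intro int) auto
      have i4: "integrable lborel (\<lambda>s. indicator {0..1} s * norm (?T n f s - f s))"
      proof (rule int)
        show "norm (?T n f s - f s) \<le> 2 * K" for s
          using norm_triangle_ineq4[of "?T n f s" "f s"] TK[OF f K, of n s] K[of s] by linarith
      qed simp
      have "norm (?T n f s - f s) \<le> norm (?T n ?h s) + norm (?T n g s - g s) + norm (?h s)" for s
      proof -
        have "?T n f s - f s = ?T n ?h s + (?T n g s - g s) - ?h s"
          using lagged_step_diff[OF f K gm g(2), of "Suc n" s] by simp
        then show ?thesis
          using norm_triangle_ineq4[of "?T n ?h s + (?T n g s - g s)" "?h s"]
            norm_triangle_ineq[of "?T n ?h s" "?T n g s - g s"] by simp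
      qed
      then have "(LINT s|lborel. indicator {0..1} s * norm (?T n f s - f s))
        \<le> (LINT s|lborel. indicator {0..1} s * norm (?T n ?h s) + indicator {0..1} s * norm (?T n g s - g s)
              + indicator {0..1} s * norm (?h s))"
        using i1 i2 i3 i4 by (intro integral_mono) (auto simp: indicator_def)
      also have "\<dots> = (LINT s:{0..1}|lborel. norm (?T n ?h s)) + (LINT s:{0..1}|lborel. norm (?T n g s - g s))
              + (LINT s:{0..1}|lborel. norm (?h s))"
        using i1 i2 i3 by (simp add: set_lebesgue_integral_def)
      also have "(LINT s:{0..1}|lborel. norm (?T n ?h s)) \<le> (LINT s:{0..1}|lborel. norm (?h s))"
        by (rule lagged_step_L1[OF hm hK]) simp
      finally have "(LINT s:{0..1}|lborel. norm (?T n f s - f s)) < e"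
        using g(3) N0[OF n] \<open>0 < e\<close> by (simp add: set_lebesgue_integral_def)
      moreover have "0 \<le> (LINT s:{0..1}|lborel. norm (?T n f s - f s))"
        unfolding set_lebesgue_integral_def by (intro integral_nonneg_AE) auto
      ultimately show "norm ((LINT s:{0..1}|lborel. norm (?T n f s - f s)) - 0) < e" by simp
    qed
  qed
  have "(\<lambda>N. (2 * K) * (LINT s:{0..1}|lborel. norm (?T N f s - f s))) \<longlonglongrightarrow> 0"
    using tendsto_mult_left[OF L1, of "2 * K"] by simp
  moreover have le: "(LINT s:{0..1}|lborel. (norm (?T N f s - f s))\<^sup>2) \<le> (2 * K) * (LINT s:{0..1}|lborel. norm (?T N f s - f s))" for N
  proof -
    have b: "norm (?T N f s - f s) \<le> 2 * K" for s
      using norm_triangle_ineq4[of "?T N f s" "f s"] TK[OF f K, of N s] K[of s] by simp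
    have "(LINT s|lborel. indicator {0..1} s * (norm (?T N f s - f s))\<^sup>2) \<le> (LINT s|lborel. (2 * K) * (indicator {0..1} s * norm (?T N f s - f s)))"
    proof (rule integral_mono)
      show "integrable lborel (\<lambda>s. (2 * K) * (indicator {0..1} s * norm (?T N f s - f s)))"
        using b by (intro integrable_mult_right int) auto
      show "integrable lborel (\<lambda>s. indicator {0..1} s * (norm (?T N f s - f s))\<^sup>2)"
      proof (rule integrableI_bounded_set[where B="4*K\<^sup>2" and A="{0..1}"])
        have "(norm (?T N f s - f s))\<^sup>2 \<le> 4 * K\<^sup>2" for s
          using power_mono[OF b[of s] norm_ge_zero, of 2] by simp
        then show "AE s in lborel. s \<in> {0..1} \<longrightarrow> norm (indicator {0..1} s * (norm (?T N f s - f s))\<^sup>2) \<le> 4 * K\<^sup>2"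
          by (auto simp: indicator_def)
      qed (auto simp: indicator_def)
      show "indicator {0..1} s * (norm (?T N f s - f s))\<^sup>2 \<le> (2 * K) * (indicator {0..1} s * norm (?T N f s - f s))" for s
        unfolding power2_eq_square
        using mult_right_mono[OF b[of s] norm_ge_zero[of "?T N f s - f s"]] by (cases "s \<in> {0..1}") simp_all
    qed
    then show ?thesis by (simp add: set_lebesgue_integral_def)
  qed
  moreover have ge: "0 \<le> (LINT s:{0..1}|lborel. (norm (?T N f s - f s))\<^sup>2)" for N
    unfolding set_lebesgue_integral_def by (intro integral_nonneg_AE) auto
  ultimately show ?thesis
    by (intro tendsto_sandwich[OF always_eventually[OF allI[OF ge]] always_eventually[OF allI[OF le]] tendsto_const])
qed

section \<open>Brownian increments\<close>

locale brownian_path_space =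
  fixes \<nu> :: "('n::finite) path measure" and \<beta> :: "'n path \<Rightarrow> 'n path"
  assumes prob_nu: "prob_space \<nu>"
    and sets_nu: "sets \<nu> = sets path_algebra"
    and brownian: "brownian_motion \<nu> \<beta>"
    and same_filtration:
          "\<And>t. t \<in> {0..1} \<Longrightarrow> sets (natural_filtration \<nu> \<beta> t) = sets (coord_filtration \<nu> t)"
begin

abbreviation P :: "'n path measure" where "P \<equiv> completion \<nu>"
abbreviation F :: "real \<Rightarrow> 'n path measure" where "F \<equiv> coord_filtration \<nu>"

sublocale prob_space P
  by (rule prob_space.prob_space_completion[OF prob_nu])

sublocale filtration "space \<nu>" F
  by (rule filtration_natural_filtration)

section \<open>Completed filtrations and null sets\<close>

lemma space_nu: "space \<nu> = space path_algebra"
  using sets_nu by (rule sets_eq_imp_space_eq)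

lemma sets_nf: "sets (natural_filtration \<nu> X t) = sigma_sets (space \<nu>)
    ({(\<lambda>w. X w s) -` B \<inter> space \<nu> | s B. s \<in> {0..1} \<and> s \<le> t \<and> B \<in> sets borel} \<union> null_sets P)"
  unfolding natural_filtration_def by (rule sets_measure_of[OF natural_filtration_generator])

lemma space_nf[simp]: "space (natural_filtration \<nu> X t) = space \<nu>"
  unfolding natural_filtration_def by (rule space_measure_of[OF natural_filtration_generator])

lemma measurable_coord: "s \<in> {0..1} \<Longrightarrow> (\<lambda>w. w s) \<in> borel_measurable \<nu>"
  unfolding measurable_cong_sets[OF sets_nu refl] path_algebra_def
  by (intro measurable_restrict_space1 measurable_component_singleton)

lemma sets_F_P: "A \<in> sets (F t) \<Longrightarrow> A \<in> sets P"
proof -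
  have "sets (F t) \<subseteq> sets P"
    unfolding sets_nf
    by (intro sets.sigma_sets_subset[of _ P, simplified])
      (auto simp: null_sets_def intro: measurable_sets[OF measurable_completion[OF measurable_coord], unfolded space_completion])
  then show "A \<in> sets (F t) \<Longrightarrow> A \<in> sets P" by blast
qed

lemma null_sets_F: "A \<in> null_sets P \<Longrightarrow> A \<in> sets (F t)"
  unfolding sets_nf by (rule sigma_sets.Basic) simp

lemma measurable_F_P: "X \<in> F t \<rightarrow>\<^sub>M N \<Longrightarrow> X \<in> P \<rightarrow>\<^sub>M N"
  by (auto simp: measurable_def intro: sets_F_P)

lemma measurable_F_mono:
  assumes st: "s \<le> t" and X: "X \<in> F s \<rightarrow>\<^sub>M N"
  shows "X \<in> F t \<rightarrow>\<^sub>M N"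
proof (rule measurableI)
  show "X w \<in> space N" if "w \<in> space (F t)" for w
    using measurable_space[OF X] that by simp
  show "X -` A \<inter> space (F t) \<in> sets (F t)" if "A \<in> sets N" for A
    using subsetD[OF sets_F_mono[OF st] measurable_sets[OF X that]] by simp
qed

text \<open>Every \<open>F t\<close> contains all null sets of the completion, so adaptedness is
  insensitive to changes on null sets. This allows limits and versions to be handled almost
  everywhere.\<close>

lemma sets_AE_F:
  assumes A: "A \<in> sets (F t)" and B: "B \<subseteq> space \<nu>" and AE: "AE w in P. w \<in> A \<longleftrightarrow> w \<in> B"
  shows "B \<in> sets (F t)"
proof -
  have 1: "{w \<in> space P. \<not> (w \<in> A \<longleftrightarrow> w \<in> B)} \<in> null_sets P"
    using AE by (simp add: completion.AE_iff_null_sets)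
  have sub: "A \<subseteq> space \<nu>" using sets.sets_into_space[OF A] by simp
  have n: "A - B \<in> null_sets P" "B - A \<in> null_sets P"
    using sub B by (auto intro!: completion.complete2[OF _ 1])
  have "B = (A - (A - B)) \<union> (B - A)" by auto
  also have "\<dots> \<in> sets (F t)" using A n[THEN null_sets_F] by blast
  finally show ?thesis .
qed

lemma measurable_AE_F:
  assumes X: "X \<in> F t \<rightarrow>\<^sub>M N" and AE: "AE w in P. X w = Y w"
    and Y: "\<And>w. w \<in> space \<nu> \<Longrightarrow> Y w \<in> space N"
  shows "Y \<in> F t \<rightarrow>\<^sub>M N"
proof (rule measurableI)
  fix A assume A: "A \<in> sets N"
  show "Y -` A \<inter> space (F t) \<in> sets (F t)"
  proof (rule sets_AE_F)
    show "X -` A \<inter> space (F t) \<in> sets (F t)" using X A by (rule measurable_sets)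
    show "AE w in P. w \<in> X -` A \<inter> space (F t) \<longleftrightarrow> w \<in> Y -` A \<inter> space (F t)"
      using AE by eventually_elim simp
  qed auto
qed (use Y in auto)

lemma measurable_beta: assumes "s \<in> {0..1}" "s \<le> t" shows "(\<lambda>w. \<beta> w s) \<in> borel_measurable (F t)"
proof -
  have "(\<lambda>w. \<beta> w s) \<in> borel_measurable (F s)"
  proof (rule measurableI)
    fix A :: "(real, 'n) vec set" assume "A \<in> sets borel"
    then have "(\<lambda>w. \<beta> w s) -` A \<inter> space \<nu> \<in> sets (natural_filtration \<nu> \<beta> s)"
      using assms unfolding sets_nf by (intro sigma_sets.Basic) blast
    then show "(\<lambda>w. \<beta> w s) -` A \<inter> space (F s) \<in> sets (F s)"
      using same_filtration[OF assms(1)] by simp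
  qed simp
  then show ?thesis using assms(2) by (rule measurable_F_mono[rotated])
qed

lemma beta_0: "AE w in P. \<beta> w 0 = 0"
  using brownian by (simp add: brownian_motion_def)

section \<open>Conditional law of a single increment\<close>

definition gauss :: "real \<Rightarrow> (real, 'n) vec \<Rightarrow> real" where
  "gauss d x = (\<Prod>i\<in>UNIV. normal_density 0 (sqrt d) (x $ i))"

lemma measurable_gauss[measurable]: "gauss d \<in> borel_measurable borel"
  unfolding gauss_def by measurable

lemma gauss_nonneg: "0 \<le> gauss d x"
  unfolding gauss_def by (intro prod_nonneg) auto

lemma gauss_uminus: "gauss d (- x) = gauss d x"
  by (simp add: gauss_def normal_density_def)

text \<open>Completing the square in each coordinate. It is the Girsanov formula for one increment
  at the level of densities: the exponential weight turns the centred Gaussian density into a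
  translate of it.\<close>

lemma gauss_shift:
  assumes "0 < d"
  shows "exp (- (z \<bullet> x) - (norm z)\<^sup>2 * d / 2) * gauss d x = gauss d (x + d *\<^sub>R z)"
proof -
  have "normal_density 0 (sqrt d) (x $ i + d * z $ i)
      = exp (- (z $ i * x $ i) - (z $ i)\<^sup>2 * d / 2) * normal_density 0 (sqrt d) (x $ i)" for i
  proof -
    have "- ((x $ i + d * z $ i)\<^sup>2) / (2 * d)
        = (- (z $ i * x $ i) - (z $ i)\<^sup>2 * d / 2) + - ((x $ i)\<^sup>2) / (2 * d)"
      using assms by (simp add: field_simps power2_eq_square)
    then show ?thesis
      using assms by (simp add: normal_density_def exp_add[symmetric])
  qed
  moreover have "(norm z)\<^sup>2 = (\<Sum>i\<in>UNIV. (z $ i)\<^sup>2)"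
    unfolding power2_norm_eq_inner by (simp add: inner_vec_def power2_eq_square)
  then have "(\<Prod>i\<in>UNIV. exp (- (z $ i * x $ i) - (z $ i)\<^sup>2 * d / 2)) = exp (- (z \<bullet> x) - (norm z)\<^sup>2 * d / 2)"
    by (simp add: exp_sum[symmetric] sum_subtractf sum_negf inner_vec_def
        sum_divide_distrib[symmetric] sum_distrib_right[symmetric])
  moreover have "(\<Prod>i\<in>UNIV. f i * g i) = (\<Prod>i\<in>UNIV. f i) * (\<Prod>i\<in>(UNIV::'n set). g i)" for f g :: "'n \<Rightarrow> real"
    by (rule prod.distrib)
  ultimately show ?thesis by (simp add: gauss_def)
qed

text \<open>The increment is independent of \<open>F s\<close>, so the joint law of the past and the
  increment is a product and Fubini applies. The function \<open>H\<close> may depend on the past in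
  any \<open>F s\<close>-measurable way, which is how drifts, stopped sets and test functions of the
  past enter later.\<close>

lemma one_step:
  assumes s: "0 \<le> s" "s < t" "t \<le> 1" and H: "H \<in> borel_measurable (F s \<Otimes>\<^sub>M borel)"
  shows "(\<integral>\<^sup>+w. H (w, \<beta> w t - \<beta> w s) \<partial>P)
       = (\<integral>\<^sup>+w. (\<integral>\<^sup>+x. ennreal (gauss (t - s) x) * H (w, x) \<partial>lborel) \<partial>P)"
proof -
  let ?D = "\<lambda>w. \<beta> w t - \<beta> w s"
  have D: "distributed P lborel ?D (\<lambda>x. ennreal (gauss (t - s) x))"
    and ind: "indep_set {?D -` B \<inter> space \<nu> | B. B \<in> sets borel} (sets (natural_filtration \<nu> \<beta> s))"
    using brownian s unfolding brownian_motion_def gauss_def by auto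
  have Dm: "?D \<in> P \<rightarrow>\<^sub>M lborel" using D by (simp add: distributed_def)
  \<comment> \<open>The past is represented by the identity map into the coarser space
    \<open>F s\<close>.\<close>
  have idm: "(\<lambda>w. w) \<in> P \<rightarrow>\<^sub>M F s"
    by (auto simp: measurable_def intro: sets_F_P dest: sets.sets_into_space)
  interpret D: prob_space "distr P lborel ?D" using Dm by (rule prob_space_distr)
  interpret I: prob_space "distr P (F s) (\<lambda>w. w)" using idm by (rule prob_space_distr)
  have pm: "(\<lambda>w. (w, ?D w)) \<in> P \<rightarrow>\<^sub>M F s \<Otimes>\<^sub>M lborel" using idm Dm by (rule measurable_Pair)
  have eq: "distr P (F s) (\<lambda>w. w) \<Otimes>\<^sub>M distr P lborel ?D = distr P (F s \<Otimes>\<^sub>M lborel) (\<lambda>w. (w, ?D w))"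
  proof (rule pair_measure_eqI)
    fix A B assume "A \<in> sets (distr P (F s) (\<lambda>w. w))" "B \<in> sets (distr P lborel ?D)"
    then have A: "A \<in> sets (F s)" and B: "B \<in> sets borel" by simp_all
    have AP: "A \<in> sets P" "A \<subseteq> space \<nu>" using sets_F_P[OF A] sets.sets_into_space[OF A] by auto
    have BP: "?D -` B \<inter> space \<nu> \<in> sets P" using measurable_sets[OF Dm, of B] B by simp
    \<comment> \<open>Independence is postulated for the filtration of \<beta>; it holds for the
      coordinate filtration because both have the same sets.\<close>
    have "prob (A \<inter> (?D -` B \<inter> space \<nu>)) = prob A * prob (?D -` B \<inter> space \<nu>)"
      using indep_setD[OF ind, of "?D -` B \<inter> space \<nu>" A] A B same_filtration[of s] s
      by (auto simp: Int_commute mult.commute)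
    moreover have "(\<lambda>w. (w, ?D w)) -` (A \<times> B) \<inter> space P = A \<inter> (?D -` B \<inter> space \<nu>)"
      using AP by auto
    moreover have "(\<lambda>w. w) -` A \<inter> space P = A" using AP by auto
    ultimately show "emeasure (distr P (F s) (\<lambda>w. w)) A * emeasure (distr P lborel ?D) B
       = emeasure (distr P (F s \<Otimes>\<^sub>M lborel) (\<lambda>w. (w, ?D w))) (A \<times> B)"
      using A B idm Dm pm
      by (simp only: emeasure_distr pair_measureI sets_lborel emeasure_eq_measure ennreal_mult[symmetric] measure_nonneg space_completion)
  qed (auto intro!: D.sigma_finite_measure_axioms I.sigma_finite_measure_axioms cong: sets_pair_measure_cong)
  have H': "H \<in> borel_measurable (F s \<Otimes>\<^sub>M lborel)"
    using H by (simp cong: measurable_cong_sets sets_pair_measure_cong)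
  have "(\<integral>\<^sup>+w. H (w, ?D w) \<partial>P) = (\<integral>\<^sup>+y. H y \<partial>distr P (F s \<Otimes>\<^sub>M lborel) (\<lambda>w. (w, ?D w)))"
    using H' idm Dm by (subst nn_integral_distr) (auto intro: measurable_Pair)
  also have "\<dots> = (\<integral>\<^sup>+w. (\<integral>\<^sup>+x. H (w, x) \<partial>distr P lborel ?D) \<partial>distr P (F s) (\<lambda>w. w))"
    unfolding eq[symmetric]
    using H' by (subst D.nn_integral_fst[symmetric])
      (auto cong: measurable_cong_sets sets_pair_measure_cong)
  also have "\<dots> = (\<integral>\<^sup>+w. (\<integral>\<^sup>+x. H (w, x) \<partial>distr P lborel ?D) \<partial>P)"
    using H' idm by (subst nn_integral_distr)
      (auto intro!: D.borel_measurable_nn_integral_fst cong: measurable_cong_sets sets_pair_measure_cong)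
  also have "\<dots> = (\<integral>\<^sup>+w. (\<integral>\<^sup>+x. ennreal (gauss (t - s) x) * H (w, x) \<partial>lborel) \<partial>P)"
  proof (rule nn_integral_cong)
    fix w assume "w \<in> space P"
    then have "(\<lambda>x. H (w, x)) \<in> borel_measurable lborel"
      using measurable_Pair2[OF H', of w] by simp
    then show "(\<integral>\<^sup>+x. H (w, x) \<partial>distr P lborel ?D) = (\<integral>\<^sup>+x. ennreal (gauss (t - s) x) * H (w, x) \<partial>lborel)"
      using D by (simp add: distributed_def nn_integral_density)
  qed
  finally show ?thesis .
qed

lemma nn_integral_lborel_plus:
  assumes "h \<in> borel_measurable borel"
  shows "(\<integral>\<^sup>+x. h (x + c) \<partial>lborel) = (\<integral>\<^sup>+x. h x \<partial>(lborel :: (real, 'n) vec measure))"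
proof -
  have "(\<integral>\<^sup>+x. h x \<partial>lborel) = (\<integral>\<^sup>+x. h x \<partial>distr lborel borel ((+) c))"
    by (simp add: lborel_distr_plus)
  also have "\<dots> = (\<integral>\<^sup>+x. h (c + x) \<partial>lborel)"
    using assms by (subst nn_integral_distr) auto
  finally show ?thesis by (simp add: add.commute)
qed

lemma nn_integral_lborel_uminus:
  assumes "h \<in> borel_measurable borel"
  shows "(\<integral>\<^sup>+x. h (- x) \<partial>lborel) = (\<integral>\<^sup>+x. h x \<partial>(lborel :: (real, 'n) vec measure))"
proof -
  have "(lborel :: (real, 'n) vec measure) = distr lborel borel uminus"
    by (subst lborel_affine[of "-1" 0]) (auto simp: density_1 one_ennreal_def[symmetric])
  then have "(\<integral>\<^sup>+x. h x \<partial>lborel) = (\<integral>\<^sup>+x. h x \<partial>distr (lborel :: (real, 'n) vec measure) borel uminus)"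
    by simp
  also have "\<dots> = (\<integral>\<^sup>+x. h (- x) \<partial>lborel)"
    using assms by (subst nn_integral_distr) auto
  finally show ?thesis by simp
qed

lemma measurable_shift_pair:
  fixes z :: "'n path \<Rightarrow> (real, 'n) vec"
  assumes z: "z \<in> borel_measurable (F s)" and H: "H \<in> borel_measurable (F s \<Otimes>\<^sub>M borel)"
  shows "(\<lambda>p. ennreal (exp (- (z (fst p) \<bullet> snd p) - (norm (z (fst p)))\<^sup>2 * d / 2)) * H (fst p, snd p + d *\<^sub>R z (fst p)))
    \<in> borel_measurable (F s \<Otimes>\<^sub>M borel)"
proof -
  have [measurable]: "(\<lambda>p. z (fst p)) \<in> borel_measurable (F s \<Otimes>\<^sub>M (borel :: (real, 'n) vec measure))"
    by (rule measurable_compose[OF measurable_fst z])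
  have "(\<lambda>p. (fst p, snd p + d *\<^sub>R z (fst p))) \<in> F s \<Otimes>\<^sub>M borel \<rightarrow>\<^sub>M F s \<Otimes>\<^sub>M borel" by measurable
  from measurable_compose[OF this H] have [measurable]: "(\<lambda>p. H (fst p, snd p + d *\<^sub>R z (fst p))) \<in> borel_measurable (F s \<Otimes>\<^sub>M borel)" .
  show ?thesis by measurable
qed

text \<open>\<open>one_step\<close> for the weighted and translated integrand: in each fibre
  \<open>gauss_shift\<close> turns the weight into a translate of the density, and translation
  invariance of Lebesgue measure undoes the shift by \<open>z\<close>.\<close>

lemma one_step_shift:
  assumes s: "0 \<le> s" "s < t" "t \<le> 1" and H: "H \<in> borel_measurable (F s \<Otimes>\<^sub>M borel)"
    and z: "z \<in> borel_measurable (F s)"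
  shows "(\<integral>\<^sup>+w. ennreal (exp (- (z w \<bullet> (\<beta> w t - \<beta> w s)) - (norm (z w))\<^sup>2 * (t - s) / 2))
              * H (w, \<beta> w t - \<beta> w s + (t - s) *\<^sub>R z w) \<partial>P)
       = (\<integral>\<^sup>+w. (\<integral>\<^sup>+x. ennreal (gauss (t - s) x) * H (w, x) \<partial>lborel) \<partial>P)"
proof -
  let ?G = "\<lambda>p. ennreal (exp (- (z (fst p) \<bullet> snd p) - (norm (z (fst p)))\<^sup>2 * (t - s) / 2)) * H (fst p, snd p + (t - s) *\<^sub>R z (fst p))"
  have "(\<integral>\<^sup>+w. ?G (w, \<beta> w t - \<beta> w s) \<partial>P) = (\<integral>\<^sup>+w. (\<integral>\<^sup>+x. ennreal (gauss (t - s) x) * ?G (w, x) \<partial>lborel) \<partial>P)"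
    by (rule one_step[OF s measurable_shift_pair[OF z H]])
  also have "\<dots> = (\<integral>\<^sup>+w. (\<integral>\<^sup>+x. ennreal (gauss (t - s) x) * H (w, x) \<partial>lborel) \<partial>P)"
  proof (rule nn_integral_cong)
    fix w assume w: "w \<in> space P"
    have [measurable]: "(\<lambda>x. H (w, x)) \<in> borel_measurable borel"
      using measurable_Pair2[OF H, of w] w by simp
    have "ennreal (gauss (t - s) x) * ?G (w, x)
        = ennreal (gauss (t - s) (x + (t - s) *\<^sub>R z w)) * H (w, x + (t - s) *\<^sub>R z w)" for x
    proof -
      have "ennreal (gauss (t - s) (x + (t - s) *\<^sub>R z w))
          = ennreal (exp (- (z w \<bullet> x) - (norm (z w))\<^sup>2 * (t - s) / 2)) * ennreal (gauss (t - s) x)"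
        using gauss_shift[of "t - s" "z w" x] s by (simp add: ennreal_mult[symmetric] gauss_nonneg)
      then show ?thesis by (simp add: ac_simps)
    qed
    then have "(\<integral>\<^sup>+x. ennreal (gauss (t - s) x) * ?G (w, x) \<partial>lborel)
        = (\<integral>\<^sup>+x. (\<lambda>y. ennreal (gauss (t - s) y) * H (w, y)) (x + (t - s) *\<^sub>R z w) \<partial>lborel)"
      by simp
    also have "\<dots> = (\<integral>\<^sup>+x. ennreal (gauss (t - s) x) * H (w, x) \<partial>lborel)"
      by (rule nn_integral_lborel_plus) measurable
    finally show "(\<integral>\<^sup>+x. ennreal (gauss (t - s) x) * ?G (w, x) \<partial>lborel) = (\<integral>\<^sup>+x. ennreal (gauss (t - s) x) * H (w, x) \<partial>lborel)" .
  qed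
  finally show ?thesis by simp
qed

text \<open>The Gaussian density is even. This does the work of vanishing conditional means and,
  being a statement about nonnegative integrals, asks for no integrability.\<close>

lemma increment_symmetric:
  assumes s: "0 \<le> s" "s < t" "t \<le> 1" and H: "H \<in> borel_measurable (F s \<Otimes>\<^sub>M borel)"
  shows "(\<integral>\<^sup>+w. H (w, - (\<beta> w t - \<beta> w s)) \<partial>P) = (\<integral>\<^sup>+w. H (w, \<beta> w t - \<beta> w s) \<partial>P)"
proof -
  have "(\<lambda>p. (fst p, - snd p)) \<in> F s \<Otimes>\<^sub>M borel \<rightarrow>\<^sub>M F s \<Otimes>\<^sub>M (borel :: (real, 'n) vec measure)" by measurable
  from measurable_compose[OF this H] have H': "(\<lambda>p. H (fst p, - snd p)) \<in> borel_measurable (F s \<Otimes>\<^sub>M borel)" .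
  have "(\<integral>\<^sup>+w. H (w, - (\<beta> w t - \<beta> w s)) \<partial>P) = (\<integral>\<^sup>+w. (\<integral>\<^sup>+x. ennreal (gauss (t - s) x) * H (w, - x) \<partial>lborel) \<partial>P)"
    using one_step[OF s H'] by simp
  also have "\<dots> = (\<integral>\<^sup>+w. (\<integral>\<^sup>+x. ennreal (gauss (t - s) x) * H (w, x) \<partial>lborel) \<partial>P)"
  proof (rule nn_integral_cong)
    fix w assume w: "w \<in> space P"
    have [measurable]: "(\<lambda>x. H (w, x)) \<in> borel_measurable borel"
      using measurable_Pair2[OF H, of w] w by simp
    show "(\<integral>\<^sup>+x. ennreal (gauss (t - s) x) * H (w, - x) \<partial>lborel) = (\<integral>\<^sup>+x. ennreal (gauss (t - s) x) * H (w, x) \<partial>lborel)"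
      using nn_integral_lborel_uminus[of "\<lambda>x. ennreal (gauss (t - s) x) * H (w, x)"]
      by (simp add: gauss_uminus)
  qed
  also have "\<dots> = (\<integral>\<^sup>+w. H (w, \<beta> w t - \<beta> w s) \<partial>P)"
    by (rule one_step[OF s H, symmetric])
  finally show ?thesis .
qed

text \<open>Exponential moments are read off from \<open>gauss_shift\<close> and dominate the square
  through \<open>y^2 \<le> 2 * (exp y + exp (- y))\<close>. The constant 8 is
  \<open>2 * (2 + 2)\<close>, with \<open>exp (1/2) \<le> 2\<close>; any finite constant serves the
  later estimates.\<close>

lemma increment_second_moment:
  assumes s: "0 \<le> s" "s < t" "t \<le> 1" and z: "z \<in> borel_measurable (F s)"
  shows "(\<integral>\<^sup>+w. ennreal ((z w \<bullet> (\<beta> w t - \<beta> w s))\<^sup>2) \<partial>P) \<le> (\<integral>\<^sup>+w. ennreal (8 * ((t - s) * (norm (z w))\<^sup>2)) \<partial>P)"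
proof -
  let ?d = "t - s"
  have d: "0 < ?d" using s by simp
  \<comment> \<open>Total mass 1 comes from \<open>one_step\<close> with a constant integrand,
    without evaluating a Gaussian integral.\<close>
  have one: "(\<integral>\<^sup>+x. ennreal (gauss ?d x) \<partial>lborel) = 1"
  proof -
    have "(\<integral>\<^sup>+w. 1 \<partial>P) = (\<integral>\<^sup>+w. (\<integral>\<^sup>+x. ennreal (gauss ?d x) * 1 \<partial>lborel) \<partial>P)"
      by (rule one_step[OF s]) simp
    then show ?thesis by (simp add: prob_space.emeasure_space_1[OF prob_nu])
  qed
  have expo: "(\<integral>\<^sup>+x. ennreal (gauss ?d x * exp (c \<bullet> x)) \<partial>lborel) = ennreal (exp ((norm c)\<^sup>2 * ?d / 2))" for c :: "(real, 'n) vec"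
  proof -
    have "gauss ?d x * exp (c \<bullet> x) = exp ((norm c)\<^sup>2 * ?d / 2) * gauss ?d (x + ?d *\<^sub>R (- c))" for x
    proof -
      have "exp (c \<bullet> x) = exp ((norm c)\<^sup>2 * ?d / 2) * exp (- ((- c) \<bullet> x) - (norm (- c))\<^sup>2 * ?d / 2)"
        by (simp add: exp_add[symmetric])
      then have "gauss ?d x * exp (c \<bullet> x) = exp ((norm c)\<^sup>2 * ?d / 2) *
          (exp (- ((- c) \<bullet> x) - (norm (- c))\<^sup>2 * ?d / 2) * gauss ?d x)"
        by (simp only: mult.left_commute mult.commute mult.assoc)
      then show ?thesis unfolding gauss_shift[OF d] .
    qed
    then have "(\<integral>\<^sup>+x. ennreal (gauss ?d x * exp (c \<bullet> x)) \<partial>lborel)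
      = (\<integral>\<^sup>+x. ennreal (exp ((norm c)\<^sup>2 * ?d / 2)) * ennreal (gauss ?d (x + ?d *\<^sub>R (- c))) \<partial>lborel)"
      by (simp add: ennreal_mult[symmetric] gauss_nonneg)
    also have "\<dots> = ennreal (exp ((norm c)\<^sup>2 * ?d / 2)) * (\<integral>\<^sup>+x. ennreal (gauss ?d (x + ?d *\<^sub>R (- c))) \<partial>lborel)"
      by (rule nn_integral_cmult) measurable
    also have "(\<integral>\<^sup>+x. ennreal (gauss ?d (x + ?d *\<^sub>R (- c))) \<partial>lborel) = 1"
      using nn_integral_lborel_plus[of "\<lambda>x. ennreal (gauss ?d x)" "?d *\<^sub>R (- c)"] one by simp
    finally show ?thesis by simp
  qed
  have sq: "y\<^sup>2 \<le> 2 * (exp y + exp (- y))" for y :: real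
  proof -
    have "x\<^sup>2 \<le> 2 * exp x" if "0 \<le> x" for x :: real
      using exp_lower_Taylor_quadratic[OF that] that by simp
    from this[of "\<bar>y\<bar>"] show ?thesis
      by (cases "0 \<le> y") (auto intro: order_trans simp: abs_if)
  qed
  have fibre: "(\<integral>\<^sup>+x. ennreal (gauss ?d x) * ennreal ((c \<bullet> x)\<^sup>2) \<partial>lborel) \<le> ennreal (8 * (?d * (norm c)\<^sup>2))" for c :: "(real, 'n) vec"
  proof (cases "c = 0")
    case False
    \<comment> \<open>Normalisation: \<open>c \<bullet> x\<close> is \<open>a\<close> times a linear
      form \<open>b \<bullet> x\<close> of variance 1, for which the exponential moment is
      \<open>exp (1/2)\<close>.\<close>
    define a where "a = norm c * sqrt ?d"
    define b where "b = (1 / a) *\<^sub>R c"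
    have a: "0 < a" "a\<^sup>2 = ?d * (norm c)\<^sup>2" using False d by (auto simp: a_def power_mult_distrib)
    have nb: "(norm b)\<^sup>2 * ?d = 1"
      using a False d by (simp add: b_def power_mult_distrib power_divide)
    have "ennreal (gauss ?d x) * ennreal ((c \<bullet> x)\<^sup>2)
        \<le> ennreal (2 * a\<^sup>2) * (ennreal (gauss ?d x * exp (b \<bullet> x)) + ennreal (gauss ?d x * exp ((- b) \<bullet> x)))" for x
    proof -
      have "c \<bullet> x = a * (b \<bullet> x)" using a by (simp add: b_def)
      then have "(c \<bullet> x)\<^sup>2 \<le> a\<^sup>2 * (2 * (exp (b \<bullet> x) + exp (- (b \<bullet> x))))"
        using sq[of "b \<bullet> x"] by (simp only: power_mult_distrib mult_left_mono zero_le_power2)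
      then have "gauss ?d x * (c \<bullet> x)\<^sup>2 \<le> gauss ?d x * (a\<^sup>2 * (2 * (exp (b \<bullet> x) + exp (- (b \<bullet> x)))))"
        by (intro mult_left_mono gauss_nonneg)
      also have "\<dots> = 2 * a\<^sup>2 * (gauss ?d x * exp (b \<bullet> x) + gauss ?d x * exp ((- b) \<bullet> x))"
        by (simp add: algebra_simps)
      finally show ?thesis
        by (simp add: ennreal_mult[symmetric] ennreal_plus[symmetric] gauss_nonneg ennreal_leI del: ennreal_plus)
    qed
    then have "(\<integral>\<^sup>+x. ennreal (gauss ?d x) * ennreal ((c \<bullet> x)\<^sup>2) \<partial>lborel)
      \<le> (\<integral>\<^sup>+x. ennreal (2 * a\<^sup>2) * (ennreal (gauss ?d x * exp (b \<bullet> x)) + ennreal (gauss ?d x * exp ((- b) \<bullet> x))) \<partial>lborel)"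
      by (rule nn_integral_mono)
    also have "\<dots> = ennreal (2 * a\<^sup>2) * (ennreal (exp (1 / 2)) + ennreal (exp (1 / 2)))"
      using expo[of b] expo[of "- b"] nb
      by (simp add: nn_integral_cmult nn_integral_add)
    also have "\<dots> = ennreal (2 * a\<^sup>2 * (2 * exp (1 / 2)))"
      by (simp add: ennreal_mult[symmetric] ennreal_plus[symmetric] del: ennreal_plus)
    also have "\<dots> \<le> ennreal (8 * (?d * (norm c)\<^sup>2))"
    proof (rule ennreal_leI)
      have "2 * a\<^sup>2 * (2 * exp (1 / 2)) \<le> 2 * a\<^sup>2 * (2 * 2)"
        using exp_half_le2 by (intro mult_left_mono) auto
      then show "2 * a\<^sup>2 * (2 * exp (1 / 2)) \<le> 8 * (?d * (norm c)\<^sup>2)" using a(2) by simp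
    qed
    finally show ?thesis .
  qed simp
  note z[measurable]
  have "(\<integral>\<^sup>+w. ennreal ((z w \<bullet> (\<beta> w t - \<beta> w s))\<^sup>2) \<partial>P)
     = (\<integral>\<^sup>+w. (\<integral>\<^sup>+x. ennreal (gauss ?d x) * ennreal ((z w \<bullet> x)\<^sup>2) \<partial>lborel) \<partial>P)"
    using one_step[OF s, of "\<lambda>p. ennreal ((z (fst p) \<bullet> snd p)\<^sup>2)"] by simp
  also have "\<dots> \<le> (\<integral>\<^sup>+w. ennreal (8 * ((t - s) * (norm (z w))\<^sup>2)) \<partial>P)"
    by (intro nn_integral_mono fibre)
  finally show ?thesis .
qed

end

section \<open>Girsanov transformation for simple drifts\<close>

text \<open>Strict increase makes the cells nonempty and the grid points distinct. The grid may
  start after 0, so that the part of a grid beyond a given grid point is again a grid.\<close>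

definition time_grid :: "nat \<Rightarrow> (nat \<Rightarrow> real) \<Rightarrow> bool" where
  "time_grid m t \<longleftrightarrow> 0 \<le> t 0 \<and> t m \<le> 1 \<and> (\<forall>k<m. t k < t (Suc k))"

lemma time_gridD:
  assumes "time_grid m t"
  shows "0 \<le> t 0" "t m \<le> 1" "k < m \<Longrightarrow> t k < t (Suc k)"
  using assms by (auto simp: time_grid_def)

lemma grid_mono:
  assumes "time_grid m t" "i \<le> j" "j \<le> m"
  shows "t i \<le> t j"
  using assms(2,3)
proof (induction j rule: dec_induct)
  case (step n)
  then show ?case using time_gridD(3)[OF assms(1), of n] by simp
qed simp

lemma grid_bounds:
  assumes "time_grid m t" "i \<le> m"
  shows "0 \<le> t i" "t i \<le> 1"
  using grid_mono[OF assms(1), of 0 i] grid_mono[OF assms(1), of i m] time_gridD[OF assms(1)] assms(2) by auto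

context brownian_path_space
begin

text \<open>Contribution of the \<open>k\<close>-th cell to the stochastic exponential of minus the
  step drift with values \<open>z k\<close>.\<close>

definition grid_exp :: "(nat \<Rightarrow> real) \<Rightarrow> (nat \<Rightarrow> 'n path \<Rightarrow> (real, 'n) vec) \<Rightarrow> nat \<Rightarrow> 'n path \<Rightarrow> real" where
  "grid_exp t z k w =
     exp (- (z k w \<bullet> (\<beta> w (t (Suc k)) - \<beta> w (t k))) - (norm (z k w))\<^sup>2 * (t (Suc k) - t k) / 2)"

text \<open>Increment from \<open>t 0\<close> to \<open>t j\<close> of \<beta> translated by the
  primitive of the step drift.\<close>

definition grid_shift :: "(nat \<Rightarrow> real) \<Rightarrow> (nat \<Rightarrow> 'n path \<Rightarrow> (real, 'n) vec) \<Rightarrow> nat \<Rightarrow> 'n path \<Rightarrow> (real, 'n) vec" where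
  "grid_shift t z j w = \<beta> w (t j) - \<beta> w (t 0) + (\<Sum>i<j. (t (Suc i) - t i) *\<^sub>R z i w)"

lemma measurable_grid_shift:
  assumes t: "time_grid m t"
    and z: "\<And>k. k < m \<Longrightarrow> z k \<in> borel_measurable (F (t k))" and j: "j \<le> m"
  shows "grid_shift t z j \<in> borel_measurable (F (t j))"
proof -
  have tb: "t 0 \<le> t i" "t i \<le> t j" "t i \<le> 1" if "i \<le> j" for i
    using grid_mono[OF t, of 0 i] grid_mono[OF t, of i j] grid_bounds[OF t, of i] that j by auto
  have [measurable]: "(\<lambda>w. \<beta> w (t i)) \<in> borel_measurable (F (t j))" if "i \<le> j" for i
    using tb[OF that] tb[of 0] time_gridD(1)[OF t] by (intro measurable_beta) auto
  have [measurable]: "z i \<in> borel_measurable (F (t j))" if "i < j" for i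
    using tb[of i] that j by (intro measurable_F_mono[OF _ z]) auto
  show ?thesis unfolding grid_shift_def
    by (intro borel_measurable_add borel_measurable_diff borel_measurable_sum borel_measurable_scaleR
        borel_measurable_const) auto
qed

lemma measurable_grid_exp:
  assumes t: "time_grid m t"
    and z: "\<And>k. k < m \<Longrightarrow> z k \<in> borel_measurable (F (t k))" and k: "k < j" "j \<le> m"
  shows "grid_exp t z k \<in> borel_measurable (F (t j))"
proof -
  have tb: "t 0 \<le> t i" "t i \<le> t j" "t i \<le> 1" if "i \<le> j" for i
    using grid_mono[OF t, of 0 i] grid_mono[OF t, of i j] grid_bounds[OF t, of i] that k by auto
  have [measurable]: "(\<lambda>w. \<beta> w (t k)) \<in> borel_measurable (F (t j))" "(\<lambda>w. \<beta> w (t (Suc k))) \<in> borel_measurable (F (t j))"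
    using tb[of k] tb[of "Suc k"] tb[of 0] time_gridD(1)[OF t] k by (auto intro!: measurable_beta)
  have [measurable]: "z k \<in> borel_measurable (F (t j))"
    using tb[of k] k by (intro measurable_F_mono[OF _ z]) auto
  show ?thesis unfolding grid_exp_def by measurable
qed

text \<open>One step of backward induction: given the past at \<open>t l\<close>, the last
  exponential factor and the last shifted increment integrate to a Gaussian average
  \<open>g\<close>, which is absorbed into the test function at \<open>t l\<close>. The new
  functions \<open>h'\<close> do not involve the drift, so that two different drifts can be reduced
  in parallel.\<close>

lemma last_increment_integrated_out:
  fixes h :: "nat \<Rightarrow> (real, 'n) vec \<Rightarrow> ennreal"
  assumes t: "time_grid m t" and lm: "l < m"
    and h: "\<And>j. j \<le> Suc l \<Longrightarrow> h j \<in> borel_measurable borel"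
    and y': "\<And>k. k < m \<Longrightarrow> y' k \<in> borel_measurable (F (t k))"
    and Y: "Y \<in> borel_measurable (F (t 0))"
    and g: "g = (\<lambda>y. \<integral>\<^sup>+x. ennreal (gauss (t (Suc l) - t l) x) * h (Suc l) (y + x) \<partial>lborel)"
    and h': "h' = (\<lambda>j. if j = l then (\<lambda>y. h l y * g y) else h j)"
  shows "(\<integral>\<^sup>+w. Y w * (\<Prod>k<Suc l. ennreal (grid_exp t y' k w)) * (\<Prod>j\<le>Suc l. h j (grid_shift t y' j w)) \<partial>P)
       = (\<integral>\<^sup>+w. Y w * (\<Prod>k<l. ennreal (grid_exp t y' k w)) * (\<Prod>j\<le>l. h' j (grid_shift t y' j w)) \<partial>P)"
    and "j \<le> l \<Longrightarrow> h' j \<in> borel_measurable borel"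
proof -
  have lm': "l \<le> m" using lm by simp
  have tl: "0 \<le> t l" "t l < t (Suc l)" "t (Suc l) \<le> 1"
    using time_gridD(3)[OF t lm] grid_bounds[OF t, of l] grid_bounds[OF t, of "Suc l"] lm by auto
  have hm[measurable]: "h (Suc l) \<in> borel_measurable borel" using h by simp
  have gm[measurable]: "g \<in> borel_measurable borel"
    unfolding g by measurable
  show "h' j \<in> borel_measurable borel" if "j \<le> l"
  proof (cases "j = l")
    case True
    have [measurable]: "h l \<in> borel_measurable borel" using h by simp
    show ?thesis unfolding h' True by simp
  qed (use h that in \<open>simp add: h'\<close>)
  define A where "A w = Y w * (\<Prod>k<l. ennreal (grid_exp t y' k w)) * (\<Prod>j\<le>l. h j (grid_shift t y' j w))" for w
  have [measurable]: "Y \<in> borel_measurable (F (t l))"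
    using grid_mono[OF t, of 0 l] lm by (intro measurable_F_mono[OF _ Y]) auto
  have e[measurable]: "grid_exp t y' k \<in> borel_measurable (F (t l))" if "k < l" for k
    using measurable_grid_exp[OF t y' that lm'] by simp
  have s[measurable]: "(\<lambda>w. h j (grid_shift t y' j w)) \<in> borel_measurable (F (t l))" if "j \<le> l" for j
  proof -
    have "grid_shift t y' j \<in> borel_measurable (F (t l))"
      using that lm grid_mono[OF t, of j l]
      by (intro measurable_F_mono[OF _ measurable_grid_shift[OF t y']]) auto
    then show ?thesis using h[of j] that by (auto intro: measurable_compose)
  qed
  have Am[measurable]: "A \<in> borel_measurable (F (t l))"
    unfolding A_def by (measurable; simp)
  have Sm[measurable]: "grid_shift t y' l \<in> borel_measurable (F (t l))"
    using measurable_grid_shift[OF t y' lm'] by simp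
  define H where "H p = A (fst p) * h (Suc l) (grid_shift t y' l (fst p) + snd p)" for p
  have Hm: "H \<in> borel_measurable (F (t l) \<Otimes>\<^sub>M borel)" unfolding H_def by measurable
  have split: "grid_shift t y' (Suc l) w = grid_shift t y' l w + (\<beta> w (t (Suc l)) - \<beta> w (t l) + (t (Suc l) - t l) *\<^sub>R y' l w)" for w
    by (simp add: grid_shift_def)
  have "(\<integral>\<^sup>+w. Y w * (\<Prod>k<Suc l. ennreal (grid_exp t y' k w)) * (\<Prod>j\<le>Suc l. h j (grid_shift t y' j w)) \<partial>P)
    = (\<integral>\<^sup>+w. ennreal (grid_exp t y' l w) * H (w, \<beta> w (t (Suc l)) - \<beta> w (t l) + (t (Suc l) - t l) *\<^sub>R y' l w) \<partial>P)"
    by (intro nn_integral_cong) (simp add: H_def A_def split ac_simps)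
  also have "\<dots> = (\<integral>\<^sup>+w. (\<integral>\<^sup>+x. ennreal (gauss (t (Suc l) - t l) x) * H (w, x) \<partial>lborel) \<partial>P)"
    unfolding grid_exp_def by (rule one_step_shift[OF tl Hm y'[OF lm]])
  also have "\<dots> = (\<integral>\<^sup>+w. A w * g (grid_shift t y' l w) \<partial>P)"
    unfolding H_def g by (intro nn_integral_cong) (simp add: nn_integral_cmult[symmetric] ac_simps)
  also have "\<dots> = (\<integral>\<^sup>+w. Y w * (\<Prod>k<l. ennreal (grid_exp t y' k w)) * (\<Prod>j\<le>l. h' j (grid_shift t y' j w)) \<partial>P)"
  proof (rule nn_integral_cong)
    fix w
    have "(\<Prod>j\<le>l. h' j (grid_shift t y' j w)) = (\<Prod>j\<le>l. h j (grid_shift t y' j w)) * g (grid_shift t y' l w)"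
      by (cases l) (auto simp: h' ac_simps intro!: prod.cong)
    then show "A w * g (grid_shift t y' l w) = Y w * (\<Prod>k<l. ennreal (grid_exp t y' k w)) * (\<Prod>j\<le>l. h' j (grid_shift t y' j w))"
      by (simp add: A_def ac_simps)
  qed
  finally show "(\<integral>\<^sup>+w. Y w * (\<Prod>k<Suc l. ennreal (grid_exp t y' k w)) * (\<Prod>j\<le>Suc l. h j (grid_shift t y' j w)) \<partial>P)
       = (\<integral>\<^sup>+w. Y w * (\<Prod>k<l. ennreal (grid_exp t y' k w)) * (\<Prod>j\<le>l. h' j (grid_shift t y' j w)) \<partial>P)" .
qed

text \<open>The drift \<open>z\<close> with weight \<open>Y\<close> and the zero drift with weight 1
  are reduced by the same sequence of test functions. On the trivial grid the shifted increment is
  0, and the weight \<open>Y\<close> separates.\<close>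

lemma simple_girsanov:
  fixes h :: "nat \<Rightarrow> (real, 'n) vec \<Rightarrow> ennreal"
  assumes t: "time_grid m t"
    and z: "\<And>k. k < m \<Longrightarrow> z k \<in> borel_measurable (F (t k))"
    and h: "\<And>j. j \<le> m \<Longrightarrow> h j \<in> borel_measurable borel"
    and Y: "Y \<in> borel_measurable (F (t 0))"
  shows "(\<integral>\<^sup>+w. Y w * (\<Prod>k<m. ennreal (grid_exp t z k w)) * (\<Prod>j\<le>m. h j (grid_shift t z j w)) \<partial>P)
       = (\<integral>\<^sup>+w. Y w \<partial>P) * (\<integral>\<^sup>+w. (\<Prod>j\<le>m. h j (\<beta> w (t j) - \<beta> w (t 0))) \<partial>P)"
proof -
  \<comment> \<open>The induction generalises over the test functions, because each step changes
    them.\<close>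
  have gen: "(\<integral>\<^sup>+w. Y w * (\<Prod>k<l. ennreal (grid_exp t z k w)) * (\<Prod>j\<le>l. h j (grid_shift t z j w)) \<partial>P)
       = (\<integral>\<^sup>+w. Y w \<partial>P) * (\<integral>\<^sup>+w. 1 * (\<Prod>k<l. ennreal (grid_exp t (\<lambda>_ _. 0) k w)) * (\<Prod>j\<le>l. h j (grid_shift t (\<lambda>_ _. 0) j w)) \<partial>P)"
    if "l \<le> m" "\<And>j. j \<le> l \<Longrightarrow> h j \<in> borel_measurable borel" for l h
    using that
  proof (induction l arbitrary: h)
    case 0
    show ?case
      using measurable_F_P[OF Y]
      by (simp add: grid_shift_def nn_integral_multc prob_space.emeasure_space_1[OF prob_nu])
  next
    case (Suc l)
    have lm: "l < m" "l \<le> m" using Suc.prems(1) by simp_all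
    define g where "g = (\<lambda>y. \<integral>\<^sup>+x. ennreal (gauss (t (Suc l) - t l) x) * h (Suc l) (y + x) \<partial>lborel)"
    define h' where "h' = (\<lambda>j. if j = l then (\<lambda>y. h l y * g y) else h j)"
    have hm: "h j \<in> borel_measurable borel" if "j \<le> Suc l" for j using Suc.prems(2) that by simp
    have z0: "(\<lambda>_. 0) \<in> borel_measurable (F (t k))" for k by simp
    have 1: "(\<lambda>_. 1) \<in> borel_measurable (F (t 0))" by simp
    have h'm: "h' j \<in> borel_measurable borel" if "j \<le> l" for j
      by (rule last_increment_integrated_out(2)[OF t lm(1) hm z Y g_def h'_def that])
    note red = last_increment_integrated_out(1)[OF t lm(1) hm _ _ g_def h'_def]
    have "(\<integral>\<^sup>+w. Y w * (\<Prod>k<Suc l. ennreal (grid_exp t z k w)) * (\<Prod>j\<le>Suc l. h j (grid_shift t z j w)) \<partial>P)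
       = (\<integral>\<^sup>+w. Y w * (\<Prod>k<l. ennreal (grid_exp t z k w)) * (\<Prod>j\<le>l. h' j (grid_shift t z j w)) \<partial>P)"
      by (rule red[OF _ z Y])
    also have "\<dots> = (\<integral>\<^sup>+w. Y w \<partial>P) * (\<integral>\<^sup>+w. 1 * (\<Prod>k<l. ennreal (grid_exp t (\<lambda>_ _. 0) k w)) * (\<Prod>j\<le>l. h' j (grid_shift t (\<lambda>_ _. 0) j w)) \<partial>P)"
      by (rule Suc.IH[OF lm(2) h'm])
    also have "(\<integral>\<^sup>+w. 1 * (\<Prod>k<l. ennreal (grid_exp t (\<lambda>_ _. 0) k w)) * (\<Prod>j\<le>l. h' j (grid_shift t (\<lambda>_ _. 0) j w)) \<partial>P)
       = (\<integral>\<^sup>+w. 1 * (\<Prod>k<Suc l. ennreal (grid_exp t (\<lambda>_ _. 0) k w)) * (\<Prod>j\<le>Suc l. h j (grid_shift t (\<lambda>_ _. 0) j w)) \<partial>P)"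
      by (rule red[OF _ z0 1, symmetric])
    finally show ?case .
  qed
  show ?thesis using gen[of m h] h by (simp add: grid_exp_def grid_shift_def)
qed

text \<open>One half of Ito's isometry, up to the constant of
  \<open>increment_second_moment\<close>. The cross term between the last increment and the earlier
  sum cancels by averaging over the sign of that increment, so no product has to be
  integrable.\<close>

lemma simple_integral_second_moment:
  assumes t: "time_grid m t"
    and z: "\<And>k. k < m \<Longrightarrow> z k \<in> borel_measurable (F (t k))"
  shows "(\<integral>\<^sup>+w. ennreal ((simple_integral \<beta> m t z w)\<^sup>2) \<partial>P)
      \<le> (\<integral>\<^sup>+w. ennreal (8 * (\<Sum>k<m. (t (Suc k) - t k) * (norm (z k w))\<^sup>2)) \<partial>P)"
proof -
  have gen: "(\<integral>\<^sup>+w. ennreal ((simple_integral \<beta> l t z w)\<^sup>2) \<partial>P)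
      \<le> (\<integral>\<^sup>+w. ennreal (8 * (\<Sum>k<l. (t (Suc k) - t k) * (norm (z k w))\<^sup>2)) \<partial>P)" if "l \<le> m" for l
    using that
  proof (induction l)
    case 0
    then show ?case by (simp add: simple_integral_def)
  next
    case (Suc l)
    have lm: "l < m" "l \<le> m" using Suc.prems by simp_all
    have mono: "t i \<le> t j" if "i \<le> j" "j \<le> m" for i j using grid_mono[OF t that] .
    have tl: "0 \<le> t l" "t l < t (Suc l)" "t (Suc l) \<le> 1"
      using time_gridD(3)[OF t lm(1)] grid_bounds[OF t, of l] grid_bounds[OF t, of "Suc l"] Suc.prems lm by auto
    have bm: "(\<lambda>w. \<beta> w (t i)) \<in> borel_measurable (F (t l))" if "i \<le> l" for i
      using mono[of 0 i] mono[of i l] that lm time_gridD(1)[OF t] tl by (intro measurable_beta) auto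
    have zm: "z i \<in> borel_measurable (F (t l))" if "i \<le> l" for i
      using mono[of i l] that lm by (intro measurable_F_mono[OF _ z]) auto
    have Sm[measurable]: "simple_integral \<beta> l t z \<in> borel_measurable (F (t l))"
      unfolding simple_integral_def
      by (intro borel_measurable_sum borel_measurable_inner borel_measurable_diff bm zm) auto
    note [measurable] = zm[OF order_refl]
    let ?D = "\<lambda>w. \<beta> w (t (Suc l)) - \<beta> w (t l)"
    let ?S = "simple_integral \<beta> l t z"
    define H where "H p = ennreal ((?S (fst p) + z l (fst p) \<bullet> snd p)\<^sup>2)" for p
    have Hm: "H \<in> borel_measurable (F (t l) \<Otimes>\<^sub>M borel)" unfolding H_def by measurable
    have DP[measurable]: "?D \<in> borel_measurable P"
      using tl by (intro borel_measurable_diff measurable_F_P[OF measurable_beta]) auto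
    note [measurable] = measurable_F_P[OF Sm] measurable_F_P[OF zm[OF order_refl]]
    \<comment> \<open>Both signs of the last increment give the same integral; adding them brings in
      the parallelogram law.\<close>
    have "2 * (\<integral>\<^sup>+w. H (w, ?D w) \<partial>P) = (\<integral>\<^sup>+w. H (w, ?D w) \<partial>P) + (\<integral>\<^sup>+w. H (w, - ?D w) \<partial>P)"
      using increment_symmetric[OF tl Hm] by (simp add: mult_2)
    also have "\<dots> = (\<integral>\<^sup>+w. H (w, ?D w) + H (w, - ?D w) \<partial>P)"
      unfolding H_def fst_conv snd_conv by (intro nn_integral_add[symmetric]) measurable
    also have "\<dots> = (\<integral>\<^sup>+w. 2 * (ennreal ((?S w)\<^sup>2) + ennreal ((z l w \<bullet> ?D w)\<^sup>2)) \<partial>P)"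
    proof (rule nn_integral_cong)
      fix w
      have "(?S w + a)\<^sup>2 + (?S w + - a)\<^sup>2 = 2 * ((?S w)\<^sup>2 + a\<^sup>2)" for a
        by (simp add: power2_eq_square algebra_simps)
      then have "ennreal ((?S w + a)\<^sup>2) + ennreal ((?S w + - a)\<^sup>2) = ennreal (2 * ((?S w)\<^sup>2 + a\<^sup>2))" for a
        by (simp add: ennreal_plus[symmetric] del: ennreal_plus)
      from this[of "z l w \<bullet> ?D w"]
      show "H (w, ?D w) + H (w, - ?D w) = 2 * (ennreal ((?S w)\<^sup>2) + ennreal ((z l w \<bullet> ?D w)\<^sup>2))"
        unfolding H_def fst_conv snd_conv inner_minus_right by (simp only: ennreal_mult ennreal_plus zero_le_power2 add_nonneg_nonneg zero_le_numeral ennreal_numeral)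
    qed
    also have "\<dots> = 2 * ((\<integral>\<^sup>+w. ennreal ((?S w)\<^sup>2) \<partial>P) + (\<integral>\<^sup>+w. ennreal ((z l w \<bullet> ?D w)\<^sup>2) \<partial>P))"
      by (subst nn_integral_cmult, simp, subst nn_integral_add, simp_all)
    finally have "(\<integral>\<^sup>+w. H (w, ?D w) \<partial>P) = (\<integral>\<^sup>+w. ennreal ((?S w)\<^sup>2) \<partial>P) + (\<integral>\<^sup>+w. ennreal ((z l w \<bullet> ?D w)\<^sup>2) \<partial>P)"
      unfolding ennreal_mult_cancel_left by simp
    also have "\<dots> \<le> (\<integral>\<^sup>+w. ennreal (8 * (\<Sum>k<l. (t (Suc k) - t k) * (norm (z k w))\<^sup>2)) \<partial>P)
        + (\<integral>\<^sup>+w. ennreal (8 * ((t (Suc l) - t l) * (norm (z l w))\<^sup>2)) \<partial>P)"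
      using Suc.IH lm increment_second_moment[OF tl zm[OF order_refl]] by (intro add_mono) auto
    also have "\<dots> = (\<integral>\<^sup>+w. ennreal (8 * (\<Sum>k<l. (t (Suc k) - t k) * (norm (z k w))\<^sup>2))
        + ennreal (8 * ((t (Suc l) - t l) * (norm (z l w))\<^sup>2)) \<partial>P)"
    proof (rule nn_integral_add[symmetric])
      have "z k \<in> borel_measurable P" if "k < l" for k using measurable_F_P[OF zm[of k]] that by simp
      then show "(\<lambda>w. ennreal (8 * (\<Sum>k<l. (t (Suc k) - t k) * (norm (z k w))\<^sup>2))) \<in> borel_measurable P"
        by (intro measurable_compose[OF _ measurable_ennreal] borel_measurable_times borel_measurable_sum
            borel_measurable_power borel_measurable_norm) auto
    qed simp
    also have "\<dots> = (\<integral>\<^sup>+w. ennreal (8 * (\<Sum>k<Suc l. (t (Suc k) - t k) * (norm (z k w))\<^sup>2)) \<partial>P)"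
    proof (rule nn_integral_cong)
      fix w
      have "0 \<le> (\<Sum>k<l. (t (Suc k) - t k) * (norm (z k w))\<^sup>2)"
        using time_gridD(3)[OF t] lm by (intro sum_nonneg mult_nonneg_nonneg) (auto simp: less_imp_le)
      then show "ennreal (8 * (\<Sum>k<l. (t (Suc k) - t k) * (norm (z k w))\<^sup>2))
        + ennreal (8 * ((t (Suc l) - t l) * (norm (z l w))\<^sup>2)) = ennreal (8 * (\<Sum>k<Suc l. (t (Suc k) - t k) * (norm (z k w))\<^sup>2))"
        using tl by (subst ennreal_plus[symmetric]) (simp_all add: distrib_left)
    qed
    finally show ?case by (simp add: H_def simple_integral_def)
  qed
  from gen[OF order_refl] show ?thesis .
qed

end

section \<open>Simple approximation of drifts\<close>

lemma grid_less_iff: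
  assumes "time_grid N s" "i \<le> N" "j \<le> N"
  shows "s i < s j \<longleftrightarrow> i < j"
proof
  show "i < j" if "s i < s j"
    using grid_mono[OF assms(1), of j i] that assms by (cases "i < j") auto
  show "s i < s j" if "i < j"
    using time_gridD(3)[OF assms(1), of i] grid_mono[OF assms(1), of "Suc i" j] that assms by auto
qed

lemma grid_cell:
  assumes "time_grid N s" "s 0 < r" "r \<le> s N"
  obtains i where "i < N" "s i < r" "r \<le> s (Suc i)"
proof -
  define j where "j = (LEAST j. r \<le> s j)"
  have j: "r \<le> s j" "j \<le> N" unfolding j_def using assms(3) by (auto intro: LeastI Least_le)
  have "j \<noteq> 0"
  proof
    assume "j = 0"
    then show False using j(1) assms(2) by simp
  qed
  then obtain i where i: "j = Suc i" by (cases j) auto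
  have "\<not> r \<le> s i" using not_less_Least[of i "\<lambda>j. r \<le> s j"] i by (auto simp: j_def)
  then show ?thesis using that[of i] i j by auto
qed

lemma simple_drift_at:
  assumes "time_grid N s" "i < N" "s i < r" "r \<le> s (Suc i)"
  shows "simple_drift N s z w r = z i w"
proof -
  have "(if s k < r \<and> r \<le> s (Suc k) then z k w else 0) = (if k = i then z i w else 0)" if "k < N" for k
  proof (cases "k = i")
    case False
    have "\<not> (s k < r \<and> r \<le> s (Suc k))"
    proof
      assume "s k < r \<and> r \<le> s (Suc k)"
      then have "s k < s (Suc i)" "s i < s (Suc k)" using assms(3,4) by linarith+
      then have "k < Suc i" "i < Suc k"
        using grid_less_iff[OF assms(1), of k "Suc i"] grid_less_iff[OF assms(1), of i "Suc k"] that assms(2) by auto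
      then show False using False by simp
    qed
    then show ?thesis using False by (simp only: if_False)
  qed (use assms in simp)
  then have "simple_drift N s z w r = (\<Sum>k<N. if k = i then z i w else 0)"
    unfolding simple_drift_def by (intro sum.cong) auto
  then show ?thesis using assms(2) by simp
qed

lemma simple_drift_outside:
  assumes "\<And>k. k < m \<Longrightarrow> a \<le> t k" "\<And>k. k < m \<Longrightarrow> t (Suc k) \<le> b" "r \<le> a \<or> b < r"
  shows "simple_drift m t z w r = 0"
  unfolding simple_drift_def
proof (rule sum.neutral, safe)
  fix k assume "k < m"
  then have "\<not> (t k < r \<and> r \<le> t (Suc k))" using assms(1)[of k] assms(2)[of k] assms(3) by linarith
  then show "(if t k < r \<and> r \<le> t (Suc k) then z k w else 0) = 0" by (rule if_not_P)
qed

lemma ex_grid: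
  fixes T :: "real set"
  assumes "finite T" "T \<subseteq> {0..1}"
  obtains N s where "time_grid N s" "s 0 = 0" "s N = 1" "T \<subseteq> s ` {..N}"
proof -
  define L where "L = sorted_list_of_set (T \<union> {0, 1})"
  have L: "set L = T \<union> {0, 1}" "sorted_wrt (<) L" "length L = card (T \<union> {0, 1})"
    using assms(1) unfolding L_def by (simp_all del: sorted_list_of_set_insert_remove)
  define N where "N = length L - 1"
  have "0 \<in> set L" using L(1) by simp
  then have len: "length L = Suc N" unfolding N_def by (cases L) auto
  have lt: "L ! i < L ! j" if "i < j" "j \<le> N" for i j
    using L(2) that len by (simp add: sorted_wrt_nth_less)
  have le: "L ! i \<le> L ! j" if "i \<le> j" "j \<le> N" for i j
    using lt[of i j] that by (cases "i = j") auto
  have mem: "L ! i \<in> {0..1}" if "i \<le> N" for i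
    using nth_mem[of i L] L(1) assms(2) that len by (auto simp del: nth_mem)
  have s0: "L ! 0 = 0"
  proof -
    obtain i where "i \<le> N" "L ! i = 0" using \<open>0 \<in> set L\<close> len by (auto simp: in_set_conv_nth less_Suc_eq_le)
    then show ?thesis using le[of 0 i] mem[of 0] by auto
  qed
  have s1: "L ! N = 1"
  proof -
    have "1 \<in> set L" using L(1) by simp
    then obtain i where "i \<le> N" "L ! i = 1" using len by (auto simp: in_set_conv_nth less_Suc_eq_le)
    then show ?thesis using le[of i N] mem[of N] by auto
  qed
  have "time_grid N ((!) L)" using s0 s1 lt by (auto simp: time_grid_def)
  moreover have "T \<subseteq> (!) L ` {..N}"
  proof
    fix x assume "x \<in> T"
    then have "x \<in> set L" using L(1) by simp
    then show "x \<in> (!) L ` {..N}" using len by (auto simp: in_set_conv_nth less_Suc_eq_le)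
  qed
  ultimately show ?thesis using that s0 s1 by blast
qed

lemma grid_telescope:
  fixes g :: "nat \<Rightarrow> 'a::ab_group_add"
  assumes "time_grid N s" "a \<le> b" "b \<le> N"
  shows "(\<Sum>i<N. if s a < s (Suc i) \<and> s (Suc i) \<le> s b then g (Suc i) - g i else 0) = g b - g a"
proof -
  have "s a < s (Suc i) \<and> s (Suc i) \<le> s b \<longleftrightarrow> a \<le> i \<and> i < b" if "i < N" for i
    using grid_less_iff[OF assms(1), of a "Suc i"] grid_less_iff[OF assms(1), of b "Suc i"] that assms by auto
  then have "(\<Sum>i<N. if s a < s (Suc i) \<and> s (Suc i) \<le> s b then g (Suc i) - g i else 0)
      = (\<Sum>i<N. if a \<le> i \<and> i < b then g (Suc i) - g i else 0)"
    by (intro sum.cong) auto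
  also have "\<dots> = (\<Sum>i\<in>{a..<b}. g (Suc i) - g i)"
    using assms(3) by (subst sum.inter_filter[symmetric]) (auto intro!: sum.cong)
  also have "\<dots> = g b - g a"
    using assms(2) by (rule sum_Suc_diff')
  finally show ?thesis .
qed

definition regrid :: "nat \<Rightarrow> (nat \<Rightarrow> real) \<Rightarrow> (nat \<Rightarrow> ('n::finite) path \<Rightarrow> (real, 'n) vec) \<Rightarrow> (nat \<Rightarrow> real)
    \<Rightarrow> nat \<Rightarrow> 'n path \<Rightarrow> (real, 'n) vec" where
  "regrid m t \<xi> s i w = simple_drift m t \<xi> w (s (Suc i))"

lemma simple_integrand_bounds:
  assumes "simple_integrand \<nu> m t \<xi>"
  shows "k \<le> m \<Longrightarrow> 0 \<le> t k" "k \<le> m \<Longrightarrow> t k \<le> 1" "i \<le> j \<Longrightarrow> j \<le> m \<Longrightarrow> t i \<le> t j"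
proof -
  have mono: "t i \<le> t j" if "i \<le> j" "j \<le> m" for i j
    using that
  proof (induction j rule: dec_induct)
    case (step n)
    then show ?case using assms by (auto simp: simple_integrand_def intro: order_trans)
  qed simp
  then show "i \<le> j \<Longrightarrow> j \<le> m \<Longrightarrow> t i \<le> t j" .
  show "k \<le> m \<Longrightarrow> 0 \<le> t k" "k \<le> m \<Longrightarrow> t k \<le> 1"
    using mono[of 0 k] mono[of k m] assms by (auto simp: simple_integrand_def intro: order_trans)
qed

context
  fixes \<nu> :: "('n::finite) path measure" and m t \<xi> N s
  assumes si: "simple_integrand \<nu> m t \<xi>" and grid: "time_grid N s"
    and sub: "t ` {..m} \<subseteq> s ` {..N}"
begin

lemma regrid_index:
  assumes "k \<le> m" obtains a where "a \<le> N" "t k = s a"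
  using sub assms by (fastforce simp: image_subset_iff)

lemma simple_integral_regrid:
  "simple_integral \<beta> m t \<xi> w = simple_integral \<beta> N s (regrid m t \<xi> s) w"
proof -
  have "simple_integral \<beta> N s (regrid m t \<xi> s) w
     = (\<Sum>i<N. \<Sum>k<m. (if t k < s (Suc i) \<and> s (Suc i) \<le> t (Suc k) then \<xi> k w else 0) \<bullet> (\<beta> w (s (Suc i)) - \<beta> w (s i)))"
    by (simp add: simple_integral_def regrid_def simple_drift_def inner_sum_left)
  also have "\<dots> = (\<Sum>k<m. \<Sum>i<N. (if t k < s (Suc i) \<and> s (Suc i) \<le> t (Suc k) then \<xi> k w else 0) \<bullet> (\<beta> w (s (Suc i)) - \<beta> w (s i)))"
    by (rule sum.swap)
  also have "\<dots> = (\<Sum>k<m. \<xi> k w \<bullet> (\<Sum>i<N. if t k < s (Suc i) \<and> s (Suc i) \<le> t (Suc k) then \<beta> w (s (Suc i)) - \<beta> w (s i) else 0))"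
    unfolding inner_sum_right by (intro sum.cong refl) auto
  also have "\<dots> = (\<Sum>k<m. \<xi> k w \<bullet> (\<beta> w (t (Suc k)) - \<beta> w (t k)))"
  proof (intro sum.cong refl)
    fix k assume "k \<in> {..<m}"
    then obtain a b where ab: "a \<le> N" "t k = s a" "b \<le> N" "t (Suc k) = s b"
      using regrid_index[of k] regrid_index[of "Suc k"] by (metis Suc_leI lessThan_iff less_imp_le)
    have "s a \<le> s b" using simple_integrand_bounds(3)[OF si, of k "Suc k"] \<open>k \<in> {..<m}\<close> ab by auto
    then have "a \<le> b" using grid_less_iff[OF grid, of b a] ab by (meson not_less)
    then show "\<xi> k w \<bullet> (\<Sum>i<N. if t k < s (Suc i) \<and> s (Suc i) \<le> t (Suc k) then \<beta> w (s (Suc i)) - \<beta> w (s i) else 0)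
        = \<xi> k w \<bullet> (\<beta> w (t (Suc k)) - \<beta> w (t k))"
      using grid_telescope[OF grid _ ab(3), of a "\<lambda>i. \<beta> w (s i)"] ab by simp
  qed
  finally show ?thesis by (simp add: simple_integral_def)
qed

lemma simple_drift_regrid:
  assumes "s 0 = 0" "s N = 1"
  shows "simple_drift m t \<xi> w r = simple_drift N s (regrid m t \<xi> s) w r"
proof (cases "0 < r \<and> r \<le> 1")
  case True
  then obtain i where i: "i < N" "s i < r" "r \<le> s (Suc i)" using grid_cell[OF grid, of r] assms by auto
  \<comment> \<open>No coarse grid point lies strictly inside a fine cell, so \<open>r\<close> and
    the right end of its cell lie on the same side of each \<open>t k\<close>.\<close>
  have eq: "(t k < r \<longleftrightarrow> t k < s (Suc i)) \<and> (r \<le> t k \<longleftrightarrow> s (Suc i) \<le> t k)" if k: "k \<le> m" for k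
  proof -
    obtain a where a: "a \<le> N" "t k = s a" using regrid_index[OF k] by blast
    have "s a < s (Suc i) \<longleftrightarrow> s a \<le> s i"
      using grid_less_iff[OF grid, of a "Suc i"] grid_less_iff[OF grid, of i a] a i(1) by (auto simp: not_less[symmetric])
    then show ?thesis using a(2) i by auto
  qed
  have "simple_drift m t \<xi> w r = simple_drift m t \<xi> w (s (Suc i))"
    unfolding simple_drift_def using eq by (intro sum.cong) auto
  also have "\<dots> = simple_drift N s (regrid m t \<xi> s) w r"
    using simple_drift_at[OF grid i, of "regrid m t \<xi> s" w] by (simp add: regrid_def)
  finally show ?thesis .
next
  case False
  then have r: "r \<le> 0 \<or> 1 < r" by auto
  have "simple_drift m t \<xi> w r = 0"
    using simple_integrand_bounds[OF si] r by (intro simple_drift_outside[of m 0 t 1]) auto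
  moreover have "simple_drift N s (regrid m t \<xi> s) w r = 0"
    using grid_bounds[OF grid] r by (intro simple_drift_outside[of N 0 s 1]) auto
  ultimately show ?thesis by simp
qed

lemma simple_integrand_regrid:
  assumes nu: "filtration (space \<nu>) (coord_filtration \<nu>)"
  shows "simple_integrand \<nu> N s (regrid m t \<xi> s)"
  unfolding simple_integrand_def
proof (intro conjI allI impI)
  show "0 \<le> s 0" "s N \<le> 1" using time_gridD[OF grid] by auto
  show "s k \<le> s (Suc k)" if "k < N" for k using time_gridD(3)[OF grid that] by simp
  show "regrid m t \<xi> s i \<in> borel_measurable (coord_filtration \<nu> (s i))" if i: "i < N" for i
    unfolding regrid_def simple_drift_def
  proof (rule borel_measurable_sum)
    fix k assume "k \<in> {..<m}"
    then have k: "k < m" by simp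
    show "(\<lambda>w. if t k < s (Suc i) \<and> s (Suc i) \<le> t (Suc k) then \<xi> k w else 0) \<in> borel_measurable (coord_filtration \<nu> (s i))"
    proof (cases "t k < s (Suc i) \<and> s (Suc i) \<le> t (Suc k)")
      case True
      obtain a where a: "a \<le> N" "t k = s a" using regrid_index[of k] k by auto
      \<comment> \<open>The coarse point \<open>t k\<close> lies below the right end of the fine
        cell and is itself a fine point; hence it is at most the left end, where the value is
        already known.\<close>
      have "a \<le> i" using True a grid_less_iff[OF grid, of a "Suc i"] i by auto
      then have le: "t k \<le> s i" using grid_mono[OF grid, of a i] a i by auto
      have m: "\<xi> k \<in> borel_measurable (coord_filtration \<nu> (t k))"
        using si k by (auto simp: simple_integrand_def)
      have "\<xi> k \<in> borel_measurable (coord_filtration \<nu> (s i))"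
      proof (rule measurableI)
        fix A :: "(real, 'n) vec set" assume "A \<in> sets borel"
        from subsetD[OF filtration.sets_F_mono[OF nu le] measurable_sets[OF m this]]
        show "\<xi> k -` A \<inter> space (coord_filtration \<nu> (s i)) \<in> sets (coord_filtration \<nu> (s i))"
          by (simp add: filtration.space_F[OF nu])
      qed simp
      then show ?thesis using True by simp
    next
      case False
      then show ?thesis by (simp only: if_False) simp
    qed
  qed
  show "bounded (regrid m t \<xi> s i ` space \<nu>)" if "i < N" for i
  proof -
    have "\<forall>k<m. \<exists>C. \<forall>w\<in>space \<nu>. norm (\<xi> k w) \<le> C"
      using si by (auto simp: simple_integrand_def bounded_iff)
    then obtain C where C: "\<And>k w. k < m \<Longrightarrow> w \<in> space \<nu> \<Longrightarrow> norm (\<xi> k w) \<le> C k" by metis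
    have "norm (regrid m t \<xi> s i w) \<le> (\<Sum>k<m. \<bar>C k\<bar>)" if "w \<in> space \<nu>" for w
      unfolding regrid_def simple_drift_def
    proof (rule order_trans[OF norm_sum], rule sum_mono)
      fix k assume "k \<in> {..<m}"
      then show "norm (if t k < s (Suc i) \<and> s (Suc i) \<le> t (Suc k) then \<xi> k w else 0) \<le> \<bar>C k\<bar>"
        using C[of k w] that by auto
    qed
    then show ?thesis by (auto simp: bounded_iff)
  qed
qed

end

lemma measurable_simple_drift_time[measurable]: "simple_drift N s z w \<in> borel_measurable borel"
  unfolding simple_drift_def by measurable

lemma indicator_cells:
  fixes g :: "nat \<Rightarrow> real \<Rightarrow> 'a::real_vector"
  assumes "time_grid N s" "i < N" "s i < r" "r \<le> s (Suc i)"
  shows "(\<Sum>k<N. indicator {s k<..s (Suc k)} r *\<^sub>R g k r) = g i r"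
proof -
  have "indicator {s k<..s (Suc k)} r *\<^sub>R g k r = (if k = i then g i r else 0)" if "k < N" for k
  proof (cases "k = i")
    case False
    have "\<not> (s k < r \<and> r \<le> s (Suc k))"
    proof
      assume "s k < r \<and> r \<le> s (Suc k)"
      then have "s k < s (Suc i)" "s i < s (Suc k)" using assms(3,4) by linarith+
      then have "k < Suc i" "i < Suc k"
        using grid_less_iff[OF assms(1), of k "Suc i"] grid_less_iff[OF assms(1), of i "Suc k"] that assms(2) by auto
      then show False using False by simp
    qed
    then have "r \<notin> {s k<..s (Suc k)}" by simp
    then show ?thesis using False by simp
  qed (use assms in simp)
  then have "(\<Sum>k<N. indicator {s k<..s (Suc k)} r *\<^sub>R g k r) = (\<Sum>k<N. if k = i then g i r else 0)"
    by (intro sum.cong) auto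
  then show ?thesis using assms(2) by simp
qed

lemma integral_cells:
  fixes g :: "nat \<Rightarrow> real \<Rightarrow> 'a::{banach, second_countable_topology}"
  assumes grid: "time_grid N s" and s0: "s 0 = 0" and j: "j \<le> N"
    and fm: "f \<in> borel_measurable borel"
    and int: "\<And>k. k < j \<Longrightarrow> set_integrable lborel {s k<..s (Suc k)} (g k)"
    and f: "\<And>k r. k < j \<Longrightarrow> s k < r \<Longrightarrow> r \<le> s (Suc k) \<Longrightarrow> f r = g k r"
  shows "(LINT r:{0..s j}|lborel. f r) = (\<Sum>k<j. LINT r:{s k<..s (Suc k)}|lborel. g k r)"
proof -
  have gj: "time_grid j s" using grid grid_bounds[OF grid j] j by (auto simp: time_grid_def)
  \<comment> \<open>The time 0 belongs to the closed interval but to no left-open cell.\<close>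
  have "AE r in lborel. r \<noteq> (0::real)" by (rule AE_lborel_singleton)
  then have "AE r in lborel. indicator {0..s j} r *\<^sub>R f r = (\<Sum>k<j. indicator {s k<..s (Suc k)} r *\<^sub>R g k r)"
  proof eventually_elim
    case (elim r)
    show ?case
    proof (cases "0 < r \<and> r \<le> s j")
      case True
      then obtain i where i: "i < j" "s i < r" "r \<le> s (Suc i)" using grid_cell[OF gj, of r] s0 by auto
      show ?thesis using indicator_cells[OF gj i, of g] f[OF i] True by simp
    next
      case False
      then have r: "r < 0 \<or> s j < r" using elim by auto
      have "indicator {s k<..s (Suc k)} r *\<^sub>R g k r = 0" if "k < j" for k
      proof -
        have "0 \<le> s k" "s (Suc k) \<le> s j" using grid_bounds[OF gj, of k] grid_mono[OF gj, of "Suc k" j] that by auto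
        then have "r \<notin> {s k<..s (Suc k)}" using r by auto
        then show ?thesis by simp
      qed
      then have "(\<Sum>k<j. indicator {s k<..s (Suc k)} r *\<^sub>R g k r) = 0"
        by (intro sum.neutral ballI) (simp only: lessThan_iff)
      moreover have "indicator {0..s j} r *\<^sub>R f r = 0" using r by auto
      ultimately show ?thesis by (simp only:)
    qed
  qed
  moreover have "(\<lambda>r. indicator {0..s j} r *\<^sub>R f r) \<in> borel_measurable lborel"
    using fm by measurable
  moreover have S: "integrable lborel (\<lambda>r. \<Sum>k<j. indicator {s k<..s (Suc k)} r *\<^sub>R g k r)"
    using int unfolding set_integrable_def by (intro Bochner_Integration.integrable_sum) auto
  ultimately have "(LINT r:{0..s j}|lborel. f r) = (LINT r|lborel. (\<Sum>k<j. indicator {s k<..s (Suc k)} r *\<^sub>R g k r))"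
    unfolding set_lebesgue_integral_def
    by (intro integral_cong_AE borel_measurable_integrable[OF S])
  also have "\<dots> = (\<Sum>k<j. LINT r:{s k<..s (Suc k)}|lborel. g k r)"
    unfolding set_lebesgue_integral_def
    using int unfolding set_integrable_def by (intro Bochner_Integration.integral_sum) auto
  finally show ?thesis .
qed

text \<open>Square of \<open>cm_norm\<close>. The integral is 0 when the integrand fails to be
  integrable, hence the integrability premises of the estimates.\<close>

definition energy :: "(real \<Rightarrow> 'a::real_normed_vector) \<Rightarrow> real" where
  "energy h = (LINT s:{0..1}|lborel. (norm (h s))\<^sup>2)"

lemma energy_nonneg: "0 \<le> energy h"
  unfolding energy_def set_lebesgue_integral_def by (intro integral_nonneg_AE) auto

lemma cm_norm_energy: "(cm_norm h)\<^sup>2 = energy h"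
  using energy_nonneg[of h] by (simp add: cm_norm_def energy_def)

lemma energy_cong: "(\<And>s. s \<in> {0..1} \<Longrightarrow> norm (h s) = norm (g s)) \<Longrightarrow> energy h = energy g"
  unfolding energy_def set_lebesgue_integral_def
  by (intro Bochner_Integration.integral_cong) (auto simp: indicator_def)

lemma energy_add_le:
  fixes h g :: "real \<Rightarrow> 'a::{real_normed_vector, second_countable_topology}"
  assumes h: "set_integrable lborel {0..1} (\<lambda>s. (norm (h s))\<^sup>2)"
    and g: "set_integrable lborel {0..1} (\<lambda>s. (norm (g s))\<^sup>2)"
  shows "energy (\<lambda>s. h s + g s) \<le> 2 * energy h + 2 * energy g"
proof -
  have p: "(norm (h s + g s))\<^sup>2 \<le> 2 * (norm (h s))\<^sup>2 + 2 * (norm (g s))\<^sup>2" for s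
  proof -
    have "(norm (h s + g s))\<^sup>2 \<le> (norm (h s) + norm (g s))\<^sup>2"
      by (intro power_mono norm_triangle_ineq) simp
    also have "\<dots> \<le> 2 * (norm (h s))\<^sup>2 + 2 * (norm (g s))\<^sup>2"
      using zero_le_power2[of "norm (h s) - norm (g s)"] by (simp add: power2_eq_square algebra_simps)
    finally show ?thesis .
  qed
  have i: "integrable lborel (\<lambda>s. indicator {0..1} s * (2 * (norm (h s))\<^sup>2) + indicator {0..1} s * (2 * (norm (g s))\<^sup>2))"
    using h g unfolding set_integrable_def by (simp add: mult.left_commute)
  have "energy (\<lambda>s. h s + g s) \<le> (LINT s|lborel. indicator {0..1} s * (2 * (norm (h s))\<^sup>2) + indicator {0..1} s * (2 * (norm (g s))\<^sup>2))"
    unfolding energy_def set_lebesgue_integral_def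
    by (rule integral_mono'[OF i]) (use p in \<open>auto simp: indicator_def\<close>)
  also have "\<dots> = 2 * energy h + 2 * energy g"
    using h g unfolding set_integrable_def energy_def set_lebesgue_integral_def
    by (simp add: mult.left_commute)
  finally show ?thesis .
qed

lemma energy_diff_le:
  fixes h g k :: "real \<Rightarrow> 'a::{real_normed_vector, second_countable_topology}"
  assumes "set_integrable lborel {0..1} (\<lambda>s. (norm (h s - k s))\<^sup>2)"
    and "set_integrable lborel {0..1} (\<lambda>s. (norm (g s - k s))\<^sup>2)"
  shows "energy (\<lambda>s. h s - g s) \<le> 2 * energy (\<lambda>s. h s - k s) + 2 * energy (\<lambda>s. g s - k s)"
proof -
  have "energy (\<lambda>s. h s - g s) = energy (\<lambda>s. (h s - k s) + (k s - g s))" by simp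
  also have "\<dots> \<le> 2 * energy (\<lambda>s. h s - k s) + 2 * energy (\<lambda>s. k s - g s)"
    using assms by (intro energy_add_le) (simp_all add: norm_minus_commute)
  also have "energy (\<lambda>s. k s - g s) = energy (\<lambda>s. g s - k s)"
    by (rule energy_cong) (rule norm_minus_commute)
  finally show ?thesis .
qed

section \<open>Joint measurability and adapted time integrals\<close>

context brownian_path_space
begin

lemma emeasure_space_nu[simp]: "emeasure \<nu> (space \<nu>) = 1"
  by (rule prob_space.emeasure_space_1[OF prob_nu])

lemma subalg: "subalgebra P (F t)"
  using sets_F_P by (auto simp: subalgebra_def)

definition jointly_measurable :: "'n drift \<Rightarrow> bool" where
  "jointly_measurable v \<longleftrightarrow> (\<lambda>p. v (fst p) (snd p)) \<in> borel_measurable (P \<Otimes>\<^sub>M (borel :: real measure))"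

text \<open>A drift is constrained on the unit interval only. Extension by 0 gives a process that is
  jointly measurable on the whole line and has the same energy.\<close>

definition on_unit :: "'n drift \<Rightarrow> 'n drift" where
  "on_unit u w s = (if s \<in> {0..1} then u w s else 0)"

lemma joint_section: "jointly_measurable v \<Longrightarrow> w \<in> space \<nu> \<Longrightarrow> v w \<in> borel_measurable borel"
  unfolding jointly_measurable_def using measurable_Pair2[of "\<lambda>p. v (fst p) (snd p)" P borel borel w] by simp

lemma joint_on_unit: assumes "u \<in> L0_adapted \<nu>" shows "jointly_measurable (on_unit u)"
proof -
  \<comment> \<open>Clamping is a measurable map of the line onto the unit interval; it transfers
    measurability on \<open>unit_time\<close> to the full Borel algebra.\<close>
  define c :: "real \<Rightarrow> real" where "c s = max 0 (min 1 s)" for s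
  have c: "c \<in> borel \<rightarrow>\<^sub>M unit_time"
    unfolding c_def by (intro measurable_restrict_space2) auto
  have "(\<lambda>p. (fst p, c (snd p))) \<in> P \<Otimes>\<^sub>M borel \<rightarrow>\<^sub>M P \<Otimes>\<^sub>M unit_time"
    using c by (intro measurable_Pair measurable_fst measurable_compose[OF measurable_snd])
  moreover have "(\<lambda>p. u (fst p) (snd p)) \<in> borel_measurable (P \<Otimes>\<^sub>M unit_time)"
    using assms by (simp add: L0_adapted_def case_prod_unfold)
  ultimately have [measurable]: "(\<lambda>p. u (fst p) (c (snd p))) \<in> borel_measurable (P \<Otimes>\<^sub>M borel)"
    by (auto dest: measurable_compose)
  have "on_unit u w s = (if s \<in> {0..1} then u w (c s) else 0)" for w s
    by (auto simp: on_unit_def c_def)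
  then show ?thesis unfolding jointly_measurable_def by simp
qed

lemma energy_on_unit: "energy (\<lambda>s. on_unit u w s - g s) = energy (\<lambda>s. u w s - g s)"
  "energy (\<lambda>s. g s - on_unit u w s) = energy (\<lambda>s. g s - u w s)" "energy (on_unit u w) = energy (u w)"
  by (rule energy_cong, simp add: on_unit_def)+

lemma measurable_integral_time:
  fixes g :: "'n path \<Rightarrow> real \<Rightarrow> 'b::{banach, second_countable_topology}"
  assumes "(\<lambda>p. g (fst p) (snd p)) \<in> borel_measurable (P \<Otimes>\<^sub>M borel)" and [measurable]: "A \<in> sets borel"
  shows "(\<lambda>w. LINT s:A|lborel. g w s) \<in> borel_measurable P"
proof -
  note assms(1)[measurable]
  have "(\<lambda>(w, s). indicator A s *\<^sub>R g w s) \<in> borel_measurable (P \<Otimes>\<^sub>M lborel)"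
    unfolding case_prod_beta by measurable
  then show ?thesis unfolding set_lebesgue_integral_def
    by (rule lborel.borel_measurable_lebesgue_integral)
qed

lemma measurable_energy: assumes "jointly_measurable v" shows "(\<lambda>w. energy (v w)) \<in> borel_measurable P"
  unfolding energy_def using assms[unfolded jointly_measurable_def]
  by (intro measurable_integral_time borel_measurable_power borel_measurable_norm) auto

lemma joint_diff: "jointly_measurable v \<Longrightarrow> jointly_measurable v' \<Longrightarrow> jointly_measurable (\<lambda>w s. v w s - v' w s)"
  unfolding jointly_measurable_def by simp

lemma joint_simple:
  assumes "\<And>k. k < N \<Longrightarrow> z k \<in> borel_measurable P"
  shows "jointly_measurable (simple_drift N s z)"
  unfolding jointly_measurable_def simple_drift_def
proof (rule borel_measurable_sum)
  fix k assume "k \<in> {..<N}"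
  then have [measurable]: "z k \<in> borel_measurable P" using assms by simp
  show "(\<lambda>p. if s k < snd p \<and> snd p \<le> s (Suc k) then z k (fst p) else 0) \<in> borel_measurable (P \<Otimes>\<^sub>M borel)"
    by measurable
qed

text \<open>A jointly measurable adapted process need not be progressively measurable. Its time integral
  is nevertheless adapted to the completed filtration, because it coincides with its conditional
  expectation.\<close>

lemma adapted_integral_real:
  fixes v :: "'n path \<Rightarrow> real \<Rightarrow> real"
  assumes vm: "(\<lambda>p. v (fst p) (snd p)) \<in> borel_measurable (P \<Otimes>\<^sub>M borel)"
    and K: "\<And>w s. \<bar>v w s\<bar> \<le> K"
    and ad: "\<And>s. s \<in> A \<Longrightarrow> v' s \<in> borel_measurable (F b) \<and> (\<forall>w\<in>space \<nu>. v' s w = v w s)"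
    and A: "A \<in> sets borel" "emeasure lborel A < \<infinity>"
  shows "(\<lambda>w. LINT s:A|lborel. v w s) \<in> borel_measurable (F b)"
proof -
  interpret S: finite_measure_subalgebra P "F b"
    by standard (rule subalg)
  interpret L: pair_sigma_finite P "lborel :: real measure" ..
  note vm[measurable] A(1)[measurable]
  define I where "I w = (LINT s:A|lborel. v w s)" for w
  have Im[measurable]: "I \<in> borel_measurable P" unfolding I_def by (rule measurable_integral_time[OF vm A(1)])
  have K0: "0 \<le> K" using K[of undefined 0] by linarith
  have IK: "\<bar>I w\<bar> \<le> K * measure lborel A" if "w \<in> space \<nu>" for w
  proof -
    have [measurable]: "v w \<in> borel_measurable borel"
      using measurable_Pair2[OF vm, of w] that by simp
    have i: "set_integrable lborel A (v w)" unfolding set_integrable_def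
      using A(2) K by (intro integrableI_bounded_set[where A=A and B=K]) (auto simp: indicator_def)
    have "norm (I w) \<le> (LINT s:A|lborel. norm (v w s))"
      unfolding I_def by (rule set_integral_norm_bound[OF i])
    also have "\<dots> \<le> (LINT s:A|lborel. K)"
      using A K by (intro set_integral_mono set_integrable_norm[OF i]) (auto simp: set_integrable_def)
    also have "\<dots> = K * measure lborel A" by (simp add: set_lebesgue_integral_def)
    finally show ?thesis by simp
  qed
  have Ii: "integrable P I"
    using IK by (intro integrable_const_bound[where B="K * measure lborel A"] AE_I2) auto
  define c where "c = real_cond_exp P (F b) I"
  have cm: "c \<in> borel_measurable (F b)" "integrable P c"
    unfolding c_def using S.real_cond_exp_int(1)[OF Ii] by auto
  \<comment> \<open>\<open>I\<close> and its conditional expectation are compared on every set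
    \<open>B\<close>: by Fubini each time section, which is \<open>F b\<close>-measurable, may trade
    the indicator of \<open>B\<close> for its conditional expectation.\<close>
  have "AE w in P. I w = c w"
  proof (rule density_unique_real)
    fix B assume B[measurable]: "B \<in> sets P"
    define e0 where "e0 = real_cond_exp P (F b) (indicator B :: _ \<Rightarrow> real)"
    \<comment> \<open>A version of the conditional probability with values in \<open>[0, 1]\<close>
      everywhere, so that Fubini applies with a constant bound.\<close>
    define e where "e w = max 0 (min 1 (e0 w))" for w
    have iB: "integrable P (indicator B :: _ \<Rightarrow> real)" using B by (intro integrable_real_indicator) (auto simp: less_top[symmetric] simp del: emeasure_completion)
    have e0m[measurable]: "e0 \<in> borel_measurable (F b)" unfolding e0_def by auto
    have em: "e \<in> borel_measurable (F b)" unfolding e_def by measurable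
    note emP[measurable] = measurable_F_P[OF em] measurable_F_P[OF e0m] measurable_F_P[OF cm(1)]
    have "AE w in P. 0 \<le> e0 w" "AE w in P. e0 w \<le> 1"
      unfolding e0_def using iB by (auto intro!: S.real_cond_exp_ge_c S.real_cond_exp_le_c simp: indicator_def)
    then have ee: "AE w in P. e0 w = e w" by eventually_elim (auto simp: e_def)
    have e01: "0 \<le> e w" "e w \<le> 1" for w by (auto simp: e_def)
    have swap: "(LINT w|P. I w * g w) = (LINT s:A|lborel. (LINT w|P. v w s * g w))"
      if [measurable]: "g \<in> borel_measurable P" and g: "\<And>w. \<bar>g w\<bar> \<le> 1" for g
    proof -
      have int: "integrable (P \<Otimes>\<^sub>M lborel) (\<lambda>(w, s). indicator A s * (v w s * g w))"
      proof (rule integrableI_bounded_set[where A="space P \<times> A" and B=K])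
        show "space P \<times> A \<in> sets (P \<Otimes>\<^sub>M lborel)" by simp
        show "emeasure (P \<Otimes>\<^sub>M lborel) (space P \<times> A) < \<infinity>"
          using A by (subst lborel.emeasure_pair_measure_Times) (auto simp: ennreal_mult_less_top)
        have "\<bar>v w s * g w\<bar> \<le> K" for w s
          using mult_mono[OF K[of w s] g[of w]] K0 by (simp add: abs_mult)
        then show "AE x in P \<Otimes>\<^sub>M lborel. x \<in> space P \<times> A \<longrightarrow> norm (case x of (w, s) \<Rightarrow> indicator A s * (v w s * g w)) \<le> K"
          by (auto simp: indicator_def K0)
        show "AE x in P \<Otimes>\<^sub>M lborel. x \<notin> space P \<times> A \<longrightarrow> (case x of (w, s) \<Rightarrow> indicator A s * (v w s * g w)) = 0"
          by (rule AE_I2) (auto simp: space_pair_measure indicator_def)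
      qed (simp add: case_prod_beta)
      have "(LINT w|P. I w * g w) = (LINT w|P. (LINT s|lborel. indicator A s * (v w s * g w)))"
        unfolding I_def set_lebesgue_integral_def by (simp add: mult.assoc[symmetric])
      also have "\<dots> = (LINT s|lborel. (LINT w|P. indicator A s * (v w s * g w)))"
        using L.Fubini_integral[OF int] by simp
      finally show ?thesis by (simp add: set_lebesgue_integral_def)
    qed
    have "(LINT w|P. I w * indicator B w) = (LINT s:A|lborel. (LINT w|P. v w s * indicator B w))"
      by (rule swap) (auto simp: indicator_def)
    also have "\<dots> = (LINT s:A|lborel. (LINT w|P. v w s * e w))"
    proof (rule set_lebesgue_integral_cong[OF _ allI[OF impI]])
      fix s assume s: "s \<in> A"
      have vF: "v' s \<in> borel_measurable (F b)" and vv: "\<And>w. w \<in> space \<nu> \<Longrightarrow> v' s w = v w s" using ad[OF s] by auto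
      note [measurable] = measurable_F_P[OF vF]
      have i: "integrable P (\<lambda>w. v' s w * indicator B w)"
        using K vv K0 by (intro integrable_const_bound[where B=K] AE_I2) (auto simp: indicator_def)
      have "(LINT w|P. v w s * indicator B w) = (LINT w|P. v' s w * indicator B w)"
        by (intro Bochner_Integration.integral_cong) (auto simp: vv)
      also have "\<dots> = (LINT w|P. v' s w * e0 w)"
        unfolding e0_def by (rule S.real_cond_exp_intg(2)[OF i vF, symmetric]) simp
      also have "\<dots> = (LINT w|P. v' s w * e w)"
        using ee by (intro integral_cong_AE) auto
      also have "\<dots> = (LINT w|P. v w s * e w)"
        by (intro Bochner_Integration.integral_cong) (auto simp: vv)
      finally show "(LINT w|P. v w s * indicator B w) = (LINT w|P. v w s * e w)" .
    qed simp
    also have "\<dots> = (LINT w|P. I w * e w)"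
      using e01 by (intro swap[symmetric]) auto
    also have "\<dots> = (LINT w|P. e w * I w)" by (simp add: mult.commute)
    also have "\<dots> = (LINT w|P. e w * c w)"
      unfolding c_def
    proof (rule S.real_cond_exp_intg(2)[symmetric, OF _ em Im])
      show "integrable P (\<lambda>w. e w * I w)"
        using e01 by (intro Bochner_Integration.integrable_bound[OF Ii] AE_I2) (auto simp: abs_mult intro!: mult_left_le_one_le)
    qed
    also have "\<dots> = (LINT w|P. c w * e0 w)"
      using ee by (intro integral_cong_AE) (auto simp: mult.commute)
    also have "\<dots> = (LINT w|P. c w * indicator B w)"
      unfolding e0_def
    proof (rule S.real_cond_exp_intg(2)[OF _ cm(1)])
      show "integrable P (\<lambda>w. c w * indicator B w)"
        using cm(2) B by (rule integrable_real_mult_indicator[rotated])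
    qed simp
    finally show "(LINT x:B|P. I x) = (LINT x:B|P. c x)"
      by (simp add: set_lebesgue_integral_def mult.commute)
  qed (rule Ii, rule cm)
  then have "AE w in P. c w = I w" by eventually_elim simp
  then have "I \<in> borel_measurable (F b)"
    by (rule measurable_AE_F[OF cm(1)]) simp
  then show ?thesis unfolding I_def[abs_def] .
qed

lemma adapted_integral:
  fixes v :: "'n drift"
  assumes vm: "jointly_measurable v"
    and K: "\<And>w s. norm (v w s) \<le> K"
    and ad: "\<And>s. s \<in> A \<Longrightarrow> (\<lambda>w. v w s) \<in> borel_measurable (F b)"
    and A: "A \<in> sets borel" "emeasure lborel A < \<infinity>"
  shows "(\<lambda>w. LINT s:A|lborel. v w s) \<in> borel_measurable (F b)"
proof (rule borel_measurable_euclidean_space[THEN iffD2], rule ballI)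
  fix i :: "(real, 'n) vec" assume i: "i \<in> Basis"
  note vm[unfolded jointly_measurable_def, measurable]
  have m: "(\<lambda>w. LINT s:A|lborel. v w s \<bullet> i) \<in> borel_measurable (F b)"
  proof (rule adapted_integral_real[where K=K and v'="\<lambda>s w. v w s \<bullet> i", OF _ _ _ A])
    show "(\<lambda>p. v (fst p) (snd p) \<bullet> i) \<in> borel_measurable (P \<Otimes>\<^sub>M borel)" by measurable
    show "\<bar>v w s \<bullet> i\<bar> \<le> K" for w s
      using Basis_le_norm[OF i, of "v w s"] K[of w s] by linarith
    show "(\<lambda>w. v w s \<bullet> i) \<in> borel_measurable (F b) \<and> (\<forall>w\<in>space \<nu>. v w s \<bullet> i = v w s \<bullet> i)" if "s \<in> A" for s
      using ad[OF that] by simp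
  qed
  have eq: "(LINT s:A|lborel. v w s) \<bullet> i = (LINT s:A|lborel. v w s \<bullet> i)" if "w \<in> space (F b)" for w
  proof -
    have [measurable]: "v w \<in> borel_measurable borel" using joint_section[OF vm, of w] that by simp
    note A(1)[measurable]
    have "integrable lborel (\<lambda>s. indicator A s *\<^sub>R v w s)"
      using A(2) K by (intro integrableI_bounded_set[where A=A and B=K]) (auto simp: indicator_def)
    then show ?thesis unfolding set_lebesgue_integral_def
      by (subst integral_inner_left[symmetric]) auto
  qed
  show "(\<lambda>w. (LINT s:A|lborel. v w s) \<bullet> i) \<in> borel_measurable (F b)"
    by (subst measurable_cong[where g="\<lambda>w. LINT s:A|lborel. v w s \<bullet> i"]) (use eq m in auto)
qed

end

section \<open>Adapted step approximations of square integrable drifts\<close>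

lemma simple_drift_uniform_grid:
  assumes "\<And>k. k < N \<Longrightarrow> z k w = lagged_average N f k"
  shows "simple_drift N (\<lambda>k. real k / N) z w s = lagged_step N f s"
  unfolding simple_drift_def lagged_step_def using assms by (intro sum.cong) auto

lemma time_grid_uniform: "0 < N \<Longrightarrow> time_grid N (\<lambda>k. real k / real N)"
  by (auto simp: time_grid_def divide_strict_right_mono)

lemma simple_integrandD:
  assumes "simple_integrand \<nu> m t z" "k < m"
  shows "z k \<in> borel_measurable (coord_filtration \<nu> (t k))" "\<exists>C. \<forall>w\<in>space \<nu>. norm (z k w) \<le> C"
  using assms by (auto simp: simple_integrand_def bounded_iff)

context brownian_path_space
begin

definition square_integrable_drift :: "'n drift \<Rightarrow> bool" where
  "square_integrable_drift u \<longleftrightarrow> u \<in> L0_adapted \<nu> \<and> integrable P (\<lambda>w. energy (u w))"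

lemma L0_adaptedD:
  assumes "u \<in> L0_adapted \<nu>"
  shows "s \<in> {0..1} \<Longrightarrow> (\<lambda>w. u w s) \<in> borel_measurable (F s)"
    and "AE w in P. set_integrable lborel {0..1} (\<lambda>s. (norm (u w s))\<^sup>2)"
  using assms by (auto simp: L0_adapted_def)

lemma measurable_drift_section: "u \<in> L0_adapted \<nu> \<Longrightarrow> w \<in> space \<nu> \<Longrightarrow> on_unit u w \<in> borel_measurable borel"
  by (rule joint_section[OF joint_on_unit])

lemma measurable_energy_L0: "u \<in> L0_adapted \<nu> \<Longrightarrow> (\<lambda>w. energy (u w)) \<in> borel_measurable P"
  using measurable_energy[OF joint_on_unit] by (simp add: energy_on_unit)

text \<open>At a fixed path and time the truncation is eventually exact. The squared norm of
  \<open>u w s\<close> dominates in time, and \<open>energy (u w)\<close> dominates over the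
  paths.\<close>

lemma truncation_converges:
  assumes u: "square_integrable_drift u" and e: "0 < e"
  obtains K where "0 \<le> K"
    "(LINT w|P. energy (\<lambda>s. (if norm (u w s) \<le> K then u w s else 0) - u w s)) < e"
proof -
  let ?v = "\<lambda>n w s. (if norm (u w s) \<le> real n then u w s else 0)"
  have uL: "u \<in> L0_adapted \<nu>" and ui: "integrable P (\<lambda>w. energy (u w))"
    using u by (auto simp: square_integrable_drift_def)
  have j: "jointly_measurable (on_unit u)" by (rule joint_on_unit[OF uL])
  have jn: "jointly_measurable (\<lambda>w s. (if norm (on_unit u w s) \<le> real n then on_unit u w s else 0) - on_unit u w s)" for n
    using j unfolding jointly_measurable_def by measurable
  have en: "energy (\<lambda>s. ?v n w s - u w s) = energy (\<lambda>s. (if norm (on_unit u w s) \<le> real n then on_unit u w s else 0) - on_unit u w s)" for n w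
    by (rule energy_cong) (simp add: on_unit_def)
  have m: "(\<lambda>w. energy (\<lambda>s. ?v n w s - u w s)) \<in> borel_measurable P" for n
    unfolding en by (rule measurable_energy[OF jn])
  have AEgood: "AE w in P. w \<in> space \<nu> \<and> set_integrable lborel {0..1} (\<lambda>s. (norm (u w s))\<^sup>2)"
    using L0_adaptedD(2)[OF uL] AE_space[of P] by eventually_elim simp
  have b: "norm (indicator {0..1} s * (norm (?v n w s - u w s))\<^sup>2) \<le> indicator {0..1} s * (norm (u w s))\<^sup>2" for n w s
    by (auto simp: indicator_def)
  have "(\<lambda>n. LINT w|P. energy (\<lambda>s. ?v n w s - u w s)) \<longlonglongrightarrow> (LINT w|P. 0)"
  proof (rule Bochner_Integration.integral_dominated_convergence[OF _ m ui])
    show "AE w in P. (\<lambda>n. energy (\<lambda>s. ?v n w s - u w s)) \<longlonglongrightarrow> 0"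
      using AEgood
    proof eventually_elim
      case (elim w)
      have [measurable]: "on_unit u w \<in> borel_measurable borel" using measurable_drift_section[OF uL] elim by simp
      have "(\<lambda>n. energy (\<lambda>s. ?v n w s - u w s)) \<longlonglongrightarrow> (LINT s::real|lborel. 0)"
        unfolding energy_def set_lebesgue_integral_def real_scaleR_def
      proof (rule Bochner_Integration.integral_dominated_convergence[where w="\<lambda>s. indicator {0..1} s * (norm (u w s))\<^sup>2"])
        show "integrable lborel (\<lambda>s. indicator {0..1} s * (norm (u w s))\<^sup>2)"
          using elim by (simp add: set_integrable_def)
        show "(\<lambda>s. indicator {0..1} s * (norm (?v n w s - u w s))\<^sup>2) \<in> borel_measurable lborel" for n
        proof -
          have "(\<lambda>s. indicator {0..1} s * (norm (?v n w s - u w s))\<^sup>2)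
            = (\<lambda>s. indicator {0..1} s * (norm ((if norm (on_unit u w s) \<le> real n then on_unit u w s else 0) - on_unit u w s))\<^sup>2)"
            by (rule ext) (simp add: on_unit_def indicator_def)
          then show ?thesis by simp
        qed
        show "AE s in lborel. (\<lambda>n. indicator {0..1} s * (norm (?v n w s - u w s))\<^sup>2) \<longlonglongrightarrow> 0"
        proof (rule AE_I2)
          fix s
          obtain n0 where n0: "norm (u w s) \<le> real n0" using real_arch_simple by blast
          have "\<forall>\<^sub>F n in sequentially. indicator {0..1} s * (norm (?v n w s - u w s))\<^sup>2 = 0"
            using eventually_ge_at_top[of n0]
          proof eventually_elim
            case (elim n)
            then have "norm (u w s) \<le> real n" using n0 by linarith
            then show ?case by simp
          qed
          then show "(\<lambda>n. indicator {0..1} s * (norm (?v n w s - u w s))\<^sup>2) \<longlonglongrightarrow> 0"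
            by (rule tendsto_eventually)
        qed
        show "AE s in lborel. norm (indicator {0..1} s * (norm (?v n w s - u w s))\<^sup>2) \<le> indicator {0..1} s * (norm (u w s))\<^sup>2" for n
          by (rule AE_I2) (rule b)
      qed simp
      then show ?case by simp
    qed
    show "AE w in P. norm (energy (\<lambda>s. ?v n w s - u w s)) \<le> energy (u w)" for n
      using AEgood
    proof eventually_elim
      case (elim w)
      have "energy (\<lambda>s. ?v n w s - u w s) \<le> energy (u w)"
        unfolding energy_def set_lebesgue_integral_def real_scaleR_def
      proof (rule integral_mono')
        show "integrable lborel (\<lambda>s. indicator {0..1} s * (norm (u w s))\<^sup>2)"
          using elim by (simp add: set_integrable_def)
      qed (use b in \<open>auto simp: abs_if\<close>)
      then show ?case using energy_nonneg[of "\<lambda>s. ?v n w s - u w s"] by simp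
    qed
  qed simp
  then have "\<forall>\<^sub>F n in sequentially. (LINT w|P. energy (\<lambda>s. ?v n w s - u w s)) < e"
    using order_tendstoD(2)[of _ "LINT w|P. 0" sequentially e] e by simp
  then obtain n where "(LINT w|P. energy (\<lambda>s. ?v n w s - u w s)) < e"
    by (auto simp: eventually_sequentially)
  then show ?thesis by (rule that[rotated]) simp
qed

lemma simple_bounded:
  assumes "simple_integrand \<nu> N t z"
  obtains C where "0 \<le> C" "\<And>w r. w \<in> space \<nu> \<Longrightarrow> norm (simple_drift N t z w r) \<le> C" "\<And>k w. k < N \<Longrightarrow> w \<in> space \<nu> \<Longrightarrow> norm (z k w) \<le> C"
proof -
  obtain C where C: "\<And>k w. k < N \<Longrightarrow> w \<in> space \<nu> \<Longrightarrow> norm (z k w) \<le> C k"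
    using simple_integrandD(2)[OF assms] by metis
  have "norm (simple_drift N t z w r) \<le> (\<Sum>k<N. \<bar>C k\<bar>)" if "w \<in> space \<nu>" for w r
    unfolding simple_drift_def
  proof (rule order_trans[OF norm_sum], rule sum_mono)
    fix k assume "k \<in> {..<N}"
    then show "norm (if t k < r \<and> r \<le> t (Suc k) then z k w else 0) \<le> \<bar>C k\<bar>"
      using C[of k w] that by auto
  qed
  moreover have "norm (z k w) \<le> (\<Sum>k<N. \<bar>C k\<bar>)" if "k < N" "w \<in> space \<nu>" for k w
    using C[OF that] that(1) member_le_sum[of k "{..<N}" "\<lambda>k. \<bar>C k\<bar>"] by fastforce
  ultimately show ?thesis by (intro that[of "\<Sum>k<N. \<bar>C k\<bar>"]) (auto intro: sum_nonneg)
qed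

lemma joint_simple_integrand:
  assumes "simple_integrand \<nu> N t z" shows "jointly_measurable (simple_drift N t z)"
  using simple_integrandD(1)[OF assms] by (intro joint_simple measurable_F_P)

lemma set_integrable_simple_diff:
  assumes si: "simple_integrand \<nu> N t z" and u: "u \<in> L0_adapted \<nu>"
  shows "AE w in P. set_integrable lborel {0..1} (\<lambda>s. (norm (simple_drift N t z w s - u w s))\<^sup>2)"
  using L0_adaptedD(2)[OF u] AE_space[of P]
proof eventually_elim
  case (elim w)
  obtain C where C0: "0 \<le> C" "\<And>w r. w \<in> space \<nu> \<Longrightarrow> norm (simple_drift N t z w r) \<le> C"
    "\<And>k w. k < N \<Longrightarrow> w \<in> space \<nu> \<Longrightarrow> norm (z k w) \<le> C"
    by (rule simple_bounded[OF si]) blast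
  have C: "0 \<le> C" "norm (simple_drift N t z w r) \<le> C" for r using C0(1) C0(2)[of w] elim by simp_all
  have [measurable]: "on_unit u w \<in> borel_measurable borel" using measurable_drift_section[OF u] elim by simp
  have i: "integrable lborel (\<lambda>s. indicator {0..1} s * (2 * C\<^sup>2) + 2 * (indicator {0..1} s * (norm (u w s))\<^sup>2))"
    using elim by (simp add: set_integrable_def)
  have eq: "indicator {0..1} s *\<^sub>R (norm (simple_drift N t z w s - u w s))\<^sup>2
     = indicator {0..1} s * (norm (simple_drift N t z w s - on_unit u w s))\<^sup>2" for s
    by (simp add: on_unit_def indicator_def)
  have p: "(norm (simple_drift N t z w s - u w s))\<^sup>2 \<le> 2 * C\<^sup>2 + 2 * (norm (u w s))\<^sup>2" for s
  proof -
    have "(norm (simple_drift N t z w s - u w s))\<^sup>2 \<le> (C + norm (u w s))\<^sup>2"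
      using C(2)[of s] norm_triangle_ineq4[of "simple_drift N t z w s" "u w s"] by (intro power_mono) auto
    also have "\<dots> \<le> 2 * C\<^sup>2 + 2 * (norm (u w s))\<^sup>2"
      using zero_le_power2[of "C - norm (u w s)"] by (simp add: power2_eq_square algebra_simps)
    finally show ?thesis .
  qed
  show ?case unfolding set_integrable_def
  proof (rule Bochner_Integration.integrable_bound[OF i])
    show "(\<lambda>s. indicator {0..1} s *\<^sub>R (norm (simple_drift N t z w s - u w s))\<^sup>2) \<in> borel_measurable lborel"
      unfolding eq by measurable
    show "AE s in lborel. norm (indicator {0..1} s *\<^sub>R (norm (simple_drift N t z w s - u w s))\<^sup>2)
        \<le> norm (indicator {0..1} s * (2 * C\<^sup>2) + 2 * (indicator {0..1} s * (norm (u w s))\<^sup>2))"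
      using p by (auto simp: indicator_def)
  qed
qed

lemma measurable_energy_simple_diff:
  assumes si: "simple_integrand \<nu> N t z" and u: "u \<in> L0_adapted \<nu>"
  shows "(\<lambda>w. energy (\<lambda>s. simple_drift N t z w s - u w s)) \<in> borel_measurable P"
  using measurable_energy[OF joint_diff[OF joint_simple_integrand[OF si] joint_on_unit[OF u]]]
  by (simp add: energy_on_unit)

text \<open>Truncation, then lagged averages along the uniform grid. The lag serves twice: it makes
  the values adapted, and since \<open>u\<close> vanishes up to \<tau> it makes the value on a cell
  vanish whenever the cell starts at or before \<tau>.\<close>

lemma simple_approximation:
  assumes u: "square_integrable_drift u" and e: "0 < e"
    and after: "\<And>w s. s \<le> \<tau> w \<Longrightarrow> u w s = 0"
  obtains N s z where "simple_integrand \<nu> N s z" "time_grid N s" "s 0 = 0" "s N = 1"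
    "\<And>k w. k < N \<Longrightarrow> s k \<le> \<tau> w \<Longrightarrow> z k w = 0"
    "(\<integral>\<^sup>+w. ennreal (energy (\<lambda>r. simple_drift N s z w r - u w r)) \<partial>P) \<le> ennreal e"
proof -
  have uL: "u \<in> L0_adapted \<nu>" using u by (auto simp: square_integrable_drift_def)
  \<comment> \<open>Two errors of at most \<open>e / 4\<close>, each doubled by
    \<open>energy_add_le\<close>, add up to \<open>e\<close>.\<close>
  obtain K where K: "0 \<le> K" "(LINT w|P. energy (\<lambda>s. (if norm (u w s) \<le> K then u w s else 0) - u w s)) < e / 4"
    using truncation_converges[OF u, of "e / 4"] e by auto
  define v where "v w s = (if norm (on_unit u w s) \<le> K then on_unit u w s else 0)" for w s
  have vu: "energy (\<lambda>s. v w s - u w s) = energy (\<lambda>s. (if norm (u w s) \<le> K then u w s else 0) - u w s)" for w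
    by (rule energy_cong) (simp add: v_def on_unit_def)
  have vj: "jointly_measurable v"
    using joint_on_unit[OF uL] unfolding jointly_measurable_def v_def by measurable
  have vK: "norm (v w s) \<le> K" for w s using K(1) by (simp add: v_def)
  have vad: "(\<lambda>w. v w s) \<in> borel_measurable (F b)" if "s \<le> b" for s b
  proof (cases "s \<in> {0..1}")
    case True
    have [measurable]: "(\<lambda>w. u w s) \<in> borel_measurable (F b)"
      using L0_adaptedD(1)[OF uL True] that by (rule measurable_F_mono[rotated])
    have "(\<lambda>w. v w s) = (\<lambda>w. if norm (u w s) \<le> K then u w s else 0)"
      using True by (auto simp: v_def on_unit_def)
    then show ?thesis by simp
  next
    case False
    then have "(\<lambda>w. v w s) = (\<lambda>w. 0)" by (auto simp: v_def on_unit_def)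
    then show ?thesis by simp
  qed
  have vsec: "v w \<in> borel_measurable borel" if "w \<in> space \<nu>" for w
    using joint_section[OF vj that] .
  define z where "z N k w = lagged_average N (v w) k" for N k w
  have zm: "z N k \<in> borel_measurable (F (real k / N))" if "0 < N" for N k
    unfolding z_def[abs_def] lagged_average_def
  proof (intro borel_measurable_scaleR borel_measurable_const adapted_integral[OF vj vK] vad)
    show "emeasure lborel ({(real k - 1) / N<..real k / N} \<inter> {0..1}) < \<infinity>"
      by (intro le_less_trans[OF emeasure_mono[of "{(real k - 1) / N<..real k / N} \<inter> {0..1}" "{0..1}"]]) auto
  qed auto
  have zK: "norm (z N k w) \<le> K" if "0 < N" "w \<in> space \<nu>" for N k w
    unfolding z_def using norm_lagged_average_le(2)[OF vsec[OF that(2)] vK that(1)] .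
  have si: "simple_integrand \<nu> N (\<lambda>k. real k / N) (z N)" if "0 < N" for N
    using that zm[OF that] zK[OF that]
    by (auto simp: simple_integrand_def divide_right_mono bounded_iff)
  have sd: "simple_drift N (\<lambda>k. real k / N) (z N) w = lagged_step N (v w)" for N w
    by (rule ext, rule simple_drift_uniform_grid) (simp add: z_def)
  have "(\<lambda>N. LINT w|P. energy (\<lambda>s. simple_drift (Suc N) (\<lambda>k. real k / Suc N) (z (Suc N)) w s - v w s)) \<longlonglongrightarrow> (LINT w|P. 0)"
  proof (rule Bochner_Integration.integral_dominated_convergence[where w="\<lambda>_. 4 * K\<^sup>2"])
    show "(\<lambda>w. energy (\<lambda>s. simple_drift (Suc N) (\<lambda>k. real k / Suc N) (z (Suc N)) w s - v w s)) \<in> borel_measurable P" for N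
      by (intro measurable_energy[OF joint_diff[OF joint_simple_integrand[OF si] vj]]) simp
    show "AE w in P. (\<lambda>N. energy (\<lambda>s. simple_drift (Suc N) (\<lambda>k. real k / Suc N) (z (Suc N)) w s - v w s)) \<longlonglongrightarrow> 0"
      using AE_space[of P] unfolding sd energy_def
      by eventually_elim (use lagged_step_tendsto_L2[OF vsec vK] in simp)
    show "AE w in P. norm (energy (\<lambda>s. simple_drift (Suc N) (\<lambda>k. real k / Suc N) (z (Suc N)) w s - v w s)) \<le> 4 * K\<^sup>2" for N
      using AE_space[of P]
    proof eventually_elim
      case (elim w)
      let ?h = "\<lambda>s. lagged_step (Suc N) (v w) s - v w s"
      have "norm (?h s) \<le> 2 * K" for s
        using norm_triangle_ineq4[of "lagged_step (Suc N) (v w) s" "v w s"]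
          norm_lagged_step_le[OF vsec vK, of w "Suc N" s] vK[of w s] elim by simp
      then have h: "(norm (?h s))\<^sup>2 \<le> 4 * K\<^sup>2" for s
        using power_mono[of "norm (?h s)" "2 * K" 2] by simp
      have "energy ?h \<le> (LINT s|lborel. indicator {0..1::real} s * (4 * K\<^sup>2))"
        unfolding energy_def set_lebesgue_integral_def
      proof (rule integral_mono')
        show "integrable lborel (\<lambda>s::real. indicator {0..1} s * (4 * K\<^sup>2))" by simp
      qed (use h in \<open>auto simp: indicator_def\<close>)
      then show ?case using energy_nonneg[of ?h] unfolding sd by simp
    qed
  qed auto
  then have "\<forall>\<^sub>F N in sequentially. (LINT w|P. energy (\<lambda>s. simple_drift (Suc N) (\<lambda>k. real k / Suc N) (z (Suc N)) w s - v w s)) < e / 4"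
    using order_tendstoD(2)[of _ "LINT w|P. 0" sequentially "e / 4"] e by simp
  then obtain N0 where N0: "(LINT w|P. energy (\<lambda>s. simple_drift (Suc N0) (\<lambda>k. real k / Suc N0) (z (Suc N0)) w s - v w s)) < e / 4"
    by (auto simp: eventually_sequentially)
  define N where "N = Suc N0"
  let ?\<phi> = "simple_drift N (\<lambda>k. real k / N) (z N)"
  have N: "0 < N" by (simp add: N_def)
  have fin: "integrable P (\<lambda>w. energy (\<lambda>s. ?\<phi> w s - v w s))"
  proof (rule integrable_const_bound[where B="4 * K\<^sup>2"])
    show "AE w in P. norm (energy (\<lambda>s. ?\<phi> w s - v w s)) \<le> 4 * K\<^sup>2"
      using AE_space[of P]
    proof eventually_elim
      case (elim w)
      let ?h = "\<lambda>s. lagged_step N (v w) s - v w s"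
      have "norm (?h s) \<le> 2 * K" for s
        using norm_triangle_ineq4[of "lagged_step N (v w) s" "v w s"]
          norm_lagged_step_le[OF vsec vK N, of w s] vK[of w s] elim by simp
      then have h: "(norm (?h s))\<^sup>2 \<le> 4 * K\<^sup>2" for s
        using power_mono[of "norm (?h s)" "2 * K" 2] by simp
      have "energy ?h \<le> (LINT s|lborel. indicator {0..1::real} s * (4 * K\<^sup>2))"
        unfolding energy_def set_lebesgue_integral_def
      proof (rule integral_mono')
        show "integrable lborel (\<lambda>s::real. indicator {0..1} s * (4 * K\<^sup>2))" by simp
      qed (use h in \<open>auto simp: indicator_def\<close>)
      then show ?case using energy_nonneg[of ?h] unfolding sd by simp
    qed
    show "(\<lambda>w. energy (\<lambda>s. ?\<phi> w s - v w s)) \<in> borel_measurable P"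
      by (rule measurable_energy[OF joint_diff[OF joint_simple_integrand[OF si[OF N]] vj]])
  qed
  have vum: "(\<lambda>w. energy (\<lambda>s. v w s - u w s)) \<in> borel_measurable P"
    using measurable_energy[OF joint_diff[OF vj joint_on_unit[OF uL]]] by (simp add: energy_on_unit)
  have AEi: "AE w in P. energy (\<lambda>s. v w s - u w s) \<le> energy (u w)
      \<and> energy (\<lambda>s. ?\<phi> w s - u w s) \<le> 2 * energy (\<lambda>s. ?\<phi> w s - v w s) + 2 * energy (\<lambda>s. v w s - u w s)"
    using AE_space[of P] L0_adaptedD(2)[OF uL]
  proof eventually_elim
    case (elim w)
    have [measurable]: "v w \<in> borel_measurable borel" using vsec elim by simp
    have [measurable]: "on_unit u w \<in> borel_measurable borel" using measurable_drift_section[OF uL] elim by simp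
    have ui: "integrable lborel (\<lambda>s. indicator {0..1} s * (norm (u w s))\<^sup>2)"
      using elim by (simp add: set_integrable_def)
    have b: "indicator {0..1} s * (norm (v w s - u w s))\<^sup>2 \<le> indicator {0..1} s * (norm (u w s))\<^sup>2" for s
      by (simp add: v_def on_unit_def indicator_def)
    have i1: "set_integrable lborel {0..1} (\<lambda>s. (norm (v w s - u w s))\<^sup>2)"
      unfolding set_integrable_def real_scaleR_def
    proof (rule Bochner_Integration.integrable_bound[OF ui])
      have "(\<lambda>s. indicator {0..1} s * (norm (v w s - u w s))\<^sup>2) = (\<lambda>s. indicator {0..1} s * (norm (v w s - on_unit u w s))\<^sup>2)"
        by (rule ext) (simp add: on_unit_def indicator_def)
      then show "(\<lambda>s. indicator {0..1} s * (norm (v w s - u w s))\<^sup>2) \<in> borel_measurable lborel" by simp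
    qed (use b in auto)
    have "norm (?\<phi> w s - v w s) \<le> 2 * K" for s
      using norm_triangle_ineq4[of "lagged_step N (v w) s" "v w s"]
        norm_lagged_step_le[OF vsec vK N, of w s] vK[of w s] elim unfolding sd by simp
    then have h: "(norm (?\<phi> w s - v w s))\<^sup>2 \<le> 4 * K\<^sup>2" for s
      using power_mono[of "norm (?\<phi> w s - v w s)" "2 * K" 2] by simp
    have i2: "set_integrable lborel {0..1} (\<lambda>s. (norm (?\<phi> w s - v w s))\<^sup>2)"
      unfolding set_integrable_def real_scaleR_def
      by (rule integrableI_bounded_set[where A="{0..1}" and B="4 * K\<^sup>2"]) (use h in \<open>auto simp: indicator_def\<close>)
    have "energy (\<lambda>s. v w s - u w s) \<le> energy (u w)"
      unfolding energy_def set_lebesgue_integral_def real_scaleR_def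
      by (rule integral_mono'[OF ui b]) simp
    moreover have "energy (\<lambda>s. ?\<phi> w s - u w s) \<le> 2 * energy (\<lambda>s. ?\<phi> w s - v w s) + 2 * energy (\<lambda>s. v w s - u w s)"
      using energy_add_le[OF i2 i1] by simp
    ultimately show ?case by blast
  qed
  have fin2: "integrable P (\<lambda>w. energy (\<lambda>s. v w s - u w s))"
  proof (rule Bochner_Integration.integrable_bound[OF _ vum])
    show "integrable P (\<lambda>w. energy (u w))" using u by (simp add: square_integrable_drift_def)
    show "AE w in P. norm (energy (\<lambda>s. v w s - u w s)) \<le> norm (energy (u w))"
      using AEi by eventually_elim (simp add: energy_nonneg)
  qed
  have "(\<integral>\<^sup>+w. ennreal (energy (\<lambda>r. ?\<phi> w r - u w r)) \<partial>P)
      \<le> (\<integral>\<^sup>+w. ennreal (2 * energy (\<lambda>s. ?\<phi> w s - v w s) + 2 * energy (\<lambda>s. v w s - u w s)) \<partial>P)"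
    using AEi by (intro nn_integral_mono_AE) (auto intro: ennreal_leI)
  also have "\<dots> = ennreal (LINT w|P. 2 * energy (\<lambda>s. ?\<phi> w s - v w s) + 2 * energy (\<lambda>s. v w s - u w s))"
    using fin fin2 by (intro nn_integral_eq_integral AE_I2) (auto simp: energy_nonneg)
  also have "\<dots> = ennreal (2 * (LINT w|P. energy (\<lambda>s. ?\<phi> w s - v w s)) + 2 * (LINT w|P. energy (\<lambda>s. v w s - u w s)))"
    using fin fin2 by simp
  also have "\<dots> \<le> ennreal e"
    using N0 K(2) unfolding N_def[symmetric] vu by (intro ennreal_leI) simp
  finally have main: "(\<integral>\<^sup>+w. ennreal (energy (\<lambda>r. ?\<phi> w r - u w r)) \<partial>P) \<le> ennreal e" .
  \<comment> \<open>The averaging window ends at \<open>k / N\<close>, where the drift still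
    vanishes.\<close>
  have zt: "z N k w = 0" if "k < N" "real k / N \<le> \<tau> w" for k w
  proof -
    have "(\<lambda>r. indicator ({(real k - 1) / N<..real k / N} \<inter> {0..1}) r *\<^sub>R v w r) = (\<lambda>r. 0)"
    proof
      fix r
      show "indicator ({(real k - 1) / N<..real k / N} \<inter> {0..1}) r *\<^sub>R v w r = 0"
        using after[of r w] that(2) by (auto simp: indicator_def v_def on_unit_def)
    qed
    then show ?thesis by (simp add: z_def lagged_average_def set_lebesgue_integral_def)
  qed
  show ?thesis
    by (rule that[OF si[OF N] time_grid_uniform[OF N] _ _ zt main]) (use N in auto)
qed

end

section \<open>The Ito integral of a square integrable drift\<close>

lemma energy_grid:
  assumes "time_grid N s" "s 0 = 0" "s N = 1"
  shows "energy (simple_drift N s y w) = (\<Sum>k<N. (s (Suc k) - s k) * (norm (y k w))\<^sup>2)"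
proof -
  have "energy (simple_drift N s y w) = (LINT r:{0..s N}|lborel. (norm (simple_drift N s y w r))\<^sup>2)"
    by (simp add: energy_def assms(3))
  also have "\<dots> = (\<Sum>k<N. LINT r:{s k<..s (Suc k)}|lborel. (norm (y k w))\<^sup>2)"
  proof (rule integral_cells[OF assms(1,2) order_refl])
    show "set_integrable lborel {s k<..s (Suc k)} (\<lambda>r. (norm (y k w))\<^sup>2)" if "k < N" for k
      using time_gridD(3)[OF assms(1) that] by (simp add: set_integrable_def emeasure_lborel_Ioc)
    show "(norm (simple_drift N s y w r))\<^sup>2 = (norm (y k w))\<^sup>2" if "k < N" "s k < r" "r \<le> s (Suc k)" for k r
      using simple_drift_at[OF assms(1) that, of y w] by simp
  qed simp
  also have "\<dots> = (\<Sum>k<N. (s (Suc k) - s k) * (norm (y k w))\<^sup>2)"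
    using time_gridD(3)[OF assms(1)] by (intro sum.cong) (auto simp: set_lebesgue_integral_def less_imp_le)
  finally show ?thesis .
qed

lemma simple_drift_diff:
  "simple_drift N s (\<lambda>k w. y k w - y' k w) w r = simple_drift N s y w r - simple_drift N s y' w r"
  unfolding simple_drift_def sum_subtractf[symmetric] by (intro sum.cong) auto

lemma simple_integral_diff:
  "simple_integral \<beta> N s (\<lambda>k w. y k w - y' k w) w = simple_integral \<beta> N s y w - simple_integral \<beta> N s y' w"
  unfolding simple_integral_def sum_subtractf[symmetric] by (intro sum.cong) (auto simp: inner_diff_left)

text \<open>Once a partial sum exceeds \<open>d\<close> it stays above \<open>d\<close>, as the
  terms are nonnegative, so the sum counts exactly the terms before that moment. The test includes
  the current term, hence there is no overshoot.\<close>

lemma sum_stopped_le: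
  fixes a :: "nat \<Rightarrow> real"
  assumes "\<And>k. 0 \<le> a k" "0 \<le> d"
  shows "(\<Sum>k<n. if (\<Sum>i\<le>k. a i) \<le> d then a k else 0) \<le> d"
proof -
  have "(\<Sum>k<n. if (\<Sum>i\<le>k. a i) \<le> d then a k else 0) \<le> d \<and>
        (\<Sum>k<n. if (\<Sum>i\<le>k. a i) \<le> d then a k else 0) \<le> (\<Sum>k<n. a k)"
  proof (induction n)
    case (Suc n)
    have "(\<Sum>i\<le>n. a i) = (\<Sum>i<n. a i) + a n" by (simp add: lessThan_Suc_atMost[symmetric])
    then show ?case using Suc assms(1)[of n] by auto
  qed (use assms in simp)
  then show ?thesis by simp
qed

context brownian_path_space
begin

lemma markov:
  assumes X: "X \<in> borel_measurable P" "\<And>w. 0 \<le> X w" and C: "(\<integral>\<^sup>+w. ennreal (X w) \<partial>P) \<le> ennreal C" "0 \<le> C" and d: "0 < d"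
  shows "prob {w \<in> space P. d \<le> X w} \<le> C / d"
proof -
  have i: "integrable P X"
    using X C by (intro integrableI_bounded) (auto intro: le_less_trans)
  have "ennreal (LINT w|P. X w) \<le> ennreal C"
    using nn_integral_eq_integral[OF i] X(2) C(1) by simp
  then have "(LINT w|P. X w) \<le> C" using C(2) by simp
  moreover have "prob {w \<in> space P. d \<le> X w} \<le> (LINT w|P. X w) / d"
    using X(2) d by (intro integral_Markov_inequality_measure[OF i sets.empty_sets]) auto
  ultimately show ?thesis using d by (meson divide_right_mono less_imp_le order_trans)
qed

text \<open>Both integrands are rewritten on a common refinement of their grids, where a difference
  is taken cell by cell.\<close>

lemma simple_difference:
  assumes s1: "simple_integrand \<nu> m t z" and s2: "simple_integrand \<nu> m' t' z'"
  obtains N s y where "simple_integrand \<nu> N s y" "time_grid N s" "s 0 = 0" "s N = 1"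
    "\<And>w. simple_integral \<beta> N s y w = simple_integral \<beta> m t z w - simple_integral \<beta> m' t' z' w"
    "\<And>w r. simple_drift N s y w r = simple_drift m t z w r - simple_drift m' t' z' w r"
proof -
  have "finite (t ` {..m} \<union> t' ` {..m'})" "t ` {..m} \<union> t' ` {..m'} \<subseteq> {0..1}"
    using simple_integrand_bounds[OF s1] simple_integrand_bounds[OF s2] by auto
  then obtain N s where g: "time_grid N s" "s 0 = 0" "s N = 1" "t ` {..m} \<union> t' ` {..m'} \<subseteq> s ` {..N}"
    by (rule ex_grid)
  then have sub: "t ` {..m} \<subseteq> s ` {..N}" "t' ` {..m'} \<subseteq> s ` {..N}" by auto
  define a b where "a = regrid m t z s" and "b = regrid m' t' z' s"
  have ab: "simple_integrand \<nu> N s a" "simple_integrand \<nu> N s b"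
    unfolding a_def b_def
    using simple_integrand_regrid[OF s1 g(1) sub(1) filtration_natural_filtration]
      simple_integrand_regrid[OF s2 g(1) sub(2) filtration_natural_filtration] by auto
  show ?thesis
  proof (rule that[of N s "\<lambda>k w. a k w - b k w"])
    show "simple_integrand \<nu> N s (\<lambda>k w. a k w - b k w)"
      unfolding simple_integrand_def
    proof (intro conjI allI impI)
      show "0 \<le> s 0" "s N \<le> 1" using g by auto
      show "s k \<le> s (Suc k)" if "k < N" for k using time_gridD(3)[OF g(1) that] by simp
      show "(\<lambda>w. a k w - b k w) \<in> borel_measurable (coord_filtration \<nu> (s k))" if "k < N" for k
        using simple_integrandD(1)[OF ab(1) that] simple_integrandD(1)[OF ab(2) that] by measurable
      show "bounded ((\<lambda>w. a k w - b k w) ` space \<nu>)" if k: "k < N" for k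
      proof -
        obtain A B where "\<forall>w\<in>space \<nu>. norm (a k w) \<le> A" "\<forall>w\<in>space \<nu>. norm (b k w) \<le> B"
          using simple_integrandD(2)[OF ab(1) k] simple_integrandD(2)[OF ab(2) k] by auto
        then have "\<forall>w\<in>space \<nu>. norm (a k w - b k w) \<le> A + B"
          by (meson add_mono norm_triangle_ineq4 order_trans)
        then show ?thesis by (auto simp: bounded_iff)
      qed
    qed
    show "simple_integral \<beta> N s (\<lambda>k w. a k w - b k w) w = simple_integral \<beta> m t z w - simple_integral \<beta> m' t' z' w" for w
      unfolding simple_integral_diff a_def b_def
      using simple_integral_regrid[OF s1 g(1) sub(1)] simple_integral_regrid[OF s2 g(1) sub(2)] by simp
    show "simple_drift N s (\<lambda>k w. a k w - b k w) w r = simple_drift m t z w r - simple_drift m' t' z' w r" for w r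
      unfolding simple_drift_diff a_def b_def
      using simple_drift_regrid[OF s1 g(1) sub(1) g(2,3)] simple_drift_regrid[OF s2 g(1) sub(2) g(2,3)] by simp
  qed (use g in auto)
qed

lemma measurable_simple_integral:
  assumes "simple_integrand \<nu> m t z"
  shows "simple_integral \<beta> m t z \<in> borel_measurable P"
  unfolding simple_integral_def
proof (intro borel_measurable_sum borel_measurable_inner borel_measurable_diff)
  fix k assume k: "k \<in> {..<m}"
  show "z k \<in> borel_measurable P" using simple_integrandD(1)[OF assms, of k] k by (auto intro: measurable_F_P)
  show "(\<lambda>w. \<beta> w (t (Suc k))) \<in> borel_measurable P" "(\<lambda>w. \<beta> w (t k)) \<in> borel_measurable P"
    using simple_integrand_bounds(1,2)[OF assms] k by (auto intro!: measurable_F_P[OF measurable_beta[OF _ order_refl]])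
qed

lemma simple_integral_L2_energy:
  assumes "simple_integrand \<nu> N s y" "time_grid N s" "s 0 = 0" "s N = 1"
  shows "(\<integral>\<^sup>+w. ennreal ((simple_integral \<beta> N s y w)\<^sup>2) \<partial>P) \<le> (\<integral>\<^sup>+w. ennreal (8 * energy (simple_drift N s y w)) \<partial>P)"
  unfolding energy_grid[OF assms(2-4)]
  by (rule simple_integral_second_moment[OF assms(2)]) (use simple_integrandD(1)[OF assms(1)] in auto)

text \<open>The integrand is stopped before its energy exceeds \<open>d\<close>. The stopped
  integral is controlled by Chebyshev's inequality, and nothing has changed on the event that the
  energy is at most \<open>d\<close>. Such a bound in probability is the right tool for
  \<open>has_ito_integral\<close>, which provides no moments.\<close>

lemma simple_integral_tail:
  assumes si: "simple_integrand \<nu> N s y" and g: "time_grid N s" "s 0 = 0" "s N = 1" and e: "0 < e" and d: "0 \<le> d"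
  shows "prob {w \<in> space P. e < \<bar>simple_integral \<beta> N s y w\<bar>}
     \<le> 8 * d / e\<^sup>2 + prob {w \<in> space P. d < energy (simple_drift N s y w)}"
proof -
  define a where "a k w = (s (Suc k) - s k) * (norm (y k w))\<^sup>2" for k w
  \<comment> \<open>The energy spent up to and including cell \<open>k\<close> is known at time
    \<open>s k\<close>, so the stopped values remain adapted.\<close>
  define y' where "y' k w = (if (\<Sum>i\<le>k. a i w) \<le> d then y k w else 0)" for k w
  have ym: "y i \<in> borel_measurable (F (s k))" if "i \<le> k" "k < N" for i k
    using that grid_mono[OF g(1), of i k] by (intro measurable_F_mono[OF _ simple_integrandD(1)[OF si]]) auto
  have y'm: "y' k \<in> borel_measurable (F (s k))" if "k < N" for k
  proof -
    have [measurable]: "(\<lambda>w. \<Sum>i\<le>k. a i w) \<in> borel_measurable (F (s k))"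
      unfolding a_def using ym[OF _ that]
      by (intro borel_measurable_sum borel_measurable_times borel_measurable_const borel_measurable_power borel_measurable_norm) auto
    have [measurable]: "y k \<in> borel_measurable (F (s k))" using ym[OF order_refl that] .
    show ?thesis unfolding y'_def[abs_def] by measurable
  qed
  \<comment> \<open>The terms are extended by 0 beyond the grid because
    \<open>sum_stopped_le\<close> asks for nonnegativity at every index.\<close>
  have "0 \<le> (if k < N then a k w else 0)" for k w using time_gridD(3)[OF g(1), of k] by (auto simp: a_def)
  then have st: "(\<Sum>k<N. if (\<Sum>i\<le>k. if i < N then a i w else 0) \<le> d then (if k < N then a k w else 0) else 0) \<le> d" for w
    using d by (intro sum_stopped_le) auto
  have e': "(\<Sum>k<N. (s (Suc k) - s k) * (norm (y' k w))\<^sup>2) \<le> d" for w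
  proof -
    have "(\<Sum>k<N. (s (Suc k) - s k) * (norm (y' k w))\<^sup>2)
        = (\<Sum>k<N. if (\<Sum>i\<le>k. if i < N then a i w else 0) \<le> d then (if k < N then a k w else 0) else 0)"
    proof (rule sum.cong[OF refl])
      fix k assume "k \<in> {..<N}"
      then have "(\<Sum>i\<le>k. if i < N then a i w else 0) = (\<Sum>i\<le>k. a i w)" by (intro sum.cong) auto
      then show "(s (Suc k) - s k) * (norm (y' k w))\<^sup>2 = (if (\<Sum>i\<le>k. if i < N then a i w else 0) \<le> d then (if k < N then a k w else 0) else 0)"
        using \<open>k \<in> {..<N}\<close> by (simp add: y'_def a_def)
    qed
    then show ?thesis using st[of w] by simp
  qed
  have eq: "simple_integral \<beta> N s y' w = simple_integral \<beta> N s y w" if "energy (simple_drift N s y w) \<le> d" for w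
    unfolding simple_integral_def
  proof (rule sum.cong[OF refl])
    fix k assume k: "k \<in> {..<N}"
    have "(\<Sum>i\<le>k. a i w) \<le> (\<Sum>i<N. a i w)"
      using k time_gridD(3)[OF g(1)] by (intro sum_mono2) (auto simp: a_def less_imp_le)
    also have "\<dots> \<le> d" using that unfolding energy_grid[OF g] a_def .
    finally show "y' k w \<bullet> (\<beta> w (s (Suc k)) - \<beta> w (s k)) = y k w \<bullet> (\<beta> w (s (Suc k)) - \<beta> w (s k))"
      by (simp add: y'_def)
  qed
  have "(\<integral>\<^sup>+w. ennreal ((simple_integral \<beta> N s y' w)\<^sup>2) \<partial>P)
      \<le> (\<integral>\<^sup>+w. ennreal (8 * (\<Sum>k<N. (s (Suc k) - s k) * (norm (y' k w))\<^sup>2)) \<partial>P)"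
    by (rule simple_integral_second_moment[OF g(1) y'm])
  also have "\<dots> \<le> (\<integral>\<^sup>+w. ennreal (8 * d) \<partial>P)"
    using e' by (intro nn_integral_mono ennreal_leI) simp
  finally have L2: "(\<integral>\<^sup>+w. ennreal ((simple_integral \<beta> N s y' w)\<^sup>2) \<partial>P) \<le> ennreal (8 * d)" by simp
  have Sm[measurable]: "simple_integral \<beta> N s y \<in> borel_measurable P" by (rule measurable_simple_integral[OF si])
  have S'm[measurable]: "simple_integral \<beta> N s y' \<in> borel_measurable P"
    unfolding simple_integral_def using grid_bounds[OF g(1)]
    by (intro borel_measurable_sum borel_measurable_inner borel_measurable_diff measurable_F_P[OF measurable_beta[OF _ order_refl]] measurable_F_P[OF y'm]) auto
  have Em[measurable]: "(\<lambda>w. energy (simple_drift N s y w)) \<in> borel_measurable P"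
    by (rule measurable_energy[OF joint_simple_integrand[OF si]])
  have "prob {w \<in> space P. e < \<bar>simple_integral \<beta> N s y w\<bar>}
     \<le> prob ({w \<in> space P. e\<^sup>2 \<le> (simple_integral \<beta> N s y' w)\<^sup>2} \<union> {w \<in> space P. d < energy (simple_drift N s y w)})"
  proof (rule finite_measure_mono)
    show "{w \<in> space P. e < \<bar>simple_integral \<beta> N s y w\<bar>}
     \<subseteq> {w \<in> space P. e\<^sup>2 \<le> (simple_integral \<beta> N s y' w)\<^sup>2} \<union> {w \<in> space P. d < energy (simple_drift N s y w)}"
    proof
      fix w assume w: "w \<in> {w \<in> space P. e < \<bar>simple_integral \<beta> N s y w\<bar>}"
      show "w \<in> {w \<in> space P. e\<^sup>2 \<le> (simple_integral \<beta> N s y' w)\<^sup>2} \<union> {w \<in> space P. d < energy (simple_drift N s y w)}"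
      proof (cases "energy (simple_drift N s y w) \<le> d")
        case True
        have "e\<^sup>2 \<le> \<bar>simple_integral \<beta> N s y' w\<bar>\<^sup>2"
          using w eq[OF True] e by (intro power_mono) auto
        then show ?thesis using w by simp
      qed (use w in auto)
    qed
  qed measurable
  also have "\<dots> \<le> prob {w \<in> space P. e\<^sup>2 \<le> (simple_integral \<beta> N s y' w)\<^sup>2} + prob {w \<in> space P. d < energy (simple_drift N s y w)}"
    by (intro measure_Un_le) measurable
  also have "prob {w \<in> space P. e\<^sup>2 \<le> (simple_integral \<beta> N s y' w)\<^sup>2} \<le> 8 * d / e\<^sup>2"
    using e d by (intro markov[OF _ _ L2]) auto
  finally show ?thesis by simp
qed

lemma L2_imp_in_prob:
  assumes m: "\<And>j. X j \<in> borel_measurable P" "Y \<in> borel_measurable P"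
    and L2: "\<And>j. (\<integral>\<^sup>+w. ennreal ((X j w - Y w)\<^sup>2) \<partial>P) \<le> ennreal (c j)" and c: "\<And>j. 0 \<le> c j" "c \<longlonglongrightarrow> 0"
  shows "tendsto_in_prob P X Y"
  unfolding tendsto_in_prob_def
proof (intro allI impI)
  fix e :: real assume e: "0 < e"
  note m[measurable]
  have le: "prob {w \<in> space P. e < \<bar>X j w - Y w\<bar>} \<le> c j / e\<^sup>2" for j
  proof -
    have "prob {w \<in> space P. e < \<bar>X j w - Y w\<bar>} \<le> prob {w \<in> space P. e\<^sup>2 \<le> (X j w - Y w)\<^sup>2}"
    proof (rule finite_measure_mono)
      have "e\<^sup>2 \<le> (X j w - Y w)\<^sup>2" if "e < \<bar>X j w - Y w\<bar>" for w
        using power_mono[of e "\<bar>X j w - Y w\<bar>" 2] that e by simp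
      then show "{w \<in> space P. e < \<bar>X j w - Y w\<bar>} \<subseteq> {w \<in> space P. e\<^sup>2 \<le> (X j w - Y w)\<^sup>2}" by auto
    qed measurable
    also have "\<dots> \<le> c j / e\<^sup>2" using e by (intro markov[OF _ _ L2 c(1)]) auto
    finally show ?thesis .
  qed
  have "(\<lambda>j. c j / e\<^sup>2) \<longlonglongrightarrow> 0" using tendsto_divide[OF c(2) tendsto_const[of "e\<^sup>2"]] e by simp
  then show "(\<lambda>j. prob {w \<in> space P. e < \<bar>X j w - Y w\<bar>}) \<longlonglongrightarrow> 0"
    by (rule tendsto_sandwich[OF always_eventually[OF allI[OF measure_nonneg]] always_eventually[OF allI[OF le]] tendsto_const])
qed

text \<open>Summable mean increments make the sum of the absolute increments finite almost
  everywhere.\<close>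

lemma nn_summable_imp_AE_convergent:
  assumes m: "\<And>j. X j \<in> borel_measurable P"
    and b: "\<And>j. (\<integral>\<^sup>+w. ennreal \<bar>X (Suc j) w - X j w\<bar> \<partial>P) \<le> ennreal (c j)" and c: "\<And>j. 0 \<le> c j" "summable c"
  shows "AE w in P. convergent (\<lambda>j. X j w :: real)"
proof -
  note m[measurable]
  have "(\<integral>\<^sup>+w. (\<Sum>j. ennreal \<bar>X (Suc j) w - X j w\<bar>) \<partial>P) = (\<Sum>j. \<integral>\<^sup>+w. ennreal \<bar>X (Suc j) w - X j w\<bar> \<partial>P)"
    by (rule nn_integral_suminf) measurable
  also have "\<dots> \<le> (\<Sum>j. ennreal (c j))" by (intro suminf_le b) auto
  also have "\<dots> < \<infinity>" using suminf_ennreal2[OF c] by (simp add: less_top)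
  finally have "AE w in P. (\<Sum>j. ennreal \<bar>X (Suc j) w - X j w\<bar>) \<noteq> \<infinity>"
    by (intro nn_integral_PInf_AE) (auto simp: less_top)
  then show ?thesis
  proof eventually_elim
    case (elim w)
    then have "summable (\<lambda>j. \<bar>X (Suc j) w - X j w\<bar>)"
      by (intro summable_suminf_not_top) auto
    then have "summable (\<lambda>j. X (Suc j) w - X j w)" by (rule summable_rabs_cancel)
    then have "convergent (\<lambda>n. \<Sum>j<n. X (Suc j) w - X j w)" by (simp add: summable_iff_convergent)
    then have "convergent (\<lambda>n. X n w - X 0 w)" by (simp only: sum_lessThan_telescope[of "\<lambda>j. X j w"])
    then show ?case using convergent_add[OF _ convergent_const[of "X 0 w"]] by fastforce
  qed
qed

lemma in_prob_unique:
  fixes I J :: "'n path \<Rightarrow> real"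
  assumes m: "I \<in> borel_measurable P" "J \<in> borel_measurable P"
    and z: "\<And>e d. 0 < e \<Longrightarrow> 0 < d \<Longrightarrow> prob {w \<in> space P. e < \<bar>I w - J w\<bar>} \<le> d"
  shows "AE w in P. I w = J w"
proof -
  note m[measurable]
  have "AE w in P. \<not> inverse (real (Suc n)) < \<bar>I w - J w\<bar>" for n
  proof -
    have "prob {w \<in> space P. inverse (real (Suc n)) < \<bar>I w - J w\<bar>} = 0"
    proof (rule antisym[OF field_le_epsilon measure_nonneg])
      fix d :: real assume "0 < d"
      then show "prob {w \<in> space P. inverse (real (Suc n)) < \<bar>I w - J w\<bar>} \<le> 0 + d"
        using z[of "inverse (real (Suc n))" d] by simp
    qed
    then have "emeasure P {w \<in> space P. inverse (real (Suc n)) < \<bar>I w - J w\<bar>} = 0"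
      by (simp only: emeasure_eq_measure ennreal_0)
    moreover have "{w \<in> space P. inverse (real (Suc n)) < \<bar>I w - J w\<bar>} \<in> sets P" by measurable
    ultimately have "{w \<in> space P. inverse (real (Suc n)) < \<bar>I w - J w\<bar>} \<in> null_sets P" by (rule null_setsI)
    from AE_not_in[OF this] show ?thesis using AE_space[of P] by eventually_elim simp
  qed
  then have "AE w in P. \<forall>n. \<not> inverse (real (Suc n)) < \<bar>I w - J w\<bar>" by (simp add: AE_all_countable)
  then show ?thesis
  proof eventually_elim
    case (elim w)
    show ?case
    proof (rule ccontr)
      assume "I w \<noteq> J w"
      then obtain n where "inverse (real (Suc n)) < \<bar>I w - J w\<bar>"
        using reals_Archimedean[of "\<bar>I w - J w\<bar>"] by auto
      then show False using elim by blast
    qed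
  qed
qed

text \<open>The choice in \<open>ito_integral\<close> may select the limit along any approximating
  sequence. The given sequence is first shown to converge to some \<open>I0\<close>, which proves
  existence; the chosen integral is then identified with \<open>I0\<close> through tail bounds for
  differences of simple integrals. The geometric rate turns convergence in the mean into convergence
  almost everywhere.\<close>

lemma ito_integral_limit:
  assumes v: "v \<in> L0_adapted \<nu>"
    and si: "\<And>j. simple_integrand \<nu> (N j) (s j) (z j)"
    and e: "\<And>j. (\<integral>\<^sup>+w. ennreal (energy (\<lambda>r. simple_drift (N j) (s j) (z j) w r - v w r)) \<partial>P) \<le> ennreal ((1/4)^j)"
  shows "ito_integral \<nu> \<beta> v \<in> borel_measurable P"
    and "AE w in P. (\<lambda>j. simple_integral \<beta> (N j) (s j) (z j) w) \<longlonglongrightarrow> ito_integral \<nu> \<beta> v w"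
    and "(\<integral>\<^sup>+w. ennreal ((simple_integral \<beta> (N j) (s j) (z j) w - ito_integral \<nu> \<beta> v w)\<^sup>2) \<partial>P) \<le> ennreal (32 * (1/4)^j)"
proof -
  define S where "S j = simple_integral \<beta> (N j) (s j) (z j)" for j
  define E where "E j w = energy (\<lambda>r. simple_drift (N j) (s j) (z j) w r - v w r)" for j w
  have Sm[measurable]: "S j \<in> borel_measurable P" for j unfolding S_def by (rule measurable_simple_integral[OF si])
  have Em[measurable]: "E j \<in> borel_measurable P" for j
    unfolding E_def[abs_def] by (rule measurable_energy_simple_diff[OF si v])
  have E0: "0 \<le> E j w" for j w by (simp add: E_def energy_nonneg)
  have E': "(\<integral>\<^sup>+w. ennreal (E j w) \<partial>P) \<le> ennreal ((1/4)^j)" for j using e by (simp add: E_def)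
  \<comment> \<open>The constant 32 comes from the factor 8 of the second moment bound, the factor 2
    of \<open>energy_diff_le\<close> and two energies whose means are at most
    \<open>(1/4)^j\<close>.\<close>
  have pair: "(\<integral>\<^sup>+w. ennreal ((S j w - S k w)\<^sup>2) \<partial>P) \<le> ennreal (32 * (1/4)^j)" if "j \<le> k" for j k
  proof -
    obtain M t y where y: "simple_integrand \<nu> M t y" "time_grid M t" "t 0 = 0" "t M = 1"
      and yS: "\<And>w. simple_integral \<beta> M t y w = S j w - S k w"
      and yd: "\<And>w r. simple_drift M t y w r = simple_drift (N j) (s j) (z j) w r - simple_drift (N k) (s k) (z k) w r"
      unfolding S_def by (rule simple_difference[OF si si, of j k]) blast
    have "AE w in P. 8 * energy (simple_drift M t y w) \<le> 16 * E j w + 16 * E k w"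
      using set_integrable_simple_diff[OF si v, of j] set_integrable_simple_diff[OF si v, of k]
    proof eventually_elim
      case (elim w)
      have "energy (simple_drift M t y w) = energy (\<lambda>r. simple_drift (N j) (s j) (z j) w r - simple_drift (N k) (s k) (z k) w r)"
        by (rule energy_cong) (simp add: yd)
      then show ?case using energy_diff_le[OF elim(1) elim(2)] by (simp add: E_def)
    qed
    then have "AE w in P. ennreal (8 * energy (simple_drift M t y w)) \<le> ennreal 16 * ennreal (E j w) + ennreal 16 * ennreal (E k w)"
    proof eventually_elim
      case (elim w)
      then have "ennreal (8 * energy (simple_drift M t y w)) \<le> ennreal (16 * E j w + 16 * E k w)" by (rule ennreal_leI)
      also have "\<dots> = ennreal 16 * ennreal (E j w) + ennreal 16 * ennreal (E k w)"
        using E0[of j w] E0[of k w] by (simp add: ennreal_mult)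
      finally show ?case .
    qed
    then have "(\<integral>\<^sup>+w. ennreal (8 * energy (simple_drift M t y w)) \<partial>P) \<le> (\<integral>\<^sup>+w. ennreal 16 * ennreal (E j w) + ennreal 16 * ennreal (E k w) \<partial>P)"
      by (rule nn_integral_mono_AE)
    also have "\<dots> = ennreal 16 * (\<integral>\<^sup>+w. ennreal (E j w) \<partial>P) + ennreal 16 * (\<integral>\<^sup>+w. ennreal (E k w) \<partial>P)"
      by (subst nn_integral_add, measurable, subst (1 2) nn_integral_cmult) auto
    also have "\<dots> \<le> ennreal 16 * ennreal ((1/4)^j) + ennreal 16 * ennreal ((1/4)^k)"
      by (intro add_mono mult_left_mono E') auto
    also have "\<dots> = ennreal (16 * (1/4)^j + 16 * (1/4)^k)"
      by (simp add: ennreal_mult)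
    also have "\<dots> \<le> ennreal (32 * (1/4)^j)"
      using power_decreasing[OF that, of "1/4 :: real"] by (intro ennreal_leI) simp
    finally show ?thesis using simple_integral_L2_energy[OF y] unfolding yS by (rule order_trans[rotated])
  qed
  have "AE w in P. convergent (\<lambda>j. S j w)"
  proof (rule nn_summable_imp_AE_convergent[OF Sm])
    show "(\<integral>\<^sup>+w. ennreal \<bar>S (Suc j) w - S j w\<bar> \<partial>P) \<le> ennreal (33 * (1/2)^j)" for j
    proof -
      \<comment> \<open>Arithmetic-geometric mean with weight \<open>2^j\<close>: the squared part
        contributes at most \<open>2^j * (32 * (1/4)^j)\<close>, which is of the same order
        \<open>(1/2)^j\<close> as the constant part, so the bounds are summable.\<close>
      have "\<bar>x\<bar> \<le> (1/2)^j + 2^j * x\<^sup>2" for x :: real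
      proof -
        have p: "(2::real)^j * (1/2)^j = 1" by (simp add: power_mult_distrib[symmetric])
        have "0 \<le> 2^j * (\<bar>x\<bar> - (1/2)^j)\<^sup>2" by simp
        also have "\<dots> = 2^j * x\<^sup>2 - 2 * (2^j * (1/2)^j) * \<bar>x\<bar> + (2^j * (1/2)^j) * (1/2)^j"
          by (simp add: power2_eq_square algebra_simps)
        finally show ?thesis unfolding p by simp
      qed
      then have "\<bar>S (Suc j) w - S j w\<bar> \<le> (1/2)^j + 2^j * (S j w - S (Suc j) w)\<^sup>2" for w
        by (metis power2_commute)
      then have "(\<integral>\<^sup>+w. ennreal \<bar>S (Suc j) w - S j w\<bar> \<partial>P) \<le> (\<integral>\<^sup>+w. ennreal ((1/2)^j) + ennreal (2^j) * ennreal ((S j w - S (Suc j) w)\<^sup>2) \<partial>P)"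
        by (intro nn_integral_mono) (simp add: ennreal_mult[symmetric] ennreal_plus[symmetric] ennreal_leI del: ennreal_plus)
      also have "\<dots> = ennreal ((1/2)^j) + ennreal (2^j) * (\<integral>\<^sup>+w. ennreal ((S j w - S (Suc j) w)\<^sup>2) \<partial>P)"
        by (subst nn_integral_add, measurable, subst nn_integral_cmult) auto
      also have "\<dots> \<le> ennreal ((1/2)^j) + ennreal (2^j) * ennreal (32 * (1/4)^j)"
        by (intro add_mono mult_left_mono pair) auto
      also have "\<dots> = ennreal ((1/2)^j + 2^j * (32 * (1/4)^j))"
        by (simp add: ennreal_mult[symmetric] ennreal_plus[symmetric] del: ennreal_plus)
      also have "(1/2)^j + 2^j * (32 * (1/4)^j) = (33 * (1/2)^j :: real)"
      proof -
        have "(2::real)^j * (1/4)^j = (1/2)^j" by (simp add: power_mult_distrib[symmetric])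
        then show ?thesis by simp
      qed
      finally show ?thesis .
    qed
    show "summable (\<lambda>j. 33 * (1/2)^j :: real)" by (intro summable_mult summable_geometric) simp
  qed auto
  define I0 where "I0 w = lim (\<lambda>j. S j w)" for w
  have I0m[measurable]: "I0 \<in> borel_measurable P" unfolding I0_def[abs_def] by measurable
  have SI0: "AE w in P. (\<lambda>j. S j w) \<longlonglongrightarrow> I0 w"
    using \<open>AE w in P. convergent (\<lambda>j. S j w)\<close> by eventually_elim (simp add: I0_def convergent_LIMSEQ_iff)
  \<comment> \<open>Fatou's lemma in the second index of \<open>pair\<close>.\<close>
  have L2: "(\<integral>\<^sup>+w. ennreal ((S j w - I0 w)\<^sup>2) \<partial>P) \<le> ennreal (32 * (1/4)^j)" for j
  proof -
    have "(\<integral>\<^sup>+w. ennreal ((S j w - I0 w)\<^sup>2) \<partial>P) = (\<integral>\<^sup>+w. liminf (\<lambda>k. ennreal ((S j w - S k w)\<^sup>2)) \<partial>P)"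
    proof (rule nn_integral_cong_AE)
      show "AE w in P. ennreal ((S j w - I0 w)\<^sup>2) = liminf (\<lambda>k. ennreal ((S j w - S k w)\<^sup>2))"
        using SI0
      proof eventually_elim
        case (elim w)
        then have "(\<lambda>k. ennreal ((S j w - S k w)\<^sup>2)) \<longlonglongrightarrow> ennreal ((S j w - I0 w)\<^sup>2)"
          by (intro tendsto_intros)
        then show ?case by (rule lim_imp_Liminf[OF trivial_limit_sequentially, symmetric])
      qed
    qed
    also have "\<dots> \<le> liminf (\<lambda>k. \<integral>\<^sup>+w. ennreal ((S j w - S k w)\<^sup>2) \<partial>P)"
      by (rule nn_integral_liminf) measurable
    also have "\<dots> \<le> ennreal (32 * (1/4)^j)"
      by (intro Liminf_le trivial_limit_sequentially eventually_mono[OF eventually_ge_at_top[of j]] pair)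
    finally show ?thesis .
  qed
  have q: "(\<lambda>j. c * (1/4)^j) \<longlonglongrightarrow> (0::real)" for c
    using tendsto_mult_right_zero[OF LIMSEQ_power_zero[of "1/4::real"], of c] by simp
  have SP: "tendsto_in_prob P S I0"
    by (rule L2_imp_in_prob[OF Sm I0m L2 _ q]) simp
  have EP: "(\<lambda>j. prob {w \<in> space P. d < E j w}) \<longlonglongrightarrow> 0" if d: "0 < d" for d
  proof -
    have le: "prob {w \<in> space P. d < E j w} \<le> (1 / d) * (1/4)^j" for j
    proof -
      have "prob {w \<in> space P. d < E j w} \<le> prob {w \<in> space P. d \<le> E j w}"
      proof (rule finite_measure_mono)
        show "{w \<in> space P. d \<le> E j w} \<in> sets P" by measurable
      qed auto
      also have "\<dots> \<le> (1/4)^j / d" using d by (intro markov[OF Em E0 E']) auto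
      finally show ?thesis by simp
    qed
    show ?thesis
      by (rule tendsto_sandwich[OF always_eventually[OF allI[OF measure_nonneg]] always_eventually[OF allI[OF le]] tendsto_const q])
  qed
  have "has_ito_integral \<nu> \<beta> v I0"
    unfolding has_ito_integral_def
  proof (intro conjI exI[of _ N] exI[of _ s] exI[of _ z] allI si I0m)
    show "tendsto_in_prob P (\<lambda>j. simple_integral \<beta> (N j) (s j) (z j)) I0" using SP by (simp add: S_def[abs_def])
    show "tendsto_in_prob P (\<lambda>j w. LINT r:{0..1}|lborel. (norm (simple_drift (N j) (s j) (z j) w r - v w r))\<^sup>2) (\<lambda>_. 0)"
      unfolding energy_def[symmetric] E_def[symmetric] tendsto_in_prob_def using EP by (simp add: E0 abs_of_nonneg)
  qed
  then have "has_ito_integral \<nu> \<beta> v (ito_integral \<nu> \<beta> v)"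
    unfolding ito_integral_def by (rule someI[where P="has_ito_integral \<nu> \<beta> v"])
  then obtain m' t' z' where
    Im: "ito_integral \<nu> \<beta> v \<in> borel_measurable P" and si': "\<And>j. simple_integrand \<nu> (m' j) (t' j) (z' j)"
    and E'P: "tendsto_in_prob P (\<lambda>j w. energy (\<lambda>r. simple_drift (m' j) (t' j) (z' j) w r - v w r)) (\<lambda>_. 0)"
    and S'P: "tendsto_in_prob P (\<lambda>j. simple_integral \<beta> (m' j) (t' j) (z' j)) (ito_integral \<nu> \<beta> v)"
    unfolding has_ito_integral_def energy_def by auto
  define I where "I = ito_integral \<nu> \<beta> v"
  define S' where "S' j = simple_integral \<beta> (m' j) (t' j) (z' j)" for j
  define E2 where "E2 j w = energy (\<lambda>r. simple_drift (m' j) (t' j) (z' j) w r - v w r)" for j w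
  have [measurable]: "I \<in> borel_measurable P" using Im by (simp add: I_def)
  have [measurable]: "S' j \<in> borel_measurable P" for j unfolding S'_def by (rule measurable_simple_integral[OF si'])
  have [measurable]: "E2 j \<in> borel_measurable P" for j
    unfolding E2_def[abs_def] by (rule measurable_energy_simple_diff[OF si' v])
  have "AE w in P. I w = I0 w"
  proof (rule in_prob_unique)
    fix e d :: real assume ed: "0 < e" "0 < d"
    \<comment> \<open>Three distances of at most \<open>e / 4\<close> cannot add up to more than
      \<open>e\<close>; \<open>c\<close> is chosen so that the stopped part of
      \<open>simple_integral_tail\<close> contributes \<open>d / 2\<close>.\<close>
    define a where "a = e / 4"
    define c where "c = d * a\<^sup>2 / 16"
    have ac: "0 < a" "0 < c" "8 * c / a\<^sup>2 = d / 2" using ed by (auto simp: a_def c_def field_simps)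
    have step: "prob {w \<in> space P. e < \<bar>I w - I0 w\<bar>}
      \<le> prob {w \<in> space P. a < \<bar>S' j w - I w\<bar>} + prob {w \<in> space P. a < \<bar>S j w - I0 w\<bar>}
        + (8 * c / a\<^sup>2 + (prob {w \<in> space P. c / 4 < E2 j w} + prob {w \<in> space P. c / 4 < E j w}))" for j
    proof -
      obtain M t y where y: "simple_integrand \<nu> M t y" "time_grid M t" "t 0 = 0" "t M = 1"
        and yS: "\<And>w. simple_integral \<beta> M t y w = S' j w - S j w"
        and yd: "\<And>w r. simple_drift M t y w r = simple_drift (m' j) (t' j) (z' j) w r - simple_drift (N j) (s j) (z j) w r"
        unfolding S_def S'_def by (rule simple_difference[OF si' si, of j j]) blast
      have [measurable]: "(\<lambda>w. energy (simple_drift M t y w)) \<in> borel_measurable P"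
        by (rule measurable_energy[OF joint_simple_integrand[OF y(1)]])
      have "prob {w \<in> space P. c < energy (simple_drift M t y w)}
          \<le> prob ({w \<in> space P. c / 4 < E2 j w} \<union> {w \<in> space P. c / 4 < E j w})"
      proof (rule finite_measure_mono_AE)
        show "AE w in P. w \<in> {w \<in> space P. c < energy (simple_drift M t y w)}
            \<longrightarrow> w \<in> {w \<in> space P. c / 4 < E2 j w} \<union> {w \<in> space P. c / 4 < E j w}"
          using set_integrable_simple_diff[OF si' v, of j] set_integrable_simple_diff[OF si v, of j]
        proof eventually_elim
          case (elim w)
          have "energy (simple_drift M t y w) = energy (\<lambda>r. simple_drift (m' j) (t' j) (z' j) w r - simple_drift (N j) (s j) (z j) w r)"
            by (rule energy_cong) (simp add: yd)
          then have "energy (simple_drift M t y w) \<le> 2 * E2 j w + 2 * E j w"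
            using energy_diff_le[OF elim(1) elim(2)] by (simp add: E_def E2_def)
          then show ?case by auto
        qed
      qed measurable
      also have "\<dots> \<le> prob {w \<in> space P. c / 4 < E2 j w} + prob {w \<in> space P. c / 4 < E j w}"
        by (intro measure_Un_le) measurable
      finally have t1: "prob {w \<in> space P. a < \<bar>S' j w - S j w\<bar>}
          \<le> 8 * c / a\<^sup>2 + (prob {w \<in> space P. c / 4 < E2 j w} + prob {w \<in> space P. c / 4 < E j w})"
        using simple_integral_tail[OF y ac(1) less_imp_le[OF ac(2)]] unfolding yS by linarith
      have "prob {w \<in> space P. e < \<bar>I w - I0 w\<bar>}
        \<le> prob (({w \<in> space P. a < \<bar>S' j w - I w\<bar>} \<union> {w \<in> space P. a < \<bar>S j w - I0 w\<bar>}) \<union> {w \<in> space P. a < \<bar>S' j w - S j w\<bar>})"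
      proof (rule finite_measure_mono)
        show "{w \<in> space P. e < \<bar>I w - I0 w\<bar>} \<subseteq> ({w \<in> space P. a < \<bar>S' j w - I w\<bar>} \<union> {w \<in> space P. a < \<bar>S j w - I0 w\<bar>}) \<union> {w \<in> space P. a < \<bar>S' j w - S j w\<bar>}"
        proof
          fix w assume w: "w \<in> {w \<in> space P. e < \<bar>I w - I0 w\<bar>}"
          have "\<bar>I w - I0 w\<bar> \<le> \<bar>S' j w - I w\<bar> + \<bar>S' j w - S j w\<bar> + \<bar>S j w - I0 w\<bar>" by linarith
          then have "a < \<bar>S' j w - I w\<bar> \<or> a < \<bar>S' j w - S j w\<bar> \<or> a < \<bar>S j w - I0 w\<bar>"
            using w ed unfolding a_def mem_Collect_eq by linarith
          then show "w \<in> ({w \<in> space P. a < \<bar>S' j w - I w\<bar>} \<union> {w \<in> space P. a < \<bar>S j w - I0 w\<bar>}) \<union> {w \<in> space P. a < \<bar>S' j w - S j w\<bar>}"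
            using w by blast
        qed
      qed measurable
      also have "\<dots> \<le> prob {w \<in> space P. a < \<bar>S' j w - I w\<bar>} + prob {w \<in> space P. a < \<bar>S j w - I0 w\<bar>} + prob {w \<in> space P. a < \<bar>S' j w - S j w\<bar>}"
        by (intro order_trans[OF measure_Un_le] add_mono order_refl) measurable
      finally show ?thesis using t1 by linarith
    qed
    have "(\<lambda>j. prob {w \<in> space P. a < \<bar>S' j w - I w\<bar>} + prob {w \<in> space P. a < \<bar>S j w - I0 w\<bar>}
        + (8 * c / a\<^sup>2 + (prob {w \<in> space P. c / 4 < E2 j w} + prob {w \<in> space P. c / 4 < E j w})))
        \<longlonglongrightarrow> 0 + 0 + (8 * c / a\<^sup>2 + (0 + 0))"
    proof (intro tendsto_add tendsto_const)
      show "(\<lambda>j. prob {w \<in> space P. a < \<bar>S' j w - I w\<bar>}) \<longlonglongrightarrow> 0"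
        using S'P ac(1) unfolding tendsto_in_prob_def S'_def I_def by simp
      show "(\<lambda>j. prob {w \<in> space P. a < \<bar>S j w - I0 w\<bar>}) \<longlonglongrightarrow> 0"
        using SP ac(1) unfolding tendsto_in_prob_def by simp
      show "(\<lambda>j. prob {w \<in> space P. c / 4 < E2 j w}) \<longlonglongrightarrow> 0"
      proof -
        have "\<forall>d>0. (\<lambda>j. prob {w \<in> space P. d < E2 j w}) \<longlonglongrightarrow> 0"
          using E'P unfolding tendsto_in_prob_def E2_def by (simp add: energy_nonneg abs_of_nonneg)
        then show ?thesis using ac(2) by (elim allE[of _ "c / 4"]) simp
      qed
      show "(\<lambda>j. prob {w \<in> space P. c / 4 < E j w}) \<longlonglongrightarrow> 0" using EP[of "c / 4"] ac(2) by simp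
    qed
    then have "prob {w \<in> space P. e < \<bar>I w - I0 w\<bar>} \<le> 0 + 0 + (8 * c / a\<^sup>2 + (0 + 0))"
      by (rule LIMSEQ_le_const) (use step in auto)
    then show "prob {w \<in> space P. e < \<bar>I w - I0 w\<bar>} \<le> d" using ac(3) ed by simp
  qed measurable
  note II0 = this[unfolded I_def]
  show "ito_integral \<nu> \<beta> v \<in> borel_measurable P" by (rule Im)
  show "AE w in P. (\<lambda>j. simple_integral \<beta> (N j) (s j) (z j) w) \<longlonglongrightarrow> ito_integral \<nu> \<beta> v w"
    using SI0 II0 unfolding S_def by eventually_elim simp
  have "(\<integral>\<^sup>+w. ennreal ((S j w - ito_integral \<nu> \<beta> v w)\<^sup>2) \<partial>P) = (\<integral>\<^sup>+w. ennreal ((S j w - I0 w)\<^sup>2) \<partial>P)"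
    using II0 by (intro nn_integral_cong_AE) auto
  then show "(\<integral>\<^sup>+w. ennreal ((simple_integral \<beta> (N j) (s j) (z j) w - ito_integral \<nu> \<beta> v w)\<^sup>2) \<partial>P) \<le> ennreal (32 * (1/4)^j)"
    using L2[of j] by (simp add: S_def)
qed

end

section \<open>Convergence of energies and primitives\<close>

text \<open>Young's inequality with a free parameter \<open>d\<close>, in the form required by
  \<open>tendsto_of_bounds\<close>.\<close>

lemma energy_diff_abs_le:
  fixes f g :: "real \<Rightarrow> 'a::euclidean_space"
  assumes f: "set_integrable lborel {0..1} (\<lambda>s. (norm (f s))\<^sup>2)"
    and g: "set_integrable lborel {0..1} (\<lambda>s. (norm (g s))\<^sup>2)"
    and fg: "set_integrable lborel {0..1} (\<lambda>s. (norm (f s - g s))\<^sup>2)" and d: "0 < d"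
  shows "\<bar>energy f - energy g\<bar> \<le> (1 + 1 / d) * energy (\<lambda>s. f s - g s) + d * energy g"
proof -
  have p: "\<bar>(norm (f s))\<^sup>2 - (norm (g s))\<^sup>2\<bar> \<le> (1 + 1 / d) * (norm (f s - g s))\<^sup>2 + d * (norm (g s))\<^sup>2" for s
  proof -
    let ?a = "f s - g s"
    have "(norm (f s))\<^sup>2 - (norm (g s))\<^sup>2 = (norm ?a)\<^sup>2 + 2 * (?a \<bullet> g s)"
      by (simp add: power2_norm_eq_inner inner_diff_left inner_diff_right inner_commute)
    moreover have "\<bar>?a \<bullet> g s\<bar> \<le> norm ?a * norm (g s)" by (rule Cauchy_Schwarz_ineq2)
    moreover have "2 * (norm ?a * norm (g s)) \<le> (norm ?a)\<^sup>2 / d + d * (norm (g s))\<^sup>2"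
    proof -
      have "0 \<le> (norm ?a - d * norm (g s))\<^sup>2 / d" using d by simp
      also have "\<dots> = (norm ?a)\<^sup>2 / d + d * (norm (g s))\<^sup>2 - 2 * (norm ?a * norm (g s))"
        using d by (simp add: power2_eq_square field_simps)
      finally show ?thesis by simp
    qed
    moreover have "(1 + 1 / d) * (norm ?a)\<^sup>2 = (norm ?a)\<^sup>2 + (norm ?a)\<^sup>2 / d" by (simp add: distrib_right)
    ultimately show ?thesis using zero_le_power2[of "norm ?a"] by linarith
  qed
  let ?I = "indicator {0..1} :: real \<Rightarrow> real"
  have i: "integrable lborel (\<lambda>s. ?I s * (norm (f s))\<^sup>2)" "integrable lborel (\<lambda>s. ?I s * (norm (g s))\<^sup>2)"
    "integrable lborel (\<lambda>s. ?I s * (norm (f s - g s))\<^sup>2)"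
    using f g fg by (simp_all add: set_integrable_def)
  have "\<bar>energy f - energy g\<bar> = \<bar>LINT s|lborel. ?I s * (norm (f s))\<^sup>2 - ?I s * (norm (g s))\<^sup>2\<bar>"
    using i by (simp add: energy_def set_lebesgue_integral_def)
  also have "\<dots> \<le> (LINT s|lborel. \<bar>?I s * (norm (f s))\<^sup>2 - ?I s * (norm (g s))\<^sup>2\<bar>)"
    by (rule integral_abs_bound)
  also have "\<dots> \<le> (LINT s|lborel. (1 + 1 / d) * (?I s * (norm (f s - g s))\<^sup>2) + d * (?I s * (norm (g s))\<^sup>2))"
  proof (rule integral_mono)
    show "\<bar>?I s * (norm (f s))\<^sup>2 - ?I s * (norm (g s))\<^sup>2\<bar>
        \<le> (1 + 1 / d) * (?I s * (norm (f s - g s))\<^sup>2) + d * (?I s * (norm (g s))\<^sup>2)" for s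
      using p[of s] by (cases "s \<in> {0..1}") auto
  qed (use i in auto)
  also have "\<dots> = (1 + 1 / d) * energy (\<lambda>s. f s - g s) + d * energy g"
    using i by (simp add: energy_def set_lebesgue_integral_def)
  finally show ?thesis .
qed

lemma set_integrable_of_square:
  fixes h :: "real \<Rightarrow> 'a::euclidean_space"
  assumes m: "(\<lambda>s. indicator {0..1} s *\<^sub>R h s) \<in> borel_measurable borel"
    and i: "set_integrable lborel {0..1} (\<lambda>s. (norm (h s))\<^sup>2)"
  shows "set_integrable lborel {0..1} h"
  unfolding set_integrable_def
proof (rule Bochner_Integration.integrable_bound)
  show "integrable lborel (\<lambda>s. indicator {0..1} s + indicator {0..1} s * (norm (h s))\<^sup>2 :: real)"
    using i by (simp add: set_integrable_def)
  show "(\<lambda>s. indicator {0..1} s *\<^sub>R h s) \<in> borel_measurable lborel" using m by simp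
  have "a \<le> 1 + a\<^sup>2" for a :: real
    using zero_le_power2[of "a - 1/2"] by (simp add: power2_eq_square algebra_simps)
  then show "AE s in lborel. norm (indicator {0..1} s *\<^sub>R h s) \<le> norm (indicator {0..1} s + indicator {0..1} s * (norm (h s))\<^sup>2 :: real)"
    by (auto simp: indicator_def)
qed

text \<open>The Cauchy-Schwarz bound in additive form, from \<open>a \<le> c + a^2 / c\<close>; it
  avoids square roots and leaves \<open>c\<close> free for \<open>tendsto_of_bounds\<close>.\<close>

lemma cm_path_diff_le:
  fixes f g :: "real \<Rightarrow> (real, 'n::finite) vec"
  assumes fm: "(\<lambda>s. indicator {0..1} s *\<^sub>R f s) \<in> borel_measurable borel"
    and gm: "(\<lambda>s. indicator {0..1} s *\<^sub>R g s) \<in> borel_measurable borel"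
    and f: "set_integrable lborel {0..1} (\<lambda>s. (norm (f s))\<^sup>2)"
    and g: "set_integrable lborel {0..1} (\<lambda>s. (norm (g s))\<^sup>2)"
    and fg: "set_integrable lborel {0..1} (\<lambda>s. (norm (f s - g s))\<^sup>2)" and c: "0 < c" and t: "0 \<le> t" "t \<le> 1"
  shows "norm (cm_path f t - cm_path g t) \<le> c + energy (\<lambda>s. f s - g s) / c"
proof -
  let ?I = "indicator {0..1} :: real \<Rightarrow> real"
  have fi: "set_integrable lborel {0..1} f" and gi: "set_integrable lborel {0..1} g"
    using set_integrable_of_square[OF fm f] set_integrable_of_square[OF gm g] .
  have sub: "{0..t} \<subseteq> {0..1}" using t by auto
  have ft: "set_integrable lborel {0..t} f" and gt: "set_integrable lborel {0..t} g"
    using set_integrable_subset[OF fi _ sub] set_integrable_subset[OF gi _ sub] by auto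
  have di: "set_integrable lborel {0..1} (\<lambda>s. f s - g s)" using fi gi by (rule set_integral_diff)
  have dt: "set_integrable lborel {0..t} (\<lambda>s. f s - g s)" using ft gt by (rule set_integral_diff)
  have "norm (cm_path f t - cm_path g t) = norm (LINT s:{0..t}|lborel. f s - g s)"
    unfolding cm_path_def using set_integral_diff(2)[OF ft gt] by simp
  also have "\<dots> \<le> (LINT s:{0..t}|lborel. norm (f s - g s))"
    by (rule set_integral_norm_bound[OF dt])
  also have "\<dots> \<le> (LINT s|lborel. ?I s * c + ?I s * (norm (f s - g s))\<^sup>2 / c)"
    unfolding set_lebesgue_integral_def
  proof (rule integral_mono)
    show "integrable lborel (\<lambda>s. indicator {0..t} s *\<^sub>R norm (f s - g s))"
      using set_integrable_norm[OF dt] by (simp add: set_integrable_def)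
    show "integrable lborel (\<lambda>s. ?I s * c + ?I s * (norm (f s - g s))\<^sup>2 / c)"
      using fg by (simp add: set_integrable_def)
    have a: "a \<le> c + a\<^sup>2 / c" for a :: real
    proof -
      have "0 \<le> ((a - c / 2)\<^sup>2 + 3 * c\<^sup>2 / 4) / c" using c by simp
      also have "\<dots> = c + a\<^sup>2 / c - a" using c by (simp add: power2_eq_square field_simps)
      finally show ?thesis by simp
    qed
    show "indicator {0..t} s *\<^sub>R norm (f s - g s) \<le> ?I s * c + ?I s * (norm (f s - g s))\<^sup>2 / c" for s
      using a[of "norm (f s - g s)"] t c by (auto simp: indicator_def)
  qed
  also have "\<dots> = c + energy (\<lambda>s. f s - g s) / c"
    using fg by (simp add: set_integrable_def energy_def set_lebesgue_integral_def)
  finally show ?thesis .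
qed

text \<open>First \<open>c\<close> is made small, then \<open>j\<close> large; the factor
  \<open>K c\<close> may blow up as \<open>c\<close> tends to 0.\<close>

lemma tendsto_of_bounds:
  fixes e :: "nat \<Rightarrow> real" and x :: "nat \<Rightarrow> 'a::real_normed_vector"
  assumes e: "e \<longlonglongrightarrow> 0" and b: "\<And>j c. 0 < c \<Longrightarrow> norm (x j - l) \<le> C * c + K c * e j" and C: "0 \<le> C"
  shows "x \<longlonglongrightarrow> l"
proof (rule LIMSEQ_I)
  fix r :: real assume r: "0 < r"
  define c where "c = r / (2 * (C + 1))"
  have c: "0 < c" "C * c < r / 2 + r / 4"
  proof -
    show "0 < c" using r C by (simp add: c_def)
    have "C * c \<le> r / 2" using r C by (simp add: c_def field_simps)
    then show "C * c < r / 2 + r / 4" using r by linarith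
  qed
  have "(\<lambda>j. K c * e j) \<longlonglongrightarrow> 0" using tendsto_mult_right_zero[OF e] by simp
  then have "\<forall>\<^sub>F j in sequentially. K c * e j < r / 4"
    using r order_tendstoD(2)[of _ 0 sequentially "r / 4"] by simp
  then obtain no where no: "\<And>n. no \<le> n \<Longrightarrow> K c * e n < r / 4" by (auto simp: eventually_sequentially)
  have "norm (x n - l) < r" if "no \<le> n" for n
    using b[OF c(1), of n] c(2) no[OF that] by linarith
  then show "\<exists>no. \<forall>n\<ge>no. norm (x n - l) < r" by blast
qed

context brownian_path_space
begin

lemma AE_tendsto_zero:
  assumes m: "\<And>j. X j \<in> borel_measurable P" "\<And>j w. 0 \<le> X j w"
    and b: "\<And>j. (\<integral>\<^sup>+w. ennreal (X j w) \<partial>P) \<le> ennreal (c j)" and c: "\<And>j. 0 \<le> c j" "summable c"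
  shows "AE w in P. (\<lambda>j. X j w :: real) \<longlonglongrightarrow> 0"
proof -
  note m[measurable]
  have "(\<integral>\<^sup>+w. (\<Sum>j. ennreal (X j w)) \<partial>P) = (\<Sum>j. \<integral>\<^sup>+w. ennreal (X j w) \<partial>P)"
    by (rule nn_integral_suminf) measurable
  also have "\<dots> \<le> (\<Sum>j. ennreal (c j))" by (intro suminf_le b) auto
  also have "\<dots> < \<infinity>" using suminf_ennreal2[OF c] by (simp add: less_top)
  finally have "AE w in P. (\<Sum>j. ennreal (X j w)) \<noteq> \<infinity>"
    by (intro nn_integral_PInf_AE) (auto simp: less_top)
  then show ?thesis
  proof eventually_elim
    case (elim w)
    then have "summable (\<lambda>j. X j w)" using m(2) by (intro summable_suminf_not_top) auto
    then show ?case by (rule summable_LIMSEQ_zero)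
  qed
qed

lemma drift_eq_AE:
  assumes "drift_eq \<nu> u v'"
  shows "AE w in P. AE s in lborel. s \<in> {0..1} \<longrightarrow> u w s = v' w s"
proof -
  interpret T: sigma_finite_measure unit_time
    by (rule sigma_finite_measure_restrict_space[OF sigma_finite_lborel]) simp
  interpret L: pair_sigma_finite P unit_time ..
  have "AE x in P \<Otimes>\<^sub>M unit_time. u (fst x) (snd x) = v' (fst x) (snd x)"
    using assms by (simp add: drift_eq_def case_prod_unfold)
  from L.AE_pair[OF this] show ?thesis by (simp add: AE_restrict_space_iff)
qed

lemma energy_cong_AE:
  assumes "AE s in lborel. s \<in> {0..1} \<longrightarrow> f s = g s"
    and "(\<lambda>s. indicator {0..1} s * (norm (f s))\<^sup>2) \<in> borel_measurable borel" "(\<lambda>s. indicator {0..1} s * (norm (g s))\<^sup>2) \<in> borel_measurable borel"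
  shows "energy f = energy g"
  unfolding energy_def set_lebesgue_integral_def
  using assms by (intro integral_cong_AE) (auto elim!: eventually_mono simp: indicator_def)

lemma drift_section_measurable:
  assumes "u \<in> L0_adapted \<nu>" "w \<in> space \<nu>"
  shows "(\<lambda>s. indicator {0..1} s *\<^sub>R u w s) \<in> borel_measurable borel"
proof -
  have "(\<lambda>s. indicator {0..1} s *\<^sub>R u w s) = on_unit u w"
    by (rule ext) (simp add: on_unit_def indicator_def)
  then show ?thesis using measurable_drift_section[OF assms] by simp
qed

lemma energy_drift_cong:
  assumes u: "u \<in> L0_adapted \<nu>" and v': "v' \<in> L0_adapted \<nu>" and eq: "drift_eq \<nu> u v'"
    and g: "\<And>w. g w \<in> borel_measurable borel"
  shows "AE w in P. energy (\<lambda>s. g w s - u w s) = energy (\<lambda>s. g w s - v' w s)"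
  using drift_eq_AE[OF eq] AE_space[of P]
proof eventually_elim
  case (elim w)
  have [measurable]: "on_unit u w \<in> borel_measurable borel" "on_unit v' w \<in> borel_measurable borel"
    using measurable_drift_section[OF u, of w] measurable_drift_section[OF v', of w] elim(2) by simp_all
  note g[measurable]
  have "energy (\<lambda>s. g w s - on_unit u w s) = energy (\<lambda>s. g w s - on_unit v' w s)"
  proof (rule energy_cong_AE)
    show "AE s in lborel. s \<in> {0..1} \<longrightarrow> g w s - on_unit u w s = g w s - on_unit v' w s"
      using elim(1) by eventually_elim (simp add: on_unit_def)
  qed measurable
  then show ?case by (simp add: energy_on_unit)
qed

lemma neg_drift_L0: "u \<in> L0_adapted \<nu> \<Longrightarrow> neg_drift u \<in> L0_adapted \<nu>"
  by (auto simp: L0_adapted_def neg_drift_def case_prod_unfold)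

text \<open>By \<open>increment_symmetric\<close> the positive and negative parts have the same
  integral, and the second moment bound makes it finite.\<close>

lemma increment_mean_zero:
  assumes s: "0 \<le> s" "s < t" "t \<le> 1" and z: "z \<in> borel_measurable (F s)" and b: "\<And>w. w \<in> space \<nu> \<Longrightarrow> norm (z w) \<le> C"
  shows "integrable P (\<lambda>w. z w \<bullet> (\<beta> w t - \<beta> w s))" "(LINT w|P. z w \<bullet> (\<beta> w t - \<beta> w s)) = 0"
proof -
  let ?X = "\<lambda>w. z w \<bullet> (\<beta> w t - \<beta> w s)"
  have Xm[measurable]: "?X \<in> borel_measurable P"
    using s by (intro borel_measurable_inner measurable_F_P[OF z] borel_measurable_diff measurable_F_P[OF measurable_beta[OF _ order_refl]]) auto
  have "(\<integral>\<^sup>+w. ennreal ((?X w)\<^sup>2) \<partial>P) \<le> (\<integral>\<^sup>+w. ennreal (8 * ((t - s) * (norm (z w))\<^sup>2)) \<partial>P)"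
    by (rule increment_second_moment[OF s z])
  also have "\<dots> \<le> (\<integral>\<^sup>+w. ennreal (8 * ((t - s) * C\<^sup>2)) \<partial>P)"
    using s b by (intro nn_integral_mono ennreal_leI mult_left_mono power_mono) auto
  also have "\<dots> < \<infinity>" by (simp add: less_top[symmetric])
  finally have "integrable P (\<lambda>w. (?X w)\<^sup>2)" by (intro integrableI_bounded) auto
  then show "integrable P ?X" by (rule square_integrable_imp_integrable[rotated]) simp
  define H where "H p = ennreal (z (fst p) \<bullet> snd p)" for p
  note z[measurable]
  have "(\<integral>\<^sup>+w. H (w, - (\<beta> w t - \<beta> w s)) \<partial>P) = (\<integral>\<^sup>+w. H (w, \<beta> w t - \<beta> w s) \<partial>P)"
    unfolding H_def by (rule increment_symmetric[OF s]) measurable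
  then have "(\<integral>\<^sup>+w. ennreal (- ?X w) \<partial>P) = (\<integral>\<^sup>+w. ennreal (?X w) \<partial>P)"
    unfolding H_def fst_conv snd_conv inner_minus_right .
  then show "(LINT w|P. ?X w) = 0"
    using \<open>integrable P ?X\<close> by (simp add: real_lebesgue_integral_def)
qed

end

section \<open>Shifts by an adapted drift\<close>

text \<open>A single drift and its shift, detached from the flow: \<open>U\<close> stands for
  \<open>WW u\<close>, and \<open>U_law\<close> says that \<open>U\<close> carries
  \<open>\<rho> \<nu>\<close> back to \<nu>.\<close>

locale adapted_shift = brownian_path_space \<nu> \<beta>
  for \<nu> :: "('n::finite) path measure" and \<beta> :: "'n path \<Rightarrow> 'n path" +
  fixes \<tau> :: "'n path \<Rightarrow> real" and u :: "'n drift" and U :: "'n path \<Rightarrow> 'n path"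
  assumes stopping_time_tau: "stopping_time (coord_filtration \<nu>) \<tau>"
    and tau_nonneg: "\<And>w. w \<in> space \<nu> \<Longrightarrow> 0 \<le> \<tau> w"
    and u_L2: "square_integrable_drift u"
    and u_after: "\<exists>v\<in>L0_adapted \<nu>. drift_eq \<nu> u (drift_after \<tau> v)"
    and integrable_rho: "integrable (completion \<nu>) (stoch_exp \<nu> \<beta> (neg_drift u))"
    and expectation_rho: "(LINT w|completion \<nu>. stoch_exp \<nu> \<beta> (neg_drift u) w) = 1"
    and U_adapted: "adapted_path_map \<nu> U"
    and U_law: "distr (girsanov_measure \<nu> \<beta> u) path_algebra U = distr (completion \<nu>) path_algebra (\<lambda>w. w)"
    and U_translates: "translates_to \<nu> \<beta> U u"
begin

abbreviation \<rho> :: "'n path \<Rightarrow> real" where "\<rho> \<equiv> stoch_exp \<nu> \<beta> (neg_drift u)"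
abbreviation I :: "'n path \<Rightarrow> real" where "I \<equiv> ito_integral \<nu> \<beta> (neg_drift u)"

lemma u_L0: "u \<in> L0_adapted \<nu>" and integrable_energy_u: "integrable P (\<lambda>w. energy (u w))"
  using u_L2 by (auto simp: square_integrable_drift_def)

lemma tau_measurable[measurable]: "\<tau> \<in> borel_measurable P"
  by (rule measurable_stopping_time[OF stopping_time_tau]) (auto intro: sets_F_P)

text \<open>The strict inequality matches \<open>drift_after\<close>, whose value at time
  \<open>s\<close> is switched on where \<open>\<tau> w < s\<close>.\<close>

lemma stopped_before:
  assumes A: "A \<in> sets (stopped_algebra \<nu> \<tau>)" shows "{w \<in> A. \<tau> w < s} \<in> sets (F s)"
proof -
  have "{w \<in> A. \<tau> w < s} = (\<Union>n. {w \<in> A. \<tau> w \<le> s - inverse (real (Suc n))})"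
  proof (safe, goal_cases)
    case (1 w)
    then obtain n where "inverse (real (Suc n)) < s - \<tau> w"
      using reals_Archimedean[of "s - \<tau> w"] by auto
    then show ?case using 1 by (intro UN_I[of n]) auto
  next
    case (2 w n)
    have "0 < inverse (real (Suc n))" by simp
    then show ?case using 2 by linarith
  qed
  also have "\<dots> \<in> sets (F s)"
  proof (intro sets.countable_UN image_subsetI)
    fix n :: nat
    have "{w \<in> A. \<tau> w \<le> s - inverse (real (Suc n))} \<in> sets (F (s - inverse (real (Suc n))))"
      using sets_pre_sigmaD[OF stopping_time_tau] A unfolding stopped_algebra_def .
    then show "{w \<in> A. \<tau> w \<le> s - inverse (real (Suc n))} \<in> sets (F s)"
      using sets_F_mono[of "s - inverse (real (Suc n))" s] by auto
  qed
  finally show ?thesis .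
qed

lemma tau_less_sets: "{w \<in> space \<nu>. \<tau> w < s} \<in> sets (F s)"
  by (rule stopped_before) (metis sets.top space_pre_sigma stopped_algebra_def)

lemma drift_after_L0:
  assumes v: "v \<in> L0_adapted \<nu>" shows "drift_after \<tau> v \<in> L0_adapted \<nu>"
proof -
  have vm[measurable]: "(\<lambda>p. v (fst p) (snd p)) \<in> borel_measurable (P \<Otimes>\<^sub>M unit_time)"
    using v by (simp add: L0_adapted_def case_prod_unfold)
  have [measurable]: "(\<lambda>p. snd p) \<in> borel_measurable (P \<Otimes>\<^sub>M unit_time)"
    by (rule measurable_compose[OF measurable_snd]) (simp add: measurable_restrict_space1)
  have 1: "(\<lambda>p. drift_after \<tau> v (fst p) (snd p)) \<in> borel_measurable (P \<Otimes>\<^sub>M unit_time)"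
    unfolding drift_after_def by measurable
  have 2: "(\<lambda>w. drift_after \<tau> v w s) \<in> borel_measurable (F s)" if "s \<in> {0..1}" for s
  proof -
    have [measurable]: "(\<lambda>w. v w s) \<in> borel_measurable (F s)" by (rule L0_adaptedD(1)[OF v that])
    have [measurable]: "Measurable.pred (F s) (\<lambda>w. \<tau> w < s)"
      using tau_less_sets[of s] by (simp add: Measurable.pred_def)
    show ?thesis unfolding drift_after_def by measurable
  qed
  have 3: "AE w in P. set_integrable lborel {0..1} (\<lambda>s. (norm (drift_after \<tau> v w s))\<^sup>2)"
    using L0_adaptedD(2)[OF v] AE_space[of P]
  proof eventually_elim
    case (elim w)
    have "(\<lambda>s. indicator {0..1} s *\<^sub>R (norm (drift_after \<tau> v w s))\<^sup>2)
       = (\<lambda>s. indicator {\<tau> w<..} s *\<^sub>R (indicator {0..1} s *\<^sub>R (norm (v w s))\<^sup>2))"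
      by (rule ext) (simp add: drift_after_def indicator_def)
    then show ?case using elim(1) unfolding set_integrable_def by (simp only:) (rule integrable_mult_indicator, simp_all)
  qed
  show ?thesis using 1 2 3 by (simp add: L0_adapted_def case_prod_unfold)
qed

text \<open>The vanishing of \<open>z j k\<close> where \<open>s j k \<le> \<tau> w\<close> allows
  multiplication by indicators of sets in \<open>F\<tau>\<close> without loss of adaptedness. The
  rate \<open>(1/4)^j\<close> stays summable after multiplication by \<open>2^j\<close>, which the
  passage from L2 to L1 costs.\<close>

definition approximates :: "(nat \<Rightarrow> nat) \<Rightarrow> (nat \<Rightarrow> nat \<Rightarrow> real) \<Rightarrow> (nat \<Rightarrow> nat \<Rightarrow> 'n path \<Rightarrow> (real, 'n) vec) \<Rightarrow> bool" where
  "approximates N s z \<longleftrightarrow> (\<forall>j. simple_integrand \<nu> (N j) (s j) (z j) \<and> time_grid (N j) (s j) \<and> s j 0 = 0 \<and> s j (N j) = 1 \<and>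
     (\<forall>k<N j. \<forall>w. s j k \<le> \<tau> w \<longrightarrow> z j k w = 0) \<and>
     (\<integral>\<^sup>+w. ennreal (energy (\<lambda>r. simple_drift (N j) (s j) (z j) w r - u w r)) \<partial>P) \<le> ennreal ((1/4)^j))"

lemma ex_approximation: obtains N s z where "approximates N s z"
proof -
  obtain v where v: "v \<in> L0_adapted \<nu>" "drift_eq \<nu> u (drift_after \<tau> v)" using u_after by auto
  \<comment> \<open>The drift \<open>u\<close> vanishes up to \<tau> only almost everywhere. The
    approximation is built for a version that does so everywhere; the energies of the errors agree
    almost surely.\<close>
  define v' where "v' = drift_after \<tau> v"
  have v': "v' \<in> L0_adapted \<nu>" "drift_eq \<nu> u v'" unfolding v'_def using drift_after_L0[OF v(1)] v(2) by auto
  have e: "AE w in P. energy (\<lambda>s. g w s - u w s) = energy (\<lambda>s. g w s - v' w s)"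
    if "\<And>w. g w \<in> borel_measurable borel" for g :: "'n drift"
    by (rule energy_drift_cong[OF u_L0 v' that])
  have "AE w in P. energy (u w) = energy (v' w)"
    using e[of "\<lambda>_ _. 0"] by (simp add: energy_def)
  then have "integrable P (\<lambda>w. energy (v' w))"
    using integrable_energy_u by (subst integrable_cong_AE[of _ _ "\<lambda>w. energy (u w)"])
      (auto simp: measurable_energy_L0 v'(1) u_L0)
  then have w2: "square_integrable_drift v'" using v'(1) by (simp add: square_integrable_drift_def)
  define R where "R j N s z \<longleftrightarrow> simple_integrand \<nu> N s z \<and> time_grid N s \<and> s 0 = 0 \<and> s N = 1 \<and>
     (\<forall>k<N. \<forall>w. s k \<le> \<tau> w \<longrightarrow> z k w = 0) \<and>
     (\<integral>\<^sup>+w. ennreal (energy (\<lambda>r. simple_drift N s z w r - u w r)) \<partial>P) \<le> ennreal ((1/4)^j)" for j :: nat and N s z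
  have "\<exists>N s z. R j N s z" for j
  proof -
    have w0: "v' w s = 0" if "s \<le> \<tau> w" for w s using that by (simp add: v'_def drift_after_def)
    have p: "0 < (1/4 :: real)^j" by simp
    obtain N s z where A: "simple_integrand \<nu> N s z" "time_grid N s" "s 0 = 0" "s N = 1"
      "\<And>k w. k < N \<Longrightarrow> s k \<le> \<tau> w \<Longrightarrow> z k w = 0"
      and b: "(\<integral>\<^sup>+w. ennreal (energy (\<lambda>r. simple_drift N s z w r - v' w r)) \<partial>P) \<le> ennreal ((1/4)^j)"
      by (rule simple_approximation[where \<tau>=\<tau>, OF w2 p w0]) (assumption | rule that)+
    have "(\<integral>\<^sup>+w. ennreal (energy (\<lambda>r. simple_drift N s z w r - u w r)) \<partial>P)
       = (\<integral>\<^sup>+w. ennreal (energy (\<lambda>r. simple_drift N s z w r - v' w r)) \<partial>P)"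
      using e[of "simple_drift N s z"] by (intro nn_integral_cong_AE) auto
    then have "R j N s z" using A b by (simp add: R_def)
    then show ?thesis by blast
  qed
  then have "\<forall>j. \<exists>N s z. R j N s z" by blast
  from choice[OF this] obtain N where "\<forall>j. \<exists>s z. R j (N j) s z" by blast
  from choice[OF this] obtain s where "\<forall>j. \<exists>z. R j (N j) (s j) z" by blast
  from choice[OF this] obtain z where "\<forall>j. R j (N j) (s j) (z j)" by blast
  then have "approximates N s z" unfolding approximates_def R_def .
  then show ?thesis by (rule that)
qed

context
  fixes N s z assumes approx: "approximates N s z"
begin

lemma approxD:
  "simple_integrand \<nu> (N j) (s j) (z j)" "time_grid (N j) (s j)" "s j 0 = 0" "s j (N j) = 1"
  "k < N j \<Longrightarrow> s j k \<le> \<tau> w \<Longrightarrow> z j k w = 0"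
  "(\<integral>\<^sup>+w. ennreal (energy (\<lambda>r. simple_drift (N j) (s j) (z j) w r - u w r)) \<partial>P) \<le> ennreal ((1/4)^j)"
  using approx by (auto simp: approximates_def)

abbreviation \<phi> :: "nat \<Rightarrow> 'n drift" where "\<phi> j \<equiv> simple_drift (N j) (s j) (z j)"

definition rhoj :: "nat \<Rightarrow> 'n path \<Rightarrow> real" where
  "rhoj j w = (\<Prod>k<N j. grid_exp (s j) (z j) k w)"

lemma z_measurable: "k < N j \<Longrightarrow> z j k \<in> borel_measurable (F (s j k))"
  using simple_integrandD(1)[OF approxD(1)] .

lemma energy_approx_tendsto: "AE w in P. (\<lambda>j. energy (\<lambda>r. \<phi> j w r - u w r)) \<longlonglongrightarrow> 0"
  by (rule AE_tendsto_zero[OF measurable_energy_simple_diff[OF approxD(1) u_L0] energy_nonneg approxD(6)])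
    (auto intro!: summable_geometric)

lemma good_paths:
  "AE w in P. w \<in> space \<nu> \<and> set_integrable lborel {0..1} (\<lambda>r. (norm (u w r))\<^sup>2)
     \<and> (\<forall>j. set_integrable lborel {0..1} (\<lambda>r. (norm (\<phi> j w r - u w r))\<^sup>2))
     \<and> (\<forall>j. set_integrable lborel {0..1} (\<lambda>r. (norm (\<phi> j w r))\<^sup>2))
     \<and> (\<lambda>j. energy (\<lambda>r. \<phi> j w r - u w r)) \<longlonglongrightarrow> 0"
proof -
  have z0: "zero_drift \<in> L0_adapted \<nu>" by (auto simp: L0_adapted_def zero_drift_def case_prod_unfold set_integrable_def)
  have "AE w in P. \<forall>j. set_integrable lborel {0..1} (\<lambda>r. (norm (\<phi> j w r - u w r))\<^sup>2)"
    using set_integrable_simple_diff[OF approxD(1) u_L0] by (simp add: AE_all_countable)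
  moreover have "AE w in P. \<forall>j. set_integrable lborel {0..1} (\<lambda>r. (norm (\<phi> j w r - zero_drift w r))\<^sup>2)"
    using set_integrable_simple_diff[OF approxD(1) z0] by (simp add: AE_all_countable)
  ultimately show ?thesis
    using AE_space[of P] L0_adaptedD(2)[OF u_L0] energy_approx_tendsto
    by eventually_elim (auto simp: zero_drift_def)
qed

lemma energy_tendsto: "AE w in P. (\<lambda>j. energy (\<phi> j w)) \<longlonglongrightarrow> energy (u w)"
  using good_paths
proof eventually_elim
  case (elim w)
  show ?case
  proof (rule tendsto_of_bounds[where e="\<lambda>j. energy (\<lambda>r. \<phi> j w r - u w r)" and C="energy (u w)" and K="\<lambda>c. 1 + 1 / c"])
    show "norm (energy (\<phi> j w) - energy (u w)) \<le> energy (u w) * c + (1 + 1 / c) * energy (\<lambda>r. \<phi> j w r - u w r)" if "0 < c" for j c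
      using energy_diff_abs_le[of "\<phi> j w" "u w" c] elim that by (simp add: mult.commute)
  qed (use elim energy_nonneg in auto)
qed

lemma cm_path_tendsto: "AE w in P. \<forall>t\<in>{0..1}. (\<lambda>j. cm_path (\<phi> j w) t) \<longlonglongrightarrow> cm_path (u w) t"
  using good_paths
proof eventually_elim
  case (elim w)
  show ?case
  proof
    fix t :: real assume t: "t \<in> {0..1}"
    show "(\<lambda>j. cm_path (\<phi> j w) t) \<longlonglongrightarrow> cm_path (u w) t"
    proof (rule tendsto_of_bounds[where e="\<lambda>j. energy (\<lambda>r. \<phi> j w r - u w r)" and C=1 and K="\<lambda>c. 1 / c"])
      show "norm (cm_path (\<phi> j w) t - cm_path (u w) t) \<le> 1 * c + 1 / c * energy (\<lambda>r. \<phi> j w r - u w r)" if "0 < c" for j c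
        using cm_path_diff_le[of "\<phi> j w" "u w" c t] drift_section_measurable[OF u_L0, of w] elim that t by simp
    qed (use elim in auto)
  qed
qed

lemma energy_phi: "energy (\<phi> j w) = (\<Sum>k<N j. (s j (Suc k) - s j k) * (norm (z j k w))\<^sup>2)"
  by (rule energy_grid[OF approxD(2-4)])

lemma rhoj_eq: "rhoj j w = exp (- simple_integral \<beta> (N j) (s j) (z j) w - energy (\<phi> j w) / 2)"
  unfolding rhoj_def grid_exp_def exp_sum[OF finite_lessThan, symmetric] energy_phi simple_integral_def
  by (simp add: sum_subtractf sum_negf sum_divide_distrib mult.commute)

lemma neg_simple:
  "simple_integrand \<nu> (N j) (s j) (\<lambda>k w. - z j k w)"
  "simple_integral \<beta> (N j) (s j) (\<lambda>k w. - z j k w) w = - simple_integral \<beta> (N j) (s j) (z j) w"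
  "simple_drift (N j) (s j) (\<lambda>k w. - z j k w) w r = - \<phi> j w r"
proof -
  have b: "bounded (z j k ` space \<nu>) \<Longrightarrow> bounded ((\<lambda>w. - z j k w) ` space \<nu>)" for k
    by (simp add: bounded_iff)
  then show "simple_integrand \<nu> (N j) (s j) (\<lambda>k w. - z j k w)"
    using approxD(1)[of j] by (auto simp: simple_integrand_def)
  show "simple_integral \<beta> (N j) (s j) (\<lambda>k w. - z j k w) w = - simple_integral \<beta> (N j) (s j) (z j) w"
    by (simp add: simple_integral_def sum_negf)
  show "simple_drift (N j) (s j) (\<lambda>k w. - z j k w) w r = - \<phi> j w r"
    unfolding simple_drift_def sum_negf[symmetric] by (intro sum.cong) auto
qed

lemma ito_limits:
  shows "I \<in> borel_measurable P"
    and "AE w in P. (\<lambda>j. - simple_integral \<beta> (N j) (s j) (z j) w) \<longlonglongrightarrow> I w"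
    and "(\<integral>\<^sup>+w. ennreal ((- simple_integral \<beta> (N j) (s j) (z j) w - I w)\<^sup>2) \<partial>P) \<le> ennreal (32 * (1/4)^j)"
proof -
  have e: "(\<integral>\<^sup>+w. ennreal (energy (\<lambda>r. simple_drift (N j) (s j) (\<lambda>k w. - z j k w) w r - neg_drift u w r)) \<partial>P) \<le> ennreal ((1/4)^j)" for j
  proof -
    have "energy (\<lambda>r. simple_drift (N j) (s j) (\<lambda>k w. - z j k w) w r - neg_drift u w r) = energy (\<lambda>r. \<phi> j w r - u w r)" for w
      by (rule energy_cong) (simp add: neg_simple(3) neg_drift_def norm_minus_commute)
    then show ?thesis using approxD(6)[of j] by simp
  qed
  note L = ito_integral_limit[OF neg_drift_L0[OF u_L0] neg_simple(1) e, unfolded neg_simple(2)]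
  show "I \<in> borel_measurable P" by (rule L(1))
  show "AE w in P. (\<lambda>j. - simple_integral \<beta> (N j) (s j) (z j) w) \<longlonglongrightarrow> I w" by (rule L(2))
  show "(\<integral>\<^sup>+w. ennreal ((- simple_integral \<beta> (N j) (s j) (z j) w - I w)\<^sup>2) \<partial>P) \<le> ennreal (32 * (1/4)^j)" by (rule L(3))
qed

lemma rho_eq: "\<rho> w = exp (I w - energy (u w) / 2)"
proof -
  have "energy (neg_drift u w) = energy (u w)" by (rule energy_cong) (simp add: neg_drift_def)
  then show ?thesis by (simp add: stoch_exp_def cm_norm_energy)
qed

lemma rhoj_tendsto: "AE w in P. (\<lambda>j. rhoj j w) \<longlonglongrightarrow> \<rho> w"
  using ito_limits(2) energy_tendsto
  by eventually_elim (auto simp: rhoj_eq rho_eq intro!: tendsto_intros)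

lemma rhoj_measurable[measurable]: "rhoj j \<in> borel_measurable P"
  unfolding rhoj_def[abs_def]
proof (rule borel_measurable_prod)
  fix k assume "k \<in> {..<N j}"
  then show "grid_exp (s j) (z j) k \<in> borel_measurable P"
    by (intro measurable_F_P[OF measurable_grid_exp[OF approxD(2) z_measurable _ order_refl]]) auto
qed

lemma rhoj_pos: "0 < rhoj j w" by (simp add: rhoj_eq)

lemma nn_integral_rhoj: "(\<integral>\<^sup>+w. ennreal (rhoj j w) \<partial>P) = 1"
proof -
  have "(\<integral>\<^sup>+w. 1 * (\<Prod>k<N j. ennreal (grid_exp (s j) (z j) k w)) * (\<Prod>i\<le>N j. (\<lambda>_. 1) (grid_shift (s j) (z j) i w)) \<partial>P)
     = (\<integral>\<^sup>+w. 1 \<partial>P) * (\<integral>\<^sup>+w. (\<Prod>i\<le>N j. (\<lambda>_. 1) (\<beta> w (s j i) - \<beta> w (s j 0))) \<partial>P)"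
    by (rule simple_girsanov[OF approxD(2) z_measurable]) auto
  moreover have "(\<Prod>k<N j. ennreal (grid_exp (s j) (z j) k w)) = ennreal (rhoj j w)" for w
    unfolding rhoj_def by (rule prod_ennreal) (simp add: grid_exp_def)
  ultimately show ?thesis by simp
qed

lemma rho_measurable[measurable]: "\<rho> \<in> borel_measurable P"
  using integrable_rho by auto

lemma rho_pos: "0 < \<rho> w" by (simp add: rho_eq)

lemma nn_integral_rho: "(\<integral>\<^sup>+w. ennreal (\<rho> w) \<partial>P) = 1"
  using nn_integral_eq_integral[OF integrable_rho] expectation_rho rho_pos by (simp add: less_imp_le)

lemma integrable_rhoj: "integrable P (rhoj j)"
  by (rule integrableI_bounded) (simp_all add: rhoj_pos less_imp_le nn_integral_rhoj)

text \<open>Scheffe's lemma: the densities converge almost surely and all have total mass 1, the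
  limit by membership of \<open>u\<close> in the Girsanov class.\<close>

lemma rhoj_L1: "(\<lambda>j. LINT w|P. \<bar>rhoj j w - \<rho> w\<bar>) \<longlonglongrightarrow> 0"
proof -
  have "(\<lambda>j. \<integral>\<^sup>+w. norm (rhoj j w - \<rho> w) \<partial>P) \<longlonglongrightarrow> 0"
    by (rule Scheffe_lemma2[OF rhoj_measurable integrable_rho rhoj_tendsto])
      (simp add: rhoj_pos rho_pos less_imp_le nn_integral_rhoj nn_integral_rho)
  moreover have "(\<integral>\<^sup>+w. norm (rhoj j w - \<rho> w) \<partial>P) = ennreal (LINT w|P. \<bar>rhoj j w - \<rho> w\<bar>)" for j
    using integrable_rhoj[of j] integrable_rho by (subst nn_integral_eq_integral) auto
  ultimately have "(\<lambda>j. ennreal (LINT w|P. \<bar>rhoj j w - \<rho> w\<bar>)) \<longlonglongrightarrow> ennreal 0" by simp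
  then show ?thesis by (subst (asm) tendsto_ennreal_iff) auto
qed

end

end

lemma prod_grid:
  fixes G :: "real \<Rightarrow> 'a::comm_monoid_mult"
  assumes t: "time_grid M t" and T: "T \<subseteq> t ` {..M}"
  shows "(\<Prod>i\<le>M. if t i \<in> T then G (t i) else 1) = (\<Prod>r\<in>T. G r)"
proof -
  have inj: "inj_on t {..M}"
  proof (rule inj_onI)
    fix i j assume "i \<in> {..M}" "j \<in> {..M}" "t i = t j"
    then show "i = j" using grid_less_iff[OF t, of i j] grid_less_iff[OF t, of j i] by (cases i j rule: linorder_cases) auto
  qed
  have "(\<Prod>i\<le>M. if t i \<in> T then G (t i) else 1) = (\<Prod>i\<in>{i\<in>{..M}. t i \<in> T}. G (t i))"
    by (rule prod.inter_filter[symmetric]) simp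
  also have "\<dots> = (\<Prod>r\<in>T. G r)"
  proof (rule prod.reindex_cong[symmetric])
    show "inj_on t {i \<in> {..M}. t i \<in> T}" using inj by (rule inj_on_subset) auto
    show "T = t ` {i \<in> {..M}. t i \<in> T}" using T by auto
  qed simp
  finally show ?thesis .
qed

lemma prod_lessThan_add: "(\<Prod>k<a. f k) * (\<Prod>k<m. f (a + k)) = (\<Prod>k<a + m. f k :: 'a::comm_monoid_mult)" for a m :: nat
  by (induction m) (simp_all add: mult.assoc[symmetric])

lemma sum_lessThan_add: "(\<Sum>k<a. f k) + (\<Sum>k<m. f (a + k)) = (\<Sum>k<a + m. f k :: 'a::comm_monoid_add)" for a m :: nat
  by (induction m) (simp_all add: add.assoc[symmetric])

section \<open>Identities for simple drifts: sets known at \<tau>, and increments after a fixed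
  time\<close>

context adapted_shift
begin

abbreviation F\<tau> :: "'n path measure" where "F\<tau> \<equiv> stopped_algebra \<nu> \<tau>"

lemma subalgebra_F\<tau>: "subalgebra P F\<tau>"
  by (intro stopped_path_space.subalgebra_stopped_algebra stopped_path_space.intro prob_nu sets_nu stopping_time_tau tau_nonneg)

lemma sets_F\<tau>_P: "A \<in> sets F\<tau> \<Longrightarrow> A \<in> sets P"
  using subalgebra_F\<tau> by (auto simp: subalgebra_def)

text \<open>Where \<tau> is at least \<open>s\<close> the variable vanishes, so the indicator of
  \<open>A\<close> may be replaced by that of the part of \<open>A\<close> with
  \<open>\<tau> w < s\<close>, which belongs to \<open>F s\<close>.\<close>

lemma restricted_measurable:
  fixes y :: "'n path \<Rightarrow> (real, 'n) vec"
  assumes A: "A \<in> sets F\<tau>" and y: "y \<in> borel_measurable (F s)" and y0: "\<And>w. s \<le> \<tau> w \<Longrightarrow> y w = 0"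
  shows "(\<lambda>w. indicator A w *\<^sub>R y w) \<in> borel_measurable (F s)"
proof -
  have "(\<lambda>w. indicator A w *\<^sub>R y w) = (\<lambda>w. indicator {w \<in> A. \<tau> w < s} w *\<^sub>R y w)"
  proof
    fix w
    show "indicator A w *\<^sub>R y w = indicator {w \<in> A. \<tau> w < s} w *\<^sub>R y w"
      using y0[of w] by (cases "\<tau> w < s") (auto simp: indicator_def not_less)
  qed
  moreover note stopped_before[OF A, of s, measurable] y[measurable]
  ultimately show ?thesis by simp
qed

text \<open>The indicator of a set of \<open>F\<tau>\<close> can be moved into the simple
  integrands, which vanish up to \<tau>, so each simple integral has mean 0 over the set;
  convergence in L1 carries this to \<open>I\<close>.\<close>

lemma ito_mean_zero:
  shows "integrable P I" and "A \<in> sets F\<tau> \<Longrightarrow> (LINT w|P. indicator A w * I w) = 0"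
proof -
  obtain N s z where ap: "approximates N s z" by (rule ex_approximation)
  let ?S = "\<lambda>j. simple_integral \<beta> (N j) (s j) (z j)"
  note D = approxD[OF ap] and Im[measurable] = ito_limits(1)[OF ap]
  have Sm[measurable]: "?S j \<in> borel_measurable P" for j by (rule measurable_simple_integral[OF D(1)])
  have bnd: "(\<integral>\<^sup>+w. ennreal \<bar>- ?S j w - I w\<bar> \<partial>P) \<le> ennreal (33 * (1/2)^j)" for j
  proof -
    have "\<bar>x\<bar> \<le> (1/2)^j + 2^j * x\<^sup>2" for x :: real
    proof -
      have p: "(2::real)^j * (1/2)^j = 1" by (simp add: power_mult_distrib[symmetric])
      have "0 \<le> 2^j * (\<bar>x\<bar> - (1/2)^j)\<^sup>2" by simp
      also have "\<dots> = 2^j * x\<^sup>2 - 2 * (2^j * (1/2)^j) * \<bar>x\<bar> + (2^j * (1/2)^j) * (1/2)^j"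
        by (simp add: power2_eq_square algebra_simps)
      finally show ?thesis unfolding p by simp
    qed
    then have "(\<integral>\<^sup>+w. ennreal \<bar>- ?S j w - I w\<bar> \<partial>P) \<le> (\<integral>\<^sup>+w. ennreal ((1/2)^j) + ennreal (2^j) * ennreal ((- ?S j w - I w)\<^sup>2) \<partial>P)"
      by (intro nn_integral_mono) (simp add: ennreal_mult[symmetric] ennreal_plus[symmetric] ennreal_leI del: ennreal_plus)
    also have "\<dots> = ennreal ((1/2)^j) + ennreal (2^j) * (\<integral>\<^sup>+w. ennreal ((- ?S j w - I w)\<^sup>2) \<partial>P)"
      by (subst nn_integral_add, measurable, subst nn_integral_cmult) auto
    also have "\<dots> \<le> ennreal ((1/2)^j) + ennreal (2^j) * ennreal (32 * (1/4)^j)"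
      by (intro add_mono mult_left_mono ito_limits(3)[OF ap]) auto
    also have "\<dots> = ennreal ((1/2)^j + 2^j * (32 * (1/4)^j))"
      by (simp add: ennreal_mult[symmetric] ennreal_plus[symmetric] del: ennreal_plus)
    also have "(1/2)^j + 2^j * (32 * (1/4)^j) = (33 * (1/2)^j :: real)"
    proof -
      have "(2::real)^j * (1/4)^j = (1/2)^j" by (simp add: power_mult_distrib[symmetric])
      then show ?thesis by simp
    qed
    finally show ?thesis .
  qed
  have di: "integrable P (\<lambda>w. - ?S j w - I w)" for j
    by (rule integrableI_bounded) (auto intro: le_less_trans[OF bnd])
  have zm: "integrable P (\<lambda>w. indicator A w * ?S j w) \<and> (LINT w|P. indicator A w * ?S j w) = 0" if A: "A \<in> sets F\<tau>" for A j
  proof -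
    have eq: "indicator A w * ?S j w = (\<Sum>k<N j. (indicator A w *\<^sub>R z j k w) \<bullet> (\<beta> w (s j (Suc k)) - \<beta> w (s j k)))" for w
      by (simp add: simple_integral_def sum_distrib_left)
    have k: "integrable P (\<lambda>w. (indicator A w *\<^sub>R z j k w) \<bullet> (\<beta> w (s j (Suc k)) - \<beta> w (s j k)))
       \<and> (LINT w|P. (indicator A w *\<^sub>R z j k w) \<bullet> (\<beta> w (s j (Suc k)) - \<beta> w (s j k))) = 0" if k: "k < N j" for k
    proof -
      obtain C where C: "\<forall>w\<in>space \<nu>. norm (z j k w) \<le> C" using simple_integrandD(2)[OF D(1) k] by auto
      have m: "(\<lambda>w. indicator A w *\<^sub>R z j k w) \<in> borel_measurable (F (s j k))"
        by (rule restricted_measurable[OF A z_measurable[OF ap k] D(5)[OF k]])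
      have b: "norm (indicator A w *\<^sub>R z j k w) \<le> \<bar>C\<bar>" if "w \<in> space \<nu>" for w
        using C that by (auto simp: indicator_def)
      have g: "0 \<le> s j k" "s j k < s j (Suc k)" "s j (Suc k) \<le> 1"
        using grid_bounds[OF D(2)[of j]] time_gridD(3)[OF D(2)[of j] k] k by auto
      show ?thesis using increment_mean_zero[OF g m b] by blast
    qed
    have ki: "integrable P (\<lambda>w. (indicator A w *\<^sub>R z j k w) \<bullet> (\<beta> w (s j (Suc k)) - \<beta> w (s j k)))" if "k \<in> {..<N j}" for k
      using k that by blast
    have "(LINT w|P. (\<Sum>k<N j. (indicator A w *\<^sub>R z j k w) \<bullet> (\<beta> w (s j (Suc k)) - \<beta> w (s j k))))
      = (\<Sum>k<N j. (LINT w|P. (indicator A w *\<^sub>R z j k w) \<bullet> (\<beta> w (s j (Suc k)) - \<beta> w (s j k))))"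
      by (rule Bochner_Integration.integral_sum[OF ki])
    also have "\<dots> = 0" using k by (intro sum.neutral) blast
    finally have m0: "(LINT w|P. (\<Sum>k<N j. (indicator A w *\<^sub>R z j k w) \<bullet> (\<beta> w (s j (Suc k)) - \<beta> w (s j k)))) = 0" .
    show ?thesis unfolding eq by (rule conjI[OF Bochner_Integration.integrable_sum[OF ki] m0])
  qed
  have Si: "integrable P (?S j)" for j
  proof -
    have "space P \<in> sets F\<tau>" using sets.top[of F\<tau>] by (simp add: stopped_algebra_def space_pre_sigma)
    then have "integrable P (\<lambda>w. indicator (space P) w * ?S j w)" using zm by blast
    then show ?thesis by (rule Bochner_Integration.integrable_cong[THEN iffD1, rotated 2]) auto
  qed
  have Ii: "integrable P I"
  proof -
    have "integrable P (\<lambda>w. - ?S 0 w)" using Si[of 0] by simp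
    from Bochner_Integration.integrable_diff[OF this di[of 0]] show ?thesis by simp
  qed
  then show "integrable P I" .
  assume A: "A \<in> sets F\<tau>"
  note [measurable] = sets_F\<tau>_P[OF A]
  have le: "\<bar>LINT w|P. indicator A w * I w\<bar> \<le> 33 * (1/2)^j" for j
  proof -
    have iA: "integrable P (\<lambda>w. indicator A w * I w)" using integrable_mult_indicator[OF sets_F\<tau>_P[OF A] Ii] by simp
    have dA: "integrable P (\<lambda>w. indicator A w * (- ?S j w - I w))" using integrable_mult_indicator[OF sets_F\<tau>_P[OF A] di] by simp
    have "(LINT w|P. indicator A w * (- ?S j w - I w)) = (LINT w|P. - (indicator A w * ?S j w) - indicator A w * I w)"
      by (simp add: algebra_simps)
    also have "\<dots> = - (LINT w|P. indicator A w * I w)"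
      using zm[OF A, of j] iA by simp
    finally have "\<bar>LINT w|P. indicator A w * I w\<bar> = \<bar>LINT w|P. indicator A w * (- ?S j w - I w)\<bar>" by simp
    also have "\<dots> \<le> (LINT w|P. \<bar>indicator A w * (- ?S j w - I w)\<bar>)" by (rule integral_abs_bound)
    also have "\<dots> \<le> (LINT w|P. \<bar>- ?S j w - I w\<bar>)"
      using dA di[of j] by (intro integral_mono integrable_abs) (auto simp: indicator_def)
    also have "\<dots> \<le> 33 * (1/2)^j"
    proof -
      have "ennreal (LINT w|P. \<bar>- ?S j w - I w\<bar>) \<le> ennreal (33 * (1/2)^j)"
        using bnd[of j] di[of j] by (subst nn_integral_eq_integral[symmetric]) auto
      then show ?thesis by simp
    qed
    finally show ?thesis .
  qed
  have "(\<lambda>j. 33 * (1/2)^j) \<longlonglongrightarrow> (0::real)"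
    using tendsto_mult_right_zero[OF LIMSEQ_power_zero[of "1/2::real"], of 33] by simp
  then have "\<bar>LINT w|P. indicator A w * I w\<bar> \<le> 0"
    by (rule LIMSEQ_le_const) (use le in auto)
  then show "(LINT w|P. indicator A w * I w) = 0" by simp
qed

text \<open>Times at which the shifted path is tested must be grid points for
  \<open>simple_girsanov\<close>. Refinement changes neither the density nor the primitive of the
  drift.\<close>

lemma refine_approximation:
  assumes ap: "approximates N s z" and T: "finite T" "T \<subseteq> {0..1}"
  obtains M t y where "time_grid M t" "t 0 = 0" "t M = 1" "T \<subseteq> t ` {..M}"
    "\<And>k. k < M \<Longrightarrow> y k \<in> borel_measurable (F (t k))"
    "\<And>k w. k < M \<Longrightarrow> t k \<le> \<tau> w \<Longrightarrow> y k w = 0"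
    "\<And>w. rhoj N s z j w = (\<Prod>k<M. grid_exp t y k w)"
    "\<And>i w. i \<le> M \<Longrightarrow> cm_path (\<phi> N s z j w) (t i) = (\<Sum>k<i. (t (Suc k) - t k) *\<^sub>R y k w)"
proof -
  note D = approxD[OF ap]
  have "finite (s j ` {..N j} \<union> T)" "s j ` {..N j} \<union> T \<subseteq> {0..1}"
    using T grid_bounds[OF D(2)[of j]] by auto
  then obtain M t where g: "time_grid M t" "t 0 = 0" "t M = 1" "s j ` {..N j} \<union> T \<subseteq> t ` {..M}"
    by (rule ex_grid)
  then have sub: "s j ` {..N j} \<subseteq> t ` {..M}" by auto
  define y where "y = regrid (N j) (s j) (z j) t"
  have y: "simple_integrand \<nu> M t y"
    unfolding y_def by (rule simple_integrand_regrid[OF D(1) g(1) sub filtration_natural_filtration])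
  have drift: "\<phi> N s z j w r = simple_drift M t y w r" for w r
    unfolding y_def by (rule simple_drift_regrid[OF D(1) g(1) sub g(2,3)])
  have int: "simple_integral \<beta> (N j) (s j) (z j) w = simple_integral \<beta> M t y w" for w
    unfolding y_def by (rule simple_integral_regrid[OF D(1) g(1) sub])
  show ?thesis
  proof (rule that[of M t y])
    show "T \<subseteq> t ` {..M}" using g(4) by auto
    show "y k \<in> borel_measurable (F (t k))" if "k < M" for k using simple_integrandD(1)[OF y that] .
    \<comment> \<open>The fine cell lies in a coarse cell, and the left end of the coarse cell is
      not later than \<open>t k\<close>, hence not later than \<tau>.\<close>
    show "y k w = 0" if k: "k < M" and le: "t k \<le> \<tau> w" for k w
    proof -
      have tk: "0 < t (Suc k)" "t (Suc k) \<le> 1"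
        using time_gridD(3)[OF g(1) k] grid_bounds[OF g(1), of k] grid_bounds[OF g(1), of "Suc k"] k by auto
      obtain i where i: "i < N j" "s j i < t (Suc k)" "t (Suc k) \<le> s j (Suc i)"
        using grid_cell[OF D(2)[of j], of "t (Suc k)"] D(3,4)[of j] tk by auto
      have "s j i \<in> t ` {..M}" using i(1) by (intro subsetD[OF sub] imageI) simp
      then obtain a where a: "a \<le> M" "s j i = t a" by auto
      have "a \<le> k" using grid_less_iff[OF g(1), of a "Suc k"] a i k by auto
      then have "s j i \<le> \<tau> w" using grid_mono[OF g(1), of a k] a k le by auto
      then have "z j i w = 0" by (rule D(5)[OF i(1)])
      then show ?thesis using simple_drift_at[OF D(2)[of j] i, of "z j" w] by (simp add: y_def regrid_def)
    qed
    show "rhoj N s z j w = (\<Prod>k<M. grid_exp t y k w)" for w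
    proof -
      have "\<phi> N s z j w = simple_drift M t y w" by (rule ext) (rule drift)
      then have "rhoj N s z j w = exp (- simple_integral \<beta> M t y w - energy (simple_drift M t y w) / 2)"
        by (simp add: rhoj_eq[OF ap] int)
      then show ?thesis
        unfolding energy_grid[OF g(1-3)] grid_exp_def exp_sum[OF finite_lessThan, symmetric] simple_integral_def
        by (simp add: sum_subtractf sum_negf sum_divide_distrib mult.commute)
    qed
    show "cm_path (\<phi> N s z j w) (t i) = (\<Sum>k<i. (t (Suc k) - t k) *\<^sub>R y k w)" if i: "i \<le> M" for i w
    proof -
      have "cm_path (\<phi> N s z j w) (t i) = (LINT r:{0..t i}|lborel. simple_drift M t y w r)"
        unfolding cm_path_def drift ..
      also have "\<dots> = (\<Sum>k<i. LINT r:{t k<..t (Suc k)}|lborel. y k w)"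
      proof (rule integral_cells[OF g(1,2) i])
        show "set_integrable lborel {t k<..t (Suc k)} (\<lambda>r. y k w)" if "k < i" for k
          using time_gridD(3)[OF g(1), of k] that i by (simp add: set_integrable_def emeasure_lborel_Ioc integrable_indicator_iff)
        show "simple_drift M t y w r = y k w" if "k < i" "t k < r" "r \<le> t (Suc k)" for k r
          using simple_drift_at[OF g(1) _ that(2,3), of y w] that(1) i by simp
      qed simp
      also have "\<dots> = (\<Sum>k<i. (t (Suc k) - t k) *\<^sub>R y k w)"
        using time_gridD(3)[OF g(1)] i by (intro sum.cong) (auto simp: set_lebesgue_integral_def less_imp_le)
      finally show ?thesis .
    qed
  qed (use g in auto)
qed

abbreviation Xj where "Xj N s z j t w \<equiv> \<beta> w t + cm_path (\<phi> N s z j w) t"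
text \<open>The process \<open>\<beta> \<circ> U\<close> up to null sets, written without
  \<open>U\<close>, so that it can be approximated along with \<open>u\<close>.\<close>

definition X :: "real \<Rightarrow> 'n path \<Rightarrow> (real, 'n) vec" where "X t w = \<beta> w t + cm_path (u w) t"

lemma beta_measurable_P: "t \<in> {0..1} \<Longrightarrow> (\<lambda>w. \<beta> w t) \<in> borel_measurable P"
  by (rule measurable_F_P[OF measurable_beta[OF _ order_refl]])

text \<open>\<open>simple_girsanov\<close> is applied to the drift multiplied by the indicator of
  \<open>A\<close>: on \<open>A\<close> it is the given drift, off \<open>A\<close> there is none.
  Subtracting the part off \<open>A\<close> leaves the identity on \<open>A\<close>; the bound 1 on
  the test functions makes the subtracted part finite.\<close>

lemma simple_identity_stopped:
  fixes h :: "real \<Rightarrow> (real, 'n) vec \<Rightarrow> ennreal"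
  assumes ap: "approximates N s z" and A: "A \<in> sets F\<tau>" and T: "finite T" "T \<subseteq> {0..1}"
    and h: "\<And>t. h t \<in> borel_measurable borel" "\<And>t x. h t x \<le> 1"
  shows "(\<integral>\<^sup>+w. indicator A w * ennreal (rhoj N s z j w) * (\<Prod>t\<in>T. h t (Xj N s z j t w - Xj N s z j 0 w)) \<partial>P)
       = (\<integral>\<^sup>+w. indicator A w * (\<Prod>t\<in>T. h t (\<beta> w t - \<beta> w 0)) \<partial>P)"
proof -
  obtain M t y where g: "time_grid M t" "t 0 = 0" "t M = 1" and sub: "T \<subseteq> t ` {..M}"
    and ym: "\<And>k. k < M \<Longrightarrow> y k \<in> borel_measurable (F (t k))"
    and y0: "\<And>k w. k < M \<Longrightarrow> t k \<le> \<tau> w \<Longrightarrow> y k w = 0"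
    and rho: "\<And>w. rhoj N s z j w = (\<Prod>k<M. grid_exp t y k w)"
    and cm: "\<And>i w. i \<le> M \<Longrightarrow> cm_path (\<phi> N s z j w) (t i) = (\<Sum>k<i. (t (Suc k) - t k) *\<^sub>R y k w)"
    by (rule refine_approximation[OF ap T, of j]) (assumption | rule that)+
  define y' where "y' k w = indicator A w *\<^sub>R y k w" for k w
  define h' where "h' i x = (if t i \<in> T then h (t i) x else 1)" for i x
  have y'm: "y' k \<in> borel_measurable (F (t k))" if "k < M" for k
    unfolding y'_def[abs_def] by (rule restricted_measurable[OF A ym[OF that] y0[OF that]])
  have h'm: "h' i \<in> borel_measurable borel" for i unfolding h'_def[abs_def] using h(1)[of "t i"] by simp
  define G0 where "G0 w = (\<Prod>r\<in>T. h r (\<beta> w r - \<beta> w 0))" for w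
  define G where "G w = (\<Prod>r\<in>T. h r (Xj N s z j r w - Xj N s z j 0 w))" for w
  have G0m[measurable]: "G0 \<in> borel_measurable P" unfolding G0_def[abs_def]
    using T by (intro borel_measurable_prod_ennreal measurable_compose[OF _ h(1)] borel_measurable_diff beta_measurable_P) auto
  have G01: "G0 w \<le> 1" for w unfolding G0_def by (rule prod_le_1) (use h(2) in auto)
  have prods: "(\<Prod>i\<le>M. h' i (v i)) = (\<Prod>r\<in>T. h r (v' r))" if "\<And>i. i \<le> M \<Longrightarrow> v i = v' (t i)" for v v'
  proof -
    have "(\<Prod>i\<le>M. h' i (v i)) = (\<Prod>i\<le>M. if t i \<in> T then h (t i) (v' (t i)) else 1)"
      using that by (intro prod.cong) (auto simp: h'_def)
    then show ?thesis using prod_grid[OF g(1) sub, of "\<lambda>r. h r (v' r)"] by simp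
  qed
  have in_A: "(\<Prod>k<M. ennreal (grid_exp t y' k w)) * (\<Prod>i\<le>M. h' i (grid_shift t y' i w))
     = ennreal (rhoj N s z j w) * G w" if "w \<in> A" for w
  proof -
    have "grid_exp t y' k w = grid_exp t y k w" for k using that by (simp add: grid_exp_def y'_def)
    moreover have "grid_shift t y' i w = Xj N s z j (t i) w - Xj N s z j 0 w" if "i \<le> M" for i
      using cm[OF that, of w] cm[of 0 w] \<open>w \<in> A\<close> g(2) by (simp add: grid_shift_def y'_def)
    ultimately show ?thesis
      unfolding G_def rho using prods[of "\<lambda>i. grid_shift t y' i w" "\<lambda>r. Xj N s z j r w - Xj N s z j 0 w"]
      by (simp add: prod_ennreal grid_exp_def)
  qed
  have off_A: "(\<Prod>k<M. ennreal (grid_exp t y' k w)) * (\<Prod>i\<le>M. h' i (grid_shift t y' i w)) = G0 w" if "w \<notin> A" for w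
  proof -
    have "grid_exp t y' k w = 1" for k using that by (simp add: grid_exp_def y'_def)
    moreover have "grid_shift t y' i w = \<beta> w (t i) - \<beta> w 0" for i
      using that g(2) by (simp add: grid_shift_def y'_def)
    ultimately show ?thesis
      unfolding G0_def using prods[of "\<lambda>i. grid_shift t y' i w" "\<lambda>r. \<beta> w r - \<beta> w 0"] by simp
  qed
  note Am[measurable] = sets_F\<tau>_P[OF A]
  have Gm: "(\<lambda>w. indicator A w * ((\<Prod>k<M. ennreal (grid_exp t y' k w)) * (\<Prod>i\<le>M. h' i (grid_shift t y' i w)))) \<in> borel_measurable P"
  proof -
    have [measurable]: "grid_exp t y' k \<in> borel_measurable P" if "k < M" for k
      using measurable_F_P[OF measurable_grid_exp[OF g(1) y'm that order_refl]] .
    have [measurable]: "(\<lambda>w. h' i (grid_shift t y' i w)) \<in> borel_measurable P" if "i \<le> M" for i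
      using measurable_F_P[OF measurable_grid_shift[OF g(1) y'm that]] by (rule measurable_compose[OF _ h'm])
    show ?thesis by (intro borel_measurable_times_ennreal borel_measurable_indicator Am borel_measurable_prod_ennreal measurable_compose[OF _ measurable_ennreal]) auto
  qed
  have eqA: "indicator A w * ((\<Prod>k<M. ennreal (grid_exp t y' k w)) * (\<Prod>i\<le>M. h' i (grid_shift t y' i w)))
     = indicator A w * ennreal (rhoj N s z j w) * G w" for w
    using in_A[of w] by (auto simp: indicator_def mult.assoc)
  have "(\<integral>\<^sup>+w. indicator A w * ennreal (rhoj N s z j w) * G w \<partial>P) + (\<integral>\<^sup>+w. indicator (- A) w * G0 w \<partial>P)
    = (\<integral>\<^sup>+w. indicator A w * ennreal (rhoj N s z j w) * G w + indicator (- A) w * G0 w \<partial>P)"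
    by (rule nn_integral_add[symmetric]) (use Gm in \<open>simp_all add: eqA\<close>)
  also have "\<dots> = (\<integral>\<^sup>+w. 1 * (\<Prod>k<M. ennreal (grid_exp t y' k w)) * (\<Prod>i\<le>M. h' i (grid_shift t y' i w)) \<partial>P)"
    using in_A off_A by (intro nn_integral_cong) (auto simp: indicator_def)
  also have "\<dots> = (\<integral>\<^sup>+w. 1 \<partial>P) * (\<integral>\<^sup>+w. (\<Prod>i\<le>M. h' i (\<beta> w (t i) - \<beta> w (t 0))) \<partial>P)"
    by (rule simple_girsanov[OF g(1) y'm h'm]) simp_all
  also have "\<dots> = (\<integral>\<^sup>+w. G0 w \<partial>P)"
    using prods[of "\<lambda>i. \<beta> w (t i) - \<beta> w (t 0)" "\<lambda>r. \<beta> w r - \<beta> w 0" for w] g(2) by (simp add: G0_def)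
  also have "\<dots> = (\<integral>\<^sup>+w. indicator A w * G0 w + indicator (- A) w * G0 w \<partial>P)"
    by (intro nn_integral_cong) (auto simp: indicator_def)
  also have "\<dots> = (\<integral>\<^sup>+w. indicator A w * G0 w \<partial>P) + (\<integral>\<^sup>+w. indicator (- A) w * G0 w \<partial>P)"
    by (rule nn_integral_add) measurable
  finally have eq: "(\<integral>\<^sup>+w. indicator A w * ennreal (rhoj N s z j w) * G w \<partial>P) + (\<integral>\<^sup>+w. indicator (- A) w * G0 w \<partial>P)
     = (\<integral>\<^sup>+w. indicator A w * G0 w \<partial>P) + (\<integral>\<^sup>+w. indicator (- A) w * G0 w \<partial>P)" .
  have "(\<integral>\<^sup>+w. indicator (- A) w * G0 w \<partial>P) \<le> (\<integral>\<^sup>+w. 1 \<partial>P)"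
    by (intro nn_integral_mono) (auto simp: indicator_def G01)
  also have "\<dots> < \<infinity>" by simp
  finally have "(\<integral>\<^sup>+w. indicator (- A) w * G0 w \<partial>P) \<noteq> \<infinity>" by simp
  then have "(\<integral>\<^sup>+w. indicator A w * ennreal (rhoj N s z j w) * G w \<partial>P) = (\<integral>\<^sup>+w. indicator A w * G0 w \<partial>P)"
    using eq unfolding add.commute[of _ "\<integral>\<^sup>+w. indicator (- A) w * G0 w \<partial>P"] ennreal_add_left_cancel by blast
  then show ?thesis by (simp add: G_def G0_def)
qed

text \<open>The grid is cut at \<open>r\<close>: the exponential factors before \<open>r\<close>
  join the weight \<open>Y\<close>, and \<open>simple_girsanov\<close> is used on the remaining
  grid.\<close>

lemma simple_identity_future:
  fixes h :: "real \<Rightarrow> (real, 'n) vec \<Rightarrow> ennreal"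
  assumes ap: "approximates N s z" and r: "0 \<le> r" "r \<le> 1" and Y: "Y \<in> borel_measurable (F r)"
    and T: "finite T" "T \<subseteq> {r..1}" and h: "\<And>t. h t \<in> borel_measurable borel"
  shows "(\<integral>\<^sup>+w. Y w * ennreal (rhoj N s z j w) * (\<Prod>t\<in>T. h t (Xj N s z j t w - Xj N s z j r w)) \<partial>P)
       = (\<integral>\<^sup>+w. Y w * ennreal (rhoj N s z j w) \<partial>P) * (\<integral>\<^sup>+w. (\<Prod>t\<in>T. h t (\<beta> w t - \<beta> w r)) \<partial>P)"
proof -
  have T': "finite (insert r T)" "insert r T \<subseteq> {0..1}" using T r by auto
  obtain M t y where g: "time_grid M t" "t 0 = 0" "t M = 1" and sub: "insert r T \<subseteq> t ` {..M}"
    and ym: "\<And>k. k < M \<Longrightarrow> y k \<in> borel_measurable (F (t k))"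
    and y0: "\<And>k w. k < M \<Longrightarrow> t k \<le> \<tau> w \<Longrightarrow> y k w = 0"
    and rho: "\<And>w. rhoj N s z j w = (\<Prod>k<M. grid_exp t y k w)"
    and cm: "\<And>i w. i \<le> M \<Longrightarrow> cm_path (\<phi> N s z j w) (t i) = (\<Sum>k<i. (t (Suc k) - t k) *\<^sub>R y k w)"
    by (rule refine_approximation[OF ap T', of j]) (assumption | rule that)+
  obtain a where a: "a \<le> M" "t a = r" using sub by auto
  define t' where "t' i = t (a + i)" for i
  define y' where "y' i = y (a + i)" for i
  define M' where "M' = M - a"
  have g': "time_grid M' t'"
    using g a grid_bounds[OF g(1), of a] time_gridD(3)[OF g(1)] by (auto simp: time_grid_def t'_def M'_def)
  have t'0: "t' 0 = r" by (simp add: t'_def a)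
  have y'm: "y' k \<in> borel_measurable (F (t' k))" if "k < M'" for k
    using ym[of "a + k"] that by (simp add: y'_def t'_def M'_def)
  have sub': "T \<subseteq> t' ` {..M'}"
  proof
    fix x assume x: "x \<in> T"
    then obtain i where i: "i \<le> M" "t i = x" using sub by auto
    have "t a \<le> t i" using x T(2) i a by auto
    then have "a \<le> i" using grid_less_iff[OF g(1), of i a] i a by (meson not_less)
    then show "x \<in> t' ` {..M'}" using i by (intro image_eqI[of _ _ "i - a"]) (auto simp: t'_def M'_def)
  qed
  define h' where "h' i x = (if t' i \<in> T then h (t' i) x else 1)" for i x
  have h'm: "h' i \<in> borel_measurable borel" for i unfolding h'_def[abs_def] using h(1)[of "t' i"] by simp
  define Y' where "Y' w = Y w * (\<Prod>k<a. ennreal (grid_exp t y k w))" for w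
  have em: "grid_exp t y k \<in> borel_measurable (F r)" if "k < a" for k
    using measurable_grid_exp[OF g(1) ym that a(1)] unfolding a(2) .
  have Y'm: "Y' \<in> borel_measurable (F (t' 0))"
    unfolding Y'_def[abs_def] t'0
    by (intro borel_measurable_times_ennreal Y borel_measurable_prod_ennreal measurable_compose[OF em measurable_ennreal]) auto
  have Y'e: "Y' w * (\<Prod>k<M'. ennreal (grid_exp t' y' k w)) = Y w * ennreal (rhoj N s z j w)" for w
  proof -
    have "grid_exp t' y' k w = grid_exp t y (a + k) w" for k by (simp add: grid_exp_def t'_def y'_def)
    then have "(\<Prod>k<M'. ennreal (grid_exp t' y' k w)) = (\<Prod>k<M'. ennreal (grid_exp t y (a + k) w))" by simp
    moreover have "(\<Prod>k<a. ennreal (grid_exp t y k w)) * (\<Prod>k<M'. ennreal (grid_exp t y (a + k) w)) = (\<Prod>k<M. ennreal (grid_exp t y k w))"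
      using prod_lessThan_add[of "\<lambda>k. ennreal (grid_exp t y k w)" a M'] a(1) by (simp add: M'_def)
    moreover have "ennreal (rhoj N s z j w) = (\<Prod>k<M. ennreal (grid_exp t y k w))"
      unfolding rho by (rule prod_ennreal[symmetric]) (simp add: grid_exp_def)
    ultimately show ?thesis by (simp add: Y'_def mult.assoc)
  qed
  have prods: "(\<Prod>i\<le>M'. h' i (v i)) = (\<Prod>x\<in>T. h x (v' x))" if "\<And>i. i \<le> M' \<Longrightarrow> v i = v' (t' i)" for v v'
  proof -
    have "(\<Prod>i\<le>M'. h' i (v i)) = (\<Prod>i\<le>M'. if t' i \<in> T then h (t' i) (v' (t' i)) else 1)"
      using that by (intro prod.cong) (auto simp: h'_def)
    then show ?thesis using prod_grid[OF g' sub', of "\<lambda>x. h x (v' x)"] by simp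
  qed
  have shift: "grid_shift t' y' i w = Xj N s z j (t' i) w - Xj N s z j r w" if "i \<le> M'" for i w
  proof -
    have "cm_path (\<phi> N s z j w) (t' i) - cm_path (\<phi> N s z j w) (t a) = (\<Sum>k<a + i. (t (Suc k) - t k) *\<^sub>R y k w) - (\<Sum>k<a. (t (Suc k) - t k) *\<^sub>R y k w)"
      using cm[of "a + i" w] cm[of a w] that a by (simp add: t'_def M'_def)
    also have "\<dots> = (\<Sum>k<i. (t' (Suc k) - t' k) *\<^sub>R y' k w)"
      unfolding sum_lessThan_add[symmetric] by (simp add: t'_def y'_def)
    finally show ?thesis by (simp add: grid_shift_def a t'0)
  qed
  have main: "(\<integral>\<^sup>+w. Y' w * (\<Prod>k<M'. ennreal (grid_exp t' y' k w)) * (\<Prod>i\<le>M'. h'' i (grid_shift t' y' i w)) \<partial>P)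
      = (\<integral>\<^sup>+w. Y' w \<partial>P) * (\<integral>\<^sup>+w. (\<Prod>i\<le>M'. h'' i (\<beta> w (t' i) - \<beta> w (t' 0))) \<partial>P)"
    if "\<And>i. h'' i \<in> borel_measurable borel" for h'' :: "nat \<Rightarrow> (real, 'n) vec \<Rightarrow> ennreal"
    by (rule simple_girsanov[OF g' y'm that Y'm])
  \<comment> \<open>Constant test functions in the same identity show that the factors after
    \<open>r\<close> do not change the integral of \<open>Y'\<close>.\<close>
  have 1: "(\<integral>\<^sup>+w. Y w * ennreal (rhoj N s z j w) \<partial>P) = (\<integral>\<^sup>+w. Y' w \<partial>P)"
    using main[of "\<lambda>_ _. 1"] by (simp add: Y'e)
  have "(\<Prod>i\<le>M'. h' i (grid_shift t' y' i w)) = (\<Prod>x\<in>T. h x (Xj N s z j x w - Xj N s z j r w))" for w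
    by (rule prods) (rule shift)
  moreover have "(\<Prod>i\<le>M'. h' i (\<beta> w (t' i) - \<beta> w (t' 0))) = (\<Prod>x\<in>T. h x (\<beta> w x - \<beta> w r))" for w
    by (rule prods) (simp add: t'0)
  ultimately show ?thesis using main[of h', OF h'm] unfolding 1 Y'e by simp
qed

end

section \<open>Laws of shifted paths\<close>

text \<open>Continuous functions that decrease, for closed \<open>B\<close>, to the indicator of
  \<open>B\<close>. The empty set is separate because \<open>infdist\<close> to it is 0 by
  convention, which would give the constant 1.\<close>

definition closed_bump :: "'a::metric_space set \<Rightarrow> nat \<Rightarrow> 'a \<Rightarrow> real" where
  "closed_bump B k x = (if B = {} then 0 else max 0 (1 - real k * infdist x B))"

lemma closed_bump_bounds: "0 \<le> closed_bump B k x" "closed_bump B k x \<le> 1"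
  by (auto simp: closed_bump_def infdist_nonneg)

lemma continuous_closed_bump: "continuous_on UNIV (closed_bump B k)"
proof (cases "B = {}")
  case True
  then have "closed_bump B k = (\<lambda>_. 0)" by (auto simp: closed_bump_def)
  then show ?thesis by simp
next
  case False
  then have "closed_bump B k = (\<lambda>x. max 0 (1 - real k * infdist x B))" by (auto simp: closed_bump_def)
  then show ?thesis by (simp add: continuous_on_max continuous_on_diff continuous_on_mult continuous_on_infdist continuous_on_id)
qed

lemma closed_bump_tendsto: "closed B \<Longrightarrow> (\<lambda>k. closed_bump B k x) \<longlonglongrightarrow> indicator B x"
proof (cases "x \<in> B")
  case True
  then have "closed_bump B k x = 1" for k by (auto simp: closed_bump_def)
  then show ?thesis using True by simp
next
  case False
  assume B: "closed B"
  show ?thesis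
  proof (cases "B = {}")
    case True
    then show ?thesis by (simp add: closed_bump_def)
  next
    case ne: False
    then have d: "0 < infdist x B" using B False infdist_pos_not_in_closed by blast
    obtain k0 where k0: "1 < real k0 * infdist x B" using reals_Archimedean3[OF d] by blast
    have "closed_bump B k x = 0" if "k0 \<le> k" for k
    proof -
      have "real k0 * infdist x B \<le> real k * infdist x B" using that d by (intro mult_right_mono) auto
      then show ?thesis using k0 by (simp add: closed_bump_def)
    qed
    then have "\<forall>\<^sub>F k in sequentially. closed_bump B k x = indicator B x"
      using False by (auto simp: eventually_sequentially)
    then show ?thesis by (rule tendsto_eventually)
  qed
qed

context brownian_path_space
begin

text \<open>Passing to the limit in the approximations requires continuous test functions,
  determining a measure requires sets; dominated convergence along \<open>closed_bump\<close> leads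
  from one to the other.\<close>

lemma test_functions_to_closed_sets:
  fixes a b :: "'n path \<Rightarrow> real" and V W :: "real \<Rightarrow> 'n path \<Rightarrow> (real, 'n) vec"
  assumes a: "integrable P a" and b: "integrable P b" and T: "finite T"
    and V: "\<And>t. t \<in> T \<Longrightarrow> V t \<in> borel_measurable P" and W: "\<And>t. t \<in> T \<Longrightarrow> W t \<in> borel_measurable P"
    and eq: "\<And>h. (\<And>t. continuous_on UNIV (h t)) \<Longrightarrow> (\<And>t x. 0 \<le> h t x \<and> h t x \<le> (1::real)) \<Longrightarrow>
      (LINT w|P. a w * (\<Prod>t\<in>T. h t (V t w))) = (LINT w|P. b w * (\<Prod>t\<in>T. h t (W t w)))"
    and B: "\<And>t. closed (B t)"
  shows "(LINT w|P. a w * (\<Prod>t\<in>T. indicator (B t) (V t w))) = (LINT w|P. b w * (\<Prod>t\<in>T. indicator (B t) (W t w)))"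
proof -
  have lim: "(\<lambda>k. LINT w|P. c w * (\<Prod>t\<in>T. closed_bump (B t) k (Z t w))) \<longlonglongrightarrow> (LINT w|P. c w * (\<Prod>t\<in>T. indicator (B t) (Z t w)))"
    if c: "integrable P c" and Z: "\<And>t. t \<in> T \<Longrightarrow> Z t \<in> borel_measurable P" for c :: "'n path \<Rightarrow> real" and Z :: "real \<Rightarrow> 'n path \<Rightarrow> (real, 'n) vec"
  proof (rule Bochner_Integration.integral_dominated_convergence[where w="\<lambda>w. \<bar>c w\<bar>"])
    have [measurable]: "c \<in> borel_measurable P" using c by auto
    have m: "closed_bump (B t) k \<in> borel_measurable borel" for t k
      using continuous_closed_bump by (rule borel_measurable_continuous_onI)
    have i: "(indicator (B t) :: _ \<Rightarrow> real) \<in> borel_measurable borel" for t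
      using B by (intro borel_measurable_indicator) (rule borel_closed)
    show "(\<lambda>w. c w * (\<Prod>t\<in>T. closed_bump (B t) k (Z t w))) \<in> borel_measurable P" for k
      using Z m by (intro borel_measurable_times borel_measurable_prod measurable_compose[OF _ m]) auto
    show "(\<lambda>w. c w * (\<Prod>t\<in>T. indicator (B t) (Z t w))) \<in> borel_measurable P"
      using Z by (intro borel_measurable_times borel_measurable_prod measurable_compose[OF _ i]) auto
    show "integrable P (\<lambda>w. \<bar>c w\<bar>)" using c by simp
    show "AE w in P. (\<lambda>k. c w * (\<Prod>t\<in>T. closed_bump (B t) k (Z t w))) \<longlonglongrightarrow> c w * (\<Prod>t\<in>T. indicator (B t) (Z t w))"
      by (intro AE_I2 tendsto_mult tendsto_const tendsto_prod closed_bump_tendsto B)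
    show "AE w in P. norm (c w * (\<Prod>t\<in>T. closed_bump (B t) k (Z t w))) \<le> \<bar>c w\<bar>" for k
    proof (rule AE_I2)
      fix w
      have "0 \<le> (\<Prod>t\<in>T. closed_bump (B t) k (Z t w))" "(\<Prod>t\<in>T. closed_bump (B t) k (Z t w)) \<le> 1"
        by (auto intro!: prod_nonneg prod_le_1 closed_bump_bounds)
      then show "norm (c w * (\<Prod>t\<in>T. closed_bump (B t) k (Z t w))) \<le> \<bar>c w\<bar>"
        by (simp add: abs_mult mult_left_le)
    qed
  qed
  have "(LINT w|P. a w * (\<Prod>t\<in>T. closed_bump (B t) k (V t w))) = (LINT w|P. b w * (\<Prod>t\<in>T. closed_bump (B t) k (W t w)))" for k
    using eq[of "\<lambda>t. closed_bump (B t) k"] continuous_closed_bump closed_bump_bounds by blast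
  moreover have "(\<lambda>k. LINT w|P. a w * (\<Prod>t\<in>T. closed_bump (B t) k (V t w))) \<longlonglongrightarrow> (LINT w|P. a w * (\<Prod>t\<in>T. indicator (B t) (V t w)))"
    by (rule lim[OF a]) (rule V)
  moreover have "(\<lambda>k. LINT w|P. b w * (\<Prod>t\<in>T. closed_bump (B t) k (W t w))) \<longlonglongrightarrow> (LINT w|P. b w * (\<Prod>t\<in>T. indicator (B t) (W t w)))"
    by (rule lim[OF b]) (rule W)
  ultimately show ?thesis by (simp add: LIMSEQ_unique)
qed

lemma id_measurable_F1: "(\<lambda>w. w) \<in> F 1 \<rightarrow>\<^sub>M path_algebra"
  unfolding path_algebra_def
proof (intro measurable_restrict_space2)
  show "(\<lambda>w. w) \<in> space (F 1) \<rightarrow> {wt. continuous_on {0..1} wt}"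
    by (auto simp: space_nu space_path_algebra)
  show "(\<lambda>w. w) \<in> F 1 \<rightarrow>\<^sub>M Pi\<^sub>M {0..1} (\<lambda>_. borel)"
  proof (rule measurable_PiM_single')
    fix i :: real assume i: "i \<in> {0..1}"
    show "(\<lambda>w. w i) \<in> borel_measurable (F 1)"
    proof (rule measurableI)
      fix A :: "(real, 'n) vec set" assume "A \<in> sets borel"
      then show "(\<lambda>w. w i) -` A \<inter> space (F 1) \<in> sets (F 1)"
        using i unfolding sets_nf space_nf by (intro sigma_sets.Basic) auto
    qed simp
  next
    show "(\<lambda>w. w) \<in> space (F 1) \<rightarrow> (\<Pi>\<^sub>E i\<in>{0..1}. space borel)"
      by (auto simp: space_nu space_path_algebra PiE_def)
  qed
qed

lemma sets_F1: "sets (F 1) = sets P"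
proof
  show "sets (F 1) \<subseteq> sets P" by (auto intro: sets_F_P)
  show "sets P \<subseteq> sets (F 1)"
  proof
    fix A assume "A \<in> sets P"
    then obtain S N N' where A: "A = S \<union> N" "N \<subseteq> N'" "N' \<in> null_sets \<nu>" "S \<in> sets \<nu>" by (rule sets_completionE)
    have "S \<in> sets (F 1)"
      using measurable_sets[OF id_measurable_F1, of S] A(4) sets_nu sets.sets_into_space[OF A(4)] by (simp add: Int_absorb2)
    moreover have "N \<in> null_sets P"
      using A null_sets_completionI[OF A(3)] by (auto intro: completion.complete2)
    ultimately show "A \<in> sets (F 1)" using null_sets_F A(1) by blast
  qed
qed

text \<open>The second set of generators, increments after time \<open>r\<close>, is only specified up to null sets,
  since \<open>\<beta>\<close> is measurable for the completion only.\<close>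

lemma measure_eq_on_increments:
  assumes r: "0 \<le> r" "r \<le> 1"
    and C: "\<C> \<subseteq> sets P" "Int_stable \<C>" "space \<nu> \<in> \<C>"
    and past: "\<And>s B. 0 \<le> s \<Longrightarrow> s \<le> r \<Longrightarrow> closed B \<Longrightarrow> \<exists>C\<in>\<C>. AE w in P. w \<in> C \<longleftrightarrow> \<beta> w s \<in> B"
    and K: "sets K1 = sets P" "sets K2 = sets P" "absolutely_continuous P K1" "absolutely_continuous P K2"
    and fin: "emeasure K1 (space \<nu>) \<noteq> \<infinity>"
    and eq: "\<And>C T B. C \<in> \<C> \<Longrightarrow> finite T \<Longrightarrow> T \<subseteq> {r..1} \<Longrightarrow> (\<And>t. closed (B t)) \<Longrightarrow>
      emeasure K1 (C \<inter> {w \<in> space \<nu>. \<forall>t\<in>T. \<beta> w t - \<beta> w r \<in> B t}) = emeasure K2 (C \<inter> {w \<in> space \<nu>. \<forall>t\<in>T. \<beta> w t - \<beta> w r \<in> B t})"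
  shows "K1 = K2"
proof -
  define cyl where "cyl T B = {w \<in> space \<nu>. \<forall>t\<in>T. \<beta> w t - \<beta> w r \<in> B t}" for T :: "real set" and B :: "real \<Rightarrow> (real, 'n) vec set"
  \<comment> \<open>An intersection-stable family: cylinders over \<open>T\<close> and
    \<open>T'\<close> combine to a cylinder over the union.\<close>
  define E where "E = {A \<in> sets P. \<exists>C\<in>\<C>. \<exists>T B. finite T \<and> T \<subseteq> {r..1} \<and> (\<forall>t. closed (B t)) \<and> (AE w in P. w \<in> A \<longleftrightarrow> w \<in> C \<inter> cyl T B)}"
  have bm: "(\<lambda>w. \<beta> w t) \<in> borel_measurable P" if "t \<in> {0..1}" for t
    by (rule measurable_F_P[OF measurable_beta[OF that order_refl]])
  have cylm: "cyl T B \<in> sets P" if T: "finite T" "T \<subseteq> {r..1}" and B: "\<And>t. closed (B t)" for T B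
  proof -
    have "cyl T B = space P \<inter> (\<Inter>t\<in>T. (\<lambda>w. \<beta> w t - \<beta> w r) -` B t \<inter> space P)" by (auto simp: cyl_def)
    moreover have "(\<lambda>w. \<beta> w t - \<beta> w r) -` B t \<inter> space P \<in> sets P" if "t \<in> T" for t
      using bm[of t] bm[of r] that T(2) r B by (intro measurable_sets[OF borel_measurable_diff] borel_closed) auto
    moreover have "space P \<inter> (\<Inter>t\<in>T. (\<lambda>w. \<beta> w t - \<beta> w r) -` B t \<inter> space P) \<in> sets P"
    proof (cases "T = {}")
      case False
      have "(\<Inter>t\<in>T. (\<lambda>w. \<beta> w t - \<beta> w r) -` B t \<inter> space P) \<in> sets P"
        by (rule sets.finite_INT[OF T(1) False]) (rule calculation(2))
      then show ?thesis by (rule sets.Int[OF sets.top])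
    qed simp
    ultimately show ?thesis by simp
  qed
  have EI: "A \<in> E" if "A \<in> sets P" "C \<in> \<C>" "finite T" "T \<subseteq> {r..1}" "\<And>t. closed (B t)" "AE w in P. w \<in> A \<longleftrightarrow> w \<in> C \<inter> cyl T B" for A C T B
    using that unfolding E_def by blast
  define Q where "Q = sigma (space \<nu>) E"
  have Esub: "E \<subseteq> Pow (space \<nu>)" unfolding E_def using sets.sets_into_space[of _ P] by auto
  have setsQ: "sets Q = sigma_sets (space \<nu>) E" unfolding Q_def by (rule sets_measure_of[OF Esub])
  have spaceQ[simp]: "space Q = space \<nu>" unfolding Q_def by (rule space_measure_of[OF Esub])
  have EQ: "A \<in> E \<Longrightarrow> A \<in> sets Q" for A unfolding setsQ by (rule sigma_sets.Basic)
  \<comment> \<open>A null set agrees almost everywhere with the empty cylinder, obtained from an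
    empty target set at time 1.\<close>
  have nullQ: "A \<in> sets Q" if A: "A \<in> null_sets P" for A
  proof (rule EQ, rule EI[OF _ C(3), of A "{1}" "\<lambda>_. {}"])
    show "AE w in P. w \<in> A \<longleftrightarrow> w \<in> space \<nu> \<inter> cyl {1} (\<lambda>_. {})"
      using AE_not_in[OF A] by eventually_elim (simp add: cyl_def)
  qed (use A r in auto)
  have meas: "Y \<in> borel_measurable Q" if "\<And>B. closed B \<Longrightarrow> Y -` B \<inter> space \<nu> \<in> sets Q" for Y :: "'n path \<Rightarrow> (real, 'n) vec"
  proof (rule borel_measurableI)
    fix S :: "(real, 'n) vec set" assume "open S"
    then have "Y -` (- S) \<inter> space \<nu> \<in> sets Q" by (intro that) (simp add: closed_Compl)
    then have "space Q - (Y -` (- S) \<inter> space \<nu>) \<in> sets Q" by blast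
    moreover have "space Q - (Y -` (- S) \<inter> space \<nu>) = Y -` S \<inter> space Q" by auto
    ultimately show "Y -` S \<inter> space Q \<in> sets Q" by simp
  qed
  have pastQ: "(\<lambda>w. \<beta> w s) \<in> borel_measurable Q" if s: "0 \<le> s" "s \<le> r" for s
  proof (rule meas, rule EQ)
    fix B :: "(real, 'n) vec set" assume B: "closed B"
    obtain D where D: "D \<in> \<C>" "AE w in P. w \<in> D \<longleftrightarrow> \<beta> w s \<in> B" using past[OF s B] by auto
    show "(\<lambda>w. \<beta> w s) -` B \<inter> space \<nu> \<in> E"
    proof (rule EI[OF _ D(1), of _ "{}" "\<lambda>_. {}"])
      show "(\<lambda>w. \<beta> w s) -` B \<inter> space \<nu> \<in> sets P"
        using measurable_sets[OF bm[of s], of B] s r B by (simp add: borel_closed)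
      show "AE w in P. w \<in> (\<lambda>w. \<beta> w s) -` B \<inter> space \<nu> \<longleftrightarrow> w \<in> D \<inter> cyl {} (\<lambda>_. {})"
        using D(2) AE_space[of P] by eventually_elim (simp add: cyl_def)
    qed auto
  qed
  have futQ: "(\<lambda>w. \<beta> w s - \<beta> w r) \<in> borel_measurable Q" if s: "r \<le> s" "s \<le> 1" for s
  proof (rule meas, rule EQ)
    fix B :: "(real, 'n) vec set" assume B: "closed B"
    have e: "(\<lambda>w. \<beta> w s - \<beta> w r) -` B \<inter> space \<nu> = cyl {s} (\<lambda>_. B)" by (auto simp: cyl_def)
    show "(\<lambda>w. \<beta> w s - \<beta> w r) -` B \<inter> space \<nu> \<in> E"
    proof (unfold e, rule EI[OF _ C(3), of _ "{s}" "\<lambda>_. B"])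
      show "cyl {s} (\<lambda>_. B) \<in> sets P" by (rule cylm) (use s B in auto)
    qed (use s B in \<open>auto simp: cyl_def\<close>)
  qed
  have betaQ: "(\<lambda>w. \<beta> w s) \<in> borel_measurable Q" if s: "s \<in> {0..1}" for s
  proof (cases "s \<le> r")
    case False
    have "(\<lambda>w. (\<beta> w s - \<beta> w r) + \<beta> w r) \<in> borel_measurable Q"
      using False s r by (intro borel_measurable_add futQ pastQ) auto
    then show ?thesis by simp
  qed (use pastQ s in auto)
  have "sets P \<subseteq> sets Q"
  proof -
    \<comment> \<open>The filtration of \<beta> at time 1 is all of \<open>sets P\<close>, so it is
      enough that \<beta> is measurable for the generated algebra.\<close>
    have "sets P = sets (natural_filtration \<nu> \<beta> 1)" using sets_F1 same_filtration[of 1] by simp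
    also have "\<dots> \<subseteq> sets Q"
      unfolding sets_nf
    proof (rule sets.sigma_sets_subset[of _ Q, unfolded spaceQ], safe)
      fix s B assume "s \<in> {0..1::real}" "B \<in> sets (borel :: (real, 'n) vec measure)"
      then show "(\<lambda>w. \<beta> w s) -` B \<inter> space \<nu> \<in> sets Q" using measurable_sets[OF betaQ] by simp
    qed (rule nullQ)
    finally show ?thesis .
  qed
  moreover have "sets Q \<subseteq> sets P"
    unfolding setsQ by (rule sets.sigma_sets_subset[of _ P, unfolded space_completion]) (auto simp: E_def)
  ultimately have PQ: "sets P = sigma_sets (space \<nu>) E" using setsQ by simp
  have null1: "emeasure K1 A = emeasure K1 B" if "A \<in> sets P" "B \<in> sets P" "AE w in P. w \<in> A \<longleftrightarrow> w \<in> B" for A B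
    using that absolutely_continuous_AE[OF K(1) K(3) that(3)] K by (intro emeasure_eq_AE) auto
  have null2: "emeasure K2 A = emeasure K2 B" if "A \<in> sets P" "B \<in> sets P" "AE w in P. w \<in> A \<longleftrightarrow> w \<in> B" for A B
    using that absolutely_continuous_AE[OF K(2) K(4) that(3)] K by (intro emeasure_eq_AE) auto
  show ?thesis
  proof (rule measure_eqI_generator_eq[OF _ Esub, where A="\<lambda>_. space \<nu>"])
    show "Int_stable E"
    proof (rule Int_stableI)
      fix A A' assume "A \<in> E" "A' \<in> E"
      then obtain D T B D' T' B' where A: "A \<in> sets P" "D \<in> \<C>" "finite T" "T \<subseteq> {r..1}" "\<And>t. closed (B t)" "AE w in P. w \<in> A \<longleftrightarrow> w \<in> D \<inter> cyl T B"
        and A': "A' \<in> sets P" "D' \<in> \<C>" "finite T'" "T' \<subseteq> {r..1}" "\<And>t. closed (B' t)" "AE w in P. w \<in> A' \<longleftrightarrow> w \<in> D' \<inter> cyl T' B'"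
        unfolding E_def by blast
      define B'' where "B'' t = (if t \<in> T then B t else UNIV) \<inter> (if t \<in> T' then B' t else UNIV)" for t
      have c: "cyl T B \<inter> cyl T' B' = cyl (T \<union> T') B''" by (auto simp: cyl_def B''_def)
      show "A \<inter> A' \<in> E"
      proof (rule EI[of _ "D \<inter> D'" "T \<union> T'" B''])
        show "D \<inter> D' \<in> \<C>" using C(2) A(2) A'(2) by (rule Int_stableD)
        show "AE w in P. w \<in> A \<inter> A' \<longleftrightarrow> w \<in> D \<inter> D' \<inter> cyl (T \<union> T') B''"
          using A(6) A'(6) unfolding c[symmetric] by eventually_elim auto
      qed (use A A' in \<open>auto simp: B''_def\<close>)
    qed
    show "emeasure K1 A = emeasure K2 A" if inE: "A \<in> E" for A
    proof -
      obtain D T B where A: "A \<in> sets P" "D \<in> \<C>" "finite T" "T \<subseteq> {r..1}" "\<And>t. closed (B t)" "AE w in P. w \<in> A \<longleftrightarrow> w \<in> D \<inter> cyl T B"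
        using inE unfolding E_def by blast
      have m: "D \<inter> cyl T B \<in> sets P" by (rule sets.Int[OF subsetD[OF C(1) A(2)] cylm[OF A(3,4,5)]])
      have "emeasure K1 A = emeasure K1 (D \<inter> cyl T B)" by (rule null1[OF A(1) m A(6)])
      also have "\<dots> = emeasure K2 (D \<inter> cyl T B)" unfolding cyl_def by (rule eq[OF A(2-5)])
      also have "\<dots> = emeasure K2 A" by (rule null2[OF A(1) m A(6), symmetric])
      finally show ?thesis .
    qed
    show "sets K1 = sigma_sets (space \<nu>) E" "sets K2 = sigma_sets (space \<nu>) E" using K PQ by auto
    have "space \<nu> \<in> E"
      by (rule EI[OF _ C(3), of _ "{}" "\<lambda>_. {}"]) (auto simp: cyl_def)
    then show "range (\<lambda>_::nat. space \<nu>) \<subseteq> E" by auto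
    show "(\<Union>i::nat. space \<nu>) = space \<nu>" by simp
    show "emeasure K1 (space \<nu>) \<noteq> \<infinity>" for i :: nat by (rule fin)
  qed
qed

text \<open>\<open>simple_girsanov\<close> with the zero drift on the part of a grid that starts at
  \<open>r\<close>.\<close>

lemma increments_independent:
  fixes h :: "real \<Rightarrow> (real, 'n) vec \<Rightarrow> ennreal"
  assumes r: "0 \<le> r" "r \<le> 1" and Y: "Y \<in> borel_measurable (F r)"
    and T: "finite T" "T \<subseteq> {r..1}" and h: "\<And>t. h t \<in> borel_measurable borel"
  shows "(\<integral>\<^sup>+w. Y w * (\<Prod>t\<in>T. h t (\<beta> w t - \<beta> w r)) \<partial>P) = (\<integral>\<^sup>+w. Y w \<partial>P) * (\<integral>\<^sup>+w. (\<Prod>t\<in>T. h t (\<beta> w t - \<beta> w r)) \<partial>P)"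
proof -
  have T': "finite (insert r T)" "insert r T \<subseteq> {0..1}" using T r by auto
  obtain M t where g: "time_grid M t" "t 0 = 0" "t M = 1" and sub: "insert r T \<subseteq> t ` {..M}"
    by (rule ex_grid[OF T'])
  obtain a where a: "a \<le> M" "t a = r" using sub by auto
  define t' where "t' i = t (a + i)" for i
  define M' where "M' = M - a"
  have g': "time_grid M' t'"
    using g a grid_bounds[OF g(1), of a] time_gridD(3)[OF g(1)] by (auto simp: time_grid_def t'_def M'_def)
  have t'0: "t' 0 = r" by (simp add: t'_def a)
  have sub': "T \<subseteq> t' ` {..M'}"
  proof
    fix x assume x: "x \<in> T"
    then obtain i where i: "i \<le> M" "t i = x" using sub by auto
    have "t a \<le> t i" using x T(2) i a by auto
    then have "a \<le> i" using grid_less_iff[OF g(1), of i a] i a by (meson not_less)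
    then show "x \<in> t' ` {..M'}" using i by (intro image_eqI[of _ _ "i - a"]) (auto simp: t'_def M'_def)
  qed
  define h' where "h' i x = (if t' i \<in> T then h (t' i) x else 1)" for i x
  have h'm: "h' i \<in> borel_measurable borel" for i unfolding h'_def[abs_def] using h(1)[of "t' i"] by simp
  have prods: "(\<Prod>i\<le>M'. h' i (\<beta> w (t' i) - \<beta> w (t' 0))) = (\<Prod>x\<in>T. h x (\<beta> w x - \<beta> w r))" for w
  proof -
    have "(\<Prod>i\<le>M'. h' i (\<beta> w (t' i) - \<beta> w (t' 0))) = (\<Prod>i\<le>M'. if t' i \<in> T then h (t' i) (\<beta> w (t' i) - \<beta> w r) else 1)"
      by (intro prod.cong) (auto simp: h'_def t'0)
    then show ?thesis using prod_grid[OF g' sub', of "\<lambda>x. h x (\<beta> w x - \<beta> w r)"] by simp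
  qed
  have "(\<integral>\<^sup>+w. Y w * (\<Prod>k<M'. ennreal (grid_exp t' (\<lambda>_ _. 0) k w)) * (\<Prod>i\<le>M'. h' i (grid_shift t' (\<lambda>_ _. 0) i w)) \<partial>P)
      = (\<integral>\<^sup>+w. Y w \<partial>P) * (\<integral>\<^sup>+w. (\<Prod>i\<le>M'. h' i (\<beta> w (t' i) - \<beta> w (t' 0))) \<partial>P)"
    by (rule simple_girsanov[OF g' _ h'm]) (simp_all add: t'0 Y)
  moreover have "grid_shift t' (\<lambda>_ _. 0) i w = \<beta> w (t' i) - \<beta> w (t' 0)" for i w by (simp add: grid_shift_def)
  moreover have "grid_exp t' (\<lambda>_ _. 0) k w = 1" for k w by (simp add: grid_exp_def)
  ultimately show ?thesis using prods by simp
qed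

end

context adapted_shift
begin

lemma cm_path_u_measurable: "(\<lambda>w. cm_path (u w) t) \<in> borel_measurable P" if "t \<in> {0..1}"
proof -
  have "cm_path (u w) t = (LINT s:{0..t}|lborel. on_unit u w s)" for w
    unfolding cm_path_def set_lebesgue_integral_def
    using that by (intro Bochner_Integration.integral_cong) (auto simp: on_unit_def indicator_def)
  then show ?thesis
    using measurable_integral_time[of "on_unit u" "{0..t}"] joint_on_unit[OF u_L0] by (simp add: jointly_measurable_def)
qed

lemma X_measurable: "t \<in> {0..1} \<Longrightarrow> X t \<in> borel_measurable P"
  unfolding X_def[abs_def] by (intro borel_measurable_add beta_measurable_P cm_path_u_measurable)

lemma Xj_measurable:
  assumes ap: "approximates N s z" and t: "t \<in> {0..1}"
  shows "(\<lambda>w. Xj N s z j t w) \<in> borel_measurable P"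
proof -
  have "(\<lambda>w. cm_path (\<phi> N s z j w) t) \<in> borel_measurable P"
    unfolding cm_path_def using joint_simple_integrand[OF approxD(1)[OF ap]]
    by (intro measurable_integral_time) (auto simp: jointly_measurable_def)
  then show ?thesis by (intro borel_measurable_add beta_measurable_P t)
qed

text \<open>The difference of the integrands splits into a part controlled by the L1 distance of the
  densities and a part where bounded factors converge almost surely against the fixed integrable
  density \<rho>.\<close>

lemma weighted_limit:
  fixes h :: "real \<Rightarrow> (real, 'n) vec \<Rightarrow> real"
  assumes ap: "approximates N s z" and Y: "Y \<in> borel_measurable P" "\<And>w. 0 \<le> Y w" "\<And>w. Y w \<le> C"
    and r: "r \<in> {0..1}" and T: "finite T" "T \<subseteq> {0..1}"
    and hc: "\<And>t. continuous_on UNIV (h t)" and h01: "\<And>t x. 0 \<le> h t x \<and> h t x \<le> 1"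
  shows "(\<lambda>j. LINT w|P. Y w * rhoj N s z j w * (\<Prod>t\<in>T. h t (Xj N s z j t w - Xj N s z j r w)))
    \<longlonglongrightarrow> (LINT w|P. Y w * \<rho> w * (\<Prod>t\<in>T. h t (X t w - X r w)))"
proof -
  define G where "G j w = (\<Prod>t\<in>T. h t (Xj N s z j t w - Xj N s z j r w))" for j w
  define H where "H w = (\<Prod>t\<in>T. h t (X t w - X r w))" for w
  have hm: "h t \<in> borel_measurable borel" for t using hc by (rule borel_measurable_continuous_onI)
  have Gm[measurable]: "G j \<in> borel_measurable P" for j unfolding G_def[abs_def]
    using T r by (intro borel_measurable_prod measurable_compose[OF _ hm] borel_measurable_diff Xj_measurable[OF ap]) auto
  have Hm[measurable]: "H \<in> borel_measurable P" unfolding H_def[abs_def]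
    using T r by (intro borel_measurable_prod measurable_compose[OF _ hm] borel_measurable_diff X_measurable) auto
  note Y(1)[measurable] rhoj_measurable[OF ap, measurable] rho_measurable[OF ap, measurable]
  have G01: "0 \<le> G j w" "G j w \<le> 1" for j w unfolding G_def using h01 by (auto intro!: prod_nonneg prod_le_1)
  have H01: "0 \<le> H w" "H w \<le> 1" for w unfolding H_def using h01 by (auto intro!: prod_nonneg prod_le_1)
  have C0: "0 \<le> C" using Y(2)[of undefined] Y(3)[of undefined] by linarith
  have GH: "AE w in P. (\<lambda>j. G j w) \<longlonglongrightarrow> H w"
    using cm_path_tendsto[OF ap]
  proof eventually_elim
    case (elim w)
    show ?case unfolding G_def H_def X_def
    proof (intro tendsto_prod)
      fix t assume "t \<in> T"
      then have "(\<lambda>j. Xj N s z j t w - Xj N s z j r w) \<longlonglongrightarrow> (\<beta> w t + cm_path (u w) t) - (\<beta> w r + cm_path (u w) r)"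
        using elim T(2) r by (intro tendsto_diff tendsto_add tendsto_const) auto
      then show "(\<lambda>j. h t (Xj N s z j t w - Xj N s z j r w)) \<longlonglongrightarrow> h t (\<beta> w t + cm_path (u w) t - (\<beta> w r + cm_path (u w) r))"
        using hc[of t] by (intro continuous_on_tendsto_compose[OF hc]) auto
    qed
  qed
  have i1: "integrable P (\<lambda>w. C * \<bar>rhoj N s z j w - \<rho> w\<bar>)" for j
    using integrable_rhoj[OF ap, of j] integrable_rho by auto
  have i2: "integrable P (\<lambda>w. C * (\<rho> w * \<bar>G j w - H w\<bar>))" for j
  proof -
    have "integrable P (\<lambda>w. \<rho> w * \<bar>G j w - H w\<bar>)"
    proof (rule Bochner_Integration.integrable_bound[OF integrable_rho])
      show "AE w in P. norm (\<rho> w * \<bar>G j w - H w\<bar>) \<le> norm (\<rho> w)"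
      proof (rule AE_I2)
        fix w
        have "\<bar>G j w - H w\<bar> \<le> 1" using G01[of j w] H01[of w] by linarith
        then show "norm (\<rho> w * \<bar>G j w - H w\<bar>) \<le> norm (\<rho> w)" by (simp add: abs_mult mult_left_le)
      qed
    qed measurable
    then show ?thesis by simp
  qed
  have iY: "integrable P (\<lambda>w. Y w * wt w * g w)"
    if wt: "integrable P wt" "\<And>w. 0 \<le> wt w" and g: "g \<in> borel_measurable P" "\<And>w. 0 \<le> g w \<and> g w \<le> 1" for wt g :: "'n path \<Rightarrow> real"
  proof (rule Bochner_Integration.integrable_bound[of P "\<lambda>w. C * wt w"])
    show "integrable P (\<lambda>w. C * wt w)" using wt by simp
    have [measurable]: "wt \<in> borel_measurable P" "g \<in> borel_measurable P" using wt g by auto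
    show "(\<lambda>w. Y w * wt w * g w) \<in> borel_measurable P" by measurable
    show "AE w in P. norm (Y w * wt w * g w) \<le> norm (C * wt w)"
    proof (rule AE_I2)
      fix w
      have "Y w * wt w * g w \<le> C * wt w * 1"
        using Y(2,3)[of w] wt(2)[of w] g(2)[of w] C0 by (intro mult_mono) auto
      moreover have "0 \<le> Y w * wt w * g w" using Y(2) wt(2) g(2) by auto
      ultimately show "norm (Y w * wt w * g w) \<le> norm (C * wt w)" using C0 wt(2)[of w] by simp
    qed
  qed
  have ij: "integrable P (\<lambda>w. Y w * rhoj N s z j w * G j w)" for j
    using rhoj_pos[OF ap] G01 by (intro iY integrable_rhoj[OF ap]) (auto simp: less_imp_le)
  have ir: "integrable P (\<lambda>w. Y w * \<rho> w * H w)"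
    using rho_pos[OF ap] H01 by (intro iY integrable_rho) (auto simp: less_imp_le)
  have bound: "\<bar>(LINT w|P. Y w * rhoj N s z j w * G j w) - (LINT w|P. Y w * \<rho> w * H w)\<bar>
      \<le> C * (LINT w|P. \<bar>rhoj N s z j w - \<rho> w\<bar>) + (LINT w|P. C * (\<rho> w * \<bar>G j w - H w\<bar>))" for j
  proof -
    have "\<bar>(LINT w|P. Y w * rhoj N s z j w * G j w) - (LINT w|P. Y w * \<rho> w * H w)\<bar>
       = \<bar>LINT w|P. Y w * rhoj N s z j w * G j w - Y w * \<rho> w * H w\<bar>"
      using ij ir by simp
    also have "\<dots> \<le> (LINT w|P. \<bar>Y w * rhoj N s z j w * G j w - Y w * \<rho> w * H w\<bar>)"
      by (rule integral_abs_bound)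
    also have "\<dots> \<le> (LINT w|P. C * \<bar>rhoj N s z j w - \<rho> w\<bar> + C * (\<rho> w * \<bar>G j w - H w\<bar>))"
    proof (rule integral_mono)
      show "\<bar>Y w * rhoj N s z j w * G j w - Y w * \<rho> w * H w\<bar> \<le> C * \<bar>rhoj N s z j w - \<rho> w\<bar> + C * (\<rho> w * \<bar>G j w - H w\<bar>)" for w
      proof -
        have "Y w * rhoj N s z j w * G j w - Y w * \<rho> w * H w
           = Y w * ((rhoj N s z j w - \<rho> w) * G j w) + Y w * (\<rho> w * (G j w - H w))" by (simp add: algebra_simps)
        then have "\<bar>Y w * rhoj N s z j w * G j w - Y w * \<rho> w * H w\<bar>
           \<le> \<bar>Y w * ((rhoj N s z j w - \<rho> w) * G j w)\<bar> + \<bar>Y w * (\<rho> w * (G j w - H w))\<bar>" by linarith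
        also have "\<dots> = Y w * (\<bar>rhoj N s z j w - \<rho> w\<bar> * G j w) + Y w * (\<rho> w * \<bar>G j w - H w\<bar>)"
          using Y(2)[of w] G01[of j w] rho_pos[OF ap, of w] by (simp add: abs_mult)
        also have "\<dots> \<le> C * (\<bar>rhoj N s z j w - \<rho> w\<bar> * 1) + C * (\<rho> w * \<bar>G j w - H w\<bar>)"
          using Y(2,3)[of w] G01[of j w] rho_pos[OF ap, of w] C0 by (intro add_mono mult_mono) auto
        finally show ?thesis by simp
      qed
    qed (use ij ir i1 i2 in auto)
    also have "\<dots> = C * (LINT w|P. \<bar>rhoj N s z j w - \<rho> w\<bar>) + (LINT w|P. C * (\<rho> w * \<bar>G j w - H w\<bar>))"
      using i1[of j] i2[of j] by (subst Bochner_Integration.integral_add) auto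
    finally show ?thesis .
  qed
  have "(\<lambda>j. LINT w|P. C * (\<rho> w * \<bar>G j w - H w\<bar>)) \<longlonglongrightarrow> (LINT w|P. 0)"
  proof (rule Bochner_Integration.integral_dominated_convergence[where w="\<lambda>w. C * \<rho> w"])
    show "integrable P (\<lambda>w. C * \<rho> w)" using integrable_rho by simp
    show "AE w in P. (\<lambda>j. C * (\<rho> w * \<bar>G j w - H w\<bar>)) \<longlonglongrightarrow> 0"
      using GH
    proof eventually_elim
      case (elim w)
      then have "(\<lambda>j. \<bar>G j w - H w\<bar>) \<longlonglongrightarrow> 0" using LIM_zero tendsto_rabs_zero by blast
      then show ?case using tendsto_mult_right_zero by blast
    qed
    show "AE w in P. norm (C * (\<rho> w * \<bar>G j w - H w\<bar>)) \<le> C * \<rho> w" for j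
    proof (rule AE_I2)
      fix w
      have "\<bar>G j w - H w\<bar> \<le> 1" using G01[of j w] H01[of w] by linarith
      then have "C * (\<rho> w * \<bar>G j w - H w\<bar>) \<le> C * (\<rho> w * 1)"
        using C0 rho_pos[OF ap, of w] by (intro mult_left_mono) auto
      then show "norm (C * (\<rho> w * \<bar>G j w - H w\<bar>)) \<le> C * \<rho> w"
        using C0 rho_pos[OF ap, of w] by (simp add: abs_mult)
    qed
  qed measurable
  then have "(\<lambda>j. C * (LINT w|P. \<bar>rhoj N s z j w - \<rho> w\<bar>) + (LINT w|P. C * (\<rho> w * \<bar>G j w - H w\<bar>))) \<longlonglongrightarrow> C * 0 + 0"
    by (intro tendsto_add tendsto_mult tendsto_const rhoj_L1[OF ap]) simp
  then have "(\<lambda>j. \<bar>(LINT w|P. Y w * rhoj N s z j w * G j w) - (LINT w|P. Y w * \<rho> w * H w)\<bar>) \<longlonglongrightarrow> 0"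
    by (intro tendsto_sandwich[OF always_eventually[OF allI[OF abs_ge_zero]] always_eventually[OF allI[OF bound]] tendsto_const]) simp
  then show ?thesis unfolding G_def H_def using LIM_zero_cancel tendsto_rabs_zero_iff by blast
qed


section \<open>Composition with the shift modulo null sets\<close>

lemma U_space: "w \<in> space \<nu> \<Longrightarrow> U w \<in> space \<nu>"
  using U_adapted by (auto simp: adapted_path_map_def)

lemma U_coord: "t \<in> {0..1} \<Longrightarrow> (\<lambda>w. U w t) \<in> borel_measurable (F t)"
  using U_adapted by (auto simp: adapted_path_map_def)

lemma U_path[measurable]: "U \<in> P \<rightarrow>\<^sub>M path_algebra"
  unfolding path_algebra_def
proof (intro measurable_restrict_space2)
  show "U \<in> space P \<rightarrow> {w. continuous_on {0..1} w}"
    using U_space by (auto simp: space_nu space_path_algebra)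
  show "U \<in> P \<rightarrow>\<^sub>M Pi\<^sub>M {0..1} (\<lambda>_. borel)"
  proof (rule measurable_PiM_single')
    show "(\<lambda>w. U w i) \<in> borel_measurable P" if "i \<in> {0..1}" for i
      by (rule measurable_F_P[OF U_coord[OF that]])
    show "U \<in> space P \<rightarrow> (\<Pi>\<^sub>E i\<in>{0..1}. space borel)"
      using U_space by (auto simp: space_nu space_path_algebra PiE_def)
  qed
qed

lemma U_nu: "U \<in> P \<rightarrow>\<^sub>M \<nu>"
  unfolding measurable_cong_sets[OF refl sets_nu] by (rule U_path)

lemma rho_P[measurable]: "\<rho> \<in> borel_measurable P"
  using integrable_rho by (rule borel_measurable_integrable)

lemma rho_positive: "0 < \<rho> w"
  by (rule ex_approximation) (rule rho_pos)

lemma U_law_nn: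
  assumes g: "g \<in> borel_measurable \<nu>"
  shows "(\<integral>\<^sup>+w. ennreal (\<rho> w) * g (U w) \<partial>P) = (\<integral>\<^sup>+w. g w \<partial>P)"
proof -
  have g': "g \<in> borel_measurable path_algebra"
    using g unfolding measurable_cong_sets[OF sets_nu refl] .
  have id: "(\<lambda>w. w) \<in> P \<rightarrow>\<^sub>M path_algebra"
    by (rule measurable_F_P[OF id_measurable_F1])
  have D: "U \<in> girsanov_measure \<nu> \<beta> u \<rightarrow>\<^sub>M path_algebra"
    unfolding girsanov_measure_def using U_path by simp
  have "(\<integral>\<^sup>+w. g w \<partial>P) = (\<integral>\<^sup>+w. g w \<partial>(distr P path_algebra (\<lambda>w. w)))"
    using g' by (intro nn_integral_distr[OF id, symmetric]) simp
  also have "\<dots> = (\<integral>\<^sup>+w. g w \<partial>(distr (girsanov_measure \<nu> \<beta> u) path_algebra U))"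
    by (simp only: U_law)
  also have "\<dots> = (\<integral>\<^sup>+w. g (U w) \<partial>(girsanov_measure \<nu> \<beta> u))"
    using g' by (intro nn_integral_distr[OF D]) simp
  also have "\<dots> = (\<integral>\<^sup>+w. ennreal (\<rho> w) * g (U w) \<partial>P)"
    unfolding girsanov_measure_def
    by (rule nn_integral_density[OF _ measurable_compose[OF U_path g']]) measurable
  finally show ?thesis by simp
qed

text \<open>The image of \<open>\<rho> \<nu>\<close> under \<open>U\<close> is \<nu>. Since \<rho>
  is strictly positive, a set negligible for \<nu> is then negligible for the image of \<nu> as
  well. Hence composition with \<open>U\<close> respects equality almost everywhere.\<close>

lemma U_pullback_null:
  assumes N: "N \<in> null_sets \<nu>" shows "U -` N \<inter> space \<nu> \<in> null_sets P"
proof -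
  have m: "N \<in> sets \<nu>" using N by auto
  have "(\<integral>\<^sup>+w. ennreal (\<rho> w) * indicator N (U w) \<partial>P) = (\<integral>\<^sup>+w. indicator N w \<partial>P)"
    using m by (intro U_law_nn) simp
  also have "\<dots> = 0" using null_sets_completionI[OF N] m by (subst nn_integral_indicator) auto
  finally have z: "(\<integral>\<^sup>+w. ennreal (\<rho> w) * indicator N (U w) \<partial>P) = 0" .
  have [measurable]: "(\<lambda>w. indicator N (U w) :: ennreal) \<in> borel_measurable P"
    by (rule measurable_compose[OF U_nu]) (use m in simp)
  have "AE w in P. ennreal (\<rho> w) * indicator N (U w) = 0"
    using z by (subst (asm) nn_integral_0_iff_AE) auto
  then have "AE w in P. w \<notin> U -` N \<inter> space \<nu>"
  proof eventually_elim
    case (elim w)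
    then show ?case using rho_positive[of w] by (auto simp: indicator_def split: if_splits)
  qed
  moreover have "U -` N \<inter> space \<nu> \<in> sets P" using measurable_sets[OF U_nu m] by simp
  ultimately show ?thesis by (auto simp: completion.null_sets_iff_AE)
qed

lemma U_pullback_null_P:
  assumes N: "N \<in> null_sets P" shows "U -` N \<inter> space \<nu> \<in> null_sets P"
proof -
  obtain N' where N': "N' \<in> null_sets \<nu>" "N \<subseteq> N'" using N unfolding null_sets_completion_iff2 by blast
  show ?thesis
    by (rule completion.complete2[OF _ U_pullback_null[OF N'(1)]]) (use N'(2) in auto)
qed

lemma AE_U:
  assumes "AE w in P. Q w" shows "AE w in P. Q (U w)"
proof -
  obtain N where N: "{w \<in> space P. \<not> Q w} \<subseteq> N" "N \<in> null_sets P"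
    using assms by (auto elim!: AE_E simp: null_sets_def)
  show ?thesis
    using AE_not_in[OF U_pullback_null_P[OF N(2)]] AE_space
  proof eventually_elim
    case (elim w)
    then show ?case using N(1) U_space[of w] by auto
  qed
qed

text \<open>Besides events of the coordinates the generators contain null sets, for which
  \<open>U_pullback_null_P\<close> is used.\<close>

lemma U_FF: "U \<in> F r \<rightarrow>\<^sub>M F r" if r: "r \<le> 1"
proof -
  have "U -` A \<inter> space \<nu> \<in> sets (F r)"
    if A: "A \<in> {(\<lambda>w. w s) -` B \<inter> space \<nu> | s B. s \<in> {0..1} \<and> s \<le> r \<and> B \<in> sets borel} \<union> null_sets P" for A
    using A
  proof
    assume "A \<in> null_sets P"
    then show ?thesis by (intro null_sets_F U_pullback_null_P)
  next
    assume "A \<in> {(\<lambda>w. w s) -` B \<inter> space \<nu> | s B. s \<in> {0..1} \<and> s \<le> r \<and> B \<in> sets borel}"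
    then obtain s B where s: "s \<in> {0..1}" "s \<le> r" "B \<in> sets borel" and A: "A = (\<lambda>w. w s) -` B \<inter> space \<nu>" by blast
    have "(\<lambda>w. U w s) \<in> borel_measurable (F r)" by (rule measurable_F_mono[OF s(2) U_coord[OF s(1)]])
    from measurable_sets[OF this s(3)] have "(\<lambda>w. U w s) -` B \<inter> space \<nu> \<in> sets (F r)" by simp
    moreover have "U -` A \<inter> space \<nu> = (\<lambda>w. U w s) -` B \<inter> space \<nu>" using A U_space by auto
    ultimately show ?thesis by simp
  qed
  then have "U \<in> F r \<rightarrow>\<^sub>M sigma (space \<nu>) ({(\<lambda>w. w s) -` B \<inter> space \<nu> | s B. s \<in> {0..1} \<and> s \<le> r \<and> B \<in> sets borel} \<union> null_sets P)"
    using U_space by (intro measurable_measure_of natural_filtration_generator) auto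
  then show ?thesis by (simp add: natural_filtration_def)
qed

lemma U_PP[measurable]: "U \<in> P \<rightarrow>\<^sub>M P"
  using U_FF[of 1] unfolding measurable_cong_sets[OF sets_F1 sets_F1] by simp

lemma beta_U: "AE w in P. \<forall>t\<in>{0..1}. \<beta> (U w) t = X t w"
  using U_translates unfolding translates_to_def X_def .

text \<open>Limit of \<open>simple_identity_stopped\<close>, whose right-hand side does not depend
  on the approximation.\<close>

lemma stopped_closed_identity:
  assumes A: "A \<in> sets F\<tau>" and T: "finite T" "T \<subseteq> {0..1}" and B: "\<And>t. closed (B t)"
  shows "(LINT w|P. (indicator A w * \<rho> w) * (\<Prod>t\<in>T. indicator (B t) (X t w - X 0 w)))
       = (LINT w|P. indicator A w * (\<Prod>t\<in>T. indicator (B t) (\<beta> w t - \<beta> w 0)))"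
proof -
  obtain N s z where ap: "approximates N s z" by (rule ex_approximation)
  have Am[measurable]: "A \<in> sets P" by (rule sets_F\<tau>_P[OF A])
  have 1: "integrable P (\<lambda>w. indicator A w * \<rho> w)"
    using integrable_mult_indicator[OF Am integrable_rho] by simp
  have 2: "integrable P (\<lambda>w. indicator A w :: real)" by (simp add: emeasure_eq_measure)
  note bm = beta_measurable_P
  have z01: "(0::real) \<in> {0..1}" by simp
  have bd: "(\<lambda>w. \<beta> w t - \<beta> w 0) \<in> borel_measurable P" if "t \<in> T" for t
    using that T by (intro borel_measurable_diff bm) auto
  have Xd: "(\<lambda>w. X t w - X 0 w) \<in> borel_measurable P" if "t \<in> T" for t
    using that T by (intro borel_measurable_diff X_measurable) auto
  have Xjd: "(\<lambda>w. Xj N s z j t w - Xj N s z j 0 w) \<in> borel_measurable P" if "t \<in> T" for t j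
    using that T by (intro borel_measurable_diff Xj_measurable[OF ap]) auto
  show ?thesis
  proof (rule test_functions_to_closed_sets[OF 1 2 T(1) Xd bd _ B])
    fix h :: "real \<Rightarrow> (real, 'n) vec \<Rightarrow> real"
    assume hc: "\<And>t. continuous_on UNIV (h t)" and h01: "\<And>t x. 0 \<le> h t x \<and> h t x \<le> 1"
    have hm: "h t \<in> borel_measurable borel" for t using hc by (rule borel_measurable_continuous_onI)
    have eq: "(LINT w|P. indicator A w * rhoj N s z j w * (\<Prod>t\<in>T. h t (Xj N s z j t w - Xj N s z j 0 w)))
       = (LINT w|P. indicator A w * (\<Prod>t\<in>T. h t (\<beta> w t - \<beta> w 0)))" for j
    proof -
      have m1: "(\<lambda>w. indicator A w * rhoj N s z j w * (\<Prod>t\<in>T. h t (Xj N s z j t w - Xj N s z j 0 w))) \<in> borel_measurable P"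
        by (intro borel_measurable_times borel_measurable_prod measurable_compose[OF Xjd hm] rhoj_measurable[OF ap] borel_measurable_indicator Am) auto
      have m2: "(\<lambda>w. indicator A w * (\<Prod>t\<in>T. h t (\<beta> w t - \<beta> w 0))) \<in> borel_measurable P"
        by (intro borel_measurable_times borel_measurable_prod measurable_compose[OF bd hm] borel_measurable_indicator Am) auto
      have n: "0 \<le> (\<Prod>t\<in>T. h t (y t))" for y using h01 by (auto intro!: prod_nonneg)
      have pe: "(\<Prod>t\<in>T. ennreal (h t (y t))) = ennreal (\<Prod>t\<in>T. h t (y t))" for y using h01 by (auto intro!: prod_ennreal)
      have r0: "0 \<le> rhoj N s z j w" for w using rhoj_pos[OF ap, of j w] by simp
      have I: "(\<integral>\<^sup>+w. indicator A w * ennreal (rhoj N s z j w) * (\<Prod>t\<in>T. ennreal (h t (Xj N s z j t w - Xj N s z j 0 w))) \<partial>P)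
         = (\<integral>\<^sup>+w. indicator A w * (\<Prod>t\<in>T. ennreal (h t (\<beta> w t - \<beta> w 0))) \<partial>P)"
        by (rule simple_identity_stopped[OF ap A T]) (use hm h01 in auto)
      have "(LINT w|P. indicator A w * rhoj N s z j w * (\<Prod>t\<in>T. h t (Xj N s z j t w - Xj N s z j 0 w)))
         = enn2real (\<integral>\<^sup>+w. ennreal (indicator A w * rhoj N s z j w * (\<Prod>t\<in>T. h t (Xj N s z j t w - Xj N s z j 0 w))) \<partial>P)"
        using n r0 by (intro integral_eq_nn_integral m1) auto
      also have "\<dots> = enn2real (\<integral>\<^sup>+w. indicator A w * ennreal (rhoj N s z j w) * (\<Prod>t\<in>T. ennreal (h t (Xj N s z j t w - Xj N s z j 0 w))) \<partial>P)"
        using n r0 by (simp only: pe ennreal_mult ennreal_indicator zero_le_mult_iff indicator_pos_le simp_thms)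
      also have "\<dots> = enn2real (\<integral>\<^sup>+w. ennreal (indicator A w * (\<Prod>t\<in>T. h t (\<beta> w t - \<beta> w 0))) \<partial>P)"
        unfolding I using n by (simp only: pe ennreal_mult ennreal_indicator zero_le_mult_iff indicator_pos_le simp_thms)
      also have "\<dots> = (LINT w|P. indicator A w * (\<Prod>t\<in>T. h t (\<beta> w t - \<beta> w 0)))"
        using n by (intro integral_eq_nn_integral[symmetric] m2) auto
      finally show ?thesis .
    qed
    have "(\<lambda>j. LINT w|P. indicator A w * rhoj N s z j w * (\<Prod>t\<in>T. h t (Xj N s z j t w - Xj N s z j 0 w)))
      \<longlonglongrightarrow> (LINT w|P. indicator A w * \<rho> w * (\<Prod>t\<in>T. h t (X t w - X 0 w)))"
      by (rule weighted_limit[OF ap _ _ _ z01 T hc h01, where C=1]) auto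
    then show "(LINT w|P. indicator A w * \<rho> w * (\<Prod>t\<in>T. h t (X t w - X 0 w)))
       = (LINT w|P. indicator A w * (\<Prod>t\<in>T. h t (\<beta> w t - \<beta> w 0)))"
      unfolding eq using LIMSEQ_unique tendsto_const by blast
  qed
qed

text \<open>Limit of \<open>simple_identity_future\<close>. It expresses that under
  \<open>\<rho> \<nu>\<close> the increments of \<open>X\<close> after \<open>r\<close> are
  independent of \<open>F r\<close> and have the law of Brownian increments.\<close>

lemma future_closed_identity:
  assumes Y: "Y \<in> borel_measurable (F r)" "\<And>w. 0 \<le> Y w" "\<And>w. Y w \<le> C"
    and r: "0 \<le> r" "r \<le> 1" and T: "finite T" "T \<subseteq> {r..1}" and B: "\<And>t. closed (B t)"
  shows "(LINT w|P. (Y w * \<rho> w) * (\<Prod>t\<in>T. indicator (B t) (X t w - X r w)))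
       = (LINT w|P. Y w * \<rho> w) * (LINT w|P. (\<Prod>t\<in>T. indicator (B t) (\<beta> w t - \<beta> w r)))"
proof -
  obtain N s z where ap: "approximates N s z" by (rule ex_approximation)
  have YP[measurable]: "Y \<in> borel_measurable P" by (rule measurable_F_P[OF Y(1)])
  have 1: "integrable P (\<lambda>w. Y w * \<rho> w)"
  proof (rule Bochner_Integration.integrable_bound)
    show "integrable P (\<lambda>w. C * \<rho> w)" using integrable_rho by simp
    show "AE w in P. norm (Y w * \<rho> w) \<le> norm (C * \<rho> w)"
    proof (rule AE_I2)
      fix w have "0 \<le> C" using Y(2,3)[of undefined] by simp
      then show "norm (Y w * \<rho> w) \<le> norm (C * \<rho> w)"
        using Y(2,3)[of w] rho_positive[of w] by (simp add: abs_mult mult_right_mono)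
    qed
  qed measurable
  define L where "L = (LINT w|P. Y w * \<rho> w)"
  have 2: "integrable P (\<lambda>w. L)" by simp
  have r01: "r \<in> {0..1}" and T01: "T \<subseteq> {0..1}" using r T by auto
  have bd: "(\<lambda>w. \<beta> w t - \<beta> w r) \<in> borel_measurable P" if "t \<in> T" for t
    using that T01 r by (intro borel_measurable_diff beta_measurable_P) auto
  have Xd: "(\<lambda>w. X t w - X r w) \<in> borel_measurable P" if "t \<in> T" for t
    using that T01 r by (intro borel_measurable_diff X_measurable) auto
  have Xjd: "(\<lambda>w. Xj N s z j t w - Xj N s z j r w) \<in> borel_measurable P" if "t \<in> T" for t j
    using that T01 r by (intro borel_measurable_diff Xj_measurable[OF ap]) auto
  have "(LINT w|P. (Y w * \<rho> w) * (\<Prod>t\<in>T. indicator (B t) (X t w - X r w)))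
       = (LINT w|P. L * (\<Prod>t\<in>T. indicator (B t) (\<beta> w t - \<beta> w r)))"
  proof (rule test_functions_to_closed_sets[OF 1 2 T(1) Xd bd _ B])
    fix h :: "real \<Rightarrow> (real, 'n) vec \<Rightarrow> real"
    assume hc: "\<And>t. continuous_on UNIV (h t)" and h01: "\<And>t x. 0 \<le> h t x \<and> h t x \<le> 1"
    have hm: "h t \<in> borel_measurable borel" for t using hc by (rule borel_measurable_continuous_onI)
    have eq: "(LINT w|P. Y w * rhoj N s z j w * (\<Prod>t\<in>T. h t (Xj N s z j t w - Xj N s z j r w)))
       = (LINT w|P. Y w * rhoj N s z j w) * (LINT w|P. (\<Prod>t\<in>T. h t (\<beta> w t - \<beta> w r)))" for j
    proof -
      have m0: "(\<lambda>w. Y w * rhoj N s z j w) \<in> borel_measurable P"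
        by (intro borel_measurable_times rhoj_measurable[OF ap] YP)
      have m1: "(\<lambda>w. Y w * rhoj N s z j w * (\<Prod>t\<in>T. h t (Xj N s z j t w - Xj N s z j r w))) \<in> borel_measurable P"
        by (intro borel_measurable_times borel_measurable_prod measurable_compose[OF Xjd hm] rhoj_measurable[OF ap] YP) auto
      have m2: "(\<lambda>w. (\<Prod>t\<in>T. h t (\<beta> w t - \<beta> w r))) \<in> borel_measurable P"
        by (intro borel_measurable_times borel_measurable_prod measurable_compose[OF bd hm] ) auto
      have n: "0 \<le> (\<Prod>t\<in>T. h t (y t))" for y using h01 by (auto intro!: prod_nonneg)
      have pe: "(\<Prod>t\<in>T. ennreal (h t (y t))) = ennreal (\<Prod>t\<in>T. h t (y t))" for y using h01 by (auto intro!: prod_ennreal)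
      have r0: "0 \<le> rhoj N s z j w" for w using rhoj_pos[OF ap, of j w] by simp
      have I: "(\<integral>\<^sup>+w. ennreal (Y w) * ennreal (rhoj N s z j w) * (\<Prod>t\<in>T. ennreal (h t (Xj N s z j t w - Xj N s z j r w))) \<partial>P)
         = (\<integral>\<^sup>+w. ennreal (Y w) * ennreal (rhoj N s z j w) \<partial>P) * (\<integral>\<^sup>+w. (\<Prod>t\<in>T. ennreal (h t (\<beta> w t - \<beta> w r))) \<partial>P)"
        by (rule simple_identity_future[OF ap r _ T]) (use hm Y in auto)
      have "(LINT w|P. Y w * rhoj N s z j w * (\<Prod>t\<in>T. h t (Xj N s z j t w - Xj N s z j r w)))
         = enn2real (\<integral>\<^sup>+w. ennreal (Y w * rhoj N s z j w * (\<Prod>t\<in>T. h t (Xj N s z j t w - Xj N s z j r w))) \<partial>P)"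
        using n r0 Y(2) by (intro integral_eq_nn_integral m1) auto
      also have "\<dots> = enn2real (\<integral>\<^sup>+w. ennreal (Y w) * ennreal (rhoj N s z j w) * (\<Prod>t\<in>T. ennreal (h t (Xj N s z j t w - Xj N s z j r w))) \<partial>P)"
        using n r0 Y(2) by (simp only: pe ennreal_mult zero_le_mult_iff simp_thms)
      also have "\<dots> = enn2real (\<integral>\<^sup>+w. ennreal (Y w * rhoj N s z j w) \<partial>P) * enn2real (\<integral>\<^sup>+w. ennreal (\<Prod>t\<in>T. h t (\<beta> w t - \<beta> w r)) \<partial>P)"
        unfolding I using r0 Y(2) by (simp only: pe ennreal_mult enn2real_mult)
      also have "\<dots> = (LINT w|P. Y w * rhoj N s z j w) * (LINT w|P. (\<Prod>t\<in>T. h t (\<beta> w t - \<beta> w r)))"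
        using n r0 Y(2) by (intro arg_cong2[where f="(*)"] integral_eq_nn_integral[symmetric] m2 m0) auto
      finally show ?thesis .
    qed
    have "(\<lambda>j. LINT w|P. Y w * rhoj N s z j w * (\<Prod>t\<in>T. h t (Xj N s z j t w - Xj N s z j r w)))
      \<longlonglongrightarrow> (LINT w|P. Y w * \<rho> w * (\<Prod>t\<in>T. h t (X t w - X r w)))"
      by (rule weighted_limit[OF ap YP Y(2,3) r01 T(1) T01 hc h01])
    \<comment> \<open>The empty set of test times gives the convergence of the masses.\<close>
    moreover have "(\<lambda>j. LINT w|P. Y w * rhoj N s z j w * (\<Prod>t\<in>{}. h t (Xj N s z j t w - Xj N s z j r w)))
      \<longlonglongrightarrow> (LINT w|P. Y w * \<rho> w * (\<Prod>t\<in>{}. h t (X t w - X r w)))"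
      by (rule weighted_limit[OF ap YP Y(2,3) r01 _ _ hc h01]) auto
    then have "(\<lambda>j. (LINT w|P. Y w * rhoj N s z j w) * (LINT w|P. (\<Prod>t\<in>T. h t (\<beta> w t - \<beta> w r))))
      \<longlonglongrightarrow> L * (LINT w|P. (\<Prod>t\<in>T. h t (\<beta> w t - \<beta> w r)))"
      unfolding L_def by (intro tendsto_mult tendsto_const) simp
    ultimately have "(LINT w|P. Y w * \<rho> w * (\<Prod>t\<in>T. h t (X t w - X r w)))
       = L * (LINT w|P. (\<Prod>t\<in>T. h t (\<beta> w t - \<beta> w r)))"
      unfolding eq using LIMSEQ_unique by blast
    then show "(LINT w|P. Y w * \<rho> w * (\<Prod>t\<in>T. h t (X t w - X r w)))
       = (LINT w|P. L * (\<Prod>t\<in>T. h t (\<beta> w t - \<beta> w r)))" by simp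
  qed
  then show ?thesis unfolding L_def by simp
qed


section \<open>Weighted images of the measure under the shift\<close>

lemma weighted_image:
  assumes wt: "wt \<in> borel_measurable P" and g: "g \<in> borel_measurable P"
  shows "(\<integral>\<^sup>+w. g w \<partial>(distr (density P wt) P U)) = (\<integral>\<^sup>+w. wt w * g (U w) \<partial>P)"
proof -
  have "(\<integral>\<^sup>+w. g w \<partial>(distr (density P wt) P U)) = (\<integral>\<^sup>+w. g (U w) \<partial>(density P wt))"
    using g U_PP by (intro nn_integral_distr) simp_all
  also have "\<dots> = (\<integral>\<^sup>+w. wt w * g (U w) \<partial>P)"
    by (rule nn_integral_density[OF wt measurable_compose[OF U_PP g]])
  finally show ?thesis .
qed

lemma weighted_image_sets:
  assumes wt: "wt \<in> borel_measurable P" and A: "A \<in> sets P"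
  shows "emeasure (distr (density P wt) P U) A = (\<integral>\<^sup>+w. wt w * indicator A (U w) \<partial>P)"
  using weighted_image[OF wt, of "indicator A"] A by simp

lemma weighted_image_ac:
  assumes wt: "wt \<in> borel_measurable P"
  shows "absolutely_continuous P (distr (density P wt) P U)"
  unfolding absolutely_continuous_def
proof
  fix N assume N: "N \<in> null_sets P"
  have "(\<integral>\<^sup>+w. wt w * indicator N (U w) \<partial>P) = (\<integral>\<^sup>+w. 0 \<partial>P)"
  proof (rule nn_integral_cong_AE)
    show "AE w in P. wt w * indicator N (U w) = 0"
      using AE_U[OF AE_not_in[OF N]] by eventually_elim simp
  qed
  then have "emeasure (distr (density P wt) P U) N = 0"
    using weighted_image_sets[OF wt null_setsD2[OF N]] by simp
  then show "N \<in> null_sets (distr (density P wt) P U)" using N by (intro null_setsI) auto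
qed

lemma density_ac: "wt \<in> borel_measurable P \<Longrightarrow> absolutely_continuous P (density P wt)"
  by (intro absolutely_continuousI_density)

lemma cylinder_sets:
  assumes r: "0 \<le> r" "r \<le> 1" and T: "finite T" "T \<subseteq> {r..1}" and B: "\<And>t. closed (B t)"
  shows "{w \<in> space \<nu>. \<forall>t\<in>T. \<beta> w t - \<beta> w r \<in> B t} \<in> sets P"
proof -
  have "{w \<in> space P. \<beta> w t - \<beta> w r \<in> B t} \<in> sets P" if t: "t \<in> T" for t
  proof -
    have "(\<lambda>w. \<beta> w t - \<beta> w r) \<in> borel_measurable P"
      using t T r by (intro borel_measurable_diff beta_measurable_P) auto
    from measurable_sets[OF this borel_closed[OF B[of t]]]
    show ?thesis by (simp add: vimage_def Int_def conj_commute)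
  qed
  then have "{w \<in> space P. \<forall>t\<in>T. \<beta> w t - \<beta> w r \<in> B t} \<in> sets P"
    by (rule sets.sets_Collect_finite_All[OF _ T(1)])
  then show ?thesis by simp
qed

lemma prod_indicator_measurable:
  assumes "\<And>t. t \<in> T \<Longrightarrow> V t \<in> borel_measurable P" "\<And>t. closed (B t)"
  shows "(\<lambda>w. (\<Prod>t\<in>T. indicator (B t) (V t w)) :: real) \<in> borel_measurable P"
  by (rule borel_measurable_prod)
    (rule measurable_compose[OF assms(1) borel_measurable_indicator[OF borel_closed[OF assms(2)]]])

lemma cylinder_indicator:
  assumes "finite T"
  shows "(indicator {w \<in> space \<nu>. \<forall>t\<in>T. \<beta> w t - \<beta> w r \<in> B t} w :: real) = indicator (space \<nu>) w * (\<Prod>t\<in>T. indicator (B t) (\<beta> w t - \<beta> w r))"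
  using assms by (induction T) (auto simp: indicator_def)

text \<open>\<open>measure_eq_on_increments\<close> with \<open>r = 0\<close>, the required identity
  on cylinders being \<open>stopped_closed_identity\<close>. As the drift starts after \<tau>, the
  weight may contain any set of \<open>F\<tau>\<close>.\<close>

lemma stopped_law:
  assumes A: "A \<in> sets F\<tau>" and g: "g \<in> borel_measurable P"
  shows "(\<integral>\<^sup>+w. indicator A w * ennreal (\<rho> w) * g (U w) \<partial>P) = (\<integral>\<^sup>+w. indicator A w * g w \<partial>P)"
proof -
  have Am[measurable]: "A \<in> sets P" by (rule sets_F\<tau>_P[OF A])
  let ?wt = "\<lambda>w. indicator A w * ennreal (\<rho> w)"
  have wt: "?wt \<in> borel_measurable P" by measurable
  have v: "(indicator A :: _ \<Rightarrow> ennreal) \<in> borel_measurable P" by measurable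
  let ?K1 = "distr (density P ?wt) P U" and ?K2 = "density P (indicator A)"
  have r0: "0 \<le> (0::real)" "(0::real) \<le> 1" by auto
  have "?K1 = ?K2"
  proof (rule measure_eq_on_increments[OF r0, where \<C>="{space \<nu>, {}}"])
    show "{space \<nu>, {}} \<subseteq> sets P" using sets.top[of P] by auto
    show "Int_stable {space \<nu>, {}}" by (auto simp: Int_stable_def)
    show "space \<nu> \<in> {space \<nu>, {}}" by simp
    \<comment> \<open>The past at time 0 is trivial because \<beta> starts at 0 almost
      surely.\<close>
    show "\<exists>C\<in>{space \<nu>, {}}. AE w in P. (w \<in> C) = (\<beta> w s \<in> B)" if "0 \<le> s" "s \<le> 0" for s and B :: "(real, 'n) vec set"
    proof -
      have s: "s = 0" using that by simp
      show ?thesis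
      proof (cases "0 \<in> B")
        case True
        have "AE w in P. (w \<in> space \<nu>) = (\<beta> w s \<in> B)"
          using beta_0 AE_space by eventually_elim (simp add: s True)
        then show ?thesis by blast
      next
        case False
        have "AE w in P. (w \<in> {}) = (\<beta> w s \<in> B)"
          using beta_0 by eventually_elim (simp add: s False)
        then show ?thesis by blast
      qed
    qed
    show "absolutely_continuous P ?K1" by (rule weighted_image_ac[OF wt])
    show "absolutely_continuous P ?K2" by (rule density_ac[OF v])
    show "emeasure ?K1 (space \<nu>) \<noteq> \<infinity>"
    proof -
      have s: "space \<nu> \<in> sets P" using sets.top[of P] by simp
      have "emeasure ?K1 (space \<nu>) \<le> (\<integral>\<^sup>+w. ennreal (\<rho> w) \<partial>P)"
        unfolding weighted_image_sets[OF wt s] by (intro nn_integral_mono) (auto simp: indicator_def)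
      also have "\<dots> = 1" by (rule ex_approximation) (rule nn_integral_rho)
      finally have "emeasure ?K1 (space \<nu>) \<le> 1" .
      then show ?thesis by (auto simp: top_unique)
    qed
    fix C and T :: "real set" and B :: "real \<Rightarrow> (real, 'n) vec set"
    assume C: "C \<in> {space \<nu>, {}}" and T: "finite T" "T \<subseteq> {0..1}" and B: "\<And>t. closed (B t)"
    let ?c = "{w \<in> space \<nu>. \<forall>t\<in>T. \<beta> w t - \<beta> w 0 \<in> B t}"
    have cm: "?c \<in> sets P" by (rule cylinder_sets[OF r0 T B])
    have "emeasure ?K1 ?c = emeasure ?K2 ?c"
    proof -
      have cU[measurable]: "(\<lambda>w. indicator ?c (U w) :: real) \<in> borel_measurable P"
        by (rule measurable_compose[OF U_PP]) (use cm in simp)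
      have "emeasure ?K1 ?c = (\<integral>\<^sup>+w. ?wt w * indicator ?c (U w) \<partial>P)" by (rule weighted_image_sets[OF wt cm])
      also have "\<dots> = (\<integral>\<^sup>+w. ennreal (indicator A w * \<rho> w * indicator ?c (U w)) \<partial>P)"
        using rho_positive by (intro nn_integral_cong) (simp add: ennreal_mult less_imp_le ennreal_indicator)
      also have "\<dots> = ennreal (LINT w|P. indicator A w * \<rho> w * indicator ?c (U w))"
      proof (rule nn_integral_eq_integral)
        show "integrable P (\<lambda>w. indicator A w * \<rho> w * indicator ?c (U w))"
          by (rule Bochner_Integration.integrable_bound[OF integrable_rho]) (measurable, auto simp: indicator_def)
        show "AE w in P. 0 \<le> indicator A w * \<rho> w * indicator ?c (U w)" using rho_positive by (auto simp: less_imp_le)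
      qed
      also have "(LINT w|P. indicator A w * \<rho> w * indicator ?c (U w))
         = (LINT w|P. (indicator A w * \<rho> w) * (\<Prod>t\<in>T. indicator (B t) (X t w - X 0 w)))"
      proof (rule Bochner_Integration.integral_cong_AE)
        have "(\<lambda>w. X t w - X 0 w) \<in> borel_measurable P" if "t \<in> T" for t
          using that T by (intro borel_measurable_diff X_measurable) auto
        then show "(\<lambda>w. (indicator A w * \<rho> w) * (\<Prod>t\<in>T. indicator (B t) (X t w - X 0 w))) \<in> borel_measurable P"
          by (intro borel_measurable_times prod_indicator_measurable borel_measurable_indicator Am rho_P B)
        show "AE w in P. indicator A w * \<rho> w * indicator ?c (U w) = (indicator A w * \<rho> w) * (\<Prod>t\<in>T. indicator (B t) (X t w - X 0 w))"
          using beta_U AE_space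
        proof eventually_elim
          case (elim w)
          have "(\<Prod>t\<in>T. indicator (B t) (\<beta> (U w) t - \<beta> (U w) 0)) = (\<Prod>t\<in>T. indicator (B t) (X t w - X 0 w) :: real)"
            using elim(1) T(2) by (intro prod.cong) auto
          then show ?case using elim(2) U_space[of w] by (simp add: cylinder_indicator[OF T(1)])
        qed
      qed measurable
      also have "\<dots> = (LINT w|P. indicator A w * (\<Prod>t\<in>T. indicator (B t) (\<beta> w t - \<beta> w 0)))"
        by (rule stopped_closed_identity[OF A T B])
      also have "\<dots> = (LINT w|P. indicator (A \<inter> ?c) w)"
      proof (rule Bochner_Integration.integral_cong[OF refl])
        fix w assume "w \<in> space P"
        then show "indicator A w * (\<Prod>t\<in>T. indicator (B t) (\<beta> w t - \<beta> w 0)) = (indicator (A \<inter> ?c) w :: real)"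
          unfolding indicator_inter_arith cylinder_indicator[OF T(1)] by simp
      qed
      also have "ennreal \<dots> = emeasure P (A \<inter> ?c)"
        using Am cm sets.sets_into_space[OF Am] by (simp add: emeasure_eq_measure Int_absorb2 inf.coboundedI1 del: emeasure_completion)
      also have "\<dots> = emeasure ?K2 ?c"
        using Am cm by (simp add: emeasure_density indicator_inter_arith[symmetric] del: emeasure_completion)
      finally show ?thesis .
    qed
    then show "emeasure ?K1 (C \<inter> ?c) = emeasure ?K2 (C \<inter> ?c)"
      using C by (elim insertE) (auto simp: Int_absorb1 inf.absorb2)
  qed simp_all
  then have "(\<integral>\<^sup>+w. g w \<partial>?K1) = (\<integral>\<^sup>+w. g w \<partial>?K2)" by simp
  then show ?thesis unfolding weighted_image[OF wt g] nn_integral_density[OF v g] .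
qed

text \<open>The case of the whole space in \<open>stopped_law\<close>; unlike
  \<open>U_law_nn\<close> it covers functions that are measurable for the completion only.\<close>

lemma U_law_P:
  assumes g: "g \<in> borel_measurable P"
  shows "(\<integral>\<^sup>+w. ennreal (\<rho> w) * g (U w) \<partial>P) = (\<integral>\<^sup>+w. g w \<partial>P)"
proof -
  have "space P \<in> sets F\<tau>" using subalgebra_F\<tau> sets.top[of F\<tau>] by (simp add: subalgebra_def)
  from stopped_law[OF this g]
  have "(\<integral>\<^sup>+w. indicator (space P) w * ennreal (\<rho> w) * g (U w) \<partial>P) = (\<integral>\<^sup>+w. indicator (space P) w * g w \<partial>P)" .
  moreover have "(\<integral>\<^sup>+w. indicator (space P) w * ennreal (\<rho> w) * g (U w) \<partial>P) = (\<integral>\<^sup>+w. ennreal (\<rho> w) * g (U w) \<partial>P)"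
    by (intro nn_integral_cong) simp
  moreover have "(\<integral>\<^sup>+w. indicator (space P) w * g w \<partial>P) = (\<integral>\<^sup>+w. g w \<partial>P)"
    by (intro nn_integral_cong) simp
  ultimately show ?thesis by simp
qed

text \<open>Testing \<open>stopped_law\<close> with the complement of \<open>A\<close> shows that
  \<open>U\<close> carries almost no point of \<open>A\<close> out of \<open>A\<close>; the
  complement is treated alike. A shift by a drift that starts after \<tau> leaves
  \<open>F\<tau>\<close> untouched.\<close>

lemma stopped_set_invariant:
  assumes A: "A \<in> sets F\<tau>" shows "AE w in P. U w \<in> A \<longleftrightarrow> w \<in> A"
proof -
  have *: "AE w in P. w \<in> A \<longrightarrow> U w \<in> A" if A: "A \<in> sets F\<tau>" for A
  proof -
    have Am[measurable]: "A \<in> sets P" by (rule sets_F\<tau>_P[OF A])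
    let ?B = "space P - A"
    have Bm[measurable]: "?B \<in> sets P" by measurable
    have UB[measurable]: "(\<lambda>w. indicator ?B (U w) :: ennreal) \<in> borel_measurable P"
      by (rule measurable_compose[OF U_PP]) measurable
    have "(\<integral>\<^sup>+w. indicator A w * ennreal (\<rho> w) * indicator ?B (U w) \<partial>P) = (\<integral>\<^sup>+w. indicator A w * indicator ?B w \<partial>P)"
      by (rule stopped_law[OF A]) measurable
    also have "\<dots> = (\<integral>\<^sup>+w. 0 \<partial>P)" by (intro nn_integral_cong) (auto simp: indicator_def)
    finally have "(\<integral>\<^sup>+w. indicator A w * ennreal (\<rho> w) * indicator ?B (U w) \<partial>P) = 0" by simp
    then have "AE w in P. indicator A w * ennreal (\<rho> w) * indicator ?B (U w) = 0"
      by (subst (asm) nn_integral_0_iff_AE) measurable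
    then show ?thesis using AE_space
    proof eventually_elim
      case (elim w)
      then show ?case using rho_positive[of w] U_space[of w] by (auto simp: indicator_def split: if_splits)
    qed
  qed
  have sp: "space F\<tau> = space P" using subalgebra_F\<tau> by (simp add: subalgebra_def)
  have "space F\<tau> - A \<in> sets F\<tau>" using A by blast
  from *[OF this] *[OF A] show ?thesis using AE_space
  proof eventually_elim
    case (elim w)
    then show ?case using U_space[of w] unfolding sp by auto
  qed
qed

text \<open>Equality is tested on the countably many level sets at rational heights.\<close>

lemma stopped_function_invariant:
  fixes Z :: "'n path \<Rightarrow> real"
  assumes Z: "Z \<in> borel_measurable F\<tau>" shows "AE w in P. Z (U w) = Z w"
proof -
  have sp: "space F\<tau> = space P" using subalgebra_F\<tau> by (simp add: subalgebra_def)
  have "AE w in P. \<forall>q::rat. U w \<in> {w \<in> space P. Z w < of_rat q} \<longleftrightarrow> w \<in> {w \<in> space P. Z w < of_rat q}"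
  proof (subst AE_all_countable, rule allI, rule stopped_set_invariant)
    fix q :: rat
    show "{w \<in> space P. Z w < of_rat q} \<in> sets F\<tau>"
      using borel_measurable_less[OF Z borel_measurable_const[of "of_rat q"]] unfolding sp .
  qed
  then show ?thesis using AE_space
  proof eventually_elim
    case (elim w)
    then have q: "Z (U w) < of_rat q \<longleftrightarrow> Z w < of_rat q" for q using U_space[of w] by auto
    show ?case
    proof (rule ccontr)
      assume "Z (U w) \<noteq> Z w"
      then consider "Z (U w) < Z w" | "Z w < Z (U w)" by linarith
      then show False using q of_rat_dense by cases (metis less_asym)+
    qed
  qed
qed

text \<open>Under \<open>\<rho> \<nu>\<close> the increments of \<open>\<beta> \<circ> U\<close>
  after \<open>r\<close> are independent of \<open>F r\<close>. So once the image of
  \<open>\<xi> \<rho> \<nu>\<close> under \<open>U\<close> has been described on \<open>F r\<close>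
  by a density, the future increments contribute the same factor as under \<nu>, and this density is
  valid on the whole algebra. In other words, conditioning on \<open>U\<close> turns an
  \<open>F r\<close>-measurable variable into an \<open>F r\<close>-measurable function of
  \<open>U\<close>.\<close>

lemma immersion_nonneg:
  assumes \<xi>: "\<xi> \<in> borel_measurable (F r)" "\<And>w. 0 \<le> \<xi> w" "\<And>w. \<xi> w \<le> c" and r: "0 \<le> r" "r \<le> 1"
  obtains q where "q \<in> borel_measurable (F r)" "\<And>w. 0 \<le> q w" "\<And>w. q w \<le> c"
    "\<And>g. g \<in> borel_measurable P \<Longrightarrow> (\<integral>\<^sup>+w. ennreal (\<xi> w * \<rho> w) * g (U w) \<partial>P) = (\<integral>\<^sup>+w. ennreal (q w) * g w \<partial>P)"
proof -
  have c: "0 \<le> c" using \<xi>(2,3)[of undefined] by simp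
  have \<xi>P[measurable]: "\<xi> \<in> borel_measurable P" by (rule measurable_F_P[OF \<xi>(1)])
  let ?wt = "\<lambda>w. ennreal (\<xi> w * \<rho> w)"
  have wt: "?wt \<in> borel_measurable P" by measurable
  have w_le: "?wt w \<le> ennreal c * ennreal (\<rho> w)" for w
    using \<xi>(2,3)[of w] rho_positive[of w] c by (simp add: ennreal_mult[symmetric] ennreal_leI mult_right_mono)
  let ?K1 = "distr (density P ?wt) P U"
  have sP: "space \<nu> \<in> sets P" using sets.top[of P] by simp
  have K1_le: "emeasure ?K1 A \<le> ennreal c * emeasure P A" if A: "A \<in> sets P" for A
  proof -
    have "emeasure ?K1 A \<le> (\<integral>\<^sup>+w. ennreal c * (ennreal (\<rho> w) * indicator A (U w)) \<partial>P)"
      unfolding weighted_image_sets[OF wt A] mult.assoc[symmetric] by (intro nn_integral_mono mult_right_mono w_le) auto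
    also have "\<dots> = ennreal c * (\<integral>\<^sup>+w. ennreal (\<rho> w) * indicator A (U w) \<partial>P)"
      by (intro nn_integral_cmult borel_measurable_times_ennreal measurable_compose[OF U_PP]) (use A in auto)
    also have "(\<integral>\<^sup>+w. ennreal (\<rho> w) * indicator A (U w) \<partial>P) = emeasure P A"
      using A by (subst U_law_P) auto
    finally show ?thesis .
  qed
  define p where "p = RN_deriv P ?K1"
  have pm[measurable]: "p \<in> borel_measurable P" by (simp add: p_def)
  have K1p: "density P p = ?K1"
    unfolding p_def by (rule density_RN_deriv[OF weighted_image_ac[OF wt]]) simp
  interpret sfs: sigma_finite_subalgebra P "F r"
    by (rule finite_measure_subalgebra_is_sigma_finite[OF finite_measure_subalgebra.intro[OF finite_measure_axioms finite_measure_subalgebra_axioms.intro[OF subalg]]])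
  \<comment> \<open>The image measure has a density \<open>p\<close> on the whole algebra. Its
    projection to \<open>F r\<close> is the candidate; that it already determines the image measure
    is the point of the proof.\<close>
  define q0 where "q0 = nn_cond_exp P (F r) p"
  have q0m: "q0 \<in> borel_measurable (F r)" by (simp add: q0_def)
  have q0P[measurable]: "q0 \<in> borel_measurable P" by (rule measurable_F_P[OF q0m])
  have q0_int: "(\<integral>\<^sup>+w. h w * q0 w \<partial>P) = (\<integral>\<^sup>+w. h w \<partial>?K1)" if h: "h \<in> borel_measurable (F r)" for h
  proof -
    have "(\<integral>\<^sup>+w. h w * q0 w \<partial>P) = (\<integral>\<^sup>+w. h w * p w \<partial>P)"
      unfolding q0_def by (rule sfs.nn_cond_exp_intg[OF h pm])
    also have "\<dots> = (\<integral>\<^sup>+w. h w \<partial>density P p)"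
      by (subst nn_integral_density[OF pm measurable_F_P[OF h]]) (simp add: mult.commute)
    finally show ?thesis unfolding K1p .
  qed
  \<comment> \<open>The image measure is at most \<open>c\<close> times \<nu>, because
    \<open>\<rho> \<nu>\<close> has image \<nu>; so its density is at most \<open>c\<close>.\<close>
  have q0_le: "AE w in P. q0 w \<le> ennreal c"
  proof -
    define D where "D = {w \<in> space (F r). ennreal c < q0 w}"
    have D: "D \<in> sets (F r)" unfolding D_def using q0m by measurable
    have DP[measurable]: "D \<in> sets P" by (rule sets_F_P[OF D])
    have "ennreal c * emeasure P D + (\<integral>\<^sup>+w. indicator D w * (q0 w - ennreal c) \<partial>P)
       = (\<integral>\<^sup>+w. ennreal c * indicator D w + indicator D w * (q0 w - ennreal c) \<partial>P)"
      by (subst nn_integral_add, measurable, simp add: nn_integral_cmult_indicator del: emeasure_completion)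
    also have "\<dots> = (\<integral>\<^sup>+w. indicator D w * q0 w \<partial>P)"
      by (intro nn_integral_cong) (auto simp: D_def indicator_def add_diff_inverse_ennreal diff_add_cancel_ennreal less_imp_le add.commute split: if_splits)
    also have "\<dots> = emeasure ?K1 D"
      using D DP by (subst q0_int) (auto intro!: nn_integral_indicator)
    also have "\<dots> \<le> ennreal c * emeasure P D + 0" using K1_le[OF DP] by simp
    finally have "ennreal c * emeasure P D + (\<integral>\<^sup>+w. indicator D w * (q0 w - ennreal c) \<partial>P) \<le> ennreal c * emeasure P D + 0" .
    moreover have "ennreal c * emeasure P D \<noteq> top" unfolding emeasure_eq_measure by (simp add: ennreal_mult[symmetric] c)
    ultimately have "(\<integral>\<^sup>+w. indicator D w * (q0 w - ennreal c) \<partial>P) = 0"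
      unfolding ennreal_add_left_cancel_le infinity_ennreal_def by (simp only: simp_thms le_zero_eq)
    then have "AE w in P. indicator D w * (q0 w - ennreal c) = 0"
      by (subst (asm) nn_integral_0_iff_AE) measurable
    then show ?thesis using AE_space
    proof eventually_elim
      case (elim w)
      then show ?case by (cases "w \<in> D") (auto simp: D_def not_less diff_eq_0_iff_ennreal)
    qed
  qed
  have K1: "?K1 = density P q0"
  proof (rule measure_eq_on_increments[OF r, where \<C>="sets (F r)"])
    show "sets (F r) \<subseteq> sets P" by (auto intro: sets_F_P)
    show "Int_stable (sets (F r))" by (auto simp: Int_stable_def)
    show "space \<nu> \<in> sets (F r)" using sets.top[of "F r"] by simp
    show "\<exists>C\<in>sets (F r). AE w in P. (w \<in> C) = (\<beta> w s \<in> B)" if "0 \<le> s" "s \<le> r" "closed B" for s B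
    proof
      have "(\<lambda>w. \<beta> w s) \<in> borel_measurable (F r)" using that r by (intro measurable_beta) auto
      from measurable_sets[OF this borel_closed[OF that(3)]]
      show "(\<lambda>w. \<beta> w s) -` B \<inter> space \<nu> \<in> sets (F r)" by simp
      show "AE w in P. (w \<in> (\<lambda>w. \<beta> w s) -` B \<inter> space \<nu>) = (\<beta> w s \<in> B)"
        using AE_space by eventually_elim simp
    qed
    show "absolutely_continuous P ?K1" by (rule weighted_image_ac[OF wt])
    show "absolutely_continuous P (density P q0)" by (rule density_ac[OF q0P])
    show "emeasure ?K1 (space \<nu>) \<noteq> \<infinity>"
      using K1_le[OF sP] by (auto simp: top_unique)
    fix C and T :: "real set" and B :: "real \<Rightarrow> (real, 'n) vec set"
    assume C: "C \<in> sets (F r)" and T: "finite T" "T \<subseteq> {r..1}" and B: "\<And>t. closed (B t)"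
    let ?c = "{w \<in> space \<nu>. \<forall>t\<in>T. \<beta> w t - \<beta> w r \<in> B t}"
    \<comment> \<open>Since \<open>U\<close> is adapted, the past set \<open>C\<close> pulled back
      by \<open>U\<close> can be moved into the \<open>F r\<close>-measurable weight.\<close>
    let ?Y = "\<lambda>w. \<xi> w * indicator C (U w)"
    have CP: "C \<in> sets P" by (rule sets_F_P[OF C])
    have cm: "?c \<in> sets P" by (rule cylinder_sets[OF r T B])
    have Y: "?Y \<in> borel_measurable (F r)"
      using C by (intro borel_measurable_times \<xi>(1) measurable_compose[OF U_FF[OF r(2)]]) auto
    have Yb: "0 \<le> ?Y w" "?Y w \<le> c" for w using \<xi>(2,3)[of w] c by (auto simp: indicator_def)
    have [measurable]: "?Y \<in> borel_measurable P" by (rule measurable_F_P[OF Y])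
    have cU[measurable]: "(\<lambda>w. indicator ?c (U w) :: real) \<in> borel_measurable P"
      by (rule measurable_compose[OF U_PP]) (use cm in simp)
    have iY: "integrable P (\<lambda>w. ?Y w * \<rho> w * h w)" if h: "h \<in> borel_measurable P" "\<And>w. 0 \<le> h w" "\<And>w. h w \<le> 1" for h :: "'n path \<Rightarrow> real"
    proof (rule Bochner_Integration.integrable_bound)
      show "integrable P (\<lambda>w. c * \<rho> w)" using integrable_rho by simp
      show "(\<lambda>w. ?Y w * \<rho> w * h w) \<in> borel_measurable P" using h(1) by measurable
      show "AE w in P. norm (?Y w * \<rho> w * h w) \<le> norm (c * \<rho> w)"
      proof (rule AE_I2)
        fix w
        have "?Y w * \<rho> w * h w \<le> c * \<rho> w * 1"
          using Yb[of w] rho_positive[of w] h(2,3)[of w] c by (intro mult_mono) auto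
        moreover have "0 \<le> ?Y w * \<rho> w * h w" using Yb(1)[of w] rho_positive[of w] h(2)[of w] by simp
        ultimately show "norm (?Y w * \<rho> w * h w) \<le> norm (c * \<rho> w)"
          using c rho_positive[of w] by (simp only: real_norm_def abs_of_nonneg mult_nonneg_nonneg less_imp_le)
      qed
    qed
    have i1: "integrable P (\<lambda>w. ?Y w * \<rho> w)" using iY[of "\<lambda>_. 1"] by simp
    have nY: "0 \<le> ?Y w * \<rho> w" for w using Yb(1)[of w] rho_positive[of w] by simp
    have a: "ennreal (LINT w|P. ?Y w * \<rho> w) = (\<integral>\<^sup>+w. indicator C w * q0 w \<partial>P)"
    proof -
      have "ennreal (LINT w|P. ?Y w * \<rho> w) = (\<integral>\<^sup>+w. ennreal (?Y w * \<rho> w) \<partial>P)"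
        using nY by (intro nn_integral_eq_integral[symmetric] i1) auto
      also have "\<dots> = (\<integral>\<^sup>+w. ?wt w * indicator C (U w) \<partial>P)"
        by (intro nn_integral_cong) (auto simp: indicator_def)
      also have "\<dots> = emeasure ?K1 C" by (rule weighted_image_sets[OF wt CP, symmetric])
      also have "\<dots> = (\<integral>\<^sup>+w. indicator C w * q0 w \<partial>P)"
        using C CP by (subst q0_int) (auto intro!: nn_integral_indicator[symmetric])
      finally show ?thesis .
    qed
    have bd: "(\<lambda>w. \<beta> w t - \<beta> w r) \<in> borel_measurable P" if "t \<in> T" for t
      using that T r by (intro borel_measurable_diff beta_measurable_P) auto
    have b: "ennreal (LINT w|P. (\<Prod>t\<in>T. indicator (B t) (\<beta> w t - \<beta> w r))) = (\<integral>\<^sup>+w. (\<Prod>t\<in>T. indicator (B t) (\<beta> w t - \<beta> w r)) \<partial>P)"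
    proof -
      have "integrable P (\<lambda>w. (\<Prod>t\<in>T. indicator (B t) (\<beta> w t - \<beta> w r) :: real))"
      proof (rule integrable_const_bound[where B=1])
        show "AE w in P. norm (\<Prod>t\<in>T. indicator (B t) (\<beta> w t - \<beta> w r) :: real) \<le> 1"
          unfolding real_norm_def abs_prod by (intro AE_I2 prod_le_1) (simp add: indicator_def)
      qed (rule prod_indicator_measurable[OF bd B])
      from nn_integral_eq_integral[OF this] show ?thesis
        by (simp add: prod_nonneg prod_ennreal[symmetric] ennreal_indicator)
    qed
    have "emeasure ?K1 (C \<inter> ?c) = (\<integral>\<^sup>+w. ?wt w * indicator (C \<inter> ?c) (U w) \<partial>P)"
      using CP cm by (intro weighted_image_sets[OF wt]) auto
    also have "\<dots> = (\<integral>\<^sup>+w. ennreal (?Y w * \<rho> w * indicator ?c (U w)) \<partial>P)"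
      by (intro nn_integral_cong) (auto simp: indicator_def)
    also have "\<dots> = ennreal (LINT w|P. ?Y w * \<rho> w * indicator ?c (U w))"
      using nY by (intro nn_integral_eq_integral iY cU) (auto simp: indicator_def)
    also have "(LINT w|P. ?Y w * \<rho> w * indicator ?c (U w))
         = (LINT w|P. (?Y w * \<rho> w) * (\<Prod>t\<in>T. indicator (B t) (X t w - X r w)))"
    proof (rule Bochner_Integration.integral_cong_AE)
      have "(\<lambda>w. X t w - X r w) \<in> borel_measurable P" if "t \<in> T" for t
        using that T r by (intro borel_measurable_diff X_measurable) auto
      then have "(\<lambda>w. (\<Prod>t\<in>T. indicator (B t) (X t w - X r w)) :: real) \<in> borel_measurable P"
        by (intro prod_indicator_measurable B)
      then show "(\<lambda>w. (?Y w * \<rho> w) * (\<Prod>t\<in>T. indicator (B t) (X t w - X r w))) \<in> borel_measurable P"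
        by measurable
      show "AE w in P. ?Y w * \<rho> w * indicator ?c (U w) = (?Y w * \<rho> w) * (\<Prod>t\<in>T. indicator (B t) (X t w - X r w))"
        using beta_U AE_space
      proof eventually_elim
        case (elim w)
        have "(\<Prod>t\<in>T. indicator (B t) (\<beta> (U w) t - \<beta> (U w) r)) = (\<Prod>t\<in>T. indicator (B t) (X t w - X r w) :: real)"
          using elim(1) T(2) r by (intro prod.cong) auto
        then show ?case using elim(2) U_space[of w] by (simp add: cylinder_indicator[OF T(1)])
      qed
    qed measurable
    also have "\<dots> = (LINT w|P. ?Y w * \<rho> w) * (LINT w|P. (\<Prod>t\<in>T. indicator (B t) (\<beta> w t - \<beta> w r)))"
      by (rule future_closed_identity[OF Y Yb r T B])
    also have "ennreal \<dots> = (\<integral>\<^sup>+w. indicator C w * q0 w \<partial>P) * (\<integral>\<^sup>+w. (\<Prod>t\<in>T. indicator (B t) (\<beta> w t - \<beta> w r)) \<partial>P)"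
      unfolding a[symmetric] b[symmetric] using nY by (intro ennreal_mult Bochner_Integration.integral_nonneg prod_nonneg) auto
    also have "\<dots> = (\<integral>\<^sup>+w. indicator C w * q0 w * (\<Prod>t\<in>T. indicator (B t) (\<beta> w t - \<beta> w r)) \<partial>P)"
      using C q0m B by (intro increments_independent[OF r _ T, symmetric] borel_measurable_times_ennreal borel_measurable_indicator borel_closed) auto
    also have "\<dots> = (\<integral>\<^sup>+w. q0 w * indicator (C \<inter> ?c) w \<partial>P)"
    proof (rule nn_integral_cong)
      fix w assume s: "w \<in> space P"
      have "(\<Prod>t\<in>T. indicator (B t) (\<beta> w t - \<beta> w r)) = (indicator ?c w :: ennreal)"
      proof -
        have "ennreal (\<Prod>t\<in>T. indicator (B t) (\<beta> w t - \<beta> w r)) = ennreal (indicator ?c w)"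
          using s by (simp add: cylinder_indicator[OF T(1)])
        then show ?thesis by (simp add: prod_ennreal[symmetric] ennreal_indicator)
      qed
      then show "indicator C w * q0 w * (\<Prod>t\<in>T. indicator (B t) (\<beta> w t - \<beta> w r)) = q0 w * indicator (C \<inter> ?c) w"
        by (simp add: indicator_inter_arith mult_ac)
    qed
    also have "\<dots> = emeasure (density P q0) (C \<inter> ?c)"
      using CP cm by (intro emeasure_density[symmetric] q0P) auto
    finally show "emeasure ?K1 (C \<inter> ?c) = emeasure (density P q0) (C \<inter> ?c)" .
  qed simp_all
  \<comment> \<open>Values above \<open>c\<close> occur on a null set only; they are cut off to have
    real values and the bounds everywhere.\<close>
  define q where "q w = enn2real (min (q0 w) (ennreal c))" for w
  show ?thesis
  proof (rule that[of q])
    show "q \<in> borel_measurable (F r)" unfolding q_def using q0m by measurable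
    show "0 \<le> q w" for w by (simp add: q_def)
    show "q w \<le> c" for w
      unfolding q_def using enn2real_mono[of "min (q0 w) (ennreal c)" "ennreal c"] c by simp
    fix g :: "'n path \<Rightarrow> ennreal" assume g: "g \<in> borel_measurable P"
    have "AE w in P. ennreal (q w) = q0 w"
      using q0_le
    proof eventually_elim
      case (elim w)
      have "q0 w < top" using elim by (rule order_le_less_trans) simp
      then show ?case using elim by (simp add: q_def min_absorb1)
    qed
    then have "(\<integral>\<^sup>+w. ennreal (q w) * g w \<partial>P) = (\<integral>\<^sup>+w. q0 w * g w \<partial>P)"
      by (intro nn_integral_cong_AE) auto
    also have "\<dots> = (\<integral>\<^sup>+w. g w \<partial>density P q0)" by (rule nn_integral_density[OF q0P g, symmetric])
    also have "\<dots> = (\<integral>\<^sup>+w. ?wt w * g (U w) \<partial>P)" unfolding K1[symmetric] by (rule weighted_image[OF wt g])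
    finally show "(\<integral>\<^sup>+w. ennreal (\<xi> w * \<rho> w) * g (U w) \<partial>P) = (\<integral>\<^sup>+w. ennreal (q w) * g w \<partial>P)" by simp
  qed
qed

end

section \<open>Projection onto the shifted path\<close>

lemma cm_path_increment:
  fixes f :: "real \<Rightarrow> (real, 'n::finite) vec"
  assumes f: "set_integrable lborel {0..1} f" and ab: "0 \<le> a" "a \<le> b" "b \<le> 1"
  shows "(LINT r:{a<..b}|lborel. f r) = cm_path f b - cm_path f a"
proof -
  have i: "set_integrable lborel {0..a} f" "set_integrable lborel {a<..b} f"
    using ab by (auto intro: set_integrable_subset[OF f])
  have "{0..b} = {0..a} \<union> {a<..b}" "{0..a} \<inter> {a<..b} = {}" using ab by auto
  then have "cm_path f b = cm_path f a + (LINT r:{a<..b}|lborel. f r)"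
    unfolding cm_path_def using set_integral_Un[OF _ i] by simp
  then show ?thesis by simp
qed

text \<open>The cross term between a step function and \<open>f\<close> involves \<open>f\<close>
  only through increments of its primitive. This is the form in which \<open>u\<close> can be
  compared with \<beta> and \<open>X\<close>.\<close>

lemma energy_simple_diff:
  fixes f :: "real \<Rightarrow> (real, 'n::finite) vec"
  assumes f: "set_integrable lborel {0..1} f" and f2: "set_integrable lborel {0..1} (\<lambda>r. (norm (f r))\<^sup>2)"
    and g: "time_grid N s" "s 0 = 0" "s N = 1"
  shows "energy (\<lambda>r. simple_drift N s y w r - f r) = energy f
     - 2 * (\<Sum>k<N. y k w \<bullet> (cm_path f (s (Suc k)) - cm_path f (s k)))
     + (\<Sum>k<N. (s (Suc k) - s k) * (norm (y k w))\<^sup>2)"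
proof -
  let ?S = "simple_drift N s y w"
  have cell: "set_integrable lborel {s k<..s (Suc k)} f" if "k < N" for k
    using grid_bounds[OF g(1), of k] grid_bounds[OF g(1), of "Suc k"] that by (intro set_integrable_subset[OF f]) auto
  have cell_sub: "{s k<..s (Suc k)} \<subseteq> {0..1}" if "k < N" for k
    using grid_bounds[OF g(1), of k] grid_bounds[OF g(1), of "Suc k"] that by auto
  have eq: "indicator {0..1} r *\<^sub>R (?S r \<bullet> f r) = (\<Sum>k<N. y k w \<bullet> (indicator {s k<..s (Suc k)} r *\<^sub>R f r))" for r
  proof -
    have "indicator {0..1} r *\<^sub>R (?S r \<bullet> f r) = (\<Sum>k<N. indicator {0..1} r *\<^sub>R ((if s k < r \<and> r \<le> s (Suc k) then y k w else 0) \<bullet> f r))"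
      by (simp add: simple_drift_def inner_sum_left sum_distrib_left)
    also have "\<dots> = (\<Sum>k<N. y k w \<bullet> (indicator {s k<..s (Suc k)} r *\<^sub>R f r))"
    proof (rule sum.cong[OF refl])
      fix k assume "k \<in> {..<N}"
      then show "indicator {0..1} r *\<^sub>R ((if s k < r \<and> r \<le> s (Suc k) then y k w else 0) \<bullet> f r) = y k w \<bullet> (indicator {s k<..s (Suc k)} r *\<^sub>R f r)"
        using cell_sub[of k] by (auto simp: indicator_def)
    qed
    finally show ?thesis .
  qed
  have ic: "integrable lborel (\<lambda>r. y k w \<bullet> (indicator {s k<..s (Suc k)} r *\<^sub>R f r))" if "k \<in> {..<N}" for k
    using cell that unfolding set_integrable_def by (intro integrable_inner_right) auto
  have i1: "set_integrable lborel {0..1} (\<lambda>r. ?S r \<bullet> f r)"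
    unfolding set_integrable_def eq by (rule Bochner_Integration.integrable_sum[OF ic])
  have "(LINT r:{0..1}|lborel. ?S r \<bullet> f r) = (\<Sum>k<N. LINT r|lborel. y k w \<bullet> (indicator {s k<..s (Suc k)} r *\<^sub>R f r))"
    unfolding set_lebesgue_integral_def eq by (rule Bochner_Integration.integral_sum[OF ic])
  also have "\<dots> = (\<Sum>k<N. y k w \<bullet> (cm_path f (s (Suc k)) - cm_path f (s k)))"
  proof (rule sum.cong[OF refl])
    fix k assume k: "k \<in> {..<N}"
    have "(LINT r|lborel. y k w \<bullet> (indicator {s k<..s (Suc k)} r *\<^sub>R f r)) = y k w \<bullet> (LINT r:{s k<..s (Suc k)}|lborel. f r)"
      using cell[of k] k unfolding set_integrable_def set_lebesgue_integral_def by (intro integral_inner_right) auto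
    also have "(LINT r:{s k<..s (Suc k)}|lborel. f r) = cm_path f (s (Suc k)) - cm_path f (s k)"
      using k grid_bounds[OF g(1), of k] grid_bounds[OF g(1), of "Suc k"] time_gridD(3)[OF g(1), of k]
      by (intro cm_path_increment[OF f]) auto
    finally show "(LINT r|lborel. y k w \<bullet> (indicator {s k<..s (Suc k)} r *\<^sub>R f r)) = y k w \<bullet> (cm_path f (s (Suc k)) - cm_path f (s k))" .
  qed
  finally have inner: "(LINT r:{0..1}|lborel. ?S r \<bullet> f r) = (\<Sum>k<N. y k w \<bullet> (cm_path f (s (Suc k)) - cm_path f (s k)))" .
  have S2: "set_integrable lborel {0..1} (\<lambda>r. (norm (?S r))\<^sup>2)"
  proof -
    have b: "norm (?S r) \<le> (\<Sum>k<N. norm (y k w))" for r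
      unfolding simple_drift_def by (intro order_trans[OF norm_sum] sum_mono) auto
    show ?thesis
      unfolding set_integrable_def
    proof (rule integrableI_bounded_set[where A="{0..1}" and B="(\<Sum>k<N. norm (y k w))\<^sup>2"])
      show "AE r in lborel. r \<in> {0..1} \<longrightarrow> norm (indicator {0..1} r *\<^sub>R (norm (?S r))\<^sup>2) \<le> (\<Sum>k<N. norm (y k w))\<^sup>2"
        using b by (auto intro!: AE_I2 power_mono simp: abs_mult)
    qed auto
  qed
  have n: "(norm (a - b))\<^sup>2 = (norm a)\<^sup>2 - 2 * (a \<bullet> b) + (norm b)\<^sup>2" for a b :: "(real, 'n) vec"
    by (simp add: power2_norm_eq_inner inner_diff_left inner_diff_right inner_commute)
  have i2: "set_integrable lborel {0..1} (\<lambda>r. 2 * (?S r \<bullet> f r))" using i1 by simp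
  have "energy (\<lambda>r. ?S r - f r) = (LINT r:{0..1}|lborel. ((norm (?S r))\<^sup>2 - 2 * (?S r \<bullet> f r)) + (norm (f r))\<^sup>2)"
    unfolding energy_def n ..
  also have "\<dots> = energy ?S - 2 * (LINT r:{0..1}|lborel. ?S r \<bullet> f r) + energy f"
    unfolding energy_def using S2 i2 f2 by (simp add: set_integral_add set_integral_diff)
  finally show ?thesis using energy_grid[OF g, of y w] unfolding inner by simp
qed

text \<open>The function \<psi> expresses that the Girsanov density depends on the path only through
  \<open>U\<close>; positivity at every path allows division by it.\<close>

locale adapted_shift_density = adapted_shift \<nu> \<beta> \<tau> u U
  for \<nu> :: "('n::finite) path measure" and \<beta> :: "'n path \<Rightarrow> 'n path"
    and \<tau> :: "'n path \<Rightarrow> real" and u :: "'n drift" and U :: "'n path \<Rightarrow> 'n path" +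
  fixes \<psi> :: "'n path \<Rightarrow> real"
  assumes \<psi>[measurable]: "\<psi> \<in> borel_measurable P" and \<psi>_pos: "\<And>w. 0 < \<psi> w"
    and rho_\<psi>: "AE w in P. \<rho> w = \<psi> (U w)"
begin

text \<open>\<open>immersion_nonneg\<close> is a projection with respect to
  \<open>\<rho> \<nu>\<close>. Testing it with \<open>h / \<psi>\<close> cancels \<rho>, which is
  \<open>\<psi> \<circ> U\<close>, and gives the projection with respect to \<nu> by the same
  function.\<close>

lemma projection_real:
  fixes \<xi> :: "'n path \<Rightarrow> real"
  assumes \<xi>: "\<xi> \<in> borel_measurable (F r)" "\<And>w. \<bar>\<xi> w\<bar> \<le> c" and r: "0 \<le> r" "r \<le> 1"
  obtains q where "q \<in> borel_measurable (F r)" "\<And>w. \<bar>q w\<bar> \<le> c"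
    "\<And>g. g \<in> borel_measurable P \<Longrightarrow> integrable P (\<lambda>w. g (U w)) \<Longrightarrow> (LINT w|P. \<xi> w * g (U w)) = (LINT w|P. q (U w) * g (U w))"
proof -
  have \<xi>P[measurable]: "\<xi> \<in> borel_measurable P" by (rule measurable_F_P[OF \<xi>(1)])
  have b1: "0 \<le> \<xi> w + c" "\<xi> w + c \<le> 2 * c" for w using \<xi>(2)[of w] by auto
  have c: "0 \<le> c" using \<xi>(2)[of undefined] by simp
  have m: "(\<lambda>w. \<xi> w + c) \<in> borel_measurable (F r)" using \<xi>(1) by simp
  \<comment> \<open>Nonnegativity is arranged by adding \<open>c\<close>; the constant is subtracted
    again at the end.\<close>
  obtain q where q: "q \<in> borel_measurable (F r)" "\<And>w. 0 \<le> q w" "\<And>w. q w \<le> 2 * c"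
    and qI: "\<And>g. g \<in> borel_measurable P \<Longrightarrow> (\<integral>\<^sup>+w. ennreal ((\<xi> w + c) * \<rho> w) * g (U w) \<partial>P) = (\<integral>\<^sup>+w. ennreal (q w) * g w \<partial>P)"
    by (rule immersion_nonneg[OF m b1 r]) (rule that)
  have qP[measurable]: "q \<in> borel_measurable P" by (rule measurable_F_P[OF q(1)])
  have qU[measurable]: "(\<lambda>w. q (U w)) \<in> borel_measurable P" by (rule measurable_compose[OF U_PP qP])
  have key: "(\<integral>\<^sup>+w. ennreal (\<xi> w + c) * h (U w) \<partial>P) = (\<integral>\<^sup>+w. ennreal (q (U w)) * h (U w) \<partial>P)"
    if h[measurable]: "h \<in> borel_measurable P" for h
  proof -
    let ?g = "\<lambda>w. h w * ennreal (1 / \<psi> w)"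
    have g: "?g \<in> borel_measurable P" by measurable
    have inv: "ennreal (a * x) * (y * ennreal (1 / x)) = ennreal a * y" if "0 < x" "0 \<le> a" for a x :: real and y
    proof -
      have "ennreal (a * x) * (y * ennreal (1 / x)) = ennreal a * y * (ennreal x * ennreal (1 / x))"
        using that by (simp add: ennreal_mult mult_ac)
      also have "ennreal x * ennreal (1 / x) = 1" using that by (simp add: ennreal_mult[symmetric])
      finally show ?thesis by simp
    qed
    have "(\<integral>\<^sup>+w. ennreal (\<xi> w + c) * h (U w) \<partial>P) = (\<integral>\<^sup>+w. ennreal ((\<xi> w + c) * \<rho> w) * ?g (U w) \<partial>P)"
      using rho_\<psi> by (intro nn_integral_cong_AE, eventually_elim) (simp only: inv[OF \<psi>_pos b1(1)])
    also have "\<dots> = (\<integral>\<^sup>+w. ennreal (q w) * ?g w \<partial>P)" by (rule qI[OF g])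
    also have "\<dots> = (\<integral>\<^sup>+w. ennreal (\<rho> w) * (ennreal (q (U w)) * ?g (U w)) \<partial>P)"
      by (rule U_law_P[symmetric]) measurable
    also have "\<dots> = (\<integral>\<^sup>+w. ennreal (q (U w)) * h (U w) \<partial>P)"
      using rho_\<psi>
    proof (intro nn_integral_cong_AE, eventually_elim)
      case (elim w)
      have "ennreal (\<rho> w) * (ennreal (q (U w)) * ?g (U w)) = ennreal (q (U w) * \<psi> (U w)) * ?g (U w)"
        using q(2)[of "U w"] \<psi>_pos[of "U w"] by (simp add: elim ennreal_mult less_imp_le mult_ac)
      then show ?case by (simp only: inv[OF \<psi>_pos q(2)])
    qed
    finally show ?thesis .
  qed
  show ?thesis
  proof (rule that[of "\<lambda>w. q w - c"])
    show "(\<lambda>w. q w - c) \<in> borel_measurable (F r)" using q(1) by simp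
    show "\<bar>q w - c\<bar> \<le> c" for w using q(2,3)[of w] by auto
    fix g :: "'n path \<Rightarrow> real" assume g[measurable]: "g \<in> borel_measurable P" and gi: "integrable P (\<lambda>w. g (U w))"
    have bi: "integrable P (\<lambda>w. a w * g (U w))" if "a \<in> borel_measurable P" "\<And>w. 0 \<le> a w" "\<And>w. a w \<le> 2 * c" for a :: "'n path \<Rightarrow> real"
    proof (rule Bochner_Integration.integrable_bound)
      show "integrable P (\<lambda>w. 2 * c * g (U w))" using gi by simp
      show "(\<lambda>w. a w * g (U w)) \<in> borel_measurable P" using that(1) by measurable
      show "AE w in P. norm (a w * g (U w)) \<le> norm (2 * c * g (U w))"
        using that(2,3) c by (intro AE_I2) (simp add: abs_mult mult_right_mono)
    qed
    have i1: "integrable P (\<lambda>w. (\<xi> w + c) * g (U w))" using b1 by (intro bi) auto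
    have i2: "integrable P (\<lambda>w. q (U w) * g (U w))" using q by (intro bi qU) auto
    have "(LINT w|P. (\<xi> w + c) * g (U w)) = (LINT w|P. q (U w) * g (U w))"
    proof -
      have e: "ennreal (x * y) = ennreal x * ennreal y" "ennreal (- (x * y)) = ennreal x * ennreal (- y)" if "0 \<le> x" for x y :: real
        using ennreal_mult'[OF that, of y] ennreal_mult'[OF that, of "- y"] by simp_all
      have k: "(\<integral>\<^sup>+w. ennreal ((\<xi> w + c) * g (U w)) \<partial>P) = (\<integral>\<^sup>+w. ennreal (q (U w) * g (U w)) \<partial>P)"
        "(\<integral>\<^sup>+w. ennreal (- ((\<xi> w + c) * g (U w))) \<partial>P) = (\<integral>\<^sup>+w. ennreal (- (q (U w) * g (U w))) \<partial>P)"
        unfolding e[OF b1(1)] e[OF q(2)] by (rule key, measurable)+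
      show ?thesis
        by (rule trans[OF real_lebesgue_integral_def[OF i1] trans[OF _ real_lebesgue_integral_def[OF i2, symmetric]]]) (simp only: k)
    qed
    moreover have "(LINT w|P. \<xi> w * g (U w)) = (LINT w|P. (\<xi> w + c) * g (U w)) - c * (LINT w|P. g (U w))"
    proof -
      have "(LINT w|P. \<xi> w * g (U w)) = (LINT w|P. (\<xi> w + c) * g (U w) - c * g (U w))"
        by (intro Bochner_Integration.integral_cong[OF refl]) (simp add: algebra_simps)
      then show ?thesis using i1 gi by simp
    qed
    moreover have "(LINT w|P. (q (U w) - c) * g (U w)) = (LINT w|P. q (U w) * g (U w)) - c * (LINT w|P. g (U w))"
      using i2 gi by (simp add: left_diff_distrib)
    ultimately show "(LINT w|P. \<xi> w * g (U w)) = (LINT w|P. (q (U w) - c) * g (U w))" by simp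
  qed
qed

text \<open>Coordinatewise projection, set to 0 where \<open>r \<le> \<tau> w\<close>. As
  \<open>\<tau> \<circ> U = \<tau>\<close> almost surely, this cut-off is itself a function of
  \<open>U\<close> and is compatible with the projection property.\<close>

lemma projection_vec:
  fixes z :: "'n path \<Rightarrow> (real, 'n) vec"
  assumes z: "z \<in> borel_measurable (F r)" "\<And>w. w \<in> space \<nu> \<Longrightarrow> norm (z w) \<le> C" "\<And>w. r \<le> \<tau> w \<Longrightarrow> z w = 0"
    and r: "0 \<le> r" "r \<le> 1"
  obtains zh q C' where "zh \<in> borel_measurable (F r)" "\<And>w. norm (zh w) \<le> C'" "\<And>w. r \<le> \<tau> w \<Longrightarrow> zh w = 0"
    "q \<in> borel_measurable P" "\<And>w. norm (q w) \<le> C'" "AE w in P. zh w = q (U w)"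
    "\<And>g. g \<in> borel_measurable P \<Longrightarrow> integrable P (\<lambda>w. g (U w)) \<Longrightarrow> (LINT w|P. z w \<bullet> g (U w)) = (LINT w|P. zh w \<bullet> g (U w))"
proof -
  \<comment> \<open>The bound on \<open>z\<close> holds on the space only. Clamping makes it valid
    for every argument, as \<open>projection_real\<close> demands, and changes nothing on the
    space.\<close>
  define \<xi> where "\<xi> i w = max (- \<bar>C\<bar>) (min \<bar>C\<bar> (z w $ i))" for i w
  have zi: "(\<lambda>w. z w $ i) \<in> borel_measurable (F r)" for i
    using borel_measurable_inner[OF z(1) borel_measurable_const[of "axis i 1"]] by (simp add: inner_axis)
  have \<xi>m: "\<xi> i \<in> borel_measurable (F r)" for i
    unfolding \<xi>_def by (intro borel_measurable_max borel_measurable_min borel_measurable_const zi)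
  have \<xi>b: "\<bar>\<xi> i w\<bar> \<le> \<bar>C\<bar>" for i w unfolding \<xi>_def by auto
  have \<xi>z: "\<xi> i w = z w $ i" if "w \<in> space \<nu>" for i w
    using order_trans[OF component_le_norm_cart z(2)[OF that], of i] unfolding \<xi>_def by auto
  have "\<exists>q. q \<in> borel_measurable (F r) \<and> (\<forall>w. \<bar>q w\<bar> \<le> \<bar>C\<bar>) \<and>
     (\<forall>g. g \<in> borel_measurable P \<longrightarrow> integrable P (\<lambda>w. g (U w)) \<longrightarrow> (LINT w|P. \<xi> i w * g (U w)) = (LINT w|P. q (U w) * g (U w)))" for i
    by (rule projection_real[OF \<xi>m[of i] \<xi>b[of i] r]) blast
  then have "\<forall>i. \<exists>q. q \<in> borel_measurable (F r) \<and> (\<forall>w. \<bar>q w\<bar> \<le> \<bar>C\<bar>) \<and>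
     (\<forall>g. g \<in> borel_measurable P \<longrightarrow> integrable P (\<lambda>w. g (U w)) \<longrightarrow> (LINT w|P. \<xi> i w * g (U w)) = (LINT w|P. q (U w) * g (U w)))" ..
  from choice[OF this] obtain qc where qc: "\<And>i. qc i \<in> borel_measurable (F r)" "\<And>i w. \<bar>qc i w\<bar> \<le> \<bar>C\<bar>"
    and qcI: "\<And>i g. g \<in> borel_measurable P \<Longrightarrow> integrable P (\<lambda>w. g (U w)) \<Longrightarrow> (LINT w|P. \<xi> i w * g (U w)) = (LINT w|P. qc i (U w) * g (U w))"
    by blast
  define q0 where "q0 w = (\<Sum>i\<in>UNIV. qc i w *\<^sub>R axis i (1::real))" for w
  have q0c: "q0 w $ i = qc i w" for w i
    by (simp add: q0_def axis_def if_distrib[of "\<lambda>x. _ * x"] cong: if_cong)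
  have q0m: "q0 \<in> borel_measurable (F r)"
    unfolding q0_def by (intro borel_measurable_sum borel_measurable_scaleR qc borel_measurable_const)
  define C' where "C' = real CARD('n) * \<bar>C\<bar>"
  have C'0: "0 \<le> C'" by (simp add: C'_def)
  have q0b: "norm (q0 w) \<le> C'" for w
  proof -
    have "norm (q0 w) \<le> (\<Sum>i\<in>UNIV. \<bar>qc i w\<bar>)" using norm_le_l1_cart[of "q0 w"] unfolding q0c .
    also have "\<dots> \<le> (\<Sum>i\<in>(UNIV :: 'n set). \<bar>C\<bar>)" by (intro sum_mono qc)
    finally show ?thesis by (simp add: C'_def)
  qed
  have "\<tau> \<in> borel_measurable F\<tau>"
    unfolding stopped_algebra_def by (rule measurable_stopping_time_pre_sigma[OF stopping_time_tau])
  then have tau_inv: "AE w in P. \<tau> (U w) = \<tau> w" by (rule stopped_function_invariant)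
  have [measurable]: "Measurable.pred (F r) (\<lambda>w. \<tau> w < r)" using tau_less_sets[of r] by (simp add: Measurable.pred_def)
  define zh where "zh w = (if \<tau> w < r then q0 (U w) else 0)" for w
  define q where "q w = (if \<tau> w < r then q0 w else 0)" for w
  have q0U: "(\<lambda>w. q0 (U w)) \<in> borel_measurable (F r)" by (rule measurable_compose[OF U_FF[OF r(2)] q0m])
  have zhm: "zh \<in> borel_measurable (F r)" unfolding zh_def using q0U by measurable
  have [measurable]: "q0 \<in> borel_measurable P" by (rule measurable_F_P[OF q0m])
  have zP[measurable]: "z \<in> borel_measurable P" by (rule measurable_F_P[OF z(1)])
  have zhP[measurable]: "zh \<in> borel_measurable P" by (rule measurable_F_P[OF zhm])
  show ?thesis
  proof (rule that[of zh C' q])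
    show "zh \<in> borel_measurable (F r)" by (rule zhm)
    show "norm (zh w) \<le> C'" for w using q0b C'0 by (simp add: zh_def)
    show "r \<le> \<tau> w \<Longrightarrow> zh w = 0" for w by (simp add: zh_def)
    show "q \<in> borel_measurable P" unfolding q_def by measurable
    show "norm (q w) \<le> C'" for w using q0b C'0 by (simp add: q_def)
    show "AE w in P. zh w = q (U w)" using tau_inv by eventually_elim (simp add: zh_def q_def)
    fix g :: "'n path \<Rightarrow> (real, 'n) vec" assume g[measurable]: "g \<in> borel_measurable P" and gi: "integrable P (\<lambda>w. g (U w))"
    define g' where "g' w = (if \<tau> w < r then g w else 0)" for w
    have g'm[measurable]: "g' \<in> borel_measurable P" unfolding g'_def by measurable
    have g'c: "(\<lambda>w. g' w $ i) \<in> borel_measurable P" for i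
      using borel_measurable_inner[OF g'm borel_measurable_const[of "axis i 1"]] by (simp add: inner_axis)
    have g'U: "(\<lambda>w. g' (U w)) \<in> borel_measurable P" by (rule measurable_compose[OF U_PP g'm])
    have g'i: "integrable P (\<lambda>w. g' (U w))"
      by (rule Bochner_Integration.integrable_bound[OF gi g'U]) (auto simp: g'_def)
    have ci: "integrable P (\<lambda>w. g' (U w) $ i)" for i
      using integrable_inner_left[of "axis i 1" P "\<lambda>w. g' (U w)"] g'i by (simp add: inner_axis)
    have bi: "integrable P (\<lambda>w. a w * g' (U w) $ i)" if "a \<in> borel_measurable P" "\<And>w. \<bar>a w\<bar> \<le> \<bar>C\<bar>" for a :: "'n path \<Rightarrow> real" and i
    proof (rule Bochner_Integration.integrable_bound)
      show "integrable P (\<lambda>w. \<bar>C\<bar> * g' (U w) $ i)" using ci by simp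
      show "(\<lambda>w. a w * g' (U w) $ i) \<in> borel_measurable P"
        by (rule borel_measurable_times[OF that(1) borel_measurable_integrable[OF ci]])
      show "AE w in P. norm (a w * g' (U w) $ i) \<le> norm (\<bar>C\<bar> * g' (U w) $ i)"
        using that(2) by (intro AE_I2) (simp add: abs_mult mult_right_mono)
    qed
    have qcU: "(\<lambda>w. qc i (U w)) \<in> borel_measurable P" for i
      by (rule measurable_compose[OF U_PP measurable_F_P[OF qc(1)]])
    have "(LINT w|P. z w \<bullet> g (U w)) = (LINT w|P. (\<Sum>i\<in>UNIV. \<xi> i w * g' (U w) $ i))"
    proof (rule Bochner_Integration.integral_cong_AE)
      show "(\<lambda>w. z w \<bullet> g (U w)) \<in> borel_measurable P"
        by (rule borel_measurable_inner[OF zP measurable_compose[OF U_PP g]])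
      show "(\<lambda>w. (\<Sum>i\<in>UNIV. \<xi> i w * g' (U w) $ i)) \<in> borel_measurable P"
        by (intro borel_measurable_sum borel_measurable_times measurable_F_P[OF \<xi>m] borel_measurable_integrable[OF ci])
      show "AE w in P. z w \<bullet> g (U w) = (\<Sum>i\<in>UNIV. \<xi> i w * g' (U w) $ i)"
        using tau_inv AE_space
      proof eventually_elim
        case (elim w)
        then show ?case using z(3)[of w] by (cases "\<tau> w < r") (auto simp: \<xi>z g'_def inner_vec_def)
      qed
    qed
    also have "\<dots> = (\<Sum>i\<in>UNIV. LINT w|P. \<xi> i w * g' (U w) $ i)"
      by (intro Bochner_Integration.integral_sum bi measurable_F_P[OF \<xi>m] \<xi>b)
    also have "\<dots> = (\<Sum>i\<in>UNIV. LINT w|P. qc i (U w) * g' (U w) $ i)"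
      by (intro sum.cong[OF refl] qcI g'c ci)
    also have "\<dots> = (LINT w|P. (\<Sum>i\<in>UNIV. qc i (U w) * g' (U w) $ i))"
      by (intro Bochner_Integration.integral_sum[symmetric] bi qcU qc)
    also have "\<dots> = (LINT w|P. zh w \<bullet> g (U w))"
    proof (rule Bochner_Integration.integral_cong_AE)
      show "(\<lambda>w. zh w \<bullet> g (U w)) \<in> borel_measurable P"
        by (rule borel_measurable_inner[OF zhP measurable_compose[OF U_PP g]])
      show "(\<lambda>w. (\<Sum>i\<in>UNIV. qc i (U w) * g' (U w) $ i)) \<in> borel_measurable P"
        by (intro borel_measurable_sum borel_measurable_times qcU borel_measurable_integrable[OF ci])
      show "AE w in P. (\<Sum>i\<in>UNIV. qc i (U w) * g' (U w) $ i) = zh w \<bullet> g (U w)"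
        using tau_inv by eventually_elim (auto simp: zh_def g'_def inner_vec_def q0c)
    qed
    finally show "(LINT w|P. z w \<bullet> g (U w)) = (LINT w|P. zh w \<bullet> g (U w))" .
  qed
qed


lemma integrable_bounded_inner:
  fixes a g :: "'n path \<Rightarrow> (real, 'n) vec"
  assumes a: "a \<in> borel_measurable P" "\<And>w. w \<in> space \<nu> \<Longrightarrow> norm (a w) \<le> C" and g: "integrable P g"
  shows "integrable P (\<lambda>w. a w \<bullet> g w)"
proof (rule Bochner_Integration.integrable_bound)
  show "integrable P (\<lambda>w. \<bar>C\<bar> * norm (g w))" using g by simp
  show "(\<lambda>w. a w \<bullet> g w) \<in> borel_measurable P" by (rule borel_measurable_inner[OF a(1) borel_measurable_integrable[OF g]])
  show "AE w in P. norm (a w \<bullet> g w) \<le> norm (\<bar>C\<bar> * norm (g w))"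
    using AE_space
  proof eventually_elim
    case (elim w)
    have "norm (a w \<bullet> g w) \<le> norm (a w) * norm (g w)" unfolding real_norm_def by (rule Cauchy_Schwarz_ineq2)
    also have "\<dots> \<le> \<bar>C\<bar> * norm (g w)" using a(2)[of w] elim by (intro mult_right_mono) auto
    finally show ?case by simp
  qed
qed

lemma integrable_cm_path_u: assumes t: "t \<in> {0..1}" shows "integrable P (\<lambda>w. cm_path (u w) t)"
proof (rule Bochner_Integration.integrable_bound)
  show "integrable P (\<lambda>w. 1 + energy (u w))" using integrable_energy_u by simp
  show "(\<lambda>w. cm_path (u w) t) \<in> borel_measurable P" by (rule cm_path_u_measurable[OF t])
  show "AE w in P. norm (cm_path (u w) t) \<le> norm (1 + energy (u w))"
    using AE_space L0_adaptedD(2)[OF u_L0]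
  proof eventually_elim
    case (elim w)
    have "norm (cm_path (u w) t - cm_path (\<lambda>_. 0) t) \<le> 1 + energy (\<lambda>s. u w s - 0) / 1"
      using elim t drift_section_measurable[OF u_L0, of w] by (intro cm_path_diff_le) (auto simp: set_integrable_def)
    then show ?case by (simp add: cm_path_def set_lebesgue_integral_def energy_nonneg)
  qed
qed

lemma integrable_increment:
  assumes "0 \<le> s" "s < t" "t \<le> 1" shows "integrable P (\<lambda>w. \<beta> w t - \<beta> w s)"
proof -
  have "integrable P (\<lambda>w. \<Sum>i\<in>UNIV. (axis i 1 \<bullet> (\<beta> w t - \<beta> w s)) *\<^sub>R axis i (1::real))"
    by (intro Bochner_Integration.integrable_sum integrable_scaleR_left increment_mean_zero(1)[OF assms, where z="\<lambda>_. axis _ 1" and C=1]) (simp_all add: norm_axis_1)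
  moreover have "(\<Sum>i\<in>UNIV. (axis i 1 \<bullet> x) *\<^sub>R axis i (1::real)) = x" for x :: "(real, 'n) vec"
    by (simp add: vec_eq_iff inner_axis') (simp add: axis_def if_distrib[of "\<lambda>x. _ * x"] cong: if_cong)
  ultimately show ?thesis by simp
qed

text \<open>By \<open>energy_simple_diff\<close> the mean error is the mean energy of
  \<open>u\<close> minus twice a cross term plus a square term. Projection onto \<open>U\<close>
  leaves the mean cross term unchanged, because increments of the primitive of \<open>u\<close> may
  be replaced by increments of \<open>\<beta> \<circ> U\<close>, and it does not increase the square
  term. So the projected integrands keep the rate.\<close>

lemma projected_approximation:
  assumes ap: "approximates N s z"
  obtains zh q where "approximates N s zh" "\<And>j k. k < N j \<Longrightarrow> q j k \<in> borel_measurable P"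
    "\<And>j k. k < N j \<Longrightarrow> AE w in P. zh j k w = q j k (U w)"
proof -
  note D = approxD[OF ap]
  have grid: "0 \<le> s j k" "s j k < s j (Suc k)" "s j (Suc k) \<le> 1" if "k < N j" for j k
    using grid_bounds[OF D(2)[of j]] time_gridD(3)[OF D(2)[of j] that] that by auto
  \<comment> \<open>All properties of a projected value are collected in one relation, so that
    values and representing functions can be chosen for all indices at once.\<close>
  define R where "R j k zh q \<longleftrightarrow> zh \<in> borel_measurable (F (s j k)) \<and> (\<exists>C'. \<forall>w. norm (zh w) \<le> C' \<and> norm (q w) \<le> C') \<and> (\<forall>w. s j k \<le> \<tau> w \<longrightarrow> zh w = 0)
     \<and> q \<in> borel_measurable P \<and> (AE w in P. zh w = q (U w)) \<and>
     (\<forall>g. g \<in> borel_measurable P \<longrightarrow> integrable P (\<lambda>w. g (U w)) \<longrightarrow> (LINT w|P. z j k w \<bullet> g (U w)) = (LINT w|P. zh w \<bullet> g (U w)))"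
    for j k and zh q :: "'n path \<Rightarrow> (real, 'n) vec"
  have "\<exists>p. k < N j \<longrightarrow> R j k (fst p) (snd p)" for j k
  proof (cases "k < N j")
    case True
    obtain C where C: "\<forall>w\<in>space \<nu>. norm (z j k w) \<le> C" using simple_integrandD(2)[OF D(1) True] by auto
    obtain zh q C' where *: "zh \<in> borel_measurable (F (s j k))" "\<And>w. norm (zh w) \<le> C'" "\<And>w. s j k \<le> \<tau> w \<Longrightarrow> zh w = 0"
      "q \<in> borel_measurable P" "\<And>w. norm (q w) \<le> C'" "AE w in P. zh w = q (U w)"
      "\<And>g. g \<in> borel_measurable P \<Longrightarrow> integrable P (\<lambda>w. g (U w)) \<Longrightarrow> (LINT w|P. z j k w \<bullet> g (U w)) = (LINT w|P. zh w \<bullet> g (U w))"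
      by (rule projection_vec[OF z_measurable[OF ap True] bspec[OF C] D(5)[OF True] grid(1)[OF True] order_trans[OF less_imp_le[OF grid(2)[OF True]] grid(3)[OF True]]])
        (assumption | rule that)+
    have "R j k zh q" unfolding R_def using * by blast
    then show ?thesis by (intro exI[of _ "(zh, q)"]) simp
  qed simp
  then have "\<forall>j. \<forall>k. \<exists>p. k < N j \<longrightarrow> R j k (fst p) (snd p)" by blast
  then have "\<forall>j. \<exists>f. \<forall>k. k < N j \<longrightarrow> R j k (fst (f k)) (snd (f k))" by (intro allI choice) blast
  from choice[OF this] obtain f where f: "\<And>j k. k < N j \<Longrightarrow> R j k (fst (f j k)) (snd (f j k))" by blast
  define zh where "zh j k = fst (f j k)" for j k
  define q where "q j k = snd (f j k)" for j k
  have R: "R j k (zh j k) (q j k)" if "k < N j" for j k using f[OF that] by (simp add: zh_def q_def)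
  have zhm: "zh j k \<in> borel_measurable (F (s j k))" if "k < N j" for j k using R[OF that] by (simp add: R_def)
  have zhP: "zh j k \<in> borel_measurable P" if "k < N j" for j k by (rule measurable_F_P[OF zhm[OF that]])
  have zP: "z j k \<in> borel_measurable P" if "k < N j" for j k by (rule measurable_F_P[OF z_measurable[OF ap that]])
  have qm: "q j k \<in> borel_measurable P" if "k < N j" for j k using R[OF that] by (simp add: R_def)
  have qae: "AE w in P. zh j k w = q j k (U w)" if "k < N j" for j k using R[OF that] by (simp add: R_def)
  have bnd: "\<exists>C'. \<forall>w. norm (zh j k w) \<le> C' \<and> norm (q j k w) \<le> C'" if "k < N j" for j k using R[OF that] by (simp add: R_def)
  have zh0: "zh j k w = 0" if "k < N j" "s j k \<le> \<tau> w" for j k w using R[OF that(1)] that(2) by (simp add: R_def)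
  have proj: "(LINT w|P. z j k w \<bullet> g (U w)) = (LINT w|P. zh j k w \<bullet> g (U w))"
    if "k < N j" "g \<in> borel_measurable P" "integrable P (\<lambda>w. g (U w))" for j k g
    using R[OF that(1)] that(2,3) unfolding R_def by blast
  have si: "simple_integrand \<nu> (N j) (s j) (zh j)" for j
    unfolding simple_integrand_def
  proof (intro conjI allI impI)
    show "0 \<le> s j 0" "s j (N j) \<le> 1" using D(3,4) by auto
    show "s j k \<le> s j (Suc k)" if "k < N j" for k using grid[OF that] by simp
    show "zh j k \<in> borel_measurable (F (s j k))" if "k < N j" for k by (rule zhm[OF that])
    show "bounded (zh j k ` space \<nu>)" if "k < N j" for k
      using bnd[OF that] unfolding bounded_iff by blast
  qed
  let ?dA = "\<lambda>j k w. cm_path (u w) (s j (Suc k)) - cm_path (u w) (s j k)"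
  let ?d = "\<lambda>j k. s j (Suc k) - s j k"
  have iA: "integrable P (?dA j k)" if "k < N j" for j k
    using grid[OF that] by (intro Bochner_Integration.integrable_diff integrable_cm_path_u) auto
  have bz: "\<exists>C. \<forall>w\<in>space \<nu>. norm (z j k w) \<le> C" if "k < N j" for j k by (rule simple_integrandD(2)[OF D(1) that])
  have bzh: "\<exists>C. \<forall>w\<in>space \<nu>. norm (zh j k w) \<le> C" if "k < N j" for j k using bnd[OF that] by blast
  have ii: "integrable P (\<lambda>w. a w \<bullet> g w)" if a: "a \<in> borel_measurable P" and b: "\<exists>C. \<forall>w\<in>space \<nu>. norm (a w) \<le> C" and g: "integrable P g"
    for a g :: "'n path \<Rightarrow> (real, 'n) vec"
  proof -
    obtain C where C: "\<forall>w\<in>space \<nu>. norm (a w) \<le> C" using b by blast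
    show ?thesis by (rule integrable_bounded_inner[OF a bspec[OF C] g])
  qed
  have i1: "integrable P a" if a: "a \<in> borel_measurable P" and b: "\<exists>C. \<forall>w\<in>space \<nu>. norm (a w) \<le> C" for a :: "'n path \<Rightarrow> (real, 'n) vec"
  proof -
    obtain C where "\<forall>w\<in>space \<nu>. norm (a w) \<le> C" using b by blast
    then show ?thesis by (intro integrable_const_bound[OF AE_I2 a, of C]) simp
  qed
  have iz: "integrable P (z j k)" if "k < N j" for j k by (rule i1[OF zP[OF that] bz[OF that]])
  have izh: "integrable P (zh j k)" if "k < N j" for j k by (rule i1[OF zhP[OF that] bzh[OF that]])
  \<comment> \<open>The increments of \<open>\<beta> \<circ> U\<close> and of the primitive of
    \<open>u\<close> differ by an increment of \<beta>, which has mean 0 against bounded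
    \<open>F (s j k)\<close>-measurable factors. Both \<open>z j k\<close> and its projection are
    such factors, and they act alike on functions of \<open>U\<close>.\<close>
  have drift: "(LINT w|P. z j k w \<bullet> ?dA j k w) = (LINT w|P. zh j k w \<bullet> ?dA j k w)" if k: "k < N j" for j k
  proof -
    let ?dB = "\<lambda>w. \<beta> w (s j (Suc k)) - \<beta> w (s j k)"
    have s01: "s j (Suc k) \<in> {0..1}" "s j k \<in> {0..1}" using grid[OF k] by auto
    have iB: "integrable P ?dB" by (rule integrable_increment[OF grid[OF k]])
    have ae: "AE w in P. ?dB (U w) = ?dB w + ?dA j k w"
      using beta_U
    proof eventually_elim
      case (elim w)
      then show ?case using s01 by (simp add: X_def)
    qed
    have mB: "?dB \<in> borel_measurable P" by (rule borel_measurable_integrable[OF iB])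
    have mBU: "(\<lambda>w. ?dB (U w)) \<in> borel_measurable P" by (rule measurable_compose[OF U_PP mB])
    have "integrable P (\<lambda>w. ?dB w + ?dA j k w)" by (rule Bochner_Integration.integrable_add[OF iB iA[OF k]])
    then have iBU: "integrable P (\<lambda>w. ?dB (U w))"
      using integrable_cong_AE[OF mBU borel_measurable_integrable ae] by blast
    have split: "(LINT w|P. a w \<bullet> ?dB (U w)) = (LINT w|P. a w \<bullet> ?dA j k w)"
      if a: "a \<in> borel_measurable (F (s j k))" and b: "\<exists>C. \<forall>w\<in>space \<nu>. norm (a w) \<le> C" for a
    proof -
      have aP: "a \<in> borel_measurable P" by (rule measurable_F_P[OF a])
      obtain C where C: "\<forall>w\<in>space \<nu>. norm (a w) \<le> C" using b by blast
      have "(LINT w|P. a w \<bullet> ?dB (U w)) = (LINT w|P. a w \<bullet> ?dB w + a w \<bullet> ?dA j k w)"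
      proof (rule Bochner_Integration.integral_cong_AE)
        show "(\<lambda>w. a w \<bullet> ?dB (U w)) \<in> borel_measurable P" by (rule borel_measurable_inner[OF aP mBU])
        show "(\<lambda>w. a w \<bullet> ?dB w + a w \<bullet> ?dA j k w) \<in> borel_measurable P"
          by (rule borel_measurable_add[OF borel_measurable_inner[OF aP mB] borel_measurable_inner[OF aP borel_measurable_integrable[OF iA[OF k]]]])
        show "AE w in P. a w \<bullet> ?dB (U w) = a w \<bullet> ?dB w + a w \<bullet> ?dA j k w"
          using ae by eventually_elim (simp only: inner_add_right)
      qed
      also have "\<dots> = (LINT w|P. a w \<bullet> ?dB w) + (LINT w|P. a w \<bullet> ?dA j k w)"
        by (rule Bochner_Integration.integral_add[OF ii[OF aP b iB] ii[OF aP b iA[OF k]]])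
      also have "(LINT w|P. a w \<bullet> ?dB w) = 0" by (rule increment_mean_zero(2)[OF grid[OF k] a bspec[OF C]])
      finally show ?thesis by simp
    qed
    show ?thesis
      using proj[OF k mB iBU] unfolding split[OF z_measurable[OF ap k] bz[OF k]] split[OF zhm[OF k] bzh[OF k]] .
  qed
  \<comment> \<open>Pythagoras: the remainder is orthogonal to the projection, as the latter is a
    function of \<open>U\<close>.\<close>
  have square: "integrable P (\<lambda>w. (norm (z j k w))\<^sup>2)" "integrable P (\<lambda>w. (norm (zh j k w))\<^sup>2)"
    "(LINT w|P. (norm (zh j k w))\<^sup>2) \<le> (LINT w|P. (norm (z j k w))\<^sup>2)" if k: "k < N j" for j k
  proof -
    have n: "(norm x)\<^sup>2 = x \<bullet> x" for x :: "(real, 'n) vec" by (rule power2_norm_eq_inner)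
    show i1: "integrable P (\<lambda>w. (norm (z j k w))\<^sup>2)" unfolding n by (rule ii[OF zP[OF k] bz[OF k] iz[OF k]])
    show i2: "integrable P (\<lambda>w. (norm (zh j k w))\<^sup>2)" unfolding n by (rule ii[OF zhP[OF k] bzh[OF k] izh[OF k]])
    have i3: "integrable P (\<lambda>w. z j k w \<bullet> zh j k w)" by (rule ii[OF zP[OF k] bz[OF k] izh[OF k]])
    have qU: "(\<lambda>w. q j k (U w)) \<in> borel_measurable P" by (rule measurable_compose[OF U_PP qm[OF k]])
    have iqU: "integrable P (\<lambda>w. q j k (U w))"
      using integrable_cong_AE[OF zhP[OF k] qU qae[OF k]] izh[OF k] by blast
    have e: "(LINT w|P. a w \<bullet> q j k (U w)) = (LINT w|P. a w \<bullet> zh j k w)" if a: "a \<in> borel_measurable P" for a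
    proof (rule Bochner_Integration.integral_cong_AE[OF borel_measurable_inner[OF a qU] borel_measurable_inner[OF a zhP[OF k]]])
      show "AE w in P. a w \<bullet> q j k (U w) = a w \<bullet> zh j k w" using qae[OF k] by eventually_elim (simp only:)
    qed
    have p: "(LINT w|P. z j k w \<bullet> zh j k w) = (LINT w|P. (norm (zh j k w))\<^sup>2)"
      using proj[OF k qm[OF k] iqU] unfolding e[OF zP[OF k]] e[OF zhP[OF k]] n .
    have "0 \<le> (LINT w|P. (norm (z j k w - zh j k w))\<^sup>2)" by simp
    also have "\<dots> = (LINT w|P. (norm (z j k w))\<^sup>2 - 2 * (z j k w \<bullet> zh j k w) + (norm (zh j k w))\<^sup>2)"
      by (intro Bochner_Integration.integral_cong[OF refl]) (simp add: n inner_diff_left inner_diff_right inner_commute)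
    also have "\<dots> = (LINT w|P. (norm (z j k w))\<^sup>2) - 2 * (LINT w|P. z j k w \<bullet> zh j k w) + (LINT w|P. (norm (zh j k w))\<^sup>2)"
      using i1 i2 i3 by simp
    finally show "(LINT w|P. (norm (zh j k w))\<^sup>2) \<le> (LINT w|P. (norm (z j k w))\<^sup>2)" unfolding p by simp
  qed
  define E where "E j y w = energy (u w) - 2 * (\<Sum>k<N j. y k w \<bullet> ?dA j k w) + (\<Sum>k<N j. ?d j k * (norm (y k w))\<^sup>2)"
    for j :: nat and y :: "nat \<Rightarrow> 'n path \<Rightarrow> (real, 'n) vec" and w
  have E: "AE w in P. energy (\<lambda>r. simple_drift (N j) (s j) y w r - u w r) = E j y w" for j y
    using AE_space L0_adaptedD(2)[OF u_L0]
  proof eventually_elim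
    case (elim w)
    have "w \<in> space \<nu>" using elim(1) by simp
    from set_integrable_of_square[OF drift_section_measurable[OF u_L0 this] elim(2)]
    show ?case unfolding E_def by (rule energy_simple_diff[OF _ elim(2) D(2) D(3) D(4)])
  qed
  have iE: "integrable P (E j y) \<and> (LINT w|P. E j y w) = (LINT w|P. energy (u w))
       - 2 * (\<Sum>k<N j. LINT w|P. y k w \<bullet> ?dA j k w) + (\<Sum>k<N j. ?d j k * (LINT w|P. (norm (y k w))\<^sup>2))"
    if y1: "\<And>k. k < N j \<Longrightarrow> integrable P (\<lambda>w. y k w \<bullet> ?dA j k w)" and y2: "\<And>k. k < N j \<Longrightarrow> integrable P (\<lambda>w. (norm (y k w))\<^sup>2)" for j y
  proof -
    have a: "integrable P (\<lambda>w. 2 * (\<Sum>k<N j. y k w \<bullet> ?dA j k w))"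
      using y1 by (intro integrable_mult_right Bochner_Integration.integrable_sum) auto
    have b: "integrable P (\<lambda>w. (\<Sum>k<N j. ?d j k * (norm (y k w))\<^sup>2))"
      using y2 by (intro integrable_mult_right Bochner_Integration.integrable_sum) auto
    have c: "integrable P (\<lambda>w. energy (u w) - 2 * (\<Sum>k<N j. y k w \<bullet> ?dA j k w))"
      by (rule Bochner_Integration.integrable_diff[OF integrable_energy_u a])
    have s1: "(LINT w|P. (\<Sum>k<N j. y k w \<bullet> ?dA j k w)) = (\<Sum>k<N j. LINT w|P. y k w \<bullet> ?dA j k w)"
      using y1 by (intro Bochner_Integration.integral_sum) auto
    have s2: "(LINT w|P. (\<Sum>k<N j. ?d j k * (norm (y k w))\<^sup>2)) = (\<Sum>k<N j. ?d j k * (LINT w|P. (norm (y k w))\<^sup>2))"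
      using y2 by (subst Bochner_Integration.integral_sum) auto
    show ?thesis
      unfolding E_def Bochner_Integration.integral_add[OF c b] Bochner_Integration.integral_diff[OF integrable_energy_u a] integral_mult_right_zero s1 s2
      using Bochner_Integration.integrable_add[OF c b] by simp
  qed
  have iEz: "integrable P (E j (z j)) \<and> (LINT w|P. E j (z j) w) = (LINT w|P. energy (u w))
       - 2 * (\<Sum>k<N j. LINT w|P. z j k w \<bullet> ?dA j k w) + (\<Sum>k<N j. ?d j k * (LINT w|P. (norm (z j k w))\<^sup>2))" for j
    by (rule iE) (rule ii[OF zP bz iA], assumption+, rule square(1))
  have iEzh: "integrable P (E j (zh j)) \<and> (LINT w|P. E j (zh j) w) = (LINT w|P. energy (u w))
       - 2 * (\<Sum>k<N j. LINT w|P. zh j k w \<bullet> ?dA j k w) + (\<Sum>k<N j. ?d j k * (LINT w|P. (norm (zh j k w))\<^sup>2))" for j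
    by (rule iE) (rule ii[OF zhP bzh iA], assumption+, rule square(2))
  have le: "(LINT w|P. E j (zh j) w) \<le> (LINT w|P. E j (z j) w)" for j
  proof -
    have "(\<Sum>k<N j. ?d j k * (LINT w|P. (norm (zh j k w))\<^sup>2)) \<le> (\<Sum>k<N j. ?d j k * (LINT w|P. (norm (z j k w))\<^sup>2))"
    proof (intro sum_mono mult_left_mono)
      fix k assume k: "k \<in> {..<N j}"
      show "(LINT w|P. (norm (zh j k w))\<^sup>2) \<le> (LINT w|P. (norm (z j k w))\<^sup>2)" using square(3) k by simp
      show "0 \<le> ?d j k" using grid(2) k by (simp add: less_imp_le)
    qed
    moreover have "(\<Sum>k<N j. LINT w|P. z j k w \<bullet> ?dA j k w) = (\<Sum>k<N j. LINT w|P. zh j k w \<bullet> ?dA j k w)"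
      using drift by (intro sum.cong) auto
    ultimately show ?thesis using iEz[of j] iEzh[of j] by linarith
  qed
  have Enn: "AE w in P. 0 \<le> E j y w" for j y
    using E[of j y] by eventually_elim (metis energy_nonneg)
  have bound: "(\<integral>\<^sup>+w. ennreal (energy (\<lambda>r. simple_drift (N j) (s j) (zh j) w r - u w r)) \<partial>P) \<le> ennreal ((1/4)^j)" for j
  proof -
    have t: "(\<integral>\<^sup>+w. ennreal (energy (\<lambda>r. simple_drift (N j) (s j) y w r - u w r)) \<partial>P) = ennreal (LINT w|P. E j y w)"
      if "integrable P (E j y)" for y
    proof -
      have "(\<integral>\<^sup>+w. ennreal (energy (\<lambda>r. simple_drift (N j) (s j) y w r - u w r)) \<partial>P) = (\<integral>\<^sup>+w. ennreal (E j y w) \<partial>P)"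
        using E[of j y] by (intro nn_integral_cong_AE, eventually_elim) (simp only:)
      also have "\<dots> = ennreal (LINT w|P. E j y w)" by (rule nn_integral_eq_integral[OF that Enn])
      finally show ?thesis .
    qed
    have "(\<integral>\<^sup>+w. ennreal (energy (\<lambda>r. simple_drift (N j) (s j) (zh j) w r - u w r)) \<partial>P) \<le> ennreal (LINT w|P. E j (z j) w)"
      using t[of "zh j"] iEzh[of j] le[of j] by (simp add: ennreal_leI)
    also have "\<dots> = (\<integral>\<^sup>+w. ennreal (energy (\<lambda>r. simple_drift (N j) (s j) (z j) w r - u w r)) \<partial>P)"
      using t[of "z j"] iEz[of j] by simp
    also have "\<dots> \<le> ennreal ((1/4)^j)" by (rule D(6))
    finally show ?thesis .
  qed
  show ?thesis
  proof (rule that[of zh q])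
    show "approximates N s zh"
      unfolding approximates_def by (intro allI conjI impI si D bound zh0)
  qed (use qm qae in auto)
qed

text \<open>The projected integrands are functions of \<open>U\<close>, hence so is the limit of
  their primitives, \<open>cm_path (u w) t\<close>; and \<beta> is \<open>\<beta> \<circ> U\<close>
  minus this limit.\<close>

lemma beta_function_of_U:
  assumes t: "t \<in> {0..1}"
  obtains b where "b \<in> borel_measurable P" "AE w in P. \<beta> w t = b (U w)"
proof -
  obtain N s z where ap: "approximates N s z" by (rule ex_approximation)
  obtain zh q where ap': "approximates N s zh" and q: "\<And>j k. k < N j \<Longrightarrow> q j k \<in> borel_measurable P"
    and zq: "\<And>j k. k < N j \<Longrightarrow> AE w in P. zh j k w = q j k (U w)"
    by (rule projected_approximation[OF ap]) (rule that)
  let ?c = "\<lambda>j w. cm_path (simple_drift (N j) (s j) (q j) w) t"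
  have cm: "?c j \<in> borel_measurable P" for j
    unfolding cm_path_def using joint_simple[of "N j" "q j" "s j"] q
    by (intro measurable_integral_time) (auto simp: jointly_measurable_def)
  define b where "b w = \<beta> w t - lim (\<lambda>j. ?c j w)" for w
  have "AE w in P. \<forall>j. \<forall>k\<in>{..<N j}. zh j k w = q j k (U w)"
    using zq by (auto simp: AE_all_countable intro!: AE_finite_allI)
  then have "AE w in P. \<beta> w t = b (U w)"
    using cm_path_tendsto[OF ap'] beta_U
  proof eventually_elim
    case (elim w)
    have "simple_drift (N j) (s j) (zh j) w = simple_drift (N j) (s j) (q j) (U w)" for j
      using elim(1) unfolding simple_drift_def by (intro ext sum.cong) auto
    then have "(\<lambda>j. ?c j (U w)) \<longlonglongrightarrow> cm_path (u w) t" using elim(2) t by simp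
    then show ?case using elim(3) t by (simp add: b_def limI X_def)
  qed
  moreover have "b \<in> borel_measurable P"
    unfolding b_def by (intro borel_measurable_diff beta_measurable_P t borel_measurable_lim_metric cm)
  ultimately show ?thesis using that by blast
qed

end

section \<open>Left inverse\<close>

text \<open>The rational points of the unit interval: a countable dense set, on which a path can be
  controlled outside a single null set.\<close>

definition sample_times :: "real set" where
  "sample_times = (\<lambda>(k, n). real k / real (Suc n)) ` {(k, n). k \<le> Suc n}"

lemma countable_sample_times: "countable sample_times"
  unfolding sample_times_def by (intro countable_image) (rule countableI_type)

lemma sample_times_sub: "sample_times \<subseteq> {0..1}"
  by (auto simp: sample_times_def divide_le_eq)

lemma sample_times_approx:
  assumes t: "t \<in> {0..1}"
  obtains r where "\<And>n. r n \<in> sample_times" "r \<longlonglongrightarrow> t"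
proof -
  define r where "r n = real (nat \<lfloor>t * real (Suc n)\<rfloor>) / real (Suc n)" for n
  have fl: "0 \<le> \<lfloor>t * real (Suc n)\<rfloor>" for n using t by simp
  have mem: "r n \<in> sample_times" for n
  proof -
    have "t * real (Suc n) \<le> 1 * real (Suc n)" using t by (intro mult_right_mono) auto
    then have "\<lfloor>t * real (Suc n)\<rfloor> \<le> \<lfloor>real (Suc n)\<rfloor>" by (intro floor_mono) simp
    then have "\<lfloor>t * real (Suc n)\<rfloor> \<le> int (Suc n)" by (simp only: floor_of_nat)
    then have "nat \<lfloor>t * real (Suc n)\<rfloor> \<le> Suc n" by linarith
    then show ?thesis unfolding r_def sample_times_def
      by (intro image_eqI[of _ _ "(nat \<lfloor>t * real (Suc n)\<rfloor>, n)"]) auto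
  qed
  have bound: "norm (r n - t) \<le> inverse (real (Suc n))" for n
  proof -
    have e: "real (nat \<lfloor>t * real (Suc n)\<rfloor>) = of_int \<lfloor>t * real (Suc n)\<rfloor>" using fl[of n] by simp
    have "\<bar>of_int \<lfloor>t * real (Suc n)\<rfloor> - t * real (Suc n)\<bar> \<le> 1" by linarith
    then have "\<bar>of_int \<lfloor>t * real (Suc n)\<rfloor> - t * real (Suc n)\<bar> / real (Suc n) \<le> 1 / real (Suc n)"
      by (rule divide_right_mono) simp
    moreover have "r n - t = (of_int \<lfloor>t * real (Suc n)\<rfloor> - t * real (Suc n)) / real (Suc n)"
      unfolding r_def e by (simp add: diff_divide_distrib)
    ultimately show ?thesis by (simp only: real_norm_def abs_divide abs_of_nat inverse_eq_divide)
  qed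
  have "(\<lambda>n. r n - t) \<longlonglongrightarrow> 0"
    by (rule Lim_null_comparison[OF always_eventually[OF allI[OF bound]] LIMSEQ_inverse_real_of_nat])
  then have "r \<longlonglongrightarrow> t" by (rule LIM_zero_cancel)
  with mem show ?thesis by (rule that)
qed

context brownian_path_space
begin

lemma path_limit:
  assumes p: "p \<in> space \<nu>" and t: "t \<in> {0..1}" and r: "\<And>n. r n \<in> sample_times" "r \<longlonglongrightarrow> t"
  shows "(\<lambda>n. p (r n)) \<longlonglongrightarrow> p t"
proof -
  have c: "continuous_on {0..1} p" using p by (simp add: space_nu space_path_algebra)
  show ?thesis
    by (rule continuous_on_tendsto_compose[OF c r(2) t]) (intro always_eventually allI subsetD[OF sample_times_sub r(1)])
qed

lemma path_determined:
  assumes p: "p \<in> space \<nu>" "p' \<in> space \<nu>" and eq: "\<And>t. t \<in> sample_times \<Longrightarrow> p t = p' t"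
  shows "p = p'"
proof
  fix t
  show "p t = p' t"
  proof (cases "t \<in> {0..1}")
    case True
    obtain r where r: "\<And>n. r n \<in> sample_times" "r \<longlonglongrightarrow> t" by (rule sample_times_approx[OF True]) (rule that)
    have "(\<lambda>n. p (r n)) \<longlonglongrightarrow> p t" "(\<lambda>n. p' (r n)) \<longlonglongrightarrow> p' t"
      by (rule path_limit[OF p(1) True r], rule path_limit[OF p(2) True r])
    then show ?thesis using eq[OF r(1)] LIMSEQ_unique by simp
  next
    case False
    then show ?thesis using p by (simp add: space_nu space_path_algebra extensional_def)
  qed
qed

text \<open>A uniformly continuous function on a dense set extends continuously to the closure,
  which contains the unit interval.\<close>

lemma path_extension:
  fixes G :: "real \<Rightarrow> (real, 'n) vec"
  assumes "uniformly_continuous_on sample_times G"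
  obtains p where "p \<in> space \<nu>" "\<And>t. t \<in> sample_times \<Longrightarrow> p t = G t"
proof -
  obtain g where g: "uniformly_continuous_on (closure sample_times) g" "\<And>x. x \<in> sample_times \<Longrightarrow> G x = g x"
    by (rule uniformly_continuous_on_extension_on_closure[OF assms]) (rule that)
  have "{0..1} \<subseteq> closure sample_times"
  proof
    fix t :: real assume "t \<in> {0..1}"
    then obtain r where "\<And>n. r n \<in> sample_times" "r \<longlonglongrightarrow> t" by (rule sample_times_approx) (rule that)
    then show "t \<in> closure sample_times" unfolding closure_sequential by blast
  qed
  then have c: "continuous_on {0..1} g"
    using continuous_on_subset[OF uniformly_continuous_imp_continuous[OF g(1)]] by blast
  have "continuous_on {0..1} (restrict g {0..1})"
    by (rule continuous_on_eq[OF c]) simp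
  then have "restrict g {0..1} \<in> space \<nu>" by (simp add: space_nu space_path_algebra)
  moreover have "restrict g {0..1} t = G t" if "t \<in> sample_times" for t
    using g(2)[OF that] sample_times_sub that by auto
  ultimately show ?thesis by (rule that)
qed

text \<open>Countably many conditions, each on two values of \<open>G\<close>; in this form the
  event of uniform continuity is measurable.\<close>

lemma uniformly_continuous_dyadic_iff:
  fixes G :: "real \<Rightarrow> (real, 'n) vec"
  shows "uniformly_continuous_on sample_times G \<longleftrightarrow>
    (\<forall>m::nat. \<exists>n::nat. \<forall>s\<in>sample_times. \<forall>t\<in>sample_times. \<bar>s - t\<bar> < inverse (real (Suc n)) \<longrightarrow> norm (G s - G t) < inverse (real (Suc m)))"
proof
  assume u: "uniformly_continuous_on sample_times G"
  show "\<forall>m::nat. \<exists>n::nat. \<forall>s\<in>sample_times. \<forall>t\<in>sample_times. \<bar>s - t\<bar> < inverse (real (Suc n)) \<longrightarrow> norm (G s - G t) < inverse (real (Suc m))"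
  proof
    fix m :: nat
    obtain d where d: "d > 0" "\<forall>x\<in>sample_times. \<forall>x'\<in>sample_times. dist x' x < d \<longrightarrow> dist (G x') (G x) < inverse (real (Suc m))"
      using u unfolding uniformly_continuous_on_def by (metis inverse_positive_iff_positive of_nat_0_less_iff zero_less_Suc)
    obtain n where "inverse (real (Suc n)) < d" using reals_Archimedean[OF d(1)] by blast
    then show "\<exists>n::nat. \<forall>s\<in>sample_times. \<forall>t\<in>sample_times. \<bar>s - t\<bar> < inverse (real (Suc n)) \<longrightarrow> norm (G s - G t) < inverse (real (Suc m))"
      using d(2) by (intro exI[of _ n]) (auto simp: dist_norm)
  qed
next
  assume *: "\<forall>m::nat. \<exists>n::nat. \<forall>s\<in>sample_times. \<forall>t\<in>sample_times. \<bar>s - t\<bar> < inverse (real (Suc n)) \<longrightarrow> norm (G s - G t) < inverse (real (Suc m))"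
  show "uniformly_continuous_on sample_times G"
    unfolding uniformly_continuous_on_def
  proof (intro allI impI)
    fix e :: real assume "0 < e"
    then obtain m where m: "inverse (real (Suc m)) < e" using reals_Archimedean by blast
    obtain n where n: "\<forall>s\<in>sample_times. \<forall>t\<in>sample_times. \<bar>s - t\<bar> < inverse (real (Suc n)) \<longrightarrow> norm (G s - G t) < inverse (real (Suc m))"
      using * by blast
    show "\<exists>d>0. \<forall>x\<in>sample_times. \<forall>x'\<in>sample_times. dist x' x < d \<longrightarrow> dist (G x') (G x) < e"
    proof (intro exI[of _ "inverse (real (Suc n))"] conjI ballI impI)
      fix x x' assume x: "x \<in> sample_times" "x' \<in> sample_times" "dist x' x < inverse (real (Suc n))"
      then have "norm (G x' - G x) < inverse (real (Suc m))" using n by (simp add: dist_norm)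
      then show "dist (G x') (G x) < e" using m by (simp add: dist_norm)
    qed simp
  qed
qed

end

context adapted_shift_density
begin

text \<open>The sets that agree almost everywhere with preimages under \<open>U\<close> form a
  \<sigma>-algebra. It contains the null sets and, by \<open>beta_function_of_U\<close>, the events
  of \<beta>; these generate everything because \<beta> has the same filtration as the
  coordinates.\<close>

lemma sets_function_of_U:
  assumes C: "C \<in> sets P"
  shows "\<exists>C'\<in>sets P. AE w in P. w \<in> C \<longleftrightarrow> U w \<in> C'"
proof -
  have "C \<in> sets (natural_filtration \<nu> \<beta> 1)" using C sets_F1 same_filtration[of 1] by simp
  then have "C \<in> sigma_sets (space \<nu>)
    ({(\<lambda>w. \<beta> w s) -` B \<inter> space \<nu> | s B. s \<in> {0..1} \<and> s \<le> 1 \<and> B \<in> sets borel} \<union> null_sets P)" unfolding sets_nf .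
  then show ?thesis
  proof (induction rule: sigma_sets.induct)
    case (Basic a)
    then show ?case
    proof
      assume "a \<in> {(\<lambda>w. \<beta> w s) -` B \<inter> space \<nu> | s B. s \<in> {0..1} \<and> s \<le> 1 \<and> B \<in> sets borel}"
      then obtain s B where s: "s \<in> {0..1}" "B \<in> sets borel" and a: "a = (\<lambda>w. \<beta> w s) -` B \<inter> space \<nu>" by blast
      obtain b where b: "b \<in> borel_measurable P" "AE w in P. \<beta> w s = b (U w)" by (rule beta_function_of_U[OF s(1)])
      show ?thesis
      proof
        show "b -` B \<inter> space P \<in> sets P" by (rule measurable_sets[OF b(1) s(2)])
        show "AE w in P. (w \<in> a) = (U w \<in> b -` B \<inter> space P)"
          using b(2) AE_space
        proof eventually_elim
          case (elim w)
          then show ?case using U_space[of w] by (simp add: a)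
        qed
      qed
    next
      assume "a \<in> null_sets P"
      from AE_not_in[OF this] have "AE w in P. (w \<in> a) = (U w \<in> {})" by eventually_elim simp
      then show ?thesis by blast
    qed
  next
    case Empty
    then show ?case by (intro bexI[of _ "{}"]) auto
  next
    case (Compl a)
    then obtain C' where C': "C' \<in> sets P" "AE w in P. (w \<in> a) = (U w \<in> C')" by blast
    show ?case
    proof
      show "space P - C' \<in> sets P" using C'(1) by blast
      show "AE w in P. (w \<in> space \<nu> - a) = (U w \<in> space P - C')"
        using C'(2) AE_space
      proof eventually_elim
        case (elim w)
        then show ?case using U_space[of w] by simp
      qed
    qed
  next
    case (Union a)
    then have "\<forall>i. \<exists>C'. C' \<in> sets P \<and> (AE w in P. (w \<in> a i) = (U w \<in> C'))" by blast
    from choice[OF this] obtain C' where C': "\<And>i. C' i \<in> sets P" "\<And>i. AE w in P. (w \<in> a i) = (U w \<in> C' i)" by blast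
    show ?case
    proof
      show "(\<Union>i. C' i) \<in> sets P" using C'(1) by blast
      have "AE w in P. \<forall>i. (w \<in> a i) = (U w \<in> C' i)" using C'(2) by (simp add: AE_all_countable)
      then show "AE w in P. (w \<in> (\<Union>i. a i)) = (U w \<in> (\<Union>i. C' i))" by eventually_elim auto
    qed
  qed
qed

lemma real_function_of_U:
  fixes X :: "'n path \<Rightarrow> real"
  assumes X: "X \<in> borel_measurable P"
  obtains g where "g \<in> borel_measurable P" "AE w in P. X w = g (U w)"
proof -
  have "\<forall>q::rat. \<exists>C'. C' \<in> sets P \<and> (AE w in P. w \<in> {w \<in> space P. X w < of_rat q} \<longleftrightarrow> U w \<in> C')"
    using sets_function_of_U[OF borel_measurable_less[OF X borel_measurable_const]] by blast
  from choice[OF this] obtain C' where C': "\<And>q::rat. C' q \<in> sets P"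
    "\<And>q. AE w in P. w \<in> {w \<in> space P. X w < of_rat q} \<longleftrightarrow> U w \<in> C' q" by blast
  \<comment> \<open>A number is the infimum of the rationals above it; the sets \<open>C' q\<close>
    represent the rational level sets of \<open>X\<close>. Where they do not fit together
    \<open>g\<close> may be infinite, hence the extended reals.\<close>
  define g where "g w = (INF q\<in>UNIV. if w \<in> C' q then ereal (of_rat q) else \<infinity>)" for w
  have gm: "g \<in> borel_measurable P"
    unfolding g_def
  proof (rule borel_measurable_INF)
    fix q :: rat
    have "Measurable.pred P (\<lambda>w. w \<in> C' q)" using C'(1)[of q] by measurable
    then show "(\<lambda>w. if w \<in> C' q then ereal (of_rat q) else \<infinity>) \<in> borel_measurable P" by measurable
  qed simp
  have INF: "(INF q\<in>UNIV. if x < of_rat q then ereal (of_rat q) else \<infinity>) = ereal x" for x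
  proof (rule antisym)
    show "ereal x \<le> (INF q\<in>UNIV. if x < of_rat q then ereal (of_rat q) else \<infinity>)"
      by (rule INF_greatest) auto
    show "(INF q\<in>UNIV. if x < of_rat q then ereal (of_rat q) else \<infinity>) \<le> ereal x"
    proof (rule dense_ge)
      fix y assume "ereal x < y"
      then obtain r where r: "ereal x < ereal r" "ereal r < y" using ereal_dense2 by blast
      then obtain q where q: "x < of_rat q" "of_rat q < r" using of_rat_dense[of x r] by auto
      have "(INF q\<in>UNIV. if x < of_rat q then ereal (of_rat q) else \<infinity>) \<le> (if x < of_rat q then ereal (of_rat q) else \<infinity>)"
        by (rule INF_lower) simp
      also have "\<dots> \<le> ereal r" using q by simp
      finally show "(INF q\<in>UNIV. if x < of_rat q then ereal (of_rat q) else \<infinity>) \<le> y" using r(2) by simp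
    qed
  qed
  have "AE w in P. \<forall>q. w \<in> {w \<in> space P. X w < of_rat q} \<longleftrightarrow> U w \<in> C' q"
    using C'(2) by (simp add: AE_all_countable)
  then have "AE w in P. X w = real_of_ereal (g (U w))"
    using AE_space
  proof eventually_elim
    case (elim w)
    then have "U w \<in> C' q \<longleftrightarrow> X w < of_rat q" for q by simp
    then have "g (U w) = ereal (X w)" unfolding g_def by (simp only: INF)
    then show ?case by simp
  qed
  moreover have "(\<lambda>w. real_of_ereal (g w)) \<in> borel_measurable P" using gm by measurable
  ultimately show ?thesis using that by blast
qed

lemma vec_function_of_U:
  fixes X :: "'n path \<Rightarrow> (real, 'n) vec"
  assumes X: "X \<in> borel_measurable P"
  obtains g where "g \<in> borel_measurable P" "AE w in P. X w = g (U w)"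
proof -
  have Xi: "(\<lambda>w. X w $ i) \<in> borel_measurable P" for i
    using borel_measurable_inner[OF X borel_measurable_const[of "axis i 1"]] by (simp add: inner_axis)
  have "\<exists>g. g \<in> borel_measurable P \<and> (AE w in P. X w $ i = g (U w))" for i
    by (rule real_function_of_U[OF Xi[of i]]) blast
  then have "\<forall>i. \<exists>g. g \<in> borel_measurable P \<and> (AE w in P. X w $ i = g (U w))" ..
  from choice[OF this] obtain g where g: "\<And>i. g i \<in> borel_measurable P" "\<And>i. AE w in P. X w $ i = g i (U w)" by blast
  have "AE w in P. \<forall>i\<in>UNIV. X w $ i = g i (U w)" using g(2) by (intro AE_finite_allI) auto
  then have "AE w in P. X w = (\<Sum>i\<in>UNIV. g i (U w) *\<^sub>R axis i (1::real))"
    by eventually_elim (simp add: vec_eq_iff axis_def if_distrib[of "\<lambda>x. _ * x"] cong: if_cong)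
  moreover have "(\<lambda>w. \<Sum>i\<in>UNIV. g i w *\<^sub>R axis i (1::real)) \<in> borel_measurable P"
    by (intro borel_measurable_sum borel_measurable_scaleR g borel_measurable_const)
  ultimately show ?thesis using that[of "\<lambda>w. \<Sum>i\<in>UNIV. g i w *\<^sub>R axis i (1::real)"] by blast
qed

text \<open>Each coordinate is almost surely a function \<open>G t\<close> of \<open>U\<close>, with
  an exceptional set that depends on \<open>t\<close>. Only countably many times are therefore used,
  and the path is recovered as the continuous extension from \<open>sample_times\<close>.\<close>

lemma left_inverse:
  obtains V where "V \<in> P \<rightarrow>\<^sub>M path_algebra" "AE w in P. V (U w) = w"
proof -
  have coord: "(\<lambda>w. w t) \<in> borel_measurable P" if "t \<in> {0..1}" for t
    by (rule measurable_completion[OF measurable_coord[OF that]])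
  have "\<exists>g. t \<in> {0..1} \<longrightarrow> g \<in> borel_measurable P \<and> (AE w in P. w t = g (U w))" for t
  proof (cases "t \<in> {0..1}")
    case True
    show ?thesis by (rule vec_function_of_U[OF coord[OF True]]) blast
  qed blast
  then have "\<forall>t. \<exists>g. t \<in> {0..1} \<longrightarrow> g \<in> borel_measurable P \<and> (AE w in P. w t = g (U w))" ..
  from choice[OF this] obtain G where G: "\<And>t. t \<in> {0..1} \<Longrightarrow> G t \<in> borel_measurable P"
    "\<And>t. t \<in> {0..1} \<Longrightarrow> AE w in P. w t = G t (U w)" by blast
  have GD: "G t \<in> borel_measurable P" if "t \<in> sample_times" for t using G(1) sample_times_sub that by blast
  \<comment> \<open>Away from the image of \<open>U\<close> the values \<open>G t\<close> need not
    fit together to a path; there \<open>V\<close> takes a default path.\<close>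
  define good where "good w \<longleftrightarrow> uniformly_continuous_on sample_times (\<lambda>t. G t w)" for w
  have good_m: "Measurable.pred P good"
  proof -
    have "{w \<in> space P. norm (G s w - G t w) < inverse (real (Suc m))} \<in> sets P"
      if "s \<in> sample_times" "t \<in> sample_times" for s t m
      by (rule borel_measurable_less[OF measurable_compose[OF borel_measurable_diff[OF GD[OF that(1)] GD[OF that(2)]] borel_measurable_norm] borel_measurable_const])
    then show ?thesis
      unfolding good_def uniformly_continuous_dyadic_iff pred_def
      by (intro sets.sets_Collect_countable_All sets.sets_Collect_countable_Ex sets.sets_Collect_countable_All'
          sets.sets_Collect_imp sets.sets_Collect_const countable_sample_times)
  qed
  define z :: "'n path" where "z = (\<lambda>t\<in>{0..1}. 0)"
  have z: "z \<in> space \<nu>"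
    unfolding z_def space_nu space_path_algebra
    by (auto intro: continuous_on_eq[OF continuous_on_const])
  define V where "V w = (if good w then (SOME p. p \<in> space \<nu> \<and> (\<forall>t\<in>sample_times. p t = G t w)) else z)" for w
  have Vg: "V w \<in> space \<nu> \<and> (\<forall>t\<in>sample_times. V w t = G t w)" if g: "good w" for w
  proof -
    have "\<exists>p. p \<in> space \<nu> \<and> (\<forall>t\<in>sample_times. p t = G t w)"
      by (rule path_extension[OF g[unfolded good_def]]) blast
    from someI_ex[OF this] show ?thesis unfolding V_def using g by simp
  qed
  have Vs: "V w \<in> space \<nu>" for w using Vg[of w] z by (cases "good w") (auto simp: V_def)
  have Vt: "(\<lambda>w. V w t) \<in> borel_measurable P" if t: "t \<in> {0..1}" for t
  proof -
    obtain r where r: "\<And>n. r n \<in> sample_times" "r \<longlonglongrightarrow> t" by (rule sample_times_approx[OF t]) (rule that)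
    \<comment> \<open>The path \<open>V w\<close> is picked by choice; its coordinates are
      nevertheless measurable, being limits of \<open>G\<close> along sample times.\<close>
    have eq: "V w t = (if good w then lim (\<lambda>n. G (r n) w) else 0)" for w
    proof (cases "good w")
      case True
      have "(\<lambda>n. V w (r n)) \<longlonglongrightarrow> V w t" by (rule path_limit[OF Vs t r])
      then have "(\<lambda>n. G (r n) w) \<longlonglongrightarrow> V w t" using Vg[OF True] r(1) by simp
      then show ?thesis using True by (simp add: limI)
    next
      case False
      then show ?thesis using t by (simp add: V_def z_def)
    qed
    have "(\<lambda>w. lim (\<lambda>n. G (r n) w)) \<in> borel_measurable P"
      by (rule borel_measurable_lim_metric[OF GD[OF r(1)]])
    then show ?thesis unfolding eq using good_m by measurable
  qed
  have "V \<in> P \<rightarrow>\<^sub>M path_algebra"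
    unfolding path_algebra_def
  proof (intro measurable_restrict_space2)
    show "V \<in> space P \<rightarrow> {p. continuous_on {0..1} p}"
      using Vs by (auto simp: space_nu space_path_algebra)
    show "V \<in> P \<rightarrow>\<^sub>M Pi\<^sub>M {0..1} (\<lambda>_. borel)"
    proof (rule measurable_PiM_single')
      show "(\<lambda>w. V w i) \<in> borel_measurable P" if "i \<in> {0..1}" for i by (rule Vt[OF that])
      show "V \<in> space P \<rightarrow> (\<Pi>\<^sub>E i\<in>{0..1}. space borel)"
        using Vs by (auto simp: space_nu space_path_algebra PiE_def)
    qed
  qed
  moreover have "AE w in P. V (U w) = w"
  proof -
    have "AE w in P. \<forall>t\<in>sample_times. w t = G t (U w)"
      using G(2) sample_times_sub by (subst AE_ball_countable[OF countable_sample_times]) auto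
    then show ?thesis using AE_space
    proof eventually_elim
      case (elim w)
      have p: "w \<in> space \<nu>" using elim(2) by simp
      have "uniformly_continuous_on {0..1} w"
        using p by (intro compact_uniformly_continuous) (auto simp: space_nu space_path_algebra)
      then have "uniformly_continuous_on sample_times w"
        using sample_times_sub unfolding uniformly_continuous_on_def by (meson subsetD)
      then have "good (U w)"
        unfolding good_def uniformly_continuous_on_def using elim(1) by simp
      from Vg[OF this] show ?case
        using elim(1) by (intro path_determined[OF _ p]) auto
    qed
  qed
  ultimately show ?thesis by (rule that)
qed

end

section \<open>Conditional cost\<close>

text \<open>Cancellation in the extended half-line: \<open>a\<close> and \<open>d\<close> may be
  infinite, \<open>r\<close> and \<open>c\<close> are finite. Since \<open>ennreal\<close> of a real
  is its positive part, \<open>L\<close> enters through both of its parts.\<close>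

lemma ereal_diff_from_sum:
  fixes a d r c :: ennreal and L :: real
  assumes eq: "a + (r + ennreal (- L)) = d + (r + (ennreal L + c))" and r: "r < \<infinity>" and c: "c < \<infinity>"
  shows "enn2ereal a - enn2ereal c = enn2ereal d + ereal L"
proof -
  obtain r' where r': "r = ennreal r'" "0 \<le> r'" using r by (cases r) auto
  obtain c' where c': "c = ennreal c'" "0 \<le> c'" using c by (cases c) auto
  define Lp where "Lp = max 0 L"
  define Lm where "Lm = max 0 (- L)"
  have L: "ennreal L = ennreal Lp" "ennreal (- L) = ennreal Lm" "0 \<le> Lp" "0 \<le> Lm" "L = Lp - Lm"
    by (auto simp: Lp_def Lm_def max_def ennreal_neg)
  have eq': "a + ennreal (r' + Lm) = d + ennreal (r' + (Lp + c'))"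
    using eq L(3,4) r'(2) c'(2) by (simp add: L(1,2) r'(1) c'(1))
  show ?thesis
  proof (cases a)
    case (real a')
    have "d \<noteq> \<top>"
    proof
      assume "d = \<top>"
      then have "ennreal (a' + (r' + Lm)) = \<top>" using eq' real L(4) r'(2) by simp
      then show False by simp
    qed
    then obtain d' where d': "d = ennreal d'" "0 \<le> d'" by (cases d) auto
    have "ennreal (a' + (r' + Lm)) = ennreal (d' + (r' + (Lp + c')))"
      using eq' real d' L(3,4) r'(2) c'(2) by simp
    then have "a' + (r' + Lm) = d' + (r' + (Lp + c'))"
      using real d' L(3,4) r'(2) c'(2) by (subst (asm) ennreal_inj) auto
    then have "a' - c' = d' + L" using L(5) by simp
    then show ?thesis using real c' d' by (simp add: enn2ereal_ennreal)
  next
    case top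
    have "d = \<top>"
    proof (rule ccontr)
      assume "d \<noteq> \<top>"
      then obtain d' where d': "d = ennreal d'" "0 \<le> d'" by (cases d) auto
      have "ennreal (d' + (r' + (Lp + c'))) = \<top>" using eq' top d' L(3) r'(2) c'(2) by simp
      then show False by simp
    qed
    then show ?thesis using top c' by (simp add: enn2ereal_ennreal)
  qed
qed

section \<open>Decomposition of the conditional cost\<close>

context adapted_shift
begin

lemma sigma_finite_F\<tau>: "sigma_finite_subalgebra P F\<tau>"
  by (rule finite_measure_subalgebra_is_sigma_finite[OF finite_measure_subalgebra.intro[OF finite_measure_axioms finite_measure_subalgebra_axioms.intro[OF subalgebra_F\<tau>]]])

context
  fixes f :: "'n path \<Rightarrow> real"
  assumes f[measurable]: "f \<in> borel_measurable P"
    and finite_cond: "AE w in P. nn_cond_exp P F\<tau> (\<lambda>w. ennreal (exp (- f w))) w < \<infinity>"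
begin

definition Z :: "'n path \<Rightarrow> real" where "Z = real_cond_exp P F\<tau> (\<lambda>w. exp (- f w))"
definition M :: "'n path \<Rightarrow> real" where "M w = exp (- f w) / Z w"
definition Q :: "'n path \<Rightarrow> real" where "Q w = M (U w) * \<rho> w"

interpretation sf: sigma_finite_subalgebra P F\<tau> by (rule sigma_finite_F\<tau>)

lemma Z_F\<tau>[measurable]: "Z \<in> borel_measurable F\<tau>" unfolding Z_def by simp

lemma Z_P[measurable]: "Z \<in> borel_measurable P"
  by (rule measurable_from_subalg[OF subalgebra_F\<tau> Z_F\<tau>])

lemma Z_eq: "AE w in P. ennreal (Z w) = nn_cond_exp P F\<tau> (\<lambda>w. ennreal (exp (- f w))) w"
proof -
  have "(\<lambda>w. ennreal (- exp (- f w))) = (\<lambda>w. 0)" by (auto simp: ennreal_neg)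
  moreover have "AE w in P. (0::ennreal) = nn_cond_exp P F\<tau> (\<lambda>w. 0) w"
    by (rule sf.nn_cond_exp_F_meas) simp
  ultimately have "AE w in P. nn_cond_exp P F\<tau> (\<lambda>w. ennreal (- exp (- f w))) w = 0" by simp
  then show ?thesis using finite_cond
  proof eventually_elim
    case (elim w)
    then show ?case by (simp add: Z_def real_cond_exp_def)
  qed
qed

text \<open>On the event that the conditional expectation is 0, which lies in
  \<open>F\<tau>\<close>, the strictly positive function \<open>exp (- f)\<close> has integral 0; so
  the event is null.\<close>

lemma Z_pos: "AE w in P. 0 < Z w"
proof -
  let ?N = "nn_cond_exp P F\<tau> (\<lambda>w. ennreal (exp (- f w)))"
  define A where "A = {w \<in> space F\<tau>. ?N w = 0}"
  have A: "A \<in> sets F\<tau>" unfolding A_def by measurable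
  have AP[measurable]: "A \<in> sets P" by (rule sets_F\<tau>_P[OF A])
  have "(\<integral>\<^sup>+w. indicator A w * ennreal (exp (- f w)) \<partial>P) = (\<integral>\<^sup>+w. indicator A w * ?N w \<partial>P)"
    by (rule sf.nn_cond_exp_intg[OF borel_measurable_indicator[OF A], symmetric]) measurable
  also have "\<dots> = (\<integral>\<^sup>+w. 0 \<partial>P)" by (intro nn_integral_cong) (auto simp: A_def indicator_def)
  finally have "(\<integral>\<^sup>+w. indicator A w * ennreal (exp (- f w)) \<partial>P) = 0" by simp
  then have "AE w in P. indicator A w * ennreal (exp (- f w)) = 0"
    by (subst (asm) nn_integral_0_iff_AE) measurable
  then show ?thesis using Z_eq AE_space
  proof eventually_elim
    case (elim w)
    have "w \<notin> A" using elim(1) by (auto simp: indicator_def split: if_splits)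
    then have "?N w \<noteq> 0" using elim(3) subalgebra_F\<tau> by (auto simp: A_def subalgebra_def)
    then have "ennreal (Z w) \<noteq> 0" using elim(2) by simp
    then show ?case by (simp add: ennreal_eq_0_iff)
  qed
qed

lemma M_measurable[measurable]: "M \<in> borel_measurable P" unfolding M_def by measurable

lemma M_pos: "AE w in P. 0 < M w"
  using Z_pos by eventually_elim (simp add: M_def)

lemma M_U_measurable[measurable]: "(\<lambda>w. M (U w)) \<in> borel_measurable P"
  by (rule measurable_compose[OF U_PP M_measurable])

lemma Q_measurable[measurable]: "Q \<in> borel_measurable P" unfolding Q_def by measurable

lemma Q_pos: "AE w in P. 0 < Q w"
  using AE_U[OF M_pos] by eventually_elim (simp add: Q_def rho_positive)

lemma M_integral:
  assumes A: "A \<in> sets F\<tau>" shows "(\<integral>\<^sup>+w. indicator A w * ennreal (M w) \<partial>P) = emeasure P A"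
proof -
  have AP[measurable]: "A \<in> sets P" by (rule sets_F\<tau>_P[OF A])
  let ?N = "nn_cond_exp P F\<tau> (\<lambda>w. ennreal (exp (- f w)))"
  have "(\<integral>\<^sup>+w. indicator A w * ennreal (M w) \<partial>P) = (\<integral>\<^sup>+w. (indicator A w * ennreal (1 / Z w)) * ennreal (exp (- f w)) \<partial>P)"
    using Z_pos by (intro nn_integral_cong_AE, eventually_elim) (simp add: M_def ennreal_mult[symmetric] mult.assoc)
  also have "\<dots> = (\<integral>\<^sup>+w. (indicator A w * ennreal (1 / Z w)) * ?N w \<partial>P)"
    by (rule sf.nn_cond_exp_intg[OF borel_measurable_times_ennreal[OF borel_measurable_indicator[OF A]
          measurable_compose[OF borel_measurable_divide[OF borel_measurable_const Z_F\<tau>] measurable_ennreal]], symmetric]) measurable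
  also have "\<dots> = (\<integral>\<^sup>+w. indicator A w \<partial>P)"
  proof (rule nn_integral_cong_AE)
    show "AE w in P. (indicator A w * ennreal (1 / Z w)) * ?N w = indicator A w"
      using Z_pos Z_eq
    proof eventually_elim
      case (elim w)
      have "ennreal (1 / Z w) * ?N w = 1" using elim(1) unfolding elim(2)[symmetric] by (simp add: ennreal_mult[symmetric])
      then show ?case by (simp add: mult.assoc)
    qed
  qed
  also have "\<dots> = emeasure P A" by (rule nn_integral_indicator[OF AP])
  finally show ?thesis .
qed

text \<open>\<open>M\<close> has conditional mean 1 given \<open>F\<tau>\<close>, and
  \<open>stopped_law\<close> transfers this to \<open>Q\<close>.\<close>

lemma Q_integral:
  assumes A: "A \<in> sets F\<tau>" shows "(\<integral>\<^sup>+w. indicator A w * ennreal (Q w) \<partial>P) = emeasure P A"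
proof -
  have "(\<integral>\<^sup>+w. indicator A w * ennreal (Q w) \<partial>P) = (\<integral>\<^sup>+w. indicator A w * ennreal (\<rho> w) * ennreal (M (U w)) \<partial>P)"
    using AE_U[OF M_pos] by (intro nn_integral_cong_AE, eventually_elim)
      (simp add: Q_def ennreal_mult rho_positive less_imp_le mult_ac)
  also have "\<dots> = (\<integral>\<^sup>+w. indicator A w * ennreal (M w) \<partial>P)" by (rule stopped_law[OF A]) measurable
  also have "\<dots> = emeasure P A" by (rule M_integral[OF A])
  finally show ?thesis .
qed

lemma Q_mean:
  shows "integrable P Q" and "A \<in> sets F\<tau> \<Longrightarrow> (LINT w|P. indicator A w * Q w) = prob A"
proof -
  have sp: "space P \<in> sets F\<tau>" using subalgebra_F\<tau> sets.top[of F\<tau>] by (simp add: subalgebra_def)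
  have "(\<integral>\<^sup>+w. ennreal (norm (Q w)) \<partial>P) = (\<integral>\<^sup>+w. indicator (space P) w * ennreal (Q w) \<partial>P)"
    using Q_pos AE_space by (intro nn_integral_cong_AE, eventually_elim) simp
  also have "\<dots> < \<infinity>" unfolding Q_integral[OF sp] by (simp add: emeasure_eq_measure less_top[symmetric] del: emeasure_completion)
  finally show i: "integrable P Q" by (intro integrableI_bounded Q_measurable)
  assume A: "A \<in> sets F\<tau>"
  have AP[measurable]: "A \<in> sets P" by (rule sets_F\<tau>_P[OF A])
  have "(LINT w|P. indicator A w * Q w) = enn2real (\<integral>\<^sup>+w. ennreal (indicator A w * Q w) \<partial>P)"
  proof (rule integral_eq_nn_integral)
    show "AE w in P. 0 \<le> indicator A w * Q w" using Q_pos by eventually_elim simp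
  qed measurable
  also have "(\<integral>\<^sup>+w. ennreal (indicator A w * Q w) \<partial>P) = (\<integral>\<^sup>+w. indicator A w * ennreal (Q w) \<partial>P)"
    by (intro nn_integral_cong) (auto simp: indicator_def)
  finally show "(LINT w|P. indicator A w * Q w) = prob A" unfolding Q_integral[OF A] by (simp add: measure_def)
qed

text \<open>Taking logarithms in \<open>Q\<close> turns the cost into
  \<open>- ln Q + I - ln Z\<close>. Adding and subtracting \<open>Q - 1\<close> splits it into
  \<open>D\<close>, which is nonnegative, the term \<open>R\<close> of conditional mean 0, and
  \<open>- ln Z\<close>.\<close>

definition D :: "'n path \<Rightarrow> real" where "D w = Q w - 1 - ln (Q w)"
definition R :: "'n path \<Rightarrow> real" where "R w = 1 - Q w + I w"
definition cost :: "'n path \<Rightarrow> real" where "cost w = f (U w) + energy (u w) / 2"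

lemma D_measurable[measurable]: "D \<in> borel_measurable P" unfolding D_def by measurable

lemma integrable_R: "integrable P R"
  unfolding R_def using Q_mean(1) ito_mean_zero(1) by simp

lemma R_measurable[measurable]: "R \<in> borel_measurable P"
  by (rule borel_measurable_integrable[OF integrable_R])

lemma cost_measurable[measurable]: "cost \<in> borel_measurable P"
  unfolding cost_def
  by (intro borel_measurable_add borel_measurable_divide measurable_compose[OF U_PP f] borel_measurable_const
      borel_measurable_integrable[OF integrable_energy_u])

lemma D_nonneg: "AE w in P. 0 \<le> D w"
  using Q_pos
proof eventually_elim
  case (elim w)
  then show ?case using ln_le_minus_one[of "Q w"] by (simp add: D_def)
qed

lemma D_zero_iff: "AE w in P. D w = 0 \<longleftrightarrow> Q w = 1"
  using Q_pos
proof eventually_elim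
  case (elim w)
  then show ?case using ln_eq_minus_one[of "Q w"] by (auto simp: D_def)
qed

lemma rho_formula: "\<rho> w = exp (I w - energy (u w) / 2)"
  by (rule ex_approximation) (rule rho_eq)

lemma cost_eq: "AE w in P. cost w = D w + R w + - ln (Z w)"
  using AE_U[OF Z_pos] stopped_function_invariant[OF Z_F\<tau>]
proof eventually_elim
  case (elim w)
  \<comment> \<open>\<open>Z\<close> is \<open>F\<tau>\<close>-measurable, so the
    \<open>Z (U w)\<close> inside \<open>M (U w)\<close> is \<open>Z w\<close>.\<close>
  have "ln (Q w) = - f (U w) - ln (Z w) + (I w - energy (u w) / 2)"
    using elim by (simp add: Q_def M_def rho_formula ln_mult ln_div)
  then show ?case by (simp add: cost_def D_def R_def)
qed

text \<open>Conditional mean 0 of \<open>R\<close>, stated for its positive and negative parts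
  separately because \<open>ereal_cond_exp\<close> is a difference of such terms; both are finite as
  \<open>R\<close> is integrable.\<close>

lemma R_cond: "AE w in P. nn_cond_exp P F\<tau> (\<lambda>w. ennreal (R w)) w = nn_cond_exp P F\<tau> (\<lambda>w. ennreal (- R w)) w"
  "AE w in P. nn_cond_exp P F\<tau> (\<lambda>w. ennreal (R w)) w < \<infinity>"
proof -
  have iR: "(\<integral>\<^sup>+w. ennreal (R w) \<partial>P) < \<infinity>" and iR': "(\<integral>\<^sup>+w. ennreal (- R w) \<partial>P) < \<infinity>"
    using integrable_R by (auto simp: real_integrable_def less_top)
  show "AE w in P. nn_cond_exp P F\<tau> (\<lambda>w. ennreal (R w)) w < \<infinity>"
  proof -
    have "(\<integral>\<^sup>+w. nn_cond_exp P F\<tau> (\<lambda>w. ennreal (R w)) w \<partial>P) = (\<integral>\<^sup>+w. ennreal (R w) \<partial>P)"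
      using sf.nn_cond_exp_intg[of "\<lambda>_. 1" "\<lambda>w. ennreal (R w)"] by simp
    then have "AE w in P. nn_cond_exp P F\<tau> (\<lambda>w. ennreal (R w)) w \<noteq> \<infinity>"
      using iR by (intro nn_integral_noteq_infinite) auto
    then show ?thesis by eventually_elim (simp add: less_top)
  qed
  show "AE w in P. nn_cond_exp P F\<tau> (\<lambda>w. ennreal (R w)) w = nn_cond_exp P F\<tau> (\<lambda>w. ennreal (- R w)) w"
  proof (rule sf.nn_cond_exp_charact)
    fix A assume A: "A \<in> sets F\<tau>"
    have AP[measurable]: "A \<in> sets P" by (rule sets_F\<tau>_P[OF A])
    have iA: "integrable P (\<lambda>w. indicator A w * R w)"
      using integrable_mult_indicator[OF AP integrable_R] by simp
    have iQ: "integrable P (\<lambda>w. indicator A w * Q w)"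
      using integrable_mult_indicator[OF AP Q_mean(1)] by simp
    have iI: "integrable P (\<lambda>w. indicator A w * I w)"
      using integrable_mult_indicator[OF AP ito_mean_zero(1)] by simp
    have i1: "integrable P (\<lambda>w. indicator A w :: real)" by (simp add: emeasure_eq_measure)
    have "(LINT w|P. indicator A w * R w) = (LINT w|P. indicator A w - indicator A w * Q w + indicator A w * I w)"
      by (intro Bochner_Integration.integral_cong[OF refl]) (simp add: R_def algebra_simps)
    also have "\<dots> = (LINT w|P. indicator A w) - (LINT w|P. indicator A w * Q w) + (LINT w|P. indicator A w * I w)"
      using i1 iQ iI by simp
    also have "(LINT w|P. indicator A w) = prob A"
      using sets.sets_into_space[OF AP] by (simp only: Bochner_Integration.integral_indicator Int_absorb2)
    finally have "(LINT w|P. indicator A w * R w) = 0" using Q_mean(2)[OF A] ito_mean_zero(2)[OF A] by simp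
    then have e: "enn2real (\<integral>\<^sup>+w. ennreal (indicator A w * R w) \<partial>P) = enn2real (\<integral>\<^sup>+w. ennreal (- (indicator A w * R w)) \<partial>P)"
      using iA by (simp add: real_lebesgue_integral_def)
    have fin: "(\<integral>\<^sup>+w. ennreal (indicator A w * R w) \<partial>P) \<noteq> \<top>" "(\<integral>\<^sup>+w. ennreal (- (indicator A w * R w)) \<partial>P) \<noteq> \<top>"
      using iA by (auto simp: real_integrable_def)
    have "(\<integral>\<^sup>+w. ennreal (indicator A w * R w) \<partial>P) = (\<integral>\<^sup>+w. ennreal (- (indicator A w * R w)) \<partial>P)"
      using arg_cong[OF e, of ennreal] fin[THEN iffD1[OF less_top]] by (simp only: ennreal_enn2real)
    moreover have "ennreal (R w) * indicator A w = ennreal (indicator A w * R w)"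
      "ennreal (- R w) * indicator A w = ennreal (- (indicator A w * R w))" for w by (auto simp: indicator_def)
    ultimately have "(\<integral>\<^sup>+w\<in>A. ennreal (- R w) \<partial>P) = (\<integral>\<^sup>+w\<in>A. ennreal (R w) \<partial>P)" by simp
    also have "\<dots> = (\<integral>\<^sup>+w. indicator A w * ennreal (R w) \<partial>P)" by (simp add: mult.commute)
    also have "\<dots> = (\<integral>\<^sup>+w. indicator A w * nn_cond_exp P F\<tau> (\<lambda>w. ennreal (R w)) w \<partial>P)"
      by (rule sf.nn_cond_exp_intg[OF borel_measurable_indicator[OF A], symmetric]) measurable
    finally show "(\<integral>\<^sup>+w\<in>A. ennreal (- R w) \<partial>P) = (\<integral>\<^sup>+w\<in>A. nn_cond_exp P F\<tau> (\<lambda>w. ennreal (R w)) w \<partial>P)"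
      by (simp add: mult.commute)
  qed auto
qed

text \<open>Conditional expectations of nonnegative functions add without restriction. The
  decomposition of the cost is therefore rearranged into an equality between sums of positive parts,
  conditioned, and solved again by \<open>ereal_diff_from_sum\<close>.\<close>

lemma cost_cond_exp:
  "AE w in P. ereal_cond_exp P F\<tau> cost w = enn2ereal (nn_cond_exp P F\<tau> (\<lambda>w. ennreal (D w)) w) + ereal (- ln (Z w))"
proof -
  let ?N = "\<lambda>g. nn_cond_exp P F\<tau> (\<lambda>w. ennreal (g w))"
  define L where "L w = - ln (Z w)" for w
  define nR where "nR w = - R w" for w
  define nL where "nL w = - L w" for w
  define nc where "nc w = - cost w" for w
  have LF: "L \<in> borel_measurable F\<tau>" unfolding L_def by measurable
  have L: "AE w in P. ennreal (L w) = ?N L w" "AE w in P. ennreal (nL w) = ?N nL w"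
    unfolding nL_def using LF by (auto intro!: sf.nn_cond_exp_F_meas)
  have [measurable]: "L \<in> borel_measurable P" "nR \<in> borel_measurable P" "nL \<in> borel_measurable P" "nc \<in> borel_measurable P"
    unfolding nR_def nL_def nc_def by (simp_all add: measurable_from_subalg[OF subalgebra_F\<tau> LF])
  have add: "AE w in P. ?N a w + (?N b w + ?N c w) = nn_cond_exp P F\<tau> (\<lambda>w. ennreal (a w) + (ennreal (b w) + ennreal (c w))) w"
    if [measurable]: "a \<in> borel_measurable P" "b \<in> borel_measurable P" "c \<in> borel_measurable P" for a b c :: "'n path \<Rightarrow> real"
  proof -
    have 1: "AE w in P. ?N b w + ?N c w = nn_cond_exp P F\<tau> (\<lambda>w. ennreal (b w) + ennreal (c w)) w"
      by (rule sf.nn_cond_exp_sum) measurable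
    have 2: "AE w in P. ?N a w + nn_cond_exp P F\<tau> (\<lambda>w. ennreal (b w) + ennreal (c w)) w
       = nn_cond_exp P F\<tau> (\<lambda>w. ennreal (a w) + (ennreal (b w) + ennreal (c w))) w"
      by (rule sf.nn_cond_exp_sum) measurable
    from 1 2 show ?thesis by eventually_elim simp
  qed
  have add': "AE w in P. ?N a w + nn_cond_exp P F\<tau> b w = nn_cond_exp P F\<tau> (\<lambda>w. ennreal (a w) + b w) w"
    if [measurable]: "a \<in> borel_measurable P" "b \<in> borel_measurable P" for a :: "'n path \<Rightarrow> real" and b
    by (rule sf.nn_cond_exp_sum) measurable
  have parts: "ennreal c + (ennreal (- r) + ennreal (- l)) = ennreal d + (ennreal r + (ennreal l + ennreal (- c)))"
    if "c = d + r + l" "0 \<le> d" for c d r l :: real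
  proof -
    have m: "ennreal x = ennreal (max 0 x)" for x by (simp add: max_def ennreal_neg)
    have "ennreal (max 0 c) + (ennreal (max 0 (- r)) + ennreal (max 0 (- l))) = ennreal (max 0 d) + (ennreal (max 0 r) + (ennreal (max 0 l) + ennreal (max 0 (- c))))"
      using that by (simp add: ennreal_plus[symmetric] max_def del: ennreal_plus)
    then show ?thesis unfolding m[symmetric] .
  qed
  have "AE w in P. ennreal (cost w) + (ennreal (nR w) + ennreal (nL w)) = ennreal (D w) + (ennreal (R w) + (ennreal (L w) + ennreal (nc w)))"
    using cost_eq D_nonneg
  proof eventually_elim
    case (elim w)
    then show ?case unfolding nR_def nL_def nc_def by (intro parts) (simp add: L_def)
  qed
  then have "AE w in P. nn_cond_exp P F\<tau> (\<lambda>w. ennreal (cost w) + (ennreal (nR w) + ennreal (nL w))) w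
     = nn_cond_exp P F\<tau> (\<lambda>w. ennreal (D w) + (ennreal (R w) + (ennreal (L w) + ennreal (nc w)))) w"
    by (rule sf.nn_cond_exp_cong) measurable
  moreover have "AE w in P. ?N cost w + (?N nR w + ?N nL w) = nn_cond_exp P F\<tau> (\<lambda>w. ennreal (cost w) + (ennreal (nR w) + ennreal (nL w))) w"
    by (rule add) measurable
  moreover have "AE w in P. ?N R w + (?N L w + ?N nc w) = nn_cond_exp P F\<tau> (\<lambda>w. ennreal (R w) + (ennreal (L w) + ennreal (nc w))) w"
    by (rule add) measurable
  moreover have "AE w in P. ?N D w + nn_cond_exp P F\<tau> (\<lambda>w. ennreal (R w) + (ennreal (L w) + ennreal (nc w))) w
     = nn_cond_exp P F\<tau> (\<lambda>w. ennreal (D w) + (ennreal (R w) + (ennreal (L w) + ennreal (nc w)))) w"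
    by (rule add') measurable
  ultimately have sum: "AE w in P. ?N cost w + (?N nR w + ?N nL w) = ?N D w + (?N R w + (?N L w + ?N nc w))"
    by eventually_elim (simp only:)
  \<comment> \<open>As \<open>D\<close> is nonnegative, the negative part of the cost is dominated
    by those of \<open>R\<close> and \<open>- ln Z\<close>; hence its conditional expectation is
    finite and may be subtracted.\<close>
  have "AE w in P. ennreal (nc w) \<le> ennreal (nR w) + ennreal (nL w)"
    using cost_eq D_nonneg
  proof eventually_elim
    case (elim w)
    have "nc w \<le> max 0 (nR w) + max 0 (nL w)" using elim by (simp add: nc_def nR_def nL_def L_def)
    then have "ennreal (nc w) \<le> ennreal (max 0 (nR w) + max 0 (nL w))" by (rule ennreal_leI)
    also have "\<dots> = ennreal (nR w) + ennreal (nL w)" by (simp add: max_def ennreal_neg)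
    finally show ?case .
  qed
  then have "AE w in P. ?N nc w \<le> nn_cond_exp P F\<tau> (\<lambda>w. ennreal (nR w) + ennreal (nL w)) w"
    by (rule sf.nn_cond_exp_mono) measurable
  moreover have "AE w in P. ?N nR w + ?N nL w = nn_cond_exp P F\<tau> (\<lambda>w. ennreal (nR w) + ennreal (nL w)) w"
    by (rule sf.nn_cond_exp_sum) measurable
  ultimately have nc_le: "AE w in P. ?N nc w \<le> ?N nR w + ?N nL w" by eventually_elim simp
  from sum nc_le L R_cond(1)[folded nR_def] R_cond(2)
  show ?thesis
  proof eventually_elim
    case (elim w)
    have R: "?N nR w < \<infinity>" using elim(5,6) by simp
    have "?N nR w + ?N nL w < \<infinity>" using R unfolding elim(4)[symmetric] by simp
    then have c: "?N nc w < \<infinity>" using elim(2) by (rule le_less_trans[rotated])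
    have "?N cost w + (?N nR w + ennreal (- L w)) = ?N D w + (?N nR w + (ennreal (L w) + ?N nc w))"
      using elim(1) unfolding elim(3)[symmetric] elim(4)[symmetric] elim(5) nL_def[symmetric] .
    from ereal_diff_from_sum[OF this R c]
    show ?case unfolding ereal_cond_exp_def nc_def L_def .
  qed
qed

text \<open>The real number \<open>- ln Z\<close> cancels, and the conditional expectation of the
  nonnegative \<open>D\<close> vanishes only if \<open>D\<close> does, which is the equality case of
  \<open>ln x \<le> x - 1\<close>.\<close>

lemma cost_attained_iff:
  "(AE w in P. ereal_cond_exp P F\<tau> cost w = ereal (- ln (Z w))) \<longleftrightarrow> (AE w in P. Q w = 1)"
proof -
  let ?N = "nn_cond_exp P F\<tau> (\<lambda>w. ennreal (D w))"
  have eq: "enn2ereal a + ereal b = ereal b \<longleftrightarrow> a = 0" for a b by (cases a) (auto simp: enn2ereal_ennreal)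
  have "(AE w in P. ereal_cond_exp P F\<tau> cost w = ereal (- ln (Z w))) \<longleftrightarrow> (AE w in P. ?N w = 0)"
  proof
    assume "AE w in P. ereal_cond_exp P F\<tau> cost w = ereal (- ln (Z w))"
    with cost_cond_exp show "AE w in P. ?N w = 0"
    proof eventually_elim
      case (elim w)
      then have "enn2ereal (?N w) + ereal (- ln (Z w)) = ereal (- ln (Z w))" by simp
      then show ?case by (simp only: eq)
    qed
  next
    assume "AE w in P. ?N w = 0"
    with cost_cond_exp show "AE w in P. ereal_cond_exp P F\<tau> cost w = ereal (- ln (Z w))"
      by eventually_elim (simp add: zero_ennreal.rep_eq)
  qed
  also have "\<dots> \<longleftrightarrow> (\<integral>\<^sup>+w. ?N w \<partial>P) = 0" by (rule nn_integral_0_iff_AE[symmetric]) simp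
  also have "(\<integral>\<^sup>+w. ?N w \<partial>P) = (\<integral>\<^sup>+w. ennreal (D w) \<partial>P)"
    using sf.nn_cond_exp_intg[of "\<lambda>_. 1" "\<lambda>w. ennreal (D w)"] by simp
  also have "\<dots> = 0 \<longleftrightarrow> (AE w in P. ennreal (D w) = 0)" by (rule nn_integral_0_iff_AE) measurable
  also have "\<dots> \<longleftrightarrow> (AE w in P. Q w = 1)"
  proof
    assume "AE w in P. ennreal (D w) = 0"
    with D_nonneg D_zero_iff show "AE w in P. Q w = 1" by eventually_elim (simp add: ennreal_eq_0_iff)
  next
    assume "AE w in P. Q w = 1"
    with D_zero_iff show "AE w in P. ennreal (D w) = 0" by eventually_elim simp
  qed
  finally show ?thesis .
qed

section \<open>Optimality and left invertibility\<close>

lemma left_invertible_of_density: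
  assumes Q1: "AE w in P. Q w = 1"
  shows "left_invertible \<nu> U" and "AE w in P. RN_deriv \<nu> (image_law \<nu> U) w = ennreal (M w)"
proof -
  \<comment> \<open>From \<open>Q = 1\<close> the density is the inverse of \<open>M (U w)\<close>;
    the value 1 on the null set where \<open>M\<close> is not positive keeps \<psi> positive
    everywhere.\<close>
  define \<psi> where "\<psi> w = (if 0 < M w then 1 / M w else 1)" for w
  have \<psi>m: "\<psi> \<in> borel_measurable P" unfolding \<psi>_def by measurable
  have \<psi>p: "0 < \<psi> w" for w by (simp add: \<psi>_def)
  have \<psi>U: "AE w in P. \<rho> w = \<psi> (U w)"
    using Q1 AE_U[OF M_pos]
  proof eventually_elim
    case (elim w)
    then show ?case by (simp add: Q_def \<psi>_def field_simps)
  qed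
  interpret d: adapted_shift_density \<nu> \<beta> \<tau> u U \<psi>
    by (intro adapted_shift_density.intro adapted_shift_density_axioms.intro adapted_shift_axioms \<psi>m \<psi>p \<psi>U)
  obtain V where V: "V \<in> P \<rightarrow>\<^sub>M path_algebra" "AE w in P. V (U w) = w" by (rule d.left_inverse) (rule that)
  have s: "sets (image_law \<nu> U) = sets \<nu>" by (simp add: image_law_def sets_nu)
  have ac: "absolutely_continuous \<nu> (image_law \<nu> U)"
    unfolding absolutely_continuous_def
  proof
    fix N assume N: "N \<in> null_sets \<nu>"
    then have Nm: "N \<in> sets path_algebra" using sets_nu by auto
    have "emeasure (image_law \<nu> U) N = emeasure P (U -` N \<inter> space P)"
      unfolding image_law_def by (rule emeasure_distr[OF U_path Nm])
    also have "\<dots> = 0" unfolding space_completion by (rule null_setsD1[OF U_pullback_null[OF N]])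
    finally show "N \<in> null_sets (image_law \<nu> U)" using N s by (intro null_setsI) auto
  qed
  show "left_invertible \<nu> U"
    unfolding left_invertible_def using U_path ac V by blast
  have Mm: "(\<lambda>w. ennreal (M w)) \<in> borel_measurable P" by measurable
  \<comment> \<open>\<open>M\<close> is measurable for the completion, whereas
    \<open>RN_deriv\<close> is taken with respect to \<nu>; a \<nu>-measurable version
    mediates.\<close>
  obtain M' where M': "M' \<in> borel_measurable \<nu>" "AE w in \<nu>. ennreal (M w) = M' w"
    using completion_ex_borel_measurable[OF Mm] by blast
  have "density \<nu> M' = image_law \<nu> U"
  proof (rule measure_eqI)
    show "sets (density \<nu> M') = sets (image_law \<nu> U)" using s by simp
    fix A assume "A \<in> sets (density \<nu> M')"
    then have A: "A \<in> sets \<nu>" by simp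
    then have AP[measurable]: "A \<in> sets P" by simp
    have "emeasure (density \<nu> M') A = (\<integral>\<^sup>+w. M' w * indicator A w \<partial>\<nu>)" by (rule emeasure_density[OF M'(1) A])
    also have "\<dots> = (\<integral>\<^sup>+w. M' w * indicator A w \<partial>P)" by (rule nn_integral_completion[symmetric])
    also have "\<dots> = (\<integral>\<^sup>+w. ennreal (M w) * indicator A w \<partial>P)"
      using AE_completion[OF M'(2)] by (intro nn_integral_cong_AE, eventually_elim) simp
    \<comment> \<open>Written under \<open>\<rho> \<nu>\<close> and composed with \<open>U\<close>,
      the density contributes the factor \<open>Q = 1\<close>, and the law of \<open>U\<close> under
      \<nu> remains.\<close>
    also have "\<dots> = (\<integral>\<^sup>+w. ennreal (\<rho> w) * (ennreal (M (U w)) * indicator A (U w)) \<partial>P)"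
      by (rule U_law_P[symmetric]) measurable
    also have "\<dots> = (\<integral>\<^sup>+w. indicator (U -` A \<inter> space P) w \<partial>P)"
    proof (rule nn_integral_cong_AE)
      show "AE w in P. ennreal (\<rho> w) * (ennreal (M (U w)) * indicator A (U w)) = indicator (U -` A \<inter> space P) w"
        using Q1 AE_U[OF M_pos] AE_space
      proof eventually_elim
        case (elim w)
        have "ennreal (\<rho> w) * ennreal (M (U w)) = 1"
          using elim(1,2) rho_positive[of w] by (simp add: Q_def ennreal_mult[symmetric] mult.commute)
        then have "ennreal (\<rho> w) * (ennreal (M (U w)) * indicator A (U w)) = indicator A (U w)"
          by (simp only: mult.assoc[symmetric] mult_1)
        then show ?case using elim(3) by (simp add: indicator_def)
      qed
    qed
    also have "\<dots> = emeasure P (U -` A \<inter> space P)" by (rule nn_integral_indicator[OF measurable_sets[OF U_PP AP]])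
    also have "\<dots> = emeasure (image_law \<nu> U) A"
      unfolding image_law_def using A sets_nu by (intro emeasure_distr[OF U_path, symmetric]) simp
    finally show "emeasure (density \<nu> M') A = emeasure (image_law \<nu> U) A" .
  qed
  then have "AE w in \<nu>. M' w = RN_deriv \<nu> (image_law \<nu> U) w"
    by (rule sigma_finite_measure.RN_deriv_unique[OF prob_space_imp_sigma_finite[OF prob_nu] M'(1)])
  with M'(2) have "AE w in \<nu>. RN_deriv \<nu> (image_law \<nu> U) w = ennreal (M w)" by eventually_elim simp
  then show "AE w in P. RN_deriv \<nu> (image_law \<nu> U) w = ennreal (M w)" by (rule AE_completion)
qed

lemma density_of_left_invertible:
  assumes li: "left_invertible \<nu> U" and RN: "AE w in P. RN_deriv \<nu> (image_law \<nu> U) w = ennreal (M w)"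
  shows "AE w in P. Q w = 1"
proof -
  obtain V where V: "V \<in> P \<rightarrow>\<^sub>M path_algebra" "AE w in P. V (U w) = w"
    and ac: "absolutely_continuous \<nu> (image_law \<nu> U)"
    using li unfolding left_invertible_def by blast
  interpret nu: sigma_finite_measure \<nu> by (rule prob_space_imp_sigma_finite[OF prob_nu])
  have s: "sets (image_law \<nu> U) = sets \<nu>" by (simp add: image_law_def sets_nu)
  have V\<nu>: "V \<in> P \<rightarrow>\<^sub>M \<nu>" unfolding measurable_cong_sets[OF refl sets_nu] by (rule V(1))
  have rm: "(\<lambda>w. ennreal (\<rho> w)) \<in> borel_measurable P" by measurable
  \<comment> \<open>\<open>V\<close> is measurable into \<nu>, and its preimages of null sets are
    not controlled, so \<rho> is replaced by a \<nu>-measurable version before composing with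
    \<open>V\<close>.\<close>
  obtain r where r: "r \<in> borel_measurable \<nu>" "AE w in \<nu>. ennreal (\<rho> w) = r w"
    using completion_ex_borel_measurable[OF rm] by blast
  define \<psi> where "\<psi> w = r (V w)" for w
  have \<psi>m[measurable]: "\<psi> \<in> borel_measurable P" unfolding \<psi>_def by (rule measurable_compose[OF V\<nu> r(1)])
  have \<psi>U: "AE w in P. ennreal (\<rho> w) = \<psi> (U w)"
    using AE_completion[OF r(2)] V(2) by eventually_elim (simp add: \<psi>_def)
  \<comment> \<open>The law of \<open>U\<close> under \<nu> has the prescribed density; passing to a
    version of \<open>g\<close> extends the formula to functions measurable for the
    completion.\<close>
  have image: "(\<integral>\<^sup>+w. g (U w) \<partial>P) = (\<integral>\<^sup>+w. ennreal (M w) * g w \<partial>P)" if g: "g \<in> borel_measurable P" for g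
  proof -
    obtain g' where g': "g' \<in> borel_measurable \<nu>" "AE w in \<nu>. g w = g' w"
      using completion_ex_borel_measurable[OF g] by blast
    have gae: "AE w in P. g w = g' w" by (rule AE_completion[OF g'(2)])
    have g'p: "g' \<in> borel_measurable path_algebra" using g'(1) unfolding measurable_cong_sets[OF sets_nu refl] .
    have "(\<integral>\<^sup>+w. g (U w) \<partial>P) = (\<integral>\<^sup>+w. g' (U w) \<partial>P)"
      by (rule nn_integral_cong_AE[OF AE_U[OF gae]])
    also have "\<dots> = (\<integral>\<^sup>+w. g' w \<partial>image_law \<nu> U)"
      unfolding image_law_def using g'p by (intro nn_integral_distr[OF U_path, symmetric]) simp
    also have "\<dots> = (\<integral>\<^sup>+w. g' w \<partial>density \<nu> (RN_deriv \<nu> (image_law \<nu> U)))"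
      unfolding nu.density_RN_deriv[OF ac s] ..
    also have "\<dots> = (\<integral>\<^sup>+w. RN_deriv \<nu> (image_law \<nu> U) w * g' w \<partial>\<nu>)"
      by (rule nn_integral_density[OF borel_measurable_RN_deriv g'(1)])
    also have "\<dots> = (\<integral>\<^sup>+w. RN_deriv \<nu> (image_law \<nu> U) w * g' w \<partial>P)" by (rule nn_integral_completion[symmetric])
    also have "\<dots> = (\<integral>\<^sup>+w. ennreal (M w) * g w \<partial>P)"
      using RN gae by (intro nn_integral_cong_AE, eventually_elim) simp
    finally show ?thesis .
  qed
  have "density P (\<lambda>_. 1) = density P (\<lambda>w. ennreal (M w) * \<psi> w)"
  proof (rule measure_eqI)
    fix A assume "A \<in> sets (density P (\<lambda>_. 1))"
    then have A[measurable]: "A \<in> sets P" by simp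
    have "emeasure (density P (\<lambda>_. 1)) A = (\<integral>\<^sup>+w. indicator A w \<partial>P)" by (subst emeasure_density) auto
    also have "\<dots> = (\<integral>\<^sup>+w. ennreal (\<rho> w) * indicator A (U w) \<partial>P)" by (rule U_law_P[symmetric]) measurable
    also have "\<dots> = (\<integral>\<^sup>+w. \<psi> (U w) * indicator A (U w) \<partial>P)"
      using \<psi>U by (intro nn_integral_cong_AE, eventually_elim) simp
    also have "\<dots> = (\<integral>\<^sup>+w. ennreal (M w) * (\<psi> w * indicator A w) \<partial>P)" by (rule image) measurable
    also have "\<dots> = emeasure (density P (\<lambda>w. ennreal (M w) * \<psi> w)) A"
      by (subst emeasure_density) (auto simp: mult.assoc)
    finally show "emeasure (density P (\<lambda>_. 1)) A = emeasure (density P (\<lambda>w. ennreal (M w) * \<psi> w)) A" .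
  qed simp
  then have "AE w in P. 1 = ennreal (M w) * \<psi> w"
    by (rule density_unique[rotated 2]) measurable
  from AE_U[OF this] \<psi>U AE_U[OF M_pos] show ?thesis
  proof eventually_elim
    case (elim w)
    have "ennreal (M (U w) * \<rho> w) = 1"
      using elim rho_positive[of w] by (simp add: ennreal_mult)
    then show ?case using elim(3) rho_positive[of w] by (simp add: Q_def)
  qed
qed

end

end

theorem theorem7:
  fixes \<nu> :: "('n::finite) path measure"
    and \<tau> :: "'n path \<Rightarrow> real"
    and \<beta> :: "'n path \<Rightarrow> 'n path"
    and WW :: "'n drift \<Rightarrow> 'n path \<Rightarrow> 'n path"
    and \<D> :: "'n drift set"
    and f :: "'n path \<Rightarrow> real"
    and J :: "'n path \<Rightarrow> ereal"
    and u :: "'n drift"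
  assumes "extended_drift_flow \<nu> \<tau> \<beta> WW \<D>"
    and "f \<in> borel_measurable (completion \<nu>)"
    and "AE \<omega> in completion \<nu>.
           nn_cond_exp (completion \<nu>) (stopped_algebra \<nu> \<tau>) (\<lambda>\<omega>. ennreal (exp (- f \<omega>))) \<omega> < \<infinity>"
    and "is_ess_inf (completion \<nu>) (drifts_after \<nu> \<tau> \<D> \<inter> Lp_adapted \<nu> 2) (cond_cost \<nu> \<tau> WW f) J"
    and "AE \<omega> in completion \<nu>.
           ereal (- ln (real_cond_exp (completion \<nu>) (stopped_algebra \<nu> \<tau>) (\<lambda>\<omega>. exp (- f \<omega>)) \<omega>)) = J \<omega>"
    and "u \<in> drifts_after \<nu> \<tau> \<D> \<inter> Lp_adapted \<nu> 2"
  shows "(AE \<omega> in completion \<nu>. cond_cost \<nu> \<tau> WW f u \<omega> = J \<omega>) \<longleftrightarrow>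
         left_invertible \<nu> (WW u) \<and>
         (AE \<omega> in completion \<nu>.
            RN_deriv \<nu> (image_law \<nu> (WW u)) \<omega> =
            ennreal (exp (- f \<omega>) /
              real_cond_exp (completion \<nu>) (stopped_algebra \<nu> \<tau>) (\<lambda>\<omega>. exp (- f \<omega>)) \<omega>))"
proof -
  let ?P = "completion \<nu>" and ?F = "stopped_algebra \<nu> \<tau>"
  let ?Z = "real_cond_exp ?P ?F (\<lambda>\<omega>. exp (- f \<omega>))"
  interpret flow: extended_drift_flow \<nu> \<tau> \<beta> WW \<D> by (rule assms(1))
  interpret brownian_path_space \<nu> \<beta>
    by (intro brownian_path_space.intro flow.prob_nu flow.sets_nu flow.brownian flow.same_filtration)
  have uD: "u \<in> \<D>" and u2: "u \<in> Lp_adapted \<nu> 2" and after: "\<exists>v\<in>L0_adapted \<nu>. drift_eq \<nu> u (drift_after \<tau> v)"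
    using assms(6) by (auto simp: drifts_after_def)
  have girsanov: "integrable ?P (stoch_exp \<nu> \<beta> (neg_drift u))" "(LINT \<omega>|?P. stoch_exp \<nu> \<beta> (neg_drift u) \<omega>) = 1"
    using uD flow.subset_girsanov by (auto simp: girsanov_class_def)
  have "cm_norm h powr 2 = energy h" for h :: "real \<Rightarrow> (real, 'n) vec"
  proof -
    have "cm_norm h = sqrt (energy h)" by (simp add: cm_norm_def energy_def)
    then show ?thesis by (simp add: energy_nonneg powr_numeral)
  qed
  then have "square_integrable_drift u"
    using u2 by (simp add: Lp_adapted_def square_integrable_drift_def)
  \<comment> \<open>The flow at \<open>u\<close> supplies the assumptions on
    \<open>U = WW u\<close>: adaptedness, the law under the Girsanov measure, and the translation of
    \<beta>.\<close>
  then interpret adapted_shift \<nu> \<beta> \<tau> u "WW u"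
    by (intro adapted_shift.intro adapted_shift_axioms.intro brownian_path_space_axioms flow.stopping_time_tau
        flow.tau_nonneg after girsanov flow.ext_adapted[OF uD] flow.ext_law[OF uD] flow.ext_translate[OF uD])
  note f = assms(2) assms(3)
  have Z: "Z f = ?Z" by (simp add: Z_def[OF f])
  have M: "M f \<omega> = exp (- f \<omega>) / ?Z \<omega>" for \<omega> unfolding M_def[OF f] Z ..
  have cost: "cond_cost \<nu> \<tau> WW f u = ereal_cond_exp ?P ?F (cost f)"
    unfolding cond_cost_def cost_def[OF f] cm_norm_energy ..
  \<comment> \<open>The infimum is \<open>- ln Z\<close> by assumption, so attainment becomes an
    equation for the conditional cost of \<open>u\<close> alone.\<close>
  have "(AE \<omega> in ?P. cond_cost \<nu> \<tau> WW f u \<omega> = J \<omega>) \<longleftrightarrow> (AE \<omega> in ?P. ereal_cond_exp ?P ?F (cost f) \<omega> = ereal (- ln (Z f \<omega>)))"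
    unfolding cost Z
  proof
    assume "AE \<omega> in ?P. ereal_cond_exp ?P ?F (cost f) \<omega> = J \<omega>"
    with assms(5) show "AE \<omega> in ?P. ereal_cond_exp ?P ?F (cost f) \<omega> = ereal (- ln (?Z \<omega>))" by eventually_elim simp
  next
    assume "AE \<omega> in ?P. ereal_cond_exp ?P ?F (cost f) \<omega> = ereal (- ln (?Z \<omega>))"
    with assms(5) show "AE \<omega> in ?P. ereal_cond_exp ?P ?F (cost f) \<omega> = J \<omega>" by eventually_elim simp
  qed
  also have "\<dots> \<longleftrightarrow> (AE \<omega> in ?P. Q f \<omega> = 1)" by (rule cost_attained_iff[OF f])
  also have "\<dots> \<longleftrightarrow> left_invertible \<nu> (WW u) \<and> (AE \<omega> in ?P. RN_deriv \<nu> (image_law \<nu> (WW u)) \<omega> = ennreal (M f \<omega>))"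
    using left_invertible_of_density[OF f] density_of_left_invertible[OF f] by blast
  finally show ?thesis unfolding M .
qed

end
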